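(* Let $m=2n\ge2$ and let $\mathbf{x}=(x_1,x_2)\in\mathbb{Q}^2/\mathbb{Z}^2$, with $\mathbf{x}\ne0$ if $m=2$. 1. For $\beta=\begin{pmatrix}a&b\\0&d\end{pmatrix}\in\mathrm{GL}^+(2,\mathbb{Q})$, $$\Phi^{(m)}_{\mathbf{x}}(\beta)=-\frac{\mathbf{B}_m(x_1)}m\int_0^{b/d}(tT_1+T_2)^{n-1}(tT_3+T_4)^{n-1}\,dt.$$ 2. For $\sigma=\begin{pmatrix}a&b\\c&d\end{pmatrix}\in\mathrm{SL}(2,\mathbb{Z})$ with $c>0$, $$\begin{aligned}\Phi^{(m)}_{\mathbf{x}}(\sigma)=&-\frac{\mathbf{B}_m(x_1)}m\int_0^{a/c}(tT_1+T_2)^{n-1}(tT_3+T_4)^{n-1}\,dt\\&-\frac{\mathbf{B}_m(ax_1+cx_2)}m\int_{-d/c}^0\big(t(aT_1+cT_2)+bT_1+dT_2\big)^{n-1}\big(t(aT_3+cT_4)+bT_3+dT_4\big)^{n-1}\,dt\\&+\sum_{k=0}^{n-1}\sum_{\ell=0}^{n-1}(-1)^{k+\ell}\binom{n-1}k\binom{n-1}\ell S^{(m-k-\ell-1,\,k+\ell+1)}_{\mathbf{x}}\Big(\frac ac\Big)\,T_1^k(aT_1+cT_2)^{n-k-1}\,T_3^\ell(aT_3+cT_4)^{n-\ell-1}.\end{aligned}$$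
   Context: **Modules.** $W_{n-1}$ is the space of homogeneous polynomials of degree $n-1$ in two variables over $\mathbb{C}$, with $\mathrm{GL}^+(2,\mathbb{R})$-action $(g\cdot P)(T_1,T_2)=\det(g)^{-(n-1)/2}P(aT_1+cT_2,bT_1+dT_2)$, $g=\begin{pmatrix}a&b\\c&d\end{pmatrix}$. $W_{n-1,n-1}=(W_{n-1}\otimes W_{n-1})^{\mathrm{sym}}$ is the subspace of $W_{n-1}\otimes W_{n-1}$ fixed by the involution $P_1\otimes P_2\mapsto P_2\otimes P_1$, with the tensor product action of $\mathrm{GL}^+(2,\mathbb{R})$; its elements are identified with the polynomials $P\in\mathbb{C}[T_1,T_2,T_3,T_4]$, homogeneous of degree $n-1$ in $(T_1,T_2)$ and of degree $n-1$ in $(T_3,T_4)$ (hence of total degree $2(n-1)$), such that $P(T_1,T_2,T_3,T_4)=P(T_3,T_4,T_1,T_2)$. $\operatorname{Re}$ takes real parts of coefficients. $F(z)=F_{n-1,n-1}(z)=(zT_1+T_2)^{n-1}(zT_3+T_4)^{n-1}$ and $\check F(z_0)=\int_0^{z_0}F(z)\,dz$. **Eisenstein series.** For $\mathbf{x}\in(\frac1N\mathbb{Z}/\mathbb{Z})^2$ let $\chi_{\mathbf{x}}$ be the additive character of $(\frac1N\mathbb{Z}/\mathbb{Z})^2$ given by $\chi_{\mathbf{x}}\big(\frac{(a_1,a_2)}N\big)=e^{2\pi i(a_2x_1-a_1x_2)}$ ($a_1,a_2\in\mathbb{Z}$). For $m>2$ and $\mathbf{a}\in(\mathbb{Q}/\mathbb{Z})^2$,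 put $G^{(m)}_{\mathbf{a}}(z)=\sum_{\mathbf{k}\in\mathbb{Q}^2\setminus0,\ \mathbf{k}\equiv\mathbf{a}\,(\mathrm{mod}\,1)}(k_1z+k_2)^{-m}$ and $$\phi^{(m)}_{\mathbf{x}}(z)=\frac{(m-1)!}{(2\pi iN)^m}\sum_{\mathbf{a}\in(\frac1N\mathbb{Z}/\mathbb{Z})^2}\chi_{\mathbf{x}}(\mathbf{a})\,G^{(m)}_{\mathbf{a}}(z).$$ For $m=2$, let $G_{\mathbf{a}}(z)$ be the value at $s=0$ of the analytic continuation of $\sum_{\mathbf{k}\ne0,\ \mathbf{k}\equiv\mathbf{a}\,(\mathrm{mod}\,1)}(k_1z+k_2)^{-2}|k_1z+k_2|^{-s}$, and let $\phi^{(2)}_{\mathbf{x}}=\phi_{\mathbf{x}}$ be the weight $2$ Eisenstein series $$\phi_{\mathbf{x}}(z)=(2\pi N)^{-2}\sum_{\mathbf{a}\in(\frac1N\mathbb{Z}/\mathbb{Z})^2}\chi_{\mathbf{x}}(\mathbf{a})\,G_{\mathbf{a}}(z),\qquad \mathbf{x}\ne 0.$$ The definitions are independent of $N$. **The function $\Phi^{(m)}_{\mathbf{x}}$.** For $f$ of weight $m$ put $(f|\gamma)(z)=\det(\gamma)^{m/2}(cz+d)^{-m}f(\gamma z)$, $\gamma=\begin{pmatrix}a&b\\c&d\end{pmatrix}\in\mathrm{GL}^+(2,\mathbb{Q})$. For a modular form $f=\sum_{j\ge0}a_je^{2\pi ijz/N}$ put $\mathbf{a}_0(f)=a_0$ and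 $\widetilde f=f-a_0$. For $\gamma\in\mathrm{GL}^+(2,\mathbb{Q})$ and $\phi=\phi^{(m)}_{\mathbf{x}}$, define $$\Psi^{(m)}_{\mathbf{x}}(\gamma)=\int_{z_0}^{\gamma z_0}F\phi\,dz+\check F(z_0)\,\mathbf{a}_0(\phi)-\gamma\cdot\check F(z_0)\,\mathbf{a}_0(\phi|\gamma)-\int_{z_0}^{i\infty}F\,\widetilde\phi\,dz+\int_{z_0}^{i\infty}\gamma\cdot F(z)\,\widetilde{\phi|\gamma}(z)\,dz,$$ which is independent of $z_0$ in the upper half plane $\mathbb{H}$, and $\Phi^{(m)}_{\mathbf{x}}(\gamma)=\operatorname{Re}\Psi^{(m)}_{\mathbf{x}}(\gamma)$. **Bernoulli functions and Dedekind sums.** $\mathbf{B}_j:\mathbb{R}\to\mathbb{R}$ is the $j$-th periodic Bernoulli function $\mathbf{B}_j(x)=B_j(x-[x])$ for all $x\in\mathbb{R}$, where $B_j$ is the Bernoulli polynomial and $[x]$ is the greatest integer $\le x$; in particular $\mathbf{B}_1(x)=x-[x]-\frac12$ for every $x\in\mathbb{R}$. For coprime integers $a,c$ with $c\ge1$ and $0<k<m$, $$S^{(m-k,k)}_{\mathbf{x}}\Big(\frac ac\Big)=\sum_{r=0}^{c-1}\frac{\mathbf{B}_{m-k}\big(\frac{x_1+r}c\big)}{m-k}\,\frac{\mathbf{B}_k\big(x_2+a\frac{x_1+r}c\big)}k .$$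
   Formalization: Two conventions are corrected, since the claim is false otherwise: the weight 2 series φ_x is normalised by -(2πN)^{-2}, the general factor at m=2, instead of (2πN)^{-2}; and B_1 takes the value 0 instead of -1/2 at integers in the Dedekind sums. *)

theory Defs
  imports "HOL-Complex_Analysis.Complex_Analysis" "HOL-Library.Poly_Mapping"
begin

no_notation fps_nth (infixl "$" 75)

(* Polynomials are finitely supported maps from exponent vectors to coefficients; only the
   variables with indices 1, 2, 3, 4 are used. *)

type_synonym 'a mpoly = "(nat \<Rightarrow>\<^sub>0 nat) \<Rightarrow>\<^sub>0 'a"

definition pconst :: "'a::comm_ring_1 \<Rightarrow> 'a mpoly" where
  "pconst c = Poly_Mapping.single 0 c"

definition pvar :: "nat \<Rightarrow> 'a::comm_ring_1 mpoly" where
  "pvar i = Poly_Mapping.single (Poly_Mapping.single i 1) 1"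

abbreviation T1 :: "'a::comm_ring_1 mpoly" where "T1 \<equiv> pvar 1"
abbreviation T2 :: "'a::comm_ring_1 mpoly" where "T2 \<equiv> pvar 2"
abbreviation T3 :: "'a::comm_ring_1 mpoly" where "T3 \<equiv> pvar 3"
abbreviation T4 :: "'a::comm_ring_1 mpoly" where "T4 \<equiv> pvar 4"

definition psubst :: "(nat \<Rightarrow> 'a mpoly) \<Rightarrow> 'a mpoly \<Rightarrow> 'a::comm_ring_1 mpoly" where
  "psubst s P = (\<Sum>\<mu>\<in>Poly_Mapping.keys P. pconst (Poly_Mapping.lookup P \<mu>) *
     (\<Prod>i\<in>Poly_Mapping.keys \<mu>. s i ^ Poly_Mapping.lookup \<mu> i))"

definition re_poly :: "complex mpoly \<Rightarrow> real mpoly" where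
  "re_poly = Poly_Mapping.map Re"

(* Apply an integration functional I to each coefficient of a polynomial-valued function.
   Abs_poly_mapping is meaningful because the integrands below all have their monomials in one
   finite set. *)
definition coeffwise :: "(('b \<Rightarrow> 'a) \<Rightarrow> 'a) \<Rightarrow> ('b \<Rightarrow> 'a mpoly) \<Rightarrow> 'a::comm_ring_1 mpoly" where
  "coeffwise I P = Poly_Mapping.Abs_poly_mapping (\<lambda>\<mu>. I (\<lambda>t. Poly_Mapping.lookup (P t) \<mu>))"

definition seg_int :: "complex \<Rightarrow> complex \<Rightarrow> (complex \<Rightarrow> complex mpoly) \<Rightarrow> complex mpoly" where
  "seg_int u v = coeffwise (contour_integral (linepath u v))"

(* The integral from u to i*infinity, along the vertical ray. *)
definition cusp_int :: "complex \<Rightarrow> (complex \<Rightarrow> complex mpoly) \<Rightarrow> complex mpoly" where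
  "cusp_int u = coeffwise (\<lambda>h. integral {0..} (\<lambda>t::real. h (u + \<i> * of_real t) * \<i>))"

(* Oriented: the sign changes when u and v are exchanged. *)
definition real_int :: "real \<Rightarrow> real \<Rightarrow> (real \<Rightarrow> real mpoly) \<Rightarrow> real mpoly" where
  "real_int u v = coeffwise (\<lambda>h. LBINT t=ereal u..ereal v. h t)"

definition mat2 :: "'a \<Rightarrow> 'a \<Rightarrow> 'a \<Rightarrow> 'a \<Rightarrow> 'a::zero ^ 2 ^ 2" where
  "mat2 a b c d = vector [vector [a, b], vector [c, d]]"

definition GL_plus_rat :: "(real ^ 2 ^ 2) set" where
  "GL_plus_rat = {\<gamma>. (\<forall>i j. \<gamma> $ i $ j \<in> \<rat>) \<and> det \<gamma> > 0}"

definition moebius :: "real ^ 2 ^ 2 \<Rightarrow> complex \<Rightarrow> complex" where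
  "moebius \<gamma> z = (of_real (\<gamma> $ 1 $ 1) * z + of_real (\<gamma> $ 1 $ 2)) /
                 (of_real (\<gamma> $ 2 $ 1) * z + of_real (\<gamma> $ 2 $ 2))"

definition slash :: "nat \<Rightarrow> (complex \<Rightarrow> complex) \<Rightarrow> real ^ 2 ^ 2 \<Rightarrow> complex \<Rightarrow> complex" where
  "slash m f \<gamma> z = of_real (det \<gamma> powr (real m / 2)) *
     inverse ((of_real (\<gamma> $ 2 $ 1) * z + of_real (\<gamma> $ 2 $ 2)) ^ m) * f (moebius \<gamma> z)"

(* The tensor product action on polynomials of bidegree (n-1, n-1): each of the two tensor factors
   contributes a determinant factor with exponent -(n-1)/2. *)
definition act :: "nat \<Rightarrow> real ^ 2 ^ 2 \<Rightarrow> complex mpoly \<Rightarrow> complex mpoly" where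
  "act n \<gamma> P = pconst (of_real ((det \<gamma> powr (- (real n - 1) / 2)) ^ 2)) * psubst
     (pvar(1 := pconst (of_real (\<gamma> $ 1 $ 1)) * T1 + pconst (of_real (\<gamma> $ 2 $ 1)) * T2,
           2 := pconst (of_real (\<gamma> $ 1 $ 2)) * T1 + pconst (of_real (\<gamma> $ 2 $ 2)) * T2,
           3 := pconst (of_real (\<gamma> $ 1 $ 1)) * T3 + pconst (of_real (\<gamma> $ 2 $ 1)) * T4,
           4 := pconst (of_real (\<gamma> $ 1 $ 2)) * T3 + pconst (of_real (\<gamma> $ 2 $ 2)) * T4)) P"

definition F :: "nat \<Rightarrow> 'a \<Rightarrow> 'a::comm_ring_1 mpoly" where
  "F n z = (pconst z * T1 + T2) ^ (n - 1) * (pconst z * T3 + T4) ^ (n - 1)"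

definition F_check :: "nat \<Rightarrow> complex \<Rightarrow> complex mpoly" where
  "F_check n z0 = seg_int 0 z0 (F n)"

definition coset :: "real \<times> real \<Rightarrow> (real \<times> real) set" where
  "coset a = {k. k \<noteq> (0, 0) \<and> fst k - fst a \<in> \<int> \<and> snd k - snd a \<in> \<int>}"

definition lin :: "real \<times> real \<Rightarrow> complex \<Rightarrow> complex" where
  "lin k z = of_real (fst k) * z + of_real (snd k)"

(* The value at 0 of the analytic continuation of a function given on Re s > 0. It does not depend
   on U or h: any two candidates agree on the connected union of the half plane with a small disc
   around 0. *)
definition continuation_at_0 :: "(complex \<Rightarrow> complex) \<Rightarrow> complex" where
  "continuation_at_0 g = (THE v. \<exists>h U. open U \<and> connected U \<and> {s. Re s > 0} \<subseteq> U \<and> 0 \<in> U \<and>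
     h holomorphic_on U \<and> (\<forall>s. Re s > 0 \<longrightarrow> h s = g s) \<and> v = h 0)"

definition eisenstein_G :: "nat \<Rightarrow> real \<times> real \<Rightarrow> complex \<Rightarrow> complex" where
  "eisenstein_G m a z =
     (if m = 2
      then continuation_at_0 (\<lambda>s. \<Sum>\<^sub>\<infinity>k\<in>coset a.
             inverse (lin k z ^ 2) * of_real (norm (lin k z)) powr (- s))
      else (\<Sum>\<^sub>\<infinity>k\<in>coset a. inverse (lin k z ^ m)))"

(* The value of the character attached to x at (p/N, q/N). *)
definition chi :: "real \<times> real \<Rightarrow> nat \<Rightarrow> nat \<Rightarrow> complex" where
  "chi x p q = exp (2 * of_real pi * \<i> * of_real (real q * fst x - real p * snd x))"

(* For m = 2 the normalising factor is -1/(2*pi*N)^2, the value of the general one at m = 2. In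
   weight 2 the opposite sign is also in use; with it every weight 2 identity for the function Phi
   below would change sign, while the present one makes the constant term at infinity equal to
   -B_m(x1)/m for every even m, m = 2 included. *)
definition phi :: "nat \<Rightarrow> nat \<Rightarrow> real \<times> real \<Rightarrow> complex \<Rightarrow> complex" where
  "phi m N x z = fact (m - 1) / (2 * of_real pi * \<i> * of_nat N) ^ m *
     (\<Sum>p<N. \<Sum>q<N. chi x p q * eisenstein_G m (real p / real N, real q / real N) z)"

definition const_term :: "(complex \<Rightarrow> complex) \<Rightarrow> complex" where
  "const_term f = (THE v. \<exists>(N::nat) (a::nat \<Rightarrow> complex). N > 0 \<and> v = a 0 \<and>
     (\<forall>z. Im z > 0 \<longrightarrow> (\<lambda>j. a j * exp (2 * of_real pi * \<i> * of_nat j * z / of_nat N)) sums f z))"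

definition tilde :: "(complex \<Rightarrow> complex) \<Rightarrow> complex \<Rightarrow> complex" where
  "tilde f z = f z - const_term f"

definition Psi :: "nat \<Rightarrow> nat \<Rightarrow> real \<times> real \<Rightarrow> complex \<Rightarrow> real ^ 2 ^ 2 \<Rightarrow> complex mpoly" where
  "Psi n N x z0 \<gamma> =
     (let \<phi> = phi (2 * n) N x; \<phi>' = slash (2 * n) \<phi> \<gamma> in
        seg_int z0 (moebius \<gamma> z0) (\<lambda>z. pconst (\<phi> z) * F n z)
        + pconst (const_term \<phi>) * F_check n z0
        - pconst (const_term \<phi>') * act n \<gamma> (F_check n z0)
        - cusp_int z0 (\<lambda>z. pconst (tilde \<phi> z) * F n z)
        + cusp_int z0 (\<lambda>z. pconst (tilde \<phi>' z) * act n \<gamma> (F n z)))"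

definition Phi :: "nat \<Rightarrow> nat \<Rightarrow> real \<times> real \<Rightarrow> complex \<Rightarrow> real ^ 2 ^ 2 \<Rightarrow> real mpoly" where
  "Phi n N x z0 \<gamma> = re_poly (Psi n N x z0 \<gamma>)"

(* The generating function of the Bernoulli polynomials is t * exp (x t) / (exp t - 1). *)
definition bernoulli_poly :: "nat \<Rightarrow> real \<Rightarrow> real" where
  "bernoulli_poly j x = fact j * fps_nth (fps_X * fps_exp x / (fps_exp 1 - 1)) j"

(* The first periodic Bernoulli function is the sawtooth function, with value 0 (not -1/2) at the
   integers. This value is forced in Dedekind sums: Phi does not change when x is replaced by -x,
   which would fail for the Dedekind sum formula with the value -1/2. *)
definition periodic_bernoulli :: "nat \<Rightarrow> real \<Rightarrow> real" where
  "periodic_bernoulli j x = (if j = 1 \<and> x \<in> \<int> then 0 else bernoulli_poly j (x - of_int \<lfloor>x\<rfloor>))"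

definition dedekind_sum :: "nat \<Rightarrow> nat \<Rightarrow> real \<times> real \<Rightarrow> int \<Rightarrow> int \<Rightarrow> real" where
  "dedekind_sum j k x a c = (\<Sum>r\<in>{0..<c}.
     periodic_bernoulli j ((fst x + of_int r) / of_int c) / real j *
     (periodic_bernoulli k (snd x + of_int a * ((fst x + of_int r) / of_int c)) / real k))"

end

theory Submission
  imports Defs "HOL-Real_Asymp.Real_Asymp"
begin

text \<open>Put \<open>\<phi> = phi m N (x1, x2)\<close> with constant term \<open>a0\<close>. Expanded in powers of \<open>z - \<alpha>\<close>, where \<open>\<alpha> = a / c\<close> (in powers
  of \<open>z\<close> for upper triangular matrices), each coefficient of \<open>Psi\<close> is a scalar period: the difference
  \<open>A (\<gamma> z) - A' z\<close> of primitives, normalised at infinity, of \<open>\<phi>\<close> and its transform times polynomials. It does not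
  depend on \<open>z\<close>. For upper triangular \<open>\<gamma>\<close> one lets \<open>z\<close> tend to infinity. For \<open>\<sigma>\<close> in \<open>SL(2, \<int>)\<close> one lets
  \<open>z = - d / c + \<i> / (c\<^sup>2 Y)\<close> tend to infinity, so that \<open>\<sigma> z = \<alpha> + \<i> Y\<close> tends to the cusp \<open>\<alpha>\<close>. Up to a pole in \<open>Y\<close>
  and the two Bernoulli terms, what remains is the limit of the cuspidal primitive at \<open>\<alpha>\<close>. Splitting the
  Lipschitz expansion of \<open>\<phi>\<close> into residue classes modulo \<open>c\<close> turns that primitive into a sum of
  \<open>p\<^sup>-\<^sup>s e(p u) M(p Y)\<close>, whose real part tends to a Fourier series of Bernoulli functions times values of
  Bernoulli polynomials, that is, to a Dedekind sum. For \<open>s = 1\<close> the series converges only conditionally, and the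
  sawtooth function appears with value 0 at the integers.\<close>


section \<open>Fourier series\<close>

text \<open>The expansion point is chosen so that each coefficient is a single scalar period: for w
  = \<open>\<sigma> z\<close> one has w - \<open>\<alpha>\<close> = -1 / (c (c z + d)), so a power
  of z - \<open>\<alpha>\<close> turns into a power of c z + d, and the weight makes the exponents
  match. The real part is essential: it pairs the frequencies p and -p, whose exponentials are
  conjugate while their weights are real, and this pairing yields the complete Fourier series of a
  Bernoulli function. The coefficient of the pole in Y is never computed: Q / Y^M can have a finite
  limit only if Q = 0. In weight 2 the lattice sum converges only conditionally, and two
  descriptions of \<open>phi\<close> must be reconciled. The modular transformation is visible on
  Hecke's regularised sum, the Fourier expansion on the iterated sum. Differences of coset sums
  converge absolutely for Re s > -1/2, and at s = 0 they are differences of iterated sums; the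
  remaining constant is common to all cosets and is killed by the nontrivial character. Rescaling
  the lattice supplies the continuation, so no functional equation enters.\<close>

definition ecis :: "real \<Rightarrow> complex" where
  "ecis t = cis (2 * pi * t)"

lemma ecis_add: "ecis (s + t) = ecis s * ecis t"
  by (simp add: ecis_def cis_mult ring_distribs)

lemma norm_ecis [simp]: "norm (ecis t) = 1"
  by (simp add: ecis_def)

lemma ecis_nonzero [simp]: "ecis t \<noteq> 0"
  by (simp add: ecis_def)

lemma ecis_0 [simp]: "ecis 0 = 1"
  by (simp add: ecis_def)

lemma ecis_Ints: "t \<in> \<int> \<Longrightarrow> ecis t = 1"
  by (auto simp: ecis_def cis_multiple_2pi elim: Ints_cases)

lemma ecis_of_int [simp]: "ecis (of_int t) = 1"
  by (simp add: ecis_Ints)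

lemma ecis_minus: "ecis (- t) = inverse (ecis t)"
  by (simp add: ecis_def)

lemma ecis_diff: "ecis (s - t) = ecis s / ecis t"
  using ecis_add[of s "-t"] by (simp add: ecis_minus field_simps)

lemma ecis_cnj: "cnj (ecis t) = ecis (- t)"
  by (simp add: ecis_def cis_cnj)

lemma ecis_exp: "ecis t = exp (2 * of_real pi * \<i> * of_real t)"
  by (simp add: ecis_def cis_conv_exp mult_ac)

lemma ecis_cong: "s - t \<in> \<int> \<Longrightarrow> ecis s = ecis t"
  using ecis_add[of "s - t" t] by (simp add: ecis_Ints)

lemma continuous_on_ecis [continuous_intros]:
  "continuous_on A f \<Longrightarrow> continuous_on A (\<lambda>x. ecis (f x))"
  unfolding ecis_def by (intro continuous_intros)

lemma Re_ecis: "Re (ecis t) = cos (2 * pi * t)" and Im_ecis: "Im (ecis t) = sin (2 * pi * t)"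
  by (simp_all add: ecis_def)

lemma has_vector_derivative_ecis:
  "((\<lambda>x. ecis (of_int q * x)) has_vector_derivative (2 * of_real pi * \<i> * of_int q * ecis (of_int q * x)))
     (at x within A)"
proof -
  have "((\<lambda>z. exp (2 * of_real pi * \<i> * (of_int q * z))) has_field_derivative
     (2 * of_real pi * \<i> * of_int q * exp (2 * of_real pi * \<i> * (of_int q * of_real x))))
        (at (of_real x))"
    by (auto intro!: derivative_eq_intros)
  from has_vector_derivative_real_field[OF this]
  show ?thesis by (simp add: ecis_exp)
qed

definition zero_fourier :: "(real \<Rightarrow> complex) \<Rightarrow> bool" where
  "zero_fourier h \<longleftrightarrow> continuous_on {0..1} h \<and>
     (\<forall>q::int. ((\<lambda>x. h x * ecis (of_int q * x)) has_integral 0) {0..1})"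

text \<open>A real-linear function of e(x) = \<open>ecis x\<close> is a combination of e(x) and
  e(-x), so multiplying by it only shifts the index of the vanishing coefficients by one. Induction
  over polynomial functions then makes \<open>h\<close> orthogonal to all polynomials on the
  circle.\<close>

lemma zero_fourier_poly:
  assumes "real_polynomial_function g" "zero_fourier h"
  shows "zero_fourier (\<lambda>x. h x * of_real (g (ecis x)))"
  using assms
proof (induction arbitrary: h rule: real_polynomial_function.induct)
  case (linear f)
  note zf = \<open>zero_fourier h\<close>
  from linear interpret bounded_linear f by simp
  have f: "f w = Re w * f 1 + Im w * f \<i>" for w
  proof -
    have "w = Re w *\<^sub>R 1 + Im w *\<^sub>R \<i>" by (simp add: complex_eq_iff)
    then have "f w = f (Re w *\<^sub>R 1 + Im w *\<^sub>R \<i>)" by simp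
    also have "\<dots> = Re w * f 1 + Im w * f \<i>" by (simp only: add scale) simp
    finally show ?thesis .
  qed
  have fe: "of_real (f (ecis x)) = (of_real (f 1) - \<i> * of_real (f \<i>)) / 2 * ecis x
      + (of_real (f 1) + \<i> * of_real (f \<i>)) / 2 * ecis (- x)" for x
    by (subst f) (simp add: complex_eq_iff Re_ecis Im_ecis ecis_cnj[symmetric] field_simps)
  from zf have h: "continuous_on {0..1} h"
    "\<And>q::int. ((\<lambda>x. h x * ecis (of_int q * x)) has_integral 0) {0..1}"
    by (auto simp: zero_fourier_def)
  show ?case unfolding zero_fourier_def
  proof (intro conjI allI)
    show "continuous_on {0..1} (\<lambda>x. h x * of_real (f (ecis x)))"
      by (intro continuous_intros h continuous_on)
    fix q :: int
    let ?A = "(of_real (f 1) - \<i> * of_real (f \<i>)) / 2" and ?B = "(of_real (f 1) + \<i> * of_real (f \<i>)) / 2"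
    have "((\<lambda>x. ?A * (h x * ecis (of_int (q + 1) * x)) + ?B * (h x * ecis (of_int (q - 1) * x)))
            has_integral ?A * 0 + ?B * 0) {0..1}"
      by (intro has_integral_add has_integral_mult_right h)
    also have "(\<lambda>x. ?A * (h x * ecis (of_int (q + 1) * x)) + ?B * (h x * ecis (of_int (q - 1) * x)))
       = (\<lambda>x. h x * of_real (f (ecis x)) * ecis (of_int q * x))"
      by (rule ext, subst fe)
         (simp add: ring_distribs ecis_add ecis_diff ecis_minus field_simps)
    finally show "((\<lambda>x. h x * of_real (f (ecis x)) * ecis (of_int q * x)) has_integral 0) {0..1}"
      by simp
  qed
next
  case (const c)
  have "((\<lambda>x. of_real c * (h x * ecis (of_int q * x))) has_integral of_real c * 0) {0..1}" for q :: int
    using const by (intro has_integral_mult_right) (simp add: zero_fourier_def)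
  moreover have "continuous_on {0..1} (\<lambda>x. of_real c * h x)"
    using const by (intro continuous_on_mult continuous_on_const) (simp add: zero_fourier_def)
  ultimately show ?case
    by (simp add: zero_fourier_def mult_ac)
next
  case (add f g)
  then have fg: "zero_fourier (\<lambda>x. h x * of_real (f (ecis x)))" "zero_fourier (\<lambda>x. h x * of_real (g (ecis x)))"
    by auto
  have "((\<lambda>x. h x * of_real (f (ecis x)) * ecis (of_int q * x) + h x * of_real (g (ecis x)) * ecis (of_int q * x))
      has_integral 0 + 0) {0..1}" for q :: int
    using fg by (intro has_integral_add) (simp_all add: zero_fourier_def)
  moreover have "continuous_on {0..1} (\<lambda>x. h x * of_real (f (ecis x)) + h x * of_real (g (ecis x)))"
    using fg by (intro continuous_on_add) (simp_all add: zero_fourier_def)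
  ultimately show ?case by (simp add: zero_fourier_def ring_distribs)
next
  case (mult f g)
  then have "zero_fourier (\<lambda>x. h x * of_real (f (ecis x)) * of_real (g (ecis x)))"
    by auto
  then show ?case by (simp add: mult_ac)
qed

text \<open>On the circle the conjugate of \<open>h\<close> is a uniform limit of polynomials
  \<open>k\<close>, and \<open>h\<close> is orthogonal to each of them. Hence the integral of |h|^2
  equals that of h (cnj h - k), which is arbitrarily small.\<close>

lemma fourier_uniqueness:
  assumes "zero_fourier h" "h 0 = h 1" "x \<in> {0..1}"
  shows "h x = 0"
proof -
  have cont: "continuous_on {0..1} h" using assms by (simp add: zero_fourier_def)
  \<comment> \<open>The homotopy is the constant one; it only serves to carry continuity of the loop
    \<open>h\<close> over to the circle, including the point 1, where \<open>Arg2pi\<close>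
    jumps.\<close>
  have "homotopic_loops UNIV h h"
    using cont assms by (simp add: path_def pathstart_def pathfinish_def homotopic_loops_refl)
  from homotopic_loops_imp_homotopic_circlemaps[OF this]
  have ch: "continuous_on (sphere 0 1) (h \<circ> (\<lambda>z. Arg2pi z / (2 * pi)))"
    using homotopic_with_imp_continuous by blast
  have Arg: "h (Arg2pi (ecis t) / (2 * pi)) = h t" if "t \<in> {0..1}" for t
  proof (cases "t = 1")
    case True
    then show ?thesis using assms Arg2pi_of_real[of 1] by (simp add: ecis_def)
  next
    case False
    then have "Arg2pi (ecis t) = 2 * pi * t"
      using that by (intro Arg2pi_unique[of 1]) (auto simp: ecis_exp mult_ac)
    then show ?thesis by simp
  qed
  define H where "H = (\<lambda>z. h (Arg2pi z / (2 * pi)))"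
  have cH: "continuous_on (sphere 0 1) (\<lambda>z. Re (H z))" "continuous_on (sphere 0 1) (\<lambda>z. Im (H z))"
    using ch unfolding H_def o_def by (auto intro: continuous_intros)
  have "compact (h ` {0..1})" using cont by (intro compact_continuous_image) auto
  then obtain M where M: "\<And>x. x \<in> {0..1} \<Longrightarrow> norm (h x) \<le> M"
    by (metis bounded_iff compact_imp_bounded imageI)
  have M0: "M \<ge> 0" using order.trans[OF norm_ge_zero M[of 0]] by simp
  define I where "I = integral {0..1} (\<lambda>x. (norm (h x))^2)"
  have cn: "continuous_on {0..1} (\<lambda>x. (norm (h x))^2)" by (intro continuous_intros cont)
  have I0: "((\<lambda>x. (norm (h x))^2) has_integral I) {0..1}"
    unfolding I_def by (intro integrable_integral integrable_continuous_interval cn)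
  have "I \<le> e" if "e > 0" for e
  proof -
    \<comment> \<open>Makes 2 d M <= e; using M + 1 instead of M avoids a division by 0.\<close>
    define d where "d = e / (2 * (M + 1))"
    have d: "d > 0" using \<open>e > 0\<close> M0 by (simp add: d_def)
    obtain g1 where g1: "real_polynomial_function g1" "\<And>w. w \<in> sphere 0 1 \<Longrightarrow> \<bar>Re (H w) - g1 w\<bar> < d"
      using Stone_Weierstrass_real_polynomial_function[OF compact_sphere cH(1) d] by blast
    obtain g2 where g2: "real_polynomial_function g2" "\<And>w. w \<in> sphere 0 1 \<Longrightarrow> \<bar>Im (H w) - g2 w\<bar> < d"
      using Stone_Weierstrass_real_polynomial_function[OF compact_sphere cH(2) d] by blast
    define k where "k t = (of_real (g1 (ecis t)) - \<i> * of_real (g2 (ecis t)) :: complex)" for t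
    from zero_fourier_poly[OF g1(1) assms(1)] zero_fourier_poly[OF g2(1) assms(1)]
    have "((\<lambda>x. h x * of_real (g1 (ecis x)) * ecis (of_int 0 * x)) has_integral 0) {0..1}"
         "((\<lambda>x. h x * of_real (g2 (ecis x)) * ecis (of_int 0 * x)) has_integral 0) {0..1}"
      unfolding zero_fourier_def by blast+
    then have z: "((\<lambda>x. h x * k x) has_integral 0) {0..1}"
      using has_integral_diff[of "\<lambda>x. h x * of_real (g1 (ecis x))" 0 "{0..1}" "\<lambda>x. \<i> * (h x * of_real (g2 (ecis x)))" 0]
        has_integral_mult_right[of "\<lambda>x. h x * of_real (g2 (ecis x))" 0 "{0..1}" \<i>]
      by (simp add: k_def algebra_simps)
    have hk: "norm (cnj (h t) - k t) \<le> 2 * d" if "t \<in> {0..1}" for t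
    proof -
      have "\<bar>Re (h t) - g1 (ecis t)\<bar> < d" "\<bar>Im (h t) - g2 (ecis t)\<bar> < d"
        using g1(2)[of "ecis t"] g2(2)[of "ecis t"] Arg[OF that] by (auto simp: H_def)
      then show ?thesis
        using cmod_le[of "cnj (h t) - k t"] by (simp add: k_def)
    qed
    have "((\<lambda>x. complex_of_real ((norm (h x))^2)) has_integral of_real I) {0..1}"
      using I0 has_integral_of_real by blast
    from has_integral_diff[OF this z]
    have "((\<lambda>x. h x * (cnj (h x) - k x)) has_integral of_real I) {0..1}"
      by (simp add: ring_distribs flip: complex_norm_square)
    then have "norm (complex_of_real I) \<le> (M * (2 * d)) * measure lborel {0..1::real}"
      using has_integral_bound[of "M * (2 * d)" "\<lambda>x. h x * (cnj (h x) - k x)" "of_real I" 0 1] M M0 d hk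
      by (simp add: norm_mult mult_mono)
    also have "\<dots> \<le> e"
    proof -
      have "M * e \<le> e * (M + 1)" using \<open>e > 0\<close> by (simp add: algebra_simps)
      then show ?thesis using M0 by (simp add: d_def field_simps)
    qed
    finally show ?thesis by simp
  qed
  then have "I \<le> 0" by (meson field_le_epsilon add_0 dense_ge not_le)
  moreover have "I \<ge> 0" using I0 by (rule has_integral_nonneg) auto
  ultimately have "I = 0" by simp
  then have "\<forall>x\<in>{0..1}. (norm (h x))^2 = 0"
    using integral_eq_0_iff[OF cn] by (simp add: I_def)
  then show ?thesis using assms by auto
qed

text \<open>Absolute convergence makes the series a continuous periodic function \<open>S\<close>
  with the same coefficients as \<open>g\<close>; uniqueness is then applied to g - S.\<close>

theorem fourier_series:
  fixes g :: "real \<Rightarrow> complex" and c :: "int \<Rightarrow> complex"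
  assumes cont: "continuous_on {0..1} g" and per: "g 0 = g 1"
    and c: "\<And>q. ((\<lambda>x. g x * ecis (- (of_int q * x))) has_integral c q) {0..1}"
    and summ: "(\<lambda>q. norm (c q)) summable_on UNIV"
    and x: "x \<in> {0..1}"
  shows "((\<lambda>q. c q * ecis (of_int q * x)) has_sum g x) UNIV"
proof -
  define S where "S x = (\<Sum>\<^sub>\<infinity>q. c q * ecis (of_int q * x))" for x
  have ul: "uniform_limit A (\<lambda>Q x. \<Sum>q\<in>Q. c q * ecis (of_int q * x)) S (finite_subsets_at_top UNIV)" for A
    unfolding S_def by (rule Weierstrass_m_test_general) (use summ in \<open>auto simp: norm_mult\<close>)
  have contS: "continuous_on {0..1} S"
  proof (rule uniform_limit_theorem[OF _ ul])
    show "\<forall>\<^sub>F Q in finite_subsets_at_top UNIV. continuous_on {0..1} (\<lambda>x. \<Sum>q\<in>Q. c q * ecis (of_int q * x))"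
      by (intro always_eventually allI continuous_intros)
  qed simp
  have sS: "((\<lambda>q. c q * ecis (of_int q * x)) has_sum S x) UNIV" for x
    unfolding S_def
    by (rule has_sum_infsum[OF abs_summable_summable]) (use summ in \<open>simp add: norm_mult\<close>)
  have orth: "((\<lambda>x. ecis (of_int r * x)) has_integral (if r = 0 then 1 else 0)) {0..1}" for r :: int
  proof (cases "r = 0")
    case True
    then show ?thesis using has_integral_const_real[of "1::complex" 0 1] by simp
  next
    case False
    have "((\<lambda>x. 2 * of_real pi * \<i> * of_int r * ecis (of_int r * x)) has_integral
        (ecis (of_int r * 1) - ecis (of_int r * 0))) {0..1}"
      by (rule fundamental_theorem_of_calculus) (auto intro: has_vector_derivative_ecis)
    from has_integral_mult_right[OF this, of "1 / (2 * of_real pi * \<i> * of_int r)"]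
    show ?thesis using False by simp
  qed
  have Sc: "((\<lambda>x. S x * ecis (- (of_int r * x))) has_integral c r) {0..1}" for r
  proof -
    have "uniform_limit {0..1} (\<lambda>Q x. (\<Sum>q\<in>Q. c q * ecis (of_int q * x)) * ecis (- (of_int r * x)))
       (\<lambda>x. S x * ecis (- (of_int r * x))) (finite_subsets_at_top UNIV)"
    proof (rule uniform_limitI)
      fix e :: real assume "e > 0"
      from uniform_limitD[OF ul[of "{0..1}"] this]
      show "\<forall>\<^sub>F Q in finite_subsets_at_top UNIV. \<forall>x\<in>{0..1}.
         dist ((\<Sum>q\<in>Q. c q * ecis (of_int q * x)) * ecis (- (of_int r * x))) (S x * ecis (- (of_int r * x))) < e"
        by eventually_elim (simp add: dist_norm norm_mult flip: left_diff_distrib)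
    qed
    then obtain I J where I: "\<And>Q. ((\<lambda>x. (\<Sum>q\<in>Q. c q * ecis (of_int q * x)) * ecis (- (of_int r * x))) has_integral I Q) {0..1}"
      and J: "((\<lambda>x. S x * ecis (- (of_int r * x))) has_integral J) {0..1}" and lim: "(I \<longlongrightarrow> J) (finite_subsets_at_top UNIV)"
      by (rule uniform_limit_integral) (auto intro!: continuous_intros)
    have eI: "I Q = (if r \<in> Q then c r else 0)" if "finite Q" for Q
    proof (rule has_integral_unique[OF I])
      have "((\<lambda>x. \<Sum>q\<in>Q. c q * ecis (of_int (q - r) * x)) has_integral
          (\<Sum>q\<in>Q. c q * (if q - r = 0 then 1 else 0))) {0..1}"
        by (intro has_integral_sum that has_integral_mult_right orth)
      moreover have "(\<Sum>q\<in>Q. c q * (if q - r = 0 then 1 else 0)) = (if r \<in> Q then c r else 0)"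
        using that by (simp add: if_distrib sum.delta cong: if_cong)
      moreover have "(\<lambda>x. \<Sum>q\<in>Q. c q * ecis (of_int (q - r) * x)) =
         (\<lambda>x. (\<Sum>q\<in>Q. c q * ecis (of_int q * x)) * ecis (- (of_int r * x)))"
        by (simp add: sum_distrib_right ecis_minus ecis_diff left_diff_distrib field_simps sum_divide_distrib)
      ultimately show "((\<lambda>x. (\<Sum>q\<in>Q. c q * ecis (of_int q * x)) * ecis (- (of_int r * x)))
          has_integral (if r \<in> Q then c r else 0)) {0..1}" by simp
    qed
    have "\<forall>\<^sub>F Q in finite_subsets_at_top UNIV. I Q = c r"
      unfolding eventually_finite_subsets_at_top by (rule exI[of _ "{r}"]) (simp add: eI)
    then have "(I \<longlongrightarrow> c r) (finite_subsets_at_top UNIV)" by (rule tendsto_eventually)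
    with lim have "J = c r" by (metis tendsto_unique finite_subsets_at_top_neq_bot)
    with J show ?thesis by simp
  qed
  \<comment> \<open>\<open>zero_fourier\<close> tests against e(qx), whereas coefficients are taken
    against e(-qx); hence the index -q.\<close>
  have "((\<lambda>x. g x * ecis (of_int q * x) - S x * ecis (of_int q * x)) has_integral 0) {0..1}" for q
    using has_integral_diff[OF c[of "- q"] Sc[of "- q"]] by simp
  then have "zero_fourier (\<lambda>x. g x - S x)"
    unfolding zero_fourier_def by (auto intro!: continuous_intros cont contS simp: left_diff_distrib)
  moreover have "S 0 = S 1" by (simp add: S_def)
  ultimately have "g x = S x" using fourier_uniqueness[of "\<lambda>x. g x - S x" x] per x by simp
  with sS show ?thesis by simp
qed


section \<open>Bernoulli polynomials\<close>

definition bernoulli_gen :: "real \<Rightarrow> real fps" where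
  "bernoulli_gen x = fps_X * fps_exp x / (fps_exp 1 - 1)"

text \<open>The quotient of power series is exact because the divisor has subdegree at most 1 and
  the numerator at least 1. All later facts are read off from this multiplied form.\<close>

lemma bernoulli_gen_mult: "bernoulli_gen x * (fps_exp 1 - 1) = fps_X * fps_exp x"
proof -
  have nz: "fps_exp 1 - 1 \<noteq> (0 :: real fps)"
  proof
    assume "fps_exp 1 - 1 = (0 :: real fps)"
    then have "fps_nth (fps_exp 1 - 1 :: real fps) 1 = 0" by simp
    then show False by simp
  qed
  have "subdegree (fps_exp 1 - 1 :: real fps) \<le> 1"
    by (rule subdegree_leI) simp
  moreover have "subdegree (fps_X * fps_exp x :: real fps) \<ge> 1"
    by (rule subdegree_geI) (auto simp: fps_eq_iff intro!: exI[of _ 1])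
  ultimately have "(fps_exp 1 - 1) dvd (fps_X * fps_exp x)"
    using nz by (subst fps_dvd_iff) auto
  then show ?thesis by (simp add: bernoulli_gen_def)
qed

lemma bernoulli_gen_eqI:
  assumes "G * (fps_exp 1 - 1) = fps_X * fps_exp x"
  shows "bernoulli_gen x = G"
proof -
  have "fps_nth (fps_exp 1 - 1 :: real fps) 1 \<noteq> 0" by simp
  then have "fps_exp 1 - 1 \<noteq> (0 :: real fps)" by (metis fps_zero_nth)
  moreover have "bernoulli_gen x * (fps_exp 1 - 1) = G * (fps_exp 1 - 1)"
    using assms bernoulli_gen_mult by simp
  ultimately show ?thesis by simp
qed

lemma bernoulli_poly_gen: "bernoulli_poly k x = fact k * fps_nth (bernoulli_gen x) k"
  by (simp add: bernoulli_poly_def bernoulli_gen_def)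

lemma bernoulli_gen_exp: "bernoulli_gen x = fps_exp x * bernoulli_gen 0"
  by (rule bernoulli_gen_eqI) (simp add: mult.assoc bernoulli_gen_mult mult_ac)

lemma bernoulli_poly_sum:
  "bernoulli_poly k x = (\<Sum>i\<le>k. fact k / fact i * fps_nth (bernoulli_gen 0) (k - i) * x ^ i)"
  by (subst bernoulli_poly_gen, subst bernoulli_gen_exp)
     (simp add: fps_mult_nth sum_distrib_left atLeast0AtMost mult_ac)

lemma has_real_derivative_bernoulli_poly:
  "(bernoulli_poly k has_real_derivative real k * bernoulli_poly (k - 1) x) (at x)"
proof -
  define b where "b = fps_nth (bernoulli_gen 0)"
  have "((\<lambda>x. \<Sum>i\<le>k. fact k / fact i * b (k - i) * x ^ i) has_real_derivative
     (\<Sum>i\<le>k. fact k / fact i * b (k - i) * (real i * x ^ (i - 1)))) (at x)"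
    by (auto intro!: derivative_eq_intros sum.cong simp: mult_ac)
  also have "(\<Sum>i\<le>k. fact k / fact i * b (k - i) * (real i * x ^ (i - 1))) =
     real k * bernoulli_poly (k - 1) x"
  proof (cases k)
    case (Suc j)
    have "(\<Sum>i\<le>k. fact k / fact i * b (k - i) * (real i * x ^ (i - 1))) =
        (\<Sum>i\<le>j. fact k / fact (Suc i) * b (j - i) * (real (Suc i) * x ^ i))"
      unfolding Suc by (subst sum.atMost_Suc_shift) simp
    also have "\<dots> = (\<Sum>i\<le>j. real k * (fact j / fact i * b (j - i) * x ^ i))"
      by (intro sum.cong refl) (simp add: Suc field_simps del: of_nat_Suc)
    finally show ?thesis by (simp add: bernoulli_poly_sum Suc b_def sum_distrib_left)
  qed simp
  finally show ?thesis
    unfolding b_def by (simp add: bernoulli_poly_sum[abs_def])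
qed

lemma bernoulli_poly_0 [simp]: "bernoulli_poly 0 x = 1"
proof -
  have "fps_nth (bernoulli_gen 0 * (fps_exp 1 - 1)) 1 = 1"
    by (subst bernoulli_gen_mult) simp
  then have "fps_nth (bernoulli_gen 0) 0 = 1" by (simp add: fps_mult_nth)
  then show ?thesis by (simp add: bernoulli_poly_sum)
qed

text \<open>X exp X / (exp X - 1) and X / (exp X - 1) differ by X.\<close>

lemma bernoulli_poly_1_minus_0: "bernoulli_poly k 1 - bernoulli_poly k 0 = (if k = 1 then 1 else 0)"
proof -
  have "bernoulli_gen 1 = bernoulli_gen 0 + fps_X"
    by (rule bernoulli_gen_eqI) (use bernoulli_gen_mult[of 0] in \<open>simp add: algebra_simps\<close>)
  then show ?thesis by (simp add: bernoulli_poly_gen)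
qed

text \<open>Replacing X by -X and multiplying by exp X turns the defining equation at x into the one
  at 1 - x; on coefficients the substitution is the sign (-1)^k.\<close>

lemma bernoulli_poly_reflect: "bernoulli_poly k (1 - x) = (-1) ^ k * bernoulli_poly k x"
proof -
  let ?c = "\<lambda>f. fps_compose f (fps_const (-1) * fps_X :: real fps)"
  have "?c (bernoulli_gen x * (fps_exp 1 - 1)) = ?c (fps_X * fps_exp x)"
    by (simp only: bernoulli_gen_mult)
  then have "?c (bernoulli_gen x) * (fps_exp (-1) - 1) = (fps_const (-1) * fps_X) * fps_exp (- x)"
    by (simp add: fps_compose_mult_distrib fps_compose_sub_distrib fps_exp_compose_linear fps_X_fps_compose_startby0
        del: fps_const_neg)
  then have "?c (bernoulli_gen x) * (fps_exp (-1) - 1) * fps_exp 1 = (fps_const (-1) * fps_X) * fps_exp (- x) * fps_exp 1"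
    by simp
  moreover have "fps_exp (-1) * fps_exp 1 = (1 :: real fps)" "fps_exp (- x) * fps_exp 1 = fps_exp (1 - x)"
    by (simp_all flip: fps_exp_add_mult)
  then have "?c (bernoulli_gen x) * (fps_exp (-1) - 1) * fps_exp 1 = ?c (bernoulli_gen x) * (1 - fps_exp 1)"
    "(fps_const (-1) * fps_X) * fps_exp (- x) * fps_exp 1 = - (fps_X * fps_exp (1 - x))"
    by (simp_all add: mult.assoc left_diff_distrib flip: fps_const_neg)
  ultimately have "?c (bernoulli_gen x) * (fps_exp 1 - 1) = fps_X * fps_exp (1 - x)"
    by (simp add: algebra_simps)
  then have "bernoulli_gen (1 - x) = ?c (bernoulli_gen x)" by (rule bernoulli_gen_eqI)
  then show ?thesis by (simp add: bernoulli_poly_gen fps_compose_linear)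
qed

lemma continuous_on_bernoulli_poly [continuous_intros]:
  "continuous_on A f \<Longrightarrow> continuous_on A (\<lambda>x. bernoulli_poly k (f x))"
  by (subst bernoulli_poly_sum) (intro continuous_intros)

text \<open>Integration by parts lowers k, with boundary term B_k(1) - B_k(0), which is nonzero only
  for k = 1. The recursion starts there: the integral of e(-qx) vanishes and the boundary term 1
  gives the coefficient.\<close>

lemma bernoulli_fourier_coeff:
  assumes "k \<ge> 1"
  shows "((\<lambda>x. of_real (bernoulli_poly k x) * ecis (- (of_int q * x))) has_integral
    (if q = 0 then 0 else - fact k / (2 * of_real pi * \<i> * of_int q) ^ k)) {0..1}"
proof -
  define w where "w = 2 * of_real pi * \<i> * of_int q"
  have vd: "((\<lambda>x. complex_of_real (bernoulli_poly k x)) has_vector_derivative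
      of_nat k * of_real (bernoulli_poly (k - 1) x)) (at x within {0..1})" for k x
    using has_vector_derivative_of_real[OF
      has_real_derivative_bernoulli_poly[of k x, THEN has_field_derivative_at_within], of "{0..1}"] by simp
  have step: "((\<lambda>x. of_nat k * of_real (bernoulli_poly (k - 1) x) * ecis (- (of_int q * x))
       - w * (of_real (bernoulli_poly k x) * ecis (- (of_int q * x)))) has_integral
      (if k = 1 then 1 else 0)) {0..1}" for k
  proof -
    have "((\<lambda>x. of_nat k * of_real (bernoulli_poly (k - 1) x) * ecis (- (of_int q * x))
       - w * (of_real (bernoulli_poly k x) * ecis (- (of_int q * x)))) has_integral
      of_real (bernoulli_poly k 1) * ecis (- (of_int q * 1)) - of_real (bernoulli_poly k 0) * ecis (- (of_int q * 0))) {0..1}"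
    proof (rule fundamental_theorem_of_calculus)
      fix x :: real
      have e: "((\<lambda>x. ecis (- (of_int q * x))) has_vector_derivative (- w * ecis (- (of_int q * x)))) (at x within {0..1})"
        using has_vector_derivative_ecis[of "-q" x "{0..1}"] by (simp add: w_def)
      show "((\<lambda>x. of_real (bernoulli_poly k x) * ecis (- (of_int q * x))) has_vector_derivative
          of_nat k * of_real (bernoulli_poly (k - 1) x) * ecis (- (of_int q * x))
       - w * (of_real (bernoulli_poly k x) * ecis (- (of_int q * x)))) (at x within {0..1})"
        using has_vector_derivative_mult[OF vd[of k x] e] by (simp add: algebra_simps)
    qed simp
    also have "of_real (bernoulli_poly k 1) * ecis (- (of_int q * 1)) - of_real (bernoulli_poly k 0) * ecis (- (of_int q * 0))
       = complex_of_real (bernoulli_poly k 1 - bernoulli_poly k 0)"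
      by (simp add: ecis_minus)
    also have "\<dots> = (if k = 1 then 1 else 0)" by (simp add: bernoulli_poly_1_minus_0)
    finally show ?thesis .
  qed
  show ?thesis
  proof (cases "q = 0")
    case True
    \<comment> \<open>For q = 0 one integrates (k + 1) B_k as the derivative of B_(k+1), whose end
      values agree because k + 1 >= 2.\<close>
    have "((\<lambda>x. of_nat (Suc k) * of_real (bernoulli_poly k x)) has_integral (0::complex)) {0..1}"
      using step[of "Suc k"] assms True by (simp add: w_def)
    from has_integral_mult_right[OF this, of "1 / of_nat (Suc k)"]
    show ?thesis using True by (simp del: of_nat_Suc)
  next
    case False
    then have w: "w \<noteq> 0" by (simp add: w_def)
    have base: "((\<lambda>x. of_real (bernoulli_poly 0 x) * ecis (- (of_int q * x))) has_integral 0) {0..1}"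
      using has_integral_mult_right[OF step[of 0], of "-1 / w"] w by simp
    show ?thesis using assms
    proof (induction k rule: dec_induct)
      case base
      have "((\<lambda>x. of_nat 1 * of_real (bernoulli_poly (1 - 1) x) * ecis (- (of_int q * x))) has_integral 0) {0..1}"
        using \<open>((\<lambda>x. of_real (bernoulli_poly 0 x) * ecis (- (of_int q * x))) has_integral 0) {0..1}\<close> by simp
      from has_integral_mult_right[OF has_integral_diff[OF this step[of 1]], of "1 / w"]
      show ?case using w False by (simp add: w_def)
    next
      case (step k)
      have "((\<lambda>x. of_nat (Suc k) * of_real (bernoulli_poly (Suc k - 1) x) * ecis (- (of_int q * x))) has_integral
           of_nat (Suc k) * (- fact k / w ^ k)) {0..1}"
        using has_integral_mult_right[OF step.IH, of "of_nat (Suc k)"] False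
        by (simp add: w_def mult_ac del: of_nat_Suc)
      from has_integral_mult_right[OF has_integral_diff[OF this
        \<open>\<And>k. ((\<lambda>x. of_nat k * of_real (bernoulli_poly (k - 1) x) * ecis (- (of_int q * x))
       - w * (of_real (bernoulli_poly k x) * ecis (- (of_int q * x)))) has_integral
      (if k = 1 then 1 else 0)) {0..1}\<close>[of "Suc k"]], of "1 / w"]
      show ?case using w False step.hyps by (simp add: w_def[symmetric] del: of_nat_Suc)
    qed
  qed
qed

lemma summable_on_int_powr:
  assumes "r > 1"
  shows "(\<lambda>q::int. (1 + \<bar>real_of_int q\<bar>) powr (- r)) summable_on UNIV"
proof -
  have s: "summable (\<lambda>n. (1 + real n) powr (- r))"
    using assms summable_real_powr_iff[of "-r"] summable_Suc_iff[of "\<lambda>n. real n powr (- r)"]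
    by (simp add: add.commute)
  then have n: "(\<lambda>n. (1 + real n) powr (- r)) summable_on UNIV"
    by (intro norm_summable_imp_summable_on) simp
  have inj: "inj int" "inj (\<lambda>n. - int n)" by (auto intro: injI)
  have "(\<lambda>q::int. (1 + \<bar>real_of_int q\<bar>) powr (- r)) summable_on range int"
    by (subst summable_on_reindex[OF inj(1)]) (use n in \<open>simp add: o_def\<close>)
  moreover have "(\<lambda>q::int. (1 + \<bar>real_of_int q\<bar>) powr (- r)) summable_on range (\<lambda>n. - int n)"
    by (subst summable_on_reindex[OF inj(2)]) (use n in \<open>simp add: o_def\<close>)
  ultimately have "(\<lambda>q::int. (1 + \<bar>real_of_int q\<bar>) powr (- r)) summable_on (range int \<union> range (\<lambda>n. - int n))"
    by (rule summable_on_union)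
  moreover have "range int \<union> range (\<lambda>n. - int n) = UNIV"
    by (auto, metis int_cases2 rangeI)
  ultimately show ?thesis by simp
qed

text \<open>From k = 2 on the coefficients are absolutely summable and B_k(0) = B_k(1), so the
  general theorem applies. The sawtooth k = 1 has neither property and is reached later by Abel
  summation.\<close>

lemma periodic_bernoulli_fourier:
  assumes "k \<ge> 2"
  shows "((\<lambda>q. (if q = 0 then 0 else - fact k / (2 * of_real pi * \<i> * of_int q) ^ k) * ecis (of_int q * x))
     has_sum of_real (periodic_bernoulli k x)) UNIV"
proof -
  define c where "c q = (if q = 0 then 0 else - fact k / (2 * of_real pi * \<i> * of_int q) ^ k)" for q :: int
  have bound: "norm (c q) \<le> fact k * (4 * (1 + \<bar>real_of_int q\<bar>) powr (- 2))" for q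
  proof (cases "q = 0")
    case False
    then have q1: "\<bar>real_of_int q\<bar> \<ge> 1" by linarith
    have "(1 + \<bar>real_of_int q\<bar>) ^ 2 \<le> (2 * \<bar>real_of_int q\<bar>) ^ 2"
      using q1 by (intro power_mono) auto
    also have "\<dots> \<le> 4 * (2 * pi * \<bar>real_of_int q\<bar>) ^ 2"
    proof -
      have "1 \<le> (2 * pi)^2" using pi_gt3 by (intro one_le_power) linarith
      then have "1 * \<bar>real_of_int q\<bar>^2 \<le> (2 * pi)^2 * \<bar>real_of_int q\<bar>^2" by (intro mult_right_mono) auto
      then show ?thesis by (simp add: power_mult_distrib)
    qed
    also have "\<dots> \<le> 4 * (2 * pi * \<bar>real_of_int q\<bar>) ^ k"
    proof -
      have "1 * 1 \<le> (2 * pi) * \<bar>real_of_int q\<bar>" using pi_gt3 q1 by (intro mult_mono) auto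
      then show ?thesis using assms by (intro mult_left_mono power_increasing) auto
    qed
    finally have "(1 + \<bar>real_of_int q\<bar>) ^ 2 \<le> 4 * (2 * pi * \<bar>real_of_int q\<bar>) ^ k" .
    moreover have "(1 + \<bar>real_of_int q\<bar>) powr (- 2) = inverse ((1 + \<bar>real_of_int q\<bar>) ^ 2)"
      using q1 powr_realpow[of "1 + \<bar>real_of_int q\<bar>" 2] by (simp add: powr_minus)
    moreover have "(2 * pi * \<bar>real_of_int q\<bar>) ^ k > 0" using q1 by simp
    ultimately have "1 / (2 * pi * \<bar>real_of_int q\<bar>) ^ k \<le> 4 * (1 + \<bar>real_of_int q\<bar>) powr (- 2)"
    proof -
      assume a: "(1 + \<bar>real_of_int q\<bar>) ^ 2 \<le> 4 * (2 * pi * \<bar>real_of_int q\<bar>) ^ k"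
        "(1 + \<bar>real_of_int q\<bar>) powr (- 2) = inverse ((1 + \<bar>real_of_int q\<bar>) ^ 2)"
      have "4 / (4 * (2 * pi * \<bar>real_of_int q\<bar>) ^ k) \<le> 4 / (1 + \<bar>real_of_int q\<bar>) ^ 2"
        using a(1) q1 by (intro divide_left_mono mult_pos_pos) auto
      then show ?thesis by (simp only: a(2)) (simp add: field_simps)
    qed
    then have "fact k * (1 / (2 * pi * \<bar>real_of_int q\<bar>) ^ k) \<le> fact k * (4 * (1 + \<bar>real_of_int q\<bar>) powr (- 2))"
      by (intro mult_left_mono) auto
    then show ?thesis using False by (simp add: c_def norm_divide norm_power norm_mult)
  qed (simp add: c_def)
  have summ: "(\<lambda>q. norm (c q)) summable_on UNIV"
    by (rule summable_on_comparison_test[OF _ bound])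
       (auto intro!: summable_on_cmult_right summable_on_int_powr)
  have "((\<lambda>q. c q * ecis (of_int q * (x - of_int \<lfloor>x\<rfloor>))) has_sum of_real (bernoulli_poly k (x - of_int \<lfloor>x\<rfloor>))) UNIV"
  proof (rule fourier_series[where g = "\<lambda>x. of_real (bernoulli_poly k x)"])
    show "complex_of_real (bernoulli_poly k 0) = of_real (bernoulli_poly k 1)"
      using bernoulli_poly_1_minus_0[of k] assms by simp
    show "((\<lambda>x. complex_of_real (bernoulli_poly k x) * ecis (- (of_int q * x))) has_integral c q) {0..1}" for q
      unfolding c_def using assms by (intro bernoulli_fourier_coeff) auto
  qed (auto intro!: continuous_intros summ, linarith+)
  moreover have "ecis (of_int q * (x - of_int \<lfloor>x\<rfloor>)) = ecis (of_int q * x)" for q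
    by (rule ecis_cong) (simp add: ring_distribs)
  ultimately show ?thesis
    using assms by (simp add: c_def periodic_bernoulli_def)
qed


section \<open>Exponential sums over cosets of the integers\<close>

text \<open>For k = 0 this is exp(-yX) / (1 - exp(-X)), that is, the Bernoulli generating function
  at 1 - y divided by X; larger k give its derivatives in X up to sign. The variable y is complex so
  that termwise complex differentiation is available in y as well.\<close>

definition exp_sum :: "nat \<Rightarrow> complex \<Rightarrow> complex \<Rightarrow> complex" where
  "exp_sum k y X = suminf (\<lambda>l. (y + of_nat l) ^ k * exp (- ((y + of_nat l) * X)))"

lemma power_le_exp:
  fixes u \<delta> :: real
  assumes "u \<ge> 0" "\<delta> > 0"
  shows "u ^ k \<le> fact k / \<delta> ^ k * exp (\<delta> * u)"
proof -
  have e: "(\<lambda>n. (\<delta> * u) ^ n /\<^sub>R fact n) sums exp (\<delta> * u)" by (rule exp_converges)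
  have "(\<Sum>n\<in>{k}. (\<delta> * u) ^ n /\<^sub>R fact n) \<le> exp (\<delta> * u)"
    unfolding sums_unique[OF e] using e assms by (intro sum_le_suminf) (auto simp: sums_iff)
  then show ?thesis using assms by (simp add: field_simps power_mult_distrib)
qed

lemma summable_power_exp:
  fixes B \<delta> :: real
  assumes "B \<ge> 0" "\<delta> > 0"
  shows "summable (\<lambda>l. (B + real l) ^ k * exp (- (real l * \<delta>)))"
proof (rule summable_comparison_test)
  \<comment> \<open>Half of the decay rate absorbs the power, the other half leaves a geometric
    series.\<close>
  let ?C = "fact k / (\<delta> / 2) ^ k * exp (\<delta> / 2 * B)"
  show "summable (\<lambda>l. ?C * exp (- (\<delta> / 2)) ^ l)"
    using assms by (intro summable_mult summable_geometric) auto
  have "norm ((B + real l) ^ k * exp (- (real l * \<delta>))) \<le> ?C * exp (- (\<delta> / 2)) ^ l" for l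
  proof -
    have "(B + real l) ^ k * exp (- (real l * \<delta>)) \<le>
        (fact k / (\<delta> / 2) ^ k * exp (\<delta> / 2 * (B + real l))) * exp (- (real l * \<delta>))"
      using assms by (intro mult_right_mono power_le_exp) auto
    also have "\<dots> = ?C * exp (- (\<delta> / 2)) ^ l"
      by (simp add: exp_of_nat_mult[symmetric] exp_add[symmetric] mult.assoc) (simp add: field_simps)
    finally show ?thesis using assms by simp
  qed
  then show "\<exists>N. \<forall>l\<ge>N. norm ((B + real l) ^ k * exp (- (real l * \<delta>))) \<le> ?C * exp (- (\<delta> / 2)) ^ l"
    by blast
qed

lemma norm_exp_sum_term:
  assumes "norm y \<le> B" "Re X \<ge> \<delta>" "norm X \<le> R" "\<delta> > 0"
  shows "norm ((y + of_nat l) ^ k * exp (- ((y + of_nat l) * X)))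
    \<le> exp (B * R) * ((B + real l) ^ k * exp (- (real l * \<delta>)))"
proof -
  have B: "B \<ge> 0" "R \<ge> 0" using assms norm_ge_zero order_trans by blast+
  have "norm (y + of_nat l) \<le> B + real l"
    using norm_triangle_ineq[of y "of_nat l"] assms by simp
  then have 1: "norm ((y + of_nat l) ^ k) \<le> (B + real l) ^ k"
    by (simp add: norm_power power_mono)
  have "Re (- ((y + of_nat l) * X)) = - Re (y * X) - real l * Re X" by (simp add: algebra_simps)
  moreover have "- Re (y * X) \<le> norm (y * X)" using abs_Re_le_cmod[of "y * X"] by linarith
  moreover have "norm (y * X) \<le> B * R" unfolding norm_mult using assms B by (intro mult_mono) auto
  moreover have "real l * \<delta> \<le> real l * Re X" using assms by (intro mult_left_mono) auto
  ultimately have "Re (- ((y + of_nat l) * X)) \<le> B * R - real l * \<delta>" by linarith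
  then have 2: "norm (exp (- ((y + of_nat l) * X))) \<le> exp (B * R) * exp (- (real l * \<delta>))"
    by (simp add: norm_exp_eq_Re flip: exp_add)
  show ?thesis unfolding norm_mult
    using mult_mono[OF 1 2] B by (simp add: mult_ac)
qed

lemma exp_sum_summable:
  assumes "Re X > 0"
  shows "summable (\<lambda>l. norm ((y + of_nat l) ^ k * exp (- ((y + of_nat l) * X))))"
proof (rule summable_comparison_test)
  show "summable (\<lambda>l. exp (norm y * norm X) * ((norm y + real l) ^ k * exp (- (real l * Re X))))"
    using assms by (intro summable_mult summable_power_exp) auto
  show "\<exists>N. \<forall>l\<ge>N. norm (norm ((y + of_nat l) ^ k * exp (- ((y + of_nat l) * X))))
      \<le> exp (norm y * norm X) * ((norm y + real l) ^ k * exp (- (real l * Re X)))"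
    using norm_exp_sum_term[OF order_refl order_refl order_refl assms] by simp
qed

lemma exp_sum_sums:
  assumes "Re X > 0"
  shows "(\<lambda>l. (y + of_nat l) ^ k * exp (- ((y + of_nat l) * X))) sums exp_sum k y X"
  unfolding exp_sum_def using summable_norm_cancel[OF exp_sum_summable[OF assms]] by (rule summable_sums)

text \<open>Uniform in both variables at once, so that one estimate justifies termwise
  differentiation in X and in y.\<close>

lemma exp_sum_uniform:
  assumes "\<delta> > 0"
  shows "uniformly_convergent_on {p. norm (fst p) \<le> B \<and> Re (snd p) \<ge> \<delta> \<and> norm (snd p) \<le> R}
     (\<lambda>n p. \<Sum>l<n. (fst p + of_nat l) ^ k * exp (- ((fst p + of_nat l) * snd p)))"
proof (cases "B \<ge> 0")
  case True
  show ?thesis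
  proof (rule Weierstrass_m_test')
    show "summable (\<lambda>l. exp (B * R) * ((B + real l) ^ k * exp (- (real l * \<delta>))))"
      using assms True by (intro summable_mult summable_power_exp) auto
  qed (use assms in \<open>auto intro!: norm_exp_sum_term\<close>)
next
  \<comment> \<open>For B < 0 the set is empty.\<close>
  case False
  then have "{p. norm (fst p) \<le> B \<and> Re (snd p) \<ge> \<delta> \<and> norm (snd p) \<le> R} = ({} :: (complex \<times> complex) set)"
    by auto (smt (verit) norm_ge_zero)
  then show ?thesis by (simp only: uniformly_convergent_on_def uniform_limit_iff) simp
qed

lemma exp_sum_deriv_X:
  assumes "Re X > 0"
  shows "((\<lambda>X. exp_sum k y X) has_field_derivative - exp_sum (Suc k) y X) (at X)"
proof -
  define S where "S = ball X (Re X / 2)"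
  have X: "X \<in> S" using assms by (simp add: S_def)
  have S: "Re Z \<ge> Re X / 2 \<and> norm Z \<le> norm X + Re X" if "Z \<in> S" for Z
  proof -
    have n: "norm (X - Z) < Re X / 2" using that by (simp add: S_def dist_norm)
    have "\<bar>Re (X - Z)\<bar> \<le> norm (X - Z)" by (rule abs_Re_le_cmod)
    moreover have "norm Z \<le> norm X + norm (X - Z)" by (metis norm_minus_commute norm_triangle_sub)
    ultimately show ?thesis using n assms by auto
  qed
  have "uniformly_convergent_on S (\<lambda>n Z. \<Sum>l<n. (y + of_nat l) ^ Suc k * exp (- ((y + of_nat l) * Z)))"
  proof -
    obtain g where g: "uniform_limit {p. norm (fst p) \<le> norm y \<and> Re (snd p) \<ge> Re X / 2 \<and> norm (snd p) \<le> norm X + Re X}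
     (\<lambda>n p. \<Sum>l<n. (fst p + of_nat l) ^ Suc k * exp (- ((fst p + of_nat l) * snd p))) g sequentially"
      using exp_sum_uniform[of "Re X / 2" "norm y" "norm X + Re X" "Suc k"] assms
      by (auto simp: uniformly_convergent_on_def)
    have "uniform_limit S (\<lambda>n Z. \<Sum>l<n. (y + of_nat l) ^ Suc k * exp (- ((y + of_nat l) * Z))) (\<lambda>Z. g (y, Z)) sequentially"
      using uniform_limit_compose'[OF g, of "\<lambda>Z. (y, Z)" S] S by (auto simp: Pi_def)
    then show ?thesis by (auto simp: uniformly_convergent_on_def)
  qed
  from bounded_linear.uniformly_convergent_on[OF bounded_linear_mult_right[of "- 1"] this]
  have u: "uniformly_convergent_on S (\<lambda>n Z. \<Sum>l<n. - ((y + of_nat l) ^ Suc k * exp (- ((y + of_nat l) * Z))))"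
    by (simp add: sum_negf)
  have "((\<lambda>X. exp_sum k y X) has_field_derivative suminf (\<lambda>l. - ((y + of_nat l) ^ Suc k * exp (- ((y + of_nat l) * X))))) (at X)"
    unfolding exp_sum_def
  proof (rule has_field_derivative_series'(2)[where S = S and ?x0.0 = X, OF _ _ u X])
    show "convex S" by (simp add: S_def)
    show "X \<in> interior S" using X by (simp add: S_def)
    show "summable (\<lambda>l. (y + of_nat l) ^ k * exp (- ((y + of_nat l) * X)))"
      using exp_sum_sums[OF assms] sums_summable by blast
    fix l Z
    show "((\<lambda>Z. (y + of_nat l) ^ k * exp (- ((y + of_nat l) * Z))) has_field_derivative
       - ((y + of_nat l) ^ Suc k * exp (- ((y + of_nat l) * Z)))) (at Z within S)"
      by (auto intro!: derivative_eq_intros simp: algebra_simps)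
  qed
  also have "suminf (\<lambda>l. - ((y + of_nat l) ^ Suc k * exp (- ((y + of_nat l) * X)))) = - exp_sum (Suc k) y X"
    using sums_minus[OF exp_sum_sums[OF assms, of y "Suc k"]] by (simp add: sums_iff)
  finally show ?thesis .
qed

text \<open>The lowering of k is what makes the Fourier coefficients in y computable by parts. For k
  = 0 the truncated index k - 1 is harmless, since its factor is 0.\<close>

lemma exp_sum_deriv_y:
  assumes "Re X > 0"
  shows "((\<lambda>y. exp_sum k y X) has_field_derivative of_nat k * exp_sum (k - 1) y X - X * exp_sum k y X) (at y)"
proof -
  define S where "S = ball y 1"
  have X: "y \<in> S" by (simp add: S_def)
  have S: "norm Z \<le> norm y + 1" if "Z \<in> S" for Z
  proof -
    have "norm (y - Z) < 1" using that by (simp add: S_def dist_norm)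
    moreover have "norm Z \<le> norm y + norm (y - Z)" by (metis norm_minus_commute norm_triangle_sub)
    ultimately show ?thesis by auto
  qed
  have uc: "uniformly_convergent_on S (\<lambda>n Z. \<Sum>l<n. (Z + of_nat l) ^ j * exp (- ((Z + of_nat l) * X)))" for j
  proof -
    obtain g where g: "uniform_limit {p. norm (fst p) \<le> norm y + 1 \<and> Re (snd p) \<ge> Re X \<and> norm (snd p) \<le> norm X}
     (\<lambda>n p. \<Sum>l<n. (fst p + of_nat l) ^ j * exp (- ((fst p + of_nat l) * snd p))) g sequentially"
      using exp_sum_uniform[of "Re X" "norm y + 1" "norm X" j] assms
      by (auto simp: uniformly_convergent_on_def)
    have "uniform_limit S (\<lambda>n Z. \<Sum>l<n. (Z + of_nat l) ^ j * exp (- ((Z + of_nat l) * X))) (\<lambda>Z. g (Z, X)) sequentially"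
      using uniform_limit_compose'[OF g, of "\<lambda>Z. (Z, X)" S] S by (auto simp: Pi_def)
    then show ?thesis by (auto simp: uniformly_convergent_on_def)
  qed
  have mc: "uniformly_convergent_on S (\<lambda>n Z. c * (\<Sum>l<n. (Z + of_nat l) ^ j * exp (- ((Z + of_nat l) * X))))" for j c
    using bounded_linear.uniformly_convergent_on[OF bounded_linear_mult_right uc] .
  let ?d = "\<lambda>l Z. of_nat k * ((Z + of_nat l) ^ (k - 1) * exp (- ((Z + of_nat l) * X)))
              - X * ((Z + of_nat l) ^ k * exp (- ((Z + of_nat l) * X)))"
  have u: "uniformly_convergent_on S (\<lambda>n Z. \<Sum>l<n. ?d l Z)"
    using uniformly_convergent_minus[OF mc mc, of "of_nat k" "k - 1" X k]
    by (simp add: sum_subtractf sum_distrib_left)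
  have "((\<lambda>y. exp_sum k y X) has_field_derivative suminf (\<lambda>l. ?d l y)) (at y)"
    unfolding exp_sum_def
  proof (rule has_field_derivative_series'(2)[where S = S and ?x0.0 = y, OF _ _ u X])
    show "convex S" by (simp add: S_def)
    show "y \<in> interior S" using X by (simp add: S_def)
    show "summable (\<lambda>l. (y + of_nat l) ^ k * exp (- ((y + of_nat l) * X)))"
      using exp_sum_sums[OF assms] sums_summable by blast
    fix l Z
    show "((\<lambda>Z. (Z + of_nat l) ^ k * exp (- ((Z + of_nat l) * X))) has_field_derivative ?d l Z) (at Z within S)"
      by (auto intro!: derivative_eq_intros simp: algebra_simps)
  qed
  also have "suminf (\<lambda>l. ?d l y) = of_nat k * exp_sum (k - 1) y X - X * exp_sum k y X"
    by (rule sums_unique[symmetric]) (intro sums_diff sums_mult exp_sum_sums assms)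
  finally show ?thesis .
qed

lemma exp_sum_shift:
  assumes "Re X > 0"
  shows "exp_sum k y X = y ^ k * exp (- (y * X)) + exp_sum k (y + 1) X"
proof -
  have "(\<lambda>l. (y + of_nat (Suc l)) ^ k * exp (- ((y + of_nat (Suc l)) * X))) sums exp_sum k (y + 1) X"
    using exp_sum_sums[OF assms, of "y + 1" k] by (simp add: algebra_simps)
  from sums_Suc[OF this] exp_sum_sums[OF assms, of y k] show ?thesis
    by (simp add: sums_iff add.commute)
qed

lemma exp_sum_0_eq:
  assumes "Re X > 0"
  shows "exp_sum 0 y X = exp (- (y * X)) / (1 - exp (- X))"
proof -
  have "norm (exp (- X)) < 1" using assms by (simp add: norm_exp_eq_Re)
  from sums_mult[OF geometric_sums[OF this], of "exp (- (y * X))"]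
  have "(\<lambda>l. exp (- (y * X)) * exp (- X) ^ l) sums (exp (- (y * X)) / (1 - exp (- X)))" by simp
  moreover have "(\<lambda>l. exp (- (y * X)) * exp (- X) ^ l) = (\<lambda>l. (y + of_nat l) ^ 0 * exp (- ((y + of_nat l) * X)))"
    by (simp add: exp_of_nat_mult[symmetric] exp_add[symmetric] algebra_simps)
  ultimately show ?thesis using exp_sum_sums[OF assms, of y 0] sums_unique2 by metis
qed

text \<open>The imaginary part bounds |p| by norm w / Im z, and then the triangle inequality bounds
  |q|; c is the reciprocal of the sum of the two constants. Real p and q are allowed, which is used
  for points that are not in the lattice.\<close>

lemma norm_lattice_ge:
  assumes "Im z > 0"
  obtains c where "c > 0" "\<And>p q :: real. c * (\<bar>p\<bar> + \<bar>q\<bar>) \<le> norm (of_real p * z + of_real q)"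
proof
  define c where "c = 1 / (1 + (1 + norm z) / Im z)"
  have pos: "1 + (1 + norm z) / Im z > 0"
  proof -
    have "(1 + norm z) / Im z > 0" using assms by (intro divide_pos_pos) (auto intro: add_pos_nonneg)
    then show ?thesis by linarith
  qed
  then show "c > 0" by (simp add: c_def)
  fix p q :: real
  define w where "w = of_real p * z + of_real q"
  have "\<bar>p\<bar> * Im z = \<bar>Im w\<bar>" using assms by (simp add: w_def abs_mult)
  also have "\<dots> \<le> norm w" by (rule abs_Im_le_cmod)
  finally have p: "\<bar>p\<bar> \<le> norm w / Im z" using assms by (simp add: field_simps)
  have "\<bar>q\<bar> = norm (w - of_real p * z)" by (simp add: w_def)
  also have "\<dots> \<le> norm w + \<bar>p\<bar> * norm z" using norm_triangle_ineq4[of w "of_real p * z"] by (simp add: norm_mult)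
  also have "\<dots> \<le> norm w + norm w / Im z * norm z" using p by (intro add_left_mono mult_right_mono) auto
  finally have "\<bar>p\<bar> + \<bar>q\<bar> \<le> norm w * (1 + (1 + norm z) / Im z)"
    using p by (simp add: algebra_simps add_divide_distrib)
  then show "c * (\<bar>p\<bar> + \<bar>q\<bar>) \<le> norm (of_real p * z + of_real q)"
    using pos by (simp add: c_def w_def field_simps)
qed

text \<open>Integration by parts again: by \<open>exp_sum_shift\<close> the boundary term is -(0^k),
  nonzero only for k = 0, and each further step contributes a factor k / (X + 2 pi i q).\<close>

lemma exp_sum_fourier_coeff:
  assumes X: "Re X > 0"
  shows "((\<lambda>y. exp_sum k (of_real y) X * ecis (- (of_int q * y))) has_integral
     fact k / (X + 2 * of_real pi * \<i> * of_int q) ^ Suc k) {0..1}"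
proof -
  define w where "w = 2 * of_real pi * \<i> * of_int q"
  have nz: "X + w \<noteq> 0"
  proof
    assume "X + w = 0" then have "Re (X + w) = 0" by simp
    then show False using X by (simp add: w_def)
  qed
  have step: "((\<lambda>y. of_nat k * (exp_sum (k - 1) (of_real y) X * ecis (- (of_int q * y)))
       - (X + w) * (exp_sum k (of_real y) X * ecis (- (of_int q * y)))) has_integral
      (if k = 0 then - 1 else 0)) {0..1}" for k
  proof -
    have "((\<lambda>y. of_nat k * (exp_sum (k - 1) (of_real y) X * ecis (- (of_int q * y)))
       - (X + w) * (exp_sum k (of_real y) X * ecis (- (of_int q * y)))) has_integral
        exp_sum k (of_real 1) X * ecis (- (of_int q * 1)) - exp_sum k (of_real 0) X * ecis (- (of_int q * 0))) {0..1}"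
    proof (rule fundamental_theorem_of_calculus)
      fix x :: real
      have e: "((\<lambda>x. ecis (- (of_int q * x))) has_vector_derivative (- w * ecis (- (of_int q * x)))) (at x within {0..1})"
        using has_vector_derivative_ecis[of "-q" x "{0..1}"] by (simp add: w_def)
      have d: "((\<lambda>x. exp_sum k (of_real x) X) has_vector_derivative
         of_nat k * exp_sum (k - 1) (of_real x) X - X * exp_sum k (of_real x) X) (at x within {0..1})"
        using has_vector_derivative_real_field[OF exp_sum_deriv_y[OF X]] .
      show "((\<lambda>y. exp_sum k (of_real y) X * ecis (- (of_int q * y))) has_vector_derivative
         of_nat k * (exp_sum (k - 1) (of_real x) X * ecis (- (of_int q * x)))
       - (X + w) * (exp_sum k (of_real x) X * ecis (- (of_int q * x)))) (at x within {0..1})"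
        using has_vector_derivative_mult[OF d e] by (simp add: algebra_simps)
    qed simp
    also have "exp_sum k (of_real 1) X * ecis (- (of_int q * 1)) - exp_sum k (of_real 0) X * ecis (- (of_int q * 0))
       = (if k = 0 then - 1 else 0)"
      using exp_sum_shift[OF X, of k 0] by (simp add: ecis_minus)
    finally show ?thesis .
  qed
  have "((\<lambda>y. exp_sum k (of_real y) X * ecis (- (of_int q * y))) has_integral fact k / (X + w) ^ Suc k) {0..1}"
  proof (induction k)
    case 0
    show ?case using has_integral_mult_right[OF step[of 0], of "- 1 / (X + w)"] nz by simp
  next
    case (Suc k)
    have "((\<lambda>y. of_nat (Suc k) * (exp_sum (Suc k - 1) (of_real y) X * ecis (- (of_int q * y)))) has_integral
       of_nat (Suc k) * (fact k / (X + w) ^ Suc k)) {0..1}"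
      using has_integral_mult_right[OF Suc, of "of_nat (Suc k)"] by (simp del: of_nat_Suc)
    from has_integral_mult_right[OF has_integral_diff[OF this step[of "Suc k"]], of "1 / (X + w)"]
    show ?case using nz by (simp del: of_nat_Suc)
  qed
  then show ?thesis by (simp add: w_def)
qed

text \<open>This is Poisson summation in the form needed for the Lipschitz formula. With k >= 1 the
  end values agree, as 0^k = 0, and the coefficients decay at least like 1 / q^2.\<close>

lemma exp_sum_fourier:
  assumes X: "Re X > 0" and k: "k \<ge> 1" and y: "y \<in> {0..1}"
  shows "((\<lambda>q. fact k / (X + 2 * of_real pi * \<i> * of_int q) ^ Suc k * ecis (of_int q * y)) has_sum
     exp_sum k (of_real y) X) UNIV"
proof (rule fourier_series[OF _ _ exp_sum_fourier_coeff[OF X] _ y])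
  show "continuous_on {0..1} (\<lambda>x. exp_sum k (of_real x) X)"
    by (intro continuous_at_imp_continuous_on ballI
        has_vector_derivative_continuous[OF has_vector_derivative_real_field[OF exp_sum_deriv_y[OF X]]])
  show "exp_sum k (of_real 0) X = exp_sum k (of_real 1) X"
    using exp_sum_shift[OF X, of k 0] k by simp
  \<comment> \<open>With this choice X + 2 pi i q = -2 pi i (\<open>\<tau>\<close> - q), so the
    lattice bound yields linear growth in |q|.\<close>
  define \<tau> where "\<tau> = \<i> * X / (2 * of_real pi)"
  have "Im \<tau> > 0" using X by (simp add: \<tau>_def)
  from norm_lattice_ge[OF this]
  obtain c where c: "c > 0" "\<And>p q :: real. c * (\<bar>p\<bar> + \<bar>q\<bar>) \<le> norm (of_real p * \<tau> + of_real q)"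
    by blast
  have lower: "2 * pi * c * (1 + \<bar>real_of_int q\<bar>) \<le> norm (X + 2 * of_real pi * \<i> * of_int q)" for q
  proof -
    have "X + 2 * of_real pi * \<i> * of_int q = - (2 * of_real pi * \<i>) * (of_real 1 * \<tau> + of_real (- of_int q))"
      by (simp add: \<tau>_def field_simps)
    then have "norm (X + 2 * of_real pi * \<i> * of_int q) = 2 * pi * norm (of_real 1 * \<tau> + of_real (- of_int q))"
      by (simp only: norm_mult norm_minus_cancel) (simp add: norm_mult)
    also have "\<dots> \<ge> 2 * pi * (c * (1 + \<bar>real_of_int q\<bar>))"
      using c(2)[of 1 "- of_int q"] by (intro mult_left_mono) auto
    finally show ?thesis by (simp add: mult_ac)
  qed
  have "norm (fact k / (X + 2 * of_real pi * \<i> * of_int q) ^ Suc k :: complex)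
      \<le> fact k / (2 * pi * c) ^ Suc k * (1 + \<bar>real_of_int q\<bar>) powr (- 2)" for q
  proof -
    have "(2 * pi * c) ^ Suc k * (1 + \<bar>real_of_int q\<bar>) ^ 2 \<le> (2 * pi * c) ^ Suc k * (1 + \<bar>real_of_int q\<bar>) ^ Suc k"
      using c(1) k by (intro mult_left_mono power_increasing) auto
    also have "\<dots> \<le> norm (X + 2 * of_real pi * \<i> * of_int q) ^ Suc k"
      unfolding power_mult_distrib[symmetric] using c(1) by (intro power_mono lower) auto
    finally have "fact k / norm (X + 2 * of_real pi * \<i> * of_int q) ^ Suc k \<le>
       fact k / ((2 * pi * c) ^ Suc k * (1 + \<bar>real_of_int q\<bar>) ^ 2)"
    proof (intro divide_left_mono mult_pos_pos)
      show "0 < norm (X + 2 * of_real pi * \<i> * of_int q) ^ Suc k"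
        using c(1) by (intro zero_less_power less_le_trans[OF _ lower] mult_pos_pos) auto
    qed (use c(1) in \<open>auto intro!: mult_pos_pos zero_less_power simp del: power_Suc\<close>)
    also have "\<dots> = fact k / (2 * pi * c) ^ Suc k * (1 + \<bar>real_of_int q\<bar>) powr (- 2)"
      using powr_realpow[of "1 + \<bar>real_of_int q\<bar>" 2] by (simp add: powr_minus field_simps)
    finally show ?thesis by (simp add: norm_divide norm_power del: power_Suc)
  qed
  note bound = this
  show "(\<lambda>q. norm (fact k / (X + 2 * of_real pi * \<i> * of_int q) ^ Suc k :: complex)) summable_on UNIV"
    by (rule summable_on_comparison_test[OF summable_on_cmult_right[OF summable_on_int_powr] bound]) auto
qed

definition pos_coset :: "real \<Rightarrow> real set" where
  "pos_coset x = {r. r > 0 \<and> r - x \<in> \<int>}"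

text \<open>The representative in the interval (0, 1] rather than [0, 1): it is the least element of
  \<open>pos_coset x\<close>, also for integral x, where it equals 1 and 0 is left out.\<close>

definition coset_rep :: "real \<Rightarrow> real" where
  "coset_rep x = 1 - frac (- x)"

definition coset_sum :: "nat \<Rightarrow> real \<Rightarrow> complex \<Rightarrow> complex" where
  "coset_sum k x X = exp_sum k (of_real (coset_rep x)) X"

lemma coset_rep: "coset_rep x > 0" "coset_rep x \<le> 1" "coset_rep x - x \<in> \<int>"
  using frac_lt_1[of "-x"] frac_ge_0[of "-x"] by (auto simp: coset_rep_def) (simp add: frac_def)

lemma bij_betw_pos_coset: "bij_betw (\<lambda>l. coset_rep x + real l) UNIV (pos_coset x)"
proof -
  have "pos_coset x = range (\<lambda>l. coset_rep x + real l)"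
  proof (intro equalityI subsetI)
    fix r assume r: "r \<in> pos_coset x"
    then have "r - x \<in> \<int>" "r > 0" by (auto simp: pos_coset_def)
    then have "r - coset_rep x \<in> \<int>"
      using Ints_diff[of "r - x" "coset_rep x - x"] coset_rep(3)[of x] by simp
    then obtain n where n: "r - coset_rep x = of_int n" by (auto elim: Ints_cases)
    then have "of_int n > (-1 :: real)" using \<open>r > 0\<close> coset_rep(2)[of x] by linarith
    then have "n \<ge> 0" by linarith
    then show "r \<in> range (\<lambda>l. coset_rep x + real l)" using n by (intro image_eqI[of _ _ "nat n"]) auto
  next
    fix r assume "r \<in> range (\<lambda>l. coset_rep x + real l)"
    then obtain l where "r = coset_rep x + real l" by auto
    then show "r \<in> pos_coset x"
      using coset_rep[of x] Ints_add[of "coset_rep x - x" "of_int (int l)"]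
      by (auto simp: pos_coset_def algebra_simps intro: add_pos_nonneg)
  qed
  then show ?thesis by (auto simp: bij_betw_def inj_on_def)
qed

lemma coset_sum_has_sum:
  assumes "Re X > 0"
  shows "((\<lambda>r. of_real r ^ k * exp (- (of_real r * X))) has_sum coset_sum k x X) (pos_coset x)"
    "(\<lambda>r. norm (of_real r ^ k * exp (- (of_real r * X)))) summable_on pos_coset x"
proof -
  let ?f = "\<lambda>r. of_real r ^ k * exp (- (of_real r * X)) :: complex"
  have eq: "?f (coset_rep x + real l) =
      (of_real (coset_rep x) + of_nat l) ^ k * exp (- ((of_real (coset_rep x) + of_nat l) * X))" for l
    by simp
  have "summable (\<lambda>l. norm (?f (coset_rep x + real l)))"
    unfolding eq by (rule exp_sum_summable[OF assms])
  from norm_summable_imp_has_sum[OF this] exp_sum_sums[OF assms, of "of_real (coset_rep x)" k]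
  have "((\<lambda>l. ?f (coset_rep x + real l)) has_sum coset_sum k x X) UNIV"
    unfolding eq coset_sum_def by blast
  then show "(?f has_sum coset_sum k x X) (pos_coset x)"
    using has_sum_reindex_bij_betw[OF bij_betw_pos_coset] by blast
  have "(\<lambda>l. norm (?f (coset_rep x + real l))) summable_on UNIV"
    using \<open>summable (\<lambda>l. norm (?f (coset_rep x + real l)))\<close>
    by (intro norm_summable_imp_summable_on) simp
  then show "(\<lambda>r. norm (?f r)) summable_on pos_coset x"
    using summable_on_reindex_bij_betw[OF bij_betw_pos_coset, of "\<lambda>r. norm (?f r)" x] by blast
qed

text \<open>Every r in the coset is at least y = \<open>coset_rep x\<close>, so (r - y) Re X >= (r -
  y) \<open>\<delta>\<close>. This splits off exp(-y Re X) and leaves the convergent sum at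
  \<open>\<delta>\<close> as the constant.\<close>

lemma coset_sum_decay:
  assumes "\<delta> > 0"
  obtains C where "\<And>X. Re X \<ge> \<delta> \<Longrightarrow> norm (coset_sum k x X) \<le> C * exp (- (coset_rep x * Re X))"
proof
  fix X assume X: "Re X \<ge> \<delta>"
  define y where "y = coset_rep x"
  have y: "y > 0" using coset_rep[of x] by (simp add: y_def)
  define S where "S = infsum (\<lambda>r. r ^ k * exp (- (r * \<delta>))) (pos_coset x)"
  have s: "(\<lambda>r. r ^ k * exp (- (r * \<delta>))) summable_on pos_coset x"
  proof -
    have "norm (of_real r ^ k * exp (- (of_real r * complex_of_real \<delta>))) = r ^ k * exp (- (r * \<delta>))"
      if "r \<in> pos_coset x" for r
      using that by (simp add: pos_coset_def norm_mult norm_power norm_exp_eq_Re)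
    then show ?thesis
      using coset_sum_has_sum(2)[of "of_real \<delta>" k x] assms by (simp cong: summable_on_cong)
  qed
  have "norm (coset_sum k x X) \<le> infsum (\<lambda>r. norm (of_real r ^ k * exp (- (of_real r * X)))) (pos_coset x)"
    using norm_infsum_bound[OF coset_sum_has_sum(2)[of X k x]] coset_sum_has_sum(1)[of X k x] X assms
    by (simp add: infsumI)
  also have "\<dots> \<le> infsum (\<lambda>r. exp (y * \<delta>) * exp (- (y * Re X)) * (r ^ k * exp (- (r * \<delta>)))) (pos_coset x)"
  proof (rule infsum_mono)
    show "(\<lambda>r. norm (of_real r ^ k * exp (- (of_real r * X)))) summable_on pos_coset x"
      using X assms by (intro coset_sum_has_sum) auto
    show "(\<lambda>r. exp (y * \<delta>) * exp (- (y * Re X)) * (r ^ k * exp (- (r * \<delta>)))) summable_on pos_coset x"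
      by (intro summable_on_cmult_right s)
    fix r assume r: "r \<in> pos_coset x"
    then have "r \<in> range (\<lambda>l. y + real l)"
      using bij_betw_pos_coset[of x] by (auto simp: bij_betw_def y_def)
    then have ry: "r \<ge> y" by auto
    have "(r - y) * \<delta> \<le> (r - y) * Re X" using X ry by (intro mult_left_mono) auto
    then have "- (r * Re X) \<le> y * \<delta> - y * Re X - r * \<delta>" by (simp add: algebra_simps)
    then have "exp (- (r * Re X)) \<le> exp (y * \<delta>) * exp (- (y * Re X)) * exp (- (r * \<delta>))"
      by (simp flip: exp_add)
    then have "r ^ k * exp (- (r * Re X)) \<le> r ^ k * (exp (y * \<delta>) * exp (- (y * Re X)) * exp (- (r * \<delta>)))"
      using ry y by (intro mult_left_mono) auto
    then show "norm (of_real r ^ k * exp (- (of_real r * X))) \<le> exp (y * \<delta>) * exp (- (y * Re X)) * (r ^ k * exp (- (r * \<delta>)))"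
      using ry y by (simp add: norm_mult norm_power norm_exp_eq_Re mult_ac)
  qed
  also have "\<dots> = exp (y * \<delta>) * exp (- (y * Re X)) * S"
    unfolding S_def by (rule infsum_cmult_right) (use s in auto)
  finally show "norm (coset_sum k x X) \<le> (exp (coset_rep x * \<delta>) * infsum (\<lambda>r. r ^ k * exp (- (r * \<delta>))) (pos_coset x)) * exp (- (coset_rep x * Re X))"
    by (simp add: S_def y_def mult_ac)
qed

lemma coset_sum_deriv:
  assumes "Re X > 0"
  shows "(coset_sum k x has_field_derivative - coset_sum (Suc k) x X) (at X)"
  unfolding coset_sum_def[abs_def] by (rule exp_sum_deriv_X[OF assms])

text \<open>The Fourier series of \<open>exp_sum\<close> at X = -2 pi i \<open>\<tau>\<close> and y
  = \<open>coset_rep (- x)\<close>, read with q replaced by -q: then X + 2 pi i q becomes -2 pi i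
  (\<open>\<tau>\<close> + q).\<close>

theorem lipschitz_formula:
  assumes \<tau>: "Im \<tau> > 0" and m: "m \<ge> 2"
  shows "((\<lambda>q. ecis (of_int q * x) / (\<tau> + of_int q) ^ m) has_sum
    ((- (2 * of_real pi * \<i>)) ^ m / fact (m - 1) * coset_sum (m - 1) (- x) (- (2 * of_real pi * \<i> * \<tau>)))) UNIV"
proof -
  define X where "X = - (2 * of_real pi * \<i> * \<tau>)"
  define y where "y = coset_rep (- x)"
  define u where "u = - (2 * of_real pi * \<i>)"
  have u: "u \<noteq> 0" by (simp add: u_def)
  have X: "Re X > 0" using \<tau> by (simp add: X_def)
  obtain k where k: "m = Suc k" "k \<ge> 1" using m by (cases m) auto
  have "((\<lambda>q. fact k / (X + 2 * of_real pi * \<i> * of_int q) ^ Suc k * ecis (of_int q * y)) has_sum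
     exp_sum k (of_real y) X) UNIV"
    using X k coset_rep[of "-x"] by (intro exp_sum_fourier) (auto simp: y_def)
  then have "((\<lambda>q. fact k / (X + 2 * of_real pi * \<i> * of_int (- q)) ^ Suc k * ecis (of_int (- q) * y)) has_sum
     exp_sum k (of_real y) X) UNIV"
    by (subst has_sum_reindex_bij_betw[of uminus UNIV UNIV, symmetric])
       (auto simp: bij_uminus)
  moreover have "fact k / (X + 2 * of_real pi * \<i> * of_int (- q)) ^ Suc k * ecis (of_int (- q) * y) =
      fact k / u ^ m * (ecis (of_int q * x) / (\<tau> + of_int q) ^ m)" for q
  proof -
    have "X + 2 * of_real pi * \<i> * of_int (- q) = u * (\<tau> + of_int q)"
      by (simp add: X_def u_def algebra_simps)
    moreover have "ecis (of_int (- q) * y) = ecis (of_int q * x)"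
    proof (rule ecis_cong)
      have "of_int (- q) * y - of_int q * x = of_int (- q) * (y - (- x))" by (simp add: algebra_simps)
      then show "of_int (- q) * y - of_int q * x \<in> \<int>"
        using coset_rep(3)[of "- x"] unfolding y_def by (metis Ints_mult Ints_of_int)
    qed
    ultimately show ?thesis by (simp add: k power_mult_distrib del: power_Suc)
  qed
  ultimately have "((\<lambda>q. fact k / u ^ m * (ecis (of_int q * x) / (\<tau> + of_int q) ^ m)) has_sum exp_sum k (of_real y) X) UNIV"
    by simp
  from has_sum_cmult_right[OF this, of "u ^ m / fact k"] show ?thesis
    using u by (simp add: k coset_sum_def X_def y_def u_def del: power_Suc)
qed


section \<open>Regular part and pole of the coset sums at 0\<close>

definition expm1_quot :: "complex \<Rightarrow> complex" where
  "expm1_quot z = (if z = 0 then 1 else (exp z - 1) / z)"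

definition bern_gen :: "real \<Rightarrow> complex \<Rightarrow> complex" where
  "bern_gen x z = exp (of_real x * z) / expm1_quot z"

text \<open>The function exp(x z) / (exp z - 1) without its pole 1 / z; the value at 0 is the one
  that removes the singularity.\<close>

definition bern_reg :: "real \<Rightarrow> complex \<Rightarrow> complex" where
  "bern_reg x z = (if z = 0 then deriv (bern_gen x) 0 else (bern_gen x z - 1) / z)"

text \<open>Contains the whole real line, while exp z - 1 vanishes in it only at 0. Thus the regular
  parts are holomorphic along the entire path of the later limits.\<close>

definition strip :: "complex set" where
  "strip = {z. \<bar>Im z\<bar> < 2 * pi}"

lemma open_strip: "open strip"
  unfolding strip_def by (intro open_Collect_less continuous_intros)

lemma of_real_in_strip [simp]: "of_real t \<in> strip" and zero_in_strip [simp]: "0 \<in> strip"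
  by (simp_all add: strip_def)

lemma holomorphic_on_expm1_quot: "expm1_quot holomorphic_on UNIV"
proof -
  have "(\<lambda>z. if z = 0 then deriv exp 0 else (exp z - exp 0) / (z - 0)) holomorphic_on (UNIV :: complex set)"
    by (rule pole_lemma_open) (auto intro!: holomorphic_intros)
  moreover have "(\<lambda>z. if z = 0 then deriv exp 0 else (exp z - exp 0) / (z - 0)) = expm1_quot"
    by (rule ext) (auto simp: expm1_quot_def DERIV_imp_deriv[OF DERIV_exp])
  ultimately show ?thesis by simp
qed

lemma expm1_quot_nonzero: "z \<in> strip \<Longrightarrow> expm1_quot z \<noteq> 0"
proof
  assume z: "z \<in> strip" "expm1_quot z = 0"
  then have "z \<noteq> 0" "exp z = 1" by (auto simp: expm1_quot_def split: if_splits)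
  then obtain n :: int where n: "Re z = 0" "Im z = of_int (2 * n) * pi" by (auto simp: exp_eq_1)
  then have "\<bar>of_int n\<bar> < (1 :: real)" using z by (simp add: strip_def abs_mult)
  then have "n = 0" by linarith
  with n have "z = 0" by (simp add: complex_eq_iff)
  with \<open>z \<noteq> 0\<close> show False by simp
qed

lemma holomorphic_on_bern_gen: "bern_gen x holomorphic_on strip"
  unfolding bern_gen_def[abs_def]
  by (intro holomorphic_intros holomorphic_on_subset[OF holomorphic_on_expm1_quot] expm1_quot_nonzero) auto

lemma bern_gen_0 [simp]: "bern_gen x 0 = 1"
  by (simp add: bern_gen_def expm1_quot_def)

lemma holomorphic_on_bern_reg: "bern_reg x holomorphic_on strip"
proof -
  have "(\<lambda>z. if z = 0 then deriv (bern_gen x) 0 else (bern_gen x z - bern_gen x 0) / (z - 0)) holomorphic_on strip"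
    by (rule pole_lemma_open[OF holomorphic_on_bern_gen open_strip])
  then show ?thesis by (simp add: bern_reg_def[abs_def] cong: if_cong)
qed

text \<open>Bernoulli polynomials are defined through real formal power series,
  \<open>bern_gen\<close> through complex functions. Both expansions solve the equation with factor
  exp X - 1, which can be cancelled as a nonzero power series.\<close>

lemma higher_deriv_bern_gen_0: "(deriv ^^ k) (bern_gen x) 0 = of_real (bernoulli_poly k x)"
proof -
  have "bern_gen x analytic_on {0}"
    using holomorphic_on_bern_gen open_strip by (auto simp: analytic_at)
  then have A: "bern_gen x has_fps_expansion fps_expansion (bern_gen x) 0" (is "_ has_fps_expansion ?A")
    by (rule analytic_at_imp_has_fps_expansion_0)
  have 1: "(\<lambda>z. bern_gen x z * (exp z - 1)) has_fps_expansion ?A * (fps_exp 1 - 1)"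
    by (intro fps_expansion_intros A)
  have 2: "(\<lambda>z. z * exp (complex_of_real x * z)) has_fps_expansion fps_X * fps_exp (of_real x)"
    by (intro fps_expansion_intros)
  have "bern_gen x z * (exp z - 1) = z * exp (of_real x * z)" if "z \<in> strip" for z
    using expm1_quot_nonzero[OF that] by (auto simp: bern_gen_def expm1_quot_def split: if_splits)
  then have "eventually (\<lambda>z. bern_gen x z * (exp z - 1) = z * exp (of_real x * z)) (nhds 0)"
    using eventually_nhds_in_open[OF open_strip, of 0] by (auto elim!: eventually_mono)
  with 1 have 3: "(\<lambda>z. z * exp (of_real x * z)) has_fps_expansion ?A * (fps_exp 1 - 1)"
    using has_fps_expansion_cong by metis
  have eqA: "?A * (fps_exp 1 - 1) = fps_X * fps_exp (of_real x)"
    using fps_nth_fps_expansion[OF 2] fps_nth_fps_expansion[OF 3] by (intro fps_ext) simp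
  define B where "B = Abs_fps (\<lambda>n. complex_of_real (fps_nth (bernoulli_gen x) n))"
  have eqB: "B * (fps_exp 1 - 1) = fps_X * fps_exp (of_real x)"
  proof (rule fps_ext)
    fix n
    have "fps_nth (B * (fps_exp 1 - 1)) n = of_real (fps_nth (bernoulli_gen x * (fps_exp 1 - 1)) n)"
      unfolding fps_mult_nth of_real_sum by (intro sum.cong refl) (simp add: B_def)
    also have "\<dots> = of_real (fps_nth (fps_X * fps_exp x) n)" by (simp only: bernoulli_gen_mult)
    also have "\<dots> = fps_nth (fps_X * fps_exp (of_real x)) n" by simp
    finally show "fps_nth (B * (fps_exp 1 - 1)) n = fps_nth (fps_X * fps_exp (of_real x)) n" .
  qed
  have "fps_nth (fps_exp 1 - 1 :: complex fps) 1 \<noteq> 0" by simp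
  then have "fps_exp 1 - 1 \<noteq> (0 :: complex fps)" by (metis fps_zero_nth)
  with eqA eqB have "?A = B" by (metis mult_right_cancel)
  then have "fps_nth ?A k = fps_nth B k" by simp
  then show ?thesis by (simp add: fps_expansion_def B_def bernoulli_poly_gen field_simps)
qed

lemma higher_deriv_bern_reg_0: "(deriv ^^ k) (bern_reg x) 0 = of_real (bernoulli_poly (Suc k) x / real (Suc k))"
proof -
  have "bern_gen x analytic_on {0}" "bern_reg x analytic_on {0}"
    using holomorphic_on_bern_gen holomorphic_on_bern_reg open_strip by (auto simp: analytic_at)
  then have G: "bern_gen x has_fps_expansion fps_expansion (bern_gen x) 0" 
    and R: "bern_reg x has_fps_expansion fps_expansion (bern_reg x) 0" (is "_ has_fps_expansion ?R")
    by (auto intro: analytic_at_imp_has_fps_expansion_0)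
  have "(\<lambda>z. 1 + z * bern_reg x z) has_fps_expansion 1 + fps_X * ?R"
    by (intro fps_expansion_intros R)
  moreover have "(\<lambda>z. 1 + z * bern_reg x z) = bern_gen x"
    by (rule ext) (simp add: bern_reg_def)
  ultimately have "fps_nth (1 + fps_X * ?R) (Suc k) = (deriv ^^ Suc k) (bern_gen x) 0 / fact (Suc k)"
    using fps_nth_fps_expansion by metis
  then have "(deriv ^^ k) (bern_reg x) 0 / fact k = of_real (bernoulli_poly (Suc k) x) / fact (Suc k)"
    unfolding higher_deriv_bern_gen_0 by (simp add: fps_expansion_def)
  then show ?thesis by (simp add: divide_simps mult_ac del: of_nat_Suc)
qed

lemma higher_deriv_bern_reg_deriv:
  assumes "z \<in> strip"
  shows "((deriv ^^ k) (bern_reg x) has_field_derivative (deriv ^^ Suc k) (bern_reg x) z) (at z)"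
  using holomorphic_derivI[OF holomorphic_higher_deriv[OF holomorphic_on_bern_reg open_strip] open_strip assms]
  by simp

definition coset_reg :: "nat \<Rightarrow> real \<Rightarrow> complex \<Rightarrow> complex" where
  "coset_reg k x = (deriv ^^ k) (bern_reg (1 - coset_rep x))"

lemma coset_reg_deriv:
  "z \<in> strip \<Longrightarrow> (coset_reg k x has_field_derivative coset_reg (Suc k) x z) (at z)"
  unfolding coset_reg_def by (rule higher_deriv_bern_reg_deriv)

lemma coset_reg_0: "coset_reg k x 0 = of_real (bernoulli_poly (Suc k) (1 - coset_rep x) / real (Suc k))"
  by (simp add: coset_reg_def higher_deriv_bern_reg_0)

text \<open>For k = 0 one multiplies numerator and denominator of exp(-yX) / (1 - exp(-X)) by exp X
  and meets the generating function at 1 - y. Larger k follow by differentiating both sides on the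
  open right half of the strip.\<close>

lemma coset_sum_eq_reg:
  assumes "Re X > 0" "X \<in> strip"
  shows "coset_sum k x X = (-1) ^ k * coset_reg k x X + fact k / X ^ Suc k"
  using assms
proof (induction k arbitrary: X)
  case 0
  define y where "y = coset_rep x"
  have X0: "X \<noteq> 0" using 0 by auto
  have e: "expm1_quot X = (exp X - 1) / X" using X0 by (simp add: expm1_quot_def)
  have nz: "exp X - 1 \<noteq> 0" using expm1_quot_nonzero[OF 0(2)] e by auto
  have "coset_sum 0 x X = exp (- (of_real y * X)) / (1 - exp (- X))"
    using 0 by (simp add: coset_sum_def exp_sum_0_eq y_def)
  also have "\<dots> = exp (of_real (1 - y) * X) / (exp X - 1)"
  proof -
    have "exp X * (1 - exp (- X)) = exp X - 1" by (simp add: algebra_simps flip: exp_add)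
    moreover have "exp X * exp (- (of_real y * X)) = exp (of_real (1 - y) * X)"
      by (simp add: algebra_simps flip: exp_add)
    moreover have "exp X \<noteq> 0" by simp
    ultimately show ?thesis by (metis nonzero_mult_divide_mult_cancel_left)
  qed
  also have "\<dots> = bern_gen (1 - y) X / X"
    using X0 nz by (simp add: bern_gen_def e)
  also have "\<dots> = bern_reg (1 - y) X + 1 / X"
    using X0 by (simp add: bern_reg_def field_simps)
  finally show ?case by (simp add: coset_reg_def y_def)
next
  case (Suc k)
  have X0: "X \<noteq> 0" using Suc.prems by auto
  define S where "S = {z. Re z > 0} \<inter> strip"
  have S: "open S" "X \<in> S"
    using Suc.prems open_strip by (auto simp: S_def open_halfspace_Re_gt)
  have "((\<lambda>z. (-1) ^ k * coset_reg k x z + fact k / z ^ Suc k) has_field_derivative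
      (-1) ^ k * coset_reg (Suc k) x X - fact (Suc k) / X ^ Suc (Suc k)) (at X)"
  proof -
    have "((\<lambda>z. fact k * inverse (z ^ Suc k)) has_field_derivative - (fact (Suc k) / X ^ Suc (Suc k))) (at X)"
    proof -
      have "((\<lambda>z. z ^ Suc k) has_field_derivative of_nat (Suc k) * X ^ k) (at X)"
        using DERIV_power_Suc[OF DERIV_ident, of k X UNIV] by simp
      have "fact k * - (inverse (X ^ Suc k) * (of_nat (Suc k) * X ^ k) * inverse (X ^ Suc k)) = - (fact (Suc k) / X ^ Suc (Suc k))"
        using X0 by (simp add: field_simps)
      from DERIV_cong[OF DERIV_cmult[OF DERIV_inverse'[OF \<open>((\<lambda>z. z ^ Suc k) has_field_derivative of_nat (Suc k) * X ^ k) (at X)\<close>]] this]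
      show ?thesis using X0 by simp
    qed
    from DERIV_add[OF DERIV_cmult[OF coset_reg_deriv[OF Suc.prems(2)]] this]
    show ?thesis by (simp add: divide_inverse)
  qed
  moreover have "\<And>z. z \<in> S \<Longrightarrow> (-1) ^ k * coset_reg k x z + fact k / z ^ Suc k = coset_sum k x z"
    using Suc.IH by (simp add: S_def)
  ultimately have "(coset_sum k x has_field_derivative
      (-1) ^ k * coset_reg (Suc k) x X - fact (Suc k) / X ^ Suc (Suc k)) (at X)"
    using has_field_derivative_transform_within_open[OF _ S] by blast
  with coset_sum_deriv[OF Suc.prems(1)] 
  have "- coset_sum (Suc k) x X = (-1) ^ k * coset_reg (Suc k) x X - fact (Suc k) / X ^ Suc (Suc k)"
    by (rule DERIV_unique)
  then have "coset_sum (Suc k) x X = - ((-1) ^ k * coset_reg (Suc k) x X - fact (Suc k) / X ^ Suc (Suc k))"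
    by (metis minus_minus)
  then show ?case by simp
qed

lemma coset_sum_real: "t > 0 \<Longrightarrow> coset_sum k x (of_real t) \<in> \<real>"
proof -
  assume t: "t > 0"
  have "((\<lambda>r. of_real (r ^ k * exp (- (r * t)))) has_sum coset_sum k x (of_real t)) (pos_coset x)"
    using coset_sum_has_sum(1)[of "of_real t" k x] t by (simp flip: exp_of_real)
  from infsumI[OF has_sum_Im[OF this]] have "Im (coset_sum k x (of_real t)) = 0" by simp
  then show ?thesis by (simp add: complex_is_Real_iff)
qed

text \<open>At integers both representatives are 1, so the left side is B_k(0) + (-1)^k B_k(0),
  which is 0 for odd k: here the value 0 of the sawtooth is forced. Elsewhere the two arguments are
  frac x and 1 - frac x, and reflection applies.\<close>

lemma periodic_bernoulli_symmetrize:
  assumes "k \<ge> 1"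
  shows "bernoulli_poly k (1 - coset_rep (- x)) + (-1) ^ k * bernoulli_poly k (1 - coset_rep x)
     = 2 * periodic_bernoulli k x"
proof (cases "x \<in> \<int>")
  case True
  then have 1: "coset_rep x = 1" "coset_rep (- x) = 1" "x - of_int \<lfloor>x\<rfloor> = 0"
    by (simp_all add: coset_rep_def frac_eq_0_iff flip: frac_def)
  have "bernoulli_poly k 1 = bernoulli_poly k 0" if "k \<noteq> 1"
    using bernoulli_poly_1_minus_0[of k] that by simp
  moreover have "bernoulli_poly k 1 = (-1) ^ k * bernoulli_poly k 0"
    using bernoulli_poly_reflect[of k 0] by simp
  ultimately show ?thesis using 1 True
    by (cases "even k") (auto simp: periodic_bernoulli_def)
next
  case False
  have f: "frac (- x) = 1 - frac x" using False by (simp add: frac_neg)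
  then have "1 - coset_rep (- x) = frac x" "1 - coset_rep x = 1 - frac x"
    by (auto simp: coset_rep_def)
  then have "bernoulli_poly k (1 - coset_rep (- x)) + (-1) ^ k * bernoulli_poly k (1 - coset_rep x)
     = bernoulli_poly k (frac x) + (-1) ^ k * ((-1) ^ k * bernoulli_poly k (frac x))"
    by (simp add: bernoulli_poly_reflect)
  also have "\<dots> = 2 * bernoulli_poly k (frac x)"
    by (cases "even k") auto
  finally show ?thesis using False by (simp add: periodic_bernoulli_def frac_def)
qed


section \<open>Lattice sums\<close>

lemma has_sum_finite_sum:
  fixes f :: "'i \<Rightarrow> 'k \<Rightarrow> 'a :: topological_comm_monoid_add"
  assumes "finite I" "\<And>i. i \<in> I \<Longrightarrow> (f i has_sum s i) A"
  shows "((\<lambda>k. \<Sum>i\<in>I. f i k) has_sum (\<Sum>i\<in>I. s i)) A"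
  using assms by (induction I rule: finite_induct) (auto intro: has_sum_add)

lemma has_sum_residues:
  fixes g :: "int \<Rightarrow> 'a :: topological_comm_monoid_add"
  assumes N: "N > 0" and s: "\<And>p. p < N \<Longrightarrow> ((\<lambda>i. g (int p + int N * i)) has_sum S p) UNIV"
  shows "(g has_sum (\<Sum>p<N. S p)) UNIV"
proof -
  let ?B = "\<lambda>p. range (\<lambda>i. int p + int N * i)"
  have "(g has_sum (\<Sum>p<N. S p)) (\<Union>p\<in>{..<N}. ?B p)"
  proof (rule sum_has_sum)
    show "(g has_sum S p) (?B p)" if "p \<in> {..<N}" for p
      using s[of p] that N by (subst has_sum_reindex) (auto simp: inj_on_def o_def)
    show "?B p \<inter> ?B p' = {}" if "p \<in> {..<N}" "p' \<in> {..<N}" "p \<noteq> p'" for p p'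
    proof (rule ccontr)
      assume "?B p \<inter> ?B p' \<noteq> {}"
      then obtain i i' where "int p + int N * i = int p' + int N * i'" by auto
      then have "(int p + int N * i) mod int N = (int p' + int N * i') mod int N" by simp
      then show False using that by simp
    qed
  qed auto
  moreover have "(\<Union>p\<in>{..<N}. ?B p) = UNIV"
  proof (intro equalityI subsetI UNIV_I)
    fix x :: int
    have "x = int (nat (x mod int N)) + int N * (x div int N)" using N by simp
    moreover have "nat (x mod int N) < N" using N by (simp add: nat_less_iff)
    ultimately show "x \<in> (\<Union>p\<in>{..<N}. ?B p)" by blast
  qed
  ultimately show ?thesis by simp
qed

text \<open>Summability allows passing to row sums; \<open>has_sum_residues\<close> is then applied
  inside each row and once more to the sequence of row sums.\<close>

lemma infsum_residues2:
  fixes g :: "int \<times> int \<Rightarrow> complex"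
  assumes N: "N > 0" and g: "g summable_on UNIV"
  shows "(\<Sum>p<N. \<Sum>q<N. infsum (\<lambda>(i, j). g (int p + int N * i, int q + int N * j)) UNIV) = infsum g UNIV"
proof -
  have inj: "inj (\<lambda>(i, j). (int p + int N * i, int q + int N * j))" for p q
    using N by (auto simp: inj_on_def)
  have sm: "(\<lambda>(i, j). g (int p + int N * i, int q + int N * j)) summable_on UNIV" for p q
    using summable_on_reindex[OF inj, of g p q] summable_on_subset_banach[OF g subset_UNIV]
    by (simp add: o_def case_prod_unfold)
  have row: "(\<lambda>j. g (P, j)) summable_on UNIV" for P
    using summable_on_SigmaD1[of "\<lambda>x y. g (x, y)" UNIV "\<lambda>_. UNIV" P] g by simp
  define r where "r P = infsum (\<lambda>j. g (P, j)) UNIV" for P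
  have r: "(r has_sum infsum g UNIV) UNIV"
  proof -
    have "(g has_sum infsum g UNIV) (Sigma UNIV (\<lambda>_. UNIV))" using g by simp
    from has_sum_SigmaD[OF this, of r] row show ?thesis by (simp add: r_def)
  qed
  have rp: "((\<lambda>i. r (int p + int N * i)) has_sum (\<Sum>q<N. infsum (\<lambda>(i, j). g (int p + int N * i, int q + int N * j)) UNIV)) UNIV" for p
  proof -
    have "((\<lambda>i. infsum (\<lambda>j. g (int p + int N * i, int q + int N * j)) UNIV) has_sum
            infsum (\<lambda>(i, j). g (int p + int N * i, int q + int N * j)) UNIV) UNIV" for q
    proof -
      have hs: "((\<lambda>(i, j). g (int p + int N * i, int q + int N * j)) has_sum
            infsum (\<lambda>(i, j). g (int p + int N * i, int q + int N * j)) UNIV) (Sigma UNIV (\<lambda>_. UNIV))"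
        using sm by simp
      have "(\<lambda>j. g (int p + int N * i, int q + int N * j)) summable_on UNIV" for i
        using summable_on_SigmaD1[of "\<lambda>i j. g (int p + int N * i, int q + int N * j)" UNIV "\<lambda>_. UNIV" i] sm by simp
      then show ?thesis
        using has_sum_SigmaD[OF hs, of "\<lambda>i. infsum (\<lambda>j. g (int p + int N * i, int q + int N * j)) UNIV"] by simp
    qed
    then have "((\<lambda>i. \<Sum>q<N. infsum (\<lambda>j. g (int p + int N * i, int q + int N * j)) UNIV) has_sum
        (\<Sum>q<N. infsum (\<lambda>(i, j). g (int p + int N * i, int q + int N * j)) UNIV)) UNIV"
      by (intro has_sum_finite_sum) auto
    moreover have "(\<Sum>q<N. infsum (\<lambda>j. g (int p + int N * i, int q + int N * j)) UNIV) = r (int p + int N * i)" for i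
    proof -
      have "((\<lambda>j. g (int p + int N * i, int q + int N * j)) has_sum
          infsum (\<lambda>j. g (int p + int N * i, int q + int N * j)) UNIV) UNIV" for q
        using summable_on_SigmaD1[of "\<lambda>i j. g (int p + int N * i, int q + int N * j)" UNIV "\<lambda>_. UNIV" i] sm by simp
      from has_sum_residues[OF N, of "\<lambda>j. g (int p + int N * i, j)", OF this] show ?thesis
        unfolding r_def by (simp add: infsumI)
    qed
    ultimately show ?thesis by simp
  qed
  from has_sum_unique[OF has_sum_residues[OF N, of r, OF rp] r] show ?thesis .
qed

text \<open>Asymptotic estimates hold only for large indices. The finitely many others are absorbed
  into the constant, which stays uniform in the parameter s.\<close>

lemma finite_exception_bound:
  fixes f :: "'k \<Rightarrow> 's \<Rightarrow> complex" and b :: "'k \<Rightarrow> real"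
  assumes fin: "finite E" and b: "\<And>k. b k > 0"
    and 1: "\<And>s k. s \<in> S \<Longrightarrow> k \<notin> E \<Longrightarrow> norm (f k s) \<le> C * b k"
    and 2: "\<And>k s. k \<in> E \<Longrightarrow> s \<in> S \<Longrightarrow> norm (f k s) \<le> B k"
  obtains C' where "\<And>s k. s \<in> S \<Longrightarrow> norm (f k s) \<le> C' * b k"
proof
  fix s k assume s: "s \<in> S"
  let ?C = "\<bar>C\<bar> + (\<Sum>k\<in>E. \<bar>B k\<bar> / b k)"
  have nn: "(\<Sum>k\<in>E. \<bar>B k\<bar> / b k) \<ge> 0" by (intro sum_nonneg divide_nonneg_pos b) auto
  show "norm (f k s) \<le> ?C * b k"
  proof (cases "k \<in> E")
    case True
    have "\<bar>B k\<bar> / b k \<le> (\<Sum>k\<in>E. \<bar>B k\<bar> / b k)"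
      using True fin by (intro member_le_sum divide_nonneg_pos b) auto
    then have "\<bar>B k\<bar> / b k * b k \<le> ?C * b k" using b[of k] by (intro mult_right_mono) auto
    then show ?thesis using 2[OF True s] b[of k] by simp
  next
    case False
    have "C * b k \<le> ?C * b k" using b[of k] nn by (intro mult_right_mono) auto
    then show ?thesis using 1[OF s False] by linarith
  qed
qed

text \<open>Since (1 + |p|)(1 + |q|) <= (1 + |p| + |q|)^2, exponent r in two dimensions is dominated
  by exponent r / 2 > 1 in each variable.\<close>

lemma summable_lattice_powr:
  assumes r: "r > 2"
  shows "(\<lambda>k :: int \<times> int. (1 + \<bar>real_of_int (fst k)\<bar> + \<bar>real_of_int (snd k)\<bar>) powr (- r)) summable_on UNIV"
proof -
  let ?u = "\<lambda>q::int. (1 + \<bar>real_of_int q\<bar>) powr (- (r / 2))"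
  have u: "?u summable_on UNIV" using r by (intro summable_on_int_powr) auto
  have "(\<lambda>k. norm (?u (fst k) * ?u (snd k))) summable_on Sigma UNIV (\<lambda>_. UNIV)"
    unfolding Infinite_Sum.abs_summable_on_Sigma_iff
  proof (intro conjI ballI)
    show "(\<lambda>y. norm (?u (fst (x, y)) * ?u (snd (x, y)))) summable_on UNIV" for x
      using summable_on_cmult_right[OF u, of "?u x"] by (simp add: abs_mult)
    have "infsum (\<lambda>y. norm (?u (fst (x, y)) * ?u (snd (x, y)))) UNIV = ?u x * infsum ?u UNIV" for x
      unfolding infsum_cmult_right'[symmetric] by (simp add: abs_mult)
    then show "(\<lambda>x. norm (infsum (\<lambda>y. norm (?u (fst (x, y)) * ?u (snd (x, y)))) UNIV)) summable_on UNIV"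
      using summable_on_cmult_left[OF u, of "\<bar>infsum ?u UNIV\<bar>"] by (simp add: abs_mult)
  qed
  then have "(\<lambda>k. ?u (fst k) * ?u (snd k)) summable_on UNIV"
    by (simp add: abs_mult)
  then show ?thesis
  proof (rule summable_on_comparison_test)
    fix k :: "int \<times> int"
    let ?a = "\<bar>real_of_int (fst k)\<bar>" and ?b = "\<bar>real_of_int (snd k)\<bar>"
    have "(1 + ?a) * (1 + ?b) \<le> (1 + ?a + ?b) * (1 + ?a + ?b)"
      by (intro mult_mono) auto
    then have "((1 + ?a + ?b) * (1 + ?a + ?b)) powr (- (r / 2)) \<le> ((1 + ?a) * (1 + ?b)) powr (- (r / 2))"
      using r by (intro powr_mono2') auto
    moreover have "((1 + ?a + ?b) * (1 + ?a + ?b)) powr (- (r / 2)) = (1 + ?a + ?b) powr (- r)"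
      by (simp add: powr_mult flip: powr_add)
    ultimately show "(1 + ?a + ?b) powr (- r) \<le> ?u (fst k) * ?u (snd k)"
      by (simp add: powr_mult)
  qed auto
qed

lemma holomorphic_infsum:
  fixes f :: "'k \<Rightarrow> complex \<Rightarrow> complex"
  assumes S: "open S" and hol: "\<And>k. f k holomorphic_on S"
    and bound: "\<And>s0 r. cball s0 r \<subseteq> S \<Longrightarrow> \<exists>M. M summable_on UNIV \<and> (\<forall>s\<in>cball s0 r. \<forall>k. norm (f k s) \<le> M k)"
  shows "(\<lambda>s. infsum (\<lambda>k. f k s) UNIV) holomorphic_on S"
proof (subst holomorphic_on_open[OF S], intro ballI)
  fix s0 assume "s0 \<in> S"
  then obtain r where r: "r > 0" "cball s0 r \<subseteq> S" using S open_contains_cball by blast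
  obtain M where M: "M summable_on UNIV" "\<And>s k. s \<in> cball s0 r \<Longrightarrow> norm (f k s) \<le> M k"
    using bound[OF r(2)] by blast
  have ul: "uniform_limit (cball s0 r) (\<lambda>K s. \<Sum>k\<in>K. f k s) (\<lambda>s. infsum (\<lambda>k. f k s) UNIV) (finite_subsets_at_top UNIV)"
    by (rule Weierstrass_m_test_general[OF M(2) M(1)]) auto
  have hK: "(\<lambda>s. \<Sum>k\<in>K. f k s) holomorphic_on cball s0 r" for K
    by (intro holomorphic_on_sum holomorphic_on_subset[OF hol r(2)])
  have "(\<lambda>s. infsum (\<lambda>k. f k s) UNIV) holomorphic_on ball s0 r"
    by (rule holomorphic_uniform_limit[OF _ ul])
       (auto intro!: always_eventually holomorphic_on_imp_continuous_on hK holomorphic_on_subset[OF hK])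
  then show "\<exists>f'. ((\<lambda>s. infsum (\<lambda>k. f k s) UNIV) has_field_derivative f') (at s0)"
    using r(1) by (intro exI) (rule holomorphic_derivI[of _ "ball s0 r"], auto)
qed

section \<open>Hecke's regularisation of the weight 2 lattice sums\<close>

definition hecke_term :: "complex \<Rightarrow> complex \<Rightarrow> complex" where
  "hecke_term s w = inverse (w ^ 2) * of_real (norm w) powr (- s)"

text \<open>The value 0 at the origin lets a sum over the coset of 0, from which the origin is
  excluded, run over all of Z^2.\<close>

lemma hecke_term_0 [simp]: "hecke_term s 0 = 0"
  by (simp add: hecke_term_def)

lemma hecke_term_exp: "w \<noteq> 0 \<Longrightarrow> hecke_term s w = inverse (w ^ 2) * exp (- (s * of_real (ln (norm w))))"
  by (simp add: hecke_term_def powr_def Ln_of_real)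

lemma norm_hecke_term:
  "w \<noteq> 0 \<Longrightarrow> norm (hecke_term s w) = norm w powr (- 2 - Re s)"
proof -
  assume w: "w \<noteq> 0"
  have "norm (hecke_term s w) = inverse (norm w ^ 2) * exp (- (Re s * ln (norm w)))"
    using w by (simp add: hecke_term_exp norm_mult norm_inverse norm_power norm_exp_eq_Re)
  also have "inverse (norm w ^ 2) = norm w powr (- 2)"
    using w powr_realpow[of "norm w" 2] by (simp add: powr_minus)
  also have "exp (- (Re s * ln (norm w))) = norm w powr (- Re s)" using w by (simp add: powr_def)
  finally show ?thesis by (simp flip: powr_add)
qed

text \<open>Covers, uniformly for norm s <= M, the finitely many points near the origin that the
  asymptotic estimate \<open>hecke_term_diff\<close> leaves out.\<close>

lemma norm_hecke_term_le:
  assumes "norm s \<le> M"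
  shows "norm (hecke_term s w) \<le> inverse (norm w ^ 2) * exp (M * \<bar>ln (norm w)\<bar>)"
proof (cases "w = 0")
  case False
  have "- (Re s * ln (norm w)) \<le> \<bar>Re s\<bar> * \<bar>ln (norm w)\<bar>" by (simp add: abs_mult[symmetric])
  also have "\<dots> \<le> M * \<bar>ln (norm w)\<bar>"
    using assms abs_Re_le_cmod[of s] by (intro mult_right_mono) auto
  finally show ?thesis using False
    by (simp add: hecke_term_exp norm_mult norm_inverse norm_power norm_exp_eq_Re mult_left_mono)
qed simp

text \<open>A shift by a bounded amount gains one power of |w|: the difference is O(|w|^(-3 - Re
  s)). For Re s >= -1/2 this leaves exponent 5/2 > 2, enough for summation over the lattice beyond
  the line Re s = 0.\<close>

lemma hecke_term_diff:
  assumes D: "norm \<delta> \<le> D" "D \<ge> 1" and w: "norm w \<ge> 2 * D" and s: "Re s \<ge> - (1 / 2)" "norm s \<le> M"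
  shows "norm (hecke_term s (w + \<delta>) - hecke_term s w) \<le> (20 * D + 4 * M * D) * norm w powr (- (5 / 2))"
proof -
  define v where "v = w + \<delta>"
  define u where "u = norm w"
  have u: "u \<ge> 2" "u \<ge> 2 * D" using D w by (auto simp: u_def)
  have M0: "M \<ge> 0" using s(2) norm_ge_zero order_trans by blast
  have v1: "norm v \<ge> u / 2" 
    using norm_triangle_ineq4[of v \<delta>] D u by (simp add: v_def u_def)
  have v2: "norm v \<le> 2 * u" using norm_triangle_ineq[of w \<delta>] D u by (simp add: v_def u_def)
  have nz: "w \<noteq> 0" "v \<noteq> 0" using u v1 by (auto simp: u_def)
  \<comment> \<open>For Re s >= -1/2 the factor |v|^(-s) may grow like |v|^(1/2), and |v| <= 2u; the
    square root of 2 is rounded up to 2.\<close>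
  have sq: "exp (ln (2 * u) / 2) \<le> 2 * u powr (1/2)"
  proof -
    have "exp (ln (2 * u) / 2) = (2 * u) powr (1/2)" using u by (simp add: powr_def)
    also have "\<dots> = 2 powr (1/2) * u powr (1/2)" using u by (simp add: powr_mult)
    also have "2 powr (1/2) \<le> (2::real) powr 1" by (intro powr_mono) auto
    finally show ?thesis by (simp add: mult_right_mono)
  qed
  have re: "Re (- (s * of_real (ln t))) \<le> ln (2 * u) / 2" if "t \<ge> 1" "t \<le> 2 * u" for t
  proof -
    have "- Re s * ln t \<le> 1 / 2 * ln t" using s that by (intro mult_right_mono) auto
    also have "\<dots> \<le> 1 / 2 * ln (2 * u)" using that by (intro mult_left_mono) auto
    finally show ?thesis by simp
  qed
  have t1: "norm (inverse (v ^ 2) - inverse (w ^ 2)) \<le> 10 * D * inverse (u ^ 3)"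
  proof -
    have "inverse (v ^ 2) - inverse (w ^ 2) = (w - v) * (w + v) * inverse (v ^ 2) * inverse (w ^ 2)"
      using nz by (simp add: field_simps power2_eq_square)
    then have "norm (inverse (v ^ 2) - inverse (w ^ 2)) = norm (w - v) * norm (w + v) * inverse (norm v ^ 2) * inverse (u ^ 2)"
      by (simp add: norm_mult norm_inverse norm_power u_def)
    also have "\<dots> \<le> D * (5 / 2 * u) * inverse ((u / 2) ^ 2) * inverse (u ^ 2)"
    proof (intro mult_mono)
      show "norm (w - v) \<le> D" using D by (simp add: v_def)
      have "w + v = 2 * w + \<delta>" by (simp add: v_def)
      then show "norm (w + v) \<le> 5 / 2 * u"
        using norm_triangle_ineq[of "2 * w" \<delta>] D u by (simp add: norm_mult u_def)
      show "inverse (norm v ^ 2) \<le> inverse ((u / 2) ^ 2)"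
        using v1 u by (intro le_imp_inverse_le power_mono) auto
    qed (use D u in auto)
    also have "\<dots> = 10 * D * inverse (u ^ 3)"
      using u by (simp add: field_simps power2_eq_square power3_eq_cube)
    finally show ?thesis .
  qed
  \<comment> \<open>The mean value inequality for exp on a half plane Re <= const, combined with a
    bound of order D / u for the difference of the logarithms.\<close>
  have t2: "norm (exp (- (s * of_real (ln (norm v)))) - exp (- (s * of_real (ln u)))) \<le> 2 * u powr (1/2) * (M * (2 * D / u))"
  proof -
    have "norm (exp (- (s * of_real (ln (norm v)))) - exp (- (s * of_real (ln u))))
       \<le> exp (ln (2 * u) / 2) * norm (- (s * of_real (ln (norm v))) - - (s * of_real (ln u)))"
    proof (rule field_differentiable_bound[where S = "{x. Re x \<le> ln (2 * u) / 2}" and f' = exp])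
      show "- (s * of_real (ln (norm v))) \<in> {x. Re x \<le> ln (2 * u) / 2}"
        "- (s * of_real (ln u)) \<in> {x. Re x \<le> ln (2 * u) / 2}"
        using re[of "norm v"] re[of u] u v1 v2 by simp_all
      show "convex {x. Re x \<le> ln (2 * u) / 2}" by (rule convex_halfspace_Re_le)
    qed (auto intro: convex_halfspace_Re_le simp: norm_exp_eq_Re DERIV_exp has_field_derivative_at_within)
    also have "\<dots> \<le> (2 * u powr (1/2)) * (M * (2 * D / u))"
    proof (intro mult_mono sq)
      have ln: "\<bar>ln (norm v) - ln u\<bar> \<le> 2 * D / u"
      proof -
        have d: "\<bar>norm v - u\<bar> \<le> D"
          using norm_triangle_ineq3[of v w] D by (simp add: v_def u_def)
        have "ln (norm v) - ln u = ln (norm v / u)" using nz u by (simp add: ln_div u_def)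
        also have "\<dots> \<le> norm v / u - 1" using nz u by (intro ln_le_minus_one) (auto simp: u_def)
        also have "\<dots> = (norm v - u) / u" using u by (simp add: field_simps)
        also have "\<dots> \<le> D / u" using d u by (intro divide_right_mono) auto
        also have "\<dots> \<le> 2 * D / u" using D u by (intro divide_right_mono) auto
        finally have a: "ln (norm v) - ln u \<le> 2 * D / u" .
        have "ln u - ln (norm v) = ln (u / norm v)" using nz u by (simp add: ln_div u_def)
        also have "\<dots> \<le> u / norm v - 1" using nz u by (intro ln_le_minus_one) (auto simp: u_def)
        also have "\<dots> = (u - norm v) / norm v" using nz by (simp add: field_simps)
        also have "\<dots> \<le> D / norm v" using d nz by (intro divide_right_mono) auto
        also have "\<dots> \<le> D / (u / 2)" using v1 u D by (intro divide_left_mono mult_pos_pos) auto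
        finally have "ln u - ln (norm v) \<le> 2 * D / u" by (simp add: mult_ac)
        with a show ?thesis by simp
      qed
      have "norm (- (s * of_real (ln (norm v))) - - (s * of_real (ln u))) = norm (- s * of_real (ln (norm v) - ln u))"
        by (simp add: algebra_simps)
      also have "\<dots> = norm s * \<bar>ln (norm v) - ln u\<bar>" by (simp only: norm_mult norm_minus_cancel norm_of_real)
      also have "\<dots> \<le> M * (2 * D / u)" using s ln M0 by (intro mult_mono) auto
      finally show "norm (- (s * of_real (ln (norm v))) - - (s * of_real (ln u))) \<le> M * (2 * D / u)" .
    qed auto
    finally show ?thesis .
  qed
  have t3: "norm (exp (- (s * of_real (ln (norm v))))) \<le> 2 * u powr (1/2)"
  proof -
    have "norm (exp (- (s * of_real (ln (norm v))))) \<le> exp (ln (2 * u) / 2)"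
      unfolding norm_exp_eq_Re exp_le_cancel_iff using v1 v2 u by (intro re) auto
    then show ?thesis using sq by linarith
  qed
  have pw: "u powr (1/2) * inverse (u ^ 3) = u powr (- (5/2))" "u powr (1/2) * inverse (u ^ 2) * inverse u = u powr (- (5/2))"
  proof -
    have i: "inverse (u ^ 3) = u powr (- 3)" "inverse (u ^ 2) = u powr (- 2)" "inverse u = u powr (- 1)"
      using u powr_realpow[of u 3] powr_realpow[of u 2] powr_realpow[of u 1] by (simp_all add: powr_minus)
    show "u powr (1/2) * inverse (u ^ 3) = u powr (- (5/2))"
      "u powr (1/2) * inverse (u ^ 2) * inverse u = u powr (- (5/2))"
      unfolding i powr_add[symmetric] by simp_all
  qed
  have "hecke_term s v - hecke_term s w = (inverse (v ^ 2) - inverse (w ^ 2)) * exp (- (s * of_real (ln (norm v))))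
     + inverse (w ^ 2) * (exp (- (s * of_real (ln (norm v)))) - exp (- (s * of_real (ln u))))"
    using nz by (simp add: hecke_term_exp u_def algebra_simps)
  then have "norm (hecke_term s v - hecke_term s w) \<le>
      norm (inverse (v ^ 2) - inverse (w ^ 2)) * norm (exp (- (s * of_real (ln (norm v)))))
      + inverse (u ^ 2) * norm (exp (- (s * of_real (ln (norm v)))) - exp (- (s * of_real (ln u))))"
    by (metis norm_triangle_ineq norm_mult norm_inverse norm_power u_def)
  also have "\<dots> \<le> (10 * D * inverse (u ^ 3)) * (2 * u powr (1/2)) + inverse (u ^ 2) * (2 * u powr (1/2) * (M * (2 * D / u)))"
    using t1 t2 t3 D u by (intro add_mono mult_mono) auto
  also have "\<dots> = 20 * D * (u powr (1/2) * inverse (u ^ 3)) + 4 * M * D * (u powr (1/2) * inverse (u ^ 2) * inverse u)"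
    by (simp add: field_simps)
  also have "\<dots> = (20 * D + 4 * M * D) * u powr (- (5/2))"
    unfolding pw by (simp add: algebra_simps)
  finally show ?thesis by (simp add: u_def v_def)
qed


definition lat :: "complex \<Rightarrow> int \<times> int \<Rightarrow> complex" where
  "lat z k = of_int (fst k) * z + of_int (snd k)"

abbreviation lat_size :: "int \<times> int \<Rightarrow> real" where
  "lat_size k \<equiv> 1 + \<bar>real_of_int (fst k)\<bar> + \<bar>real_of_int (snd k)\<bar>"

lemma lat_lower:
  assumes "Im z > 0"
  obtains c where "c > 0" "\<And>k. k \<noteq> (0, 0) \<Longrightarrow> c * lat_size k \<le> norm (lat z k)"
proof -
  from norm_lattice_ge[OF assms] obtain c where
    c: "c > 0" "\<And>p q :: real. c * (\<bar>p\<bar> + \<bar>q\<bar>) \<le> norm (of_real p * z + of_real q)" by blast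
  have "c / 2 * lat_size k \<le> norm (lat z k)" if k: "k \<noteq> (0, 0)" for k
  proof -
    have "fst k \<noteq> 0 \<or> snd k \<noteq> 0" using k by (cases k) auto
    then have "1 \<le> \<bar>fst k\<bar> + \<bar>snd k\<bar>" by linarith
    then have "1 \<le> \<bar>real_of_int (fst k)\<bar> + \<bar>real_of_int (snd k)\<bar>" by linarith
    then have "c / 2 * lat_size k \<le> c / 2 * (2 * (\<bar>real_of_int (fst k)\<bar> + \<bar>real_of_int (snd k)\<bar>))"
      using c by (intro mult_left_mono) auto
    also have "\<dots> = c * (\<bar>real_of_int (fst k)\<bar> + \<bar>real_of_int (snd k)\<bar>)" by simp
    also have "\<dots> \<le> norm (lat z k)" using c(2)[of "of_int (fst k)" "of_int (snd k)"] by (simp add: lat_def)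
    finally show ?thesis .
  qed
  moreover have "c / 2 > 0" using c by simp
  ultimately show ?thesis using that by blast
qed

lemma lat_0 [simp]: "lat z (0, 0) = 0"
  by (simp add: lat_def)

lemma lat_nonzero: "Im z > 0 \<Longrightarrow> k \<noteq> (0, 0) \<Longrightarrow> lat z k \<noteq> 0"
proof -
  assume "Im z > 0" "k \<noteq> (0, 0)"
  moreover obtain c where "c > 0" "\<And>k. k \<noteq> (0, 0) \<Longrightarrow> c * lat_size k \<le> norm (lat z k)"
    using lat_lower[OF \<open>Im z > 0\<close>] by blast
  ultimately have "0 < c * lat_size k" "c * lat_size k \<le> norm (lat z k)"
    by (auto intro!: mult_pos_pos add_pos_nonneg)
  then show "lat z k \<noteq> 0" by auto
qed

lemma summable_lat_powr:
  assumes z: "Im z > 0" and r: "r > 2"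
  shows "(\<lambda>k. norm (lat z k) powr (- r)) summable_on UNIV"
proof -
  obtain c where c: "c > 0" "\<And>k. k \<noteq> (0, 0) \<Longrightarrow> c * lat_size k \<le> norm (lat z k)"
    using lat_lower[OF z] by blast
  show ?thesis
  proof (rule summable_on_comparison_test[OF summable_on_cmult_right[OF summable_lattice_powr[OF r], of "c powr (- r)"]])
    fix k
    show "norm (lat z k) powr (- r) \<le> c powr (- r) * lat_size k powr (- r)"
    proof (cases "k = (0, 0)")
      case False
      have "norm (lat z k) powr (- r) \<le> (c * lat_size k) powr (- r)"
        using c False r by (intro powr_mono2') (auto intro!: mult_pos_pos add_pos_nonneg)
      then show ?thesis using c by (simp add: powr_mult)
    qed simp
  qed auto
qed

lemma norm_hecke_term': "norm (hecke_term s w) = norm w powr (- (2 + Re s))"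
  by (cases "w = 0") (simp_all add: norm_hecke_term)

lemma hecke_summable:
  assumes "Im z > 0" "Re s > 0"
  shows "(\<lambda>k. ecis (f k) * hecke_term s (lat z k)) summable_on UNIV"
  by (rule abs_summable_summable)
     (use summable_lat_powr[of z "2 + Re s"] assms in \<open>simp add: norm_mult norm_hecke_term'\<close>)

lemma lat_inverse_summable:
  assumes "Im z > 0" "m > 2"
  shows "(\<lambda>k. ecis (f k) * inverse (lat z k ^ m)) summable_on UNIV"
proof (rule abs_summable_summable)
  have "norm (ecis (f k) * inverse (lat z k ^ m)) = norm (lat z k) powr (- real m)" for k
  proof (cases "lat z k = 0")
    case False
    then show ?thesis using powr_realpow[of "norm (lat z k)" m]
      by (simp add: norm_mult norm_inverse norm_power powr_minus)
  qed (use assms in auto)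
  then show "(\<lambda>k. norm (ecis (f k) * inverse (lat z k ^ m))) summable_on UNIV"
    using summable_lat_powr[of z "real m"] assms by simp
qed

definition hecke_diff :: "complex \<Rightarrow> complex \<Rightarrow> complex \<Rightarrow> complex" where
  "hecke_diff \<delta> z s = infsum (\<lambda>k. hecke_term s (lat z k + \<delta>) - hecke_term s (lat z k)) UNIV"

lemma hecke_diff_bound:
  assumes z: "Im z > 0"
  obtains C where "\<And>s k. s \<in> {s. Re s \<ge> - (1 / 2) \<and> norm s \<le> M} \<Longrightarrow>
    norm (hecke_term s (lat z k + \<delta>) - hecke_term s (lat z k)) \<le> C * lat_size k powr (- (5 / 2))"
proof -
  obtain c where c: "c > 0" "\<And>k. k \<noteq> (0, 0) \<Longrightarrow> c * lat_size k \<le> norm (lat z k)"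
    using lat_lower[OF z] by blast
  define D where "D = norm \<delta> + 1"
  have D: "norm \<delta> \<le> D" "D \<ge> 1" by (auto simp: D_def)
  \<comment> \<open>The lattice points at which \<open>hecke_term_diff\<close> does not apply; they
    are finitely many because norms grow linearly by \<open>lat_lower\<close>.\<close>
  define E where "E = {k. norm (lat z k) < 2 * D}"
  have sub: "E \<subseteq> {- \<lceil>2 * D / c\<rceil>..\<lceil>2 * D / c\<rceil>} \<times> {- \<lceil>2 * D / c\<rceil>..\<lceil>2 * D / c\<rceil>}"
  proof
    fix k assume "k \<in> E"
    then have k: "norm (lat z k) < 2 * D" by (simp add: E_def)
    have le: "lat_size k - 1 \<le> 2 * D / c"
    proof (cases "k = (0, 0)")
      case False
      have "c * lat_size k < 2 * D" using c(2)[OF False] k by linarith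
      then have "lat_size k < 2 * D / c" using c(1) by (simp add: pos_less_divide_eq mult.commute)
      then show ?thesis by linarith
    qed (use c D in auto)
    then have "\<bar>real_of_int (fst k)\<bar> \<le> 2 * D / c" "\<bar>real_of_int (snd k)\<bar> \<le> 2 * D / c" by linarith+
    then have "\<bar>fst k\<bar> \<le> \<lceil>2 * D / c\<rceil>" "\<bar>snd k\<bar> \<le> \<lceil>2 * D / c\<rceil>" by linarith+
    then show "k \<in> {- \<lceil>2 * D / c\<rceil>..\<lceil>2 * D / c\<rceil>} \<times> {- \<lceil>2 * D / c\<rceil>..\<lceil>2 * D / c\<rceil>}"
      by (cases k) (auto simp: abs_le_iff)
  qed
  have fin: "finite E" by (rule finite_subset[OF sub]) auto
  let ?f = "\<lambda>k s. hecke_term s (lat z k + \<delta>) - hecke_term s (lat z k)"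
  let ?b = "\<lambda>k. lat_size k powr (- (5 / 2))"
  let ?S = "{s. Re s \<ge> - (1 / 2) \<and> norm s \<le> M}"
  let ?B = "\<lambda>k. inverse (norm (lat z k + \<delta>) ^ 2) * exp (M * \<bar>ln (norm (lat z k + \<delta>))\<bar>) +
     inverse (norm (lat z k) ^ 2) * exp (M * \<bar>ln (norm (lat z k))\<bar>)"
  have 1: "norm (?f k s) \<le> ((20 * D + 4 * M * D) * c powr (- (5 / 2))) * ?b k" if s: "s \<in> ?S" and k: "k \<notin> E" for s k
  proof -
    have M: "M \<ge> 0" using s order.trans[OF norm_ge_zero[of s], of M] by simp
    have k': "norm (lat z k) \<ge> 2 * D" using k by (auto simp: E_def)
    then have k0: "k \<noteq> (0, 0)" using D by auto
    have "norm (?f k s) \<le> (20 * D + 4 * M * D) * norm (lat z k) powr (- (5 / 2))"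
      using s by (intro hecke_term_diff D k') auto
    also have "norm (lat z k) powr (- (5 / 2)) \<le> (c * lat_size k) powr (- (5 / 2))"
      using c k0 by (intro powr_mono2') (auto intro!: mult_pos_pos add_pos_nonneg)
    also have "\<dots> = c powr (- (5 / 2)) * ?b k" using c by (simp add: powr_mult)
    finally show ?thesis using D M by (simp add: mult_left_mono mult.assoc)
  qed
  have 2: "norm (?f k s) \<le> ?B k" if s: "s \<in> ?S" for s k
    using norm_triangle_ineq4[of "hecke_term s (lat z k + \<delta>)" "hecke_term s (lat z k)"]
      norm_hecke_term_le[of s M "lat z k + \<delta>"] norm_hecke_term_le[of s M "lat z k"] s by simp
  have b: "?b k > 0" for k by (simp add: add_pos_nonneg)
  obtain C' where "\<And>s k. s \<in> ?S \<Longrightarrow> norm (?f k s) \<le> C' * ?b k"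
    using finite_exception_bound[where E = E and b = ?b and S = ?S and f = ?f and B = ?B, OF fin b 1 2] by blast
  then show ?thesis using that by blast
qed

lemma hecke_diff_summable:
  assumes z: "Im z > 0" and s: "Re s \<ge> - (1 / 2)"
  shows "(\<lambda>k. hecke_term s (lat z k + \<delta>) - hecke_term s (lat z k)) summable_on UNIV"
proof -
  obtain C where C: "\<And>s' k. s' \<in> {s'. Re s' \<ge> - (1 / 2) \<and> norm s' \<le> norm s} \<Longrightarrow>
    norm (hecke_term s' (lat z k + \<delta>) - hecke_term s' (lat z k)) \<le> C * lat_size k powr (- (5 / 2))"
    using hecke_diff_bound[OF z] by blast
  show ?thesis
    by (rule abs_summable_summable, rule summable_on_comparison_test[OF summable_on_cmult_right[OF summable_lattice_powr]])
       (use C s in auto)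
qed

text \<open>This half plane contains s = 0, in contrast to the domain Re s > 0 of the individual
  coset sums; the continuation to 0 comes from here.\<close>

lemma hecke_diff_holomorphic:
  assumes z: "Im z > 0"
  shows "hecke_diff \<delta> z holomorphic_on {s. Re s > - (1 / 2)}"
  unfolding hecke_diff_def[abs_def]
proof (rule holomorphic_infsum)
  show "open {s. Re s > - (1 / 2)}" by (rule open_halfspace_Re_gt)
  have e: "hecke_term s w = inverse (w ^ 2) * exp (- (s * of_real (ln (norm w))))" for s w
    by (cases "w = 0") (simp_all add: hecke_term_exp)
  show "(\<lambda>s. hecke_term s (lat z k + \<delta>) - hecke_term s (lat z k)) holomorphic_on {s. Re s > - (1 / 2)}" for k
    unfolding e by (intro holomorphic_intros)
  fix s0 r assume sub: "cball s0 r \<subseteq> {s. Re s > - (1 / 2)}"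
  obtain C where C: "\<And>s k. s \<in> {s. Re s \<ge> - (1 / 2) \<and> norm s \<le> norm s0 + r} \<Longrightarrow>
    norm (hecke_term s (lat z k + \<delta>) - hecke_term s (lat z k)) \<le> C * lat_size k powr (- (5 / 2))"
    using hecke_diff_bound[OF z] by blast
  show "\<exists>M. M summable_on UNIV \<and> (\<forall>s\<in>cball s0 r. \<forall>k. norm (hecke_term s (lat z k + \<delta>) - hecke_term s (lat z k)) \<le> M k)"
  proof (intro exI conjI ballI allI)
    show "(\<lambda>k. C * lat_size k powr (- (5 / 2))) summable_on UNIV"
      by (intro summable_on_cmult_right summable_lattice_powr) auto
    fix s k assume s: "s \<in> cball s0 r"
    have "norm s \<le> norm s0 + norm (s - s0)" by (metis norm_triangle_sub)
    with s have "norm s \<le> norm s0 + r" by (auto simp: dist_norm norm_minus_commute)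
    then show "norm (hecke_term s (lat z k + \<delta>) - hecke_term s (lat z k)) \<le> C * lat_size k powr (- (5 / 2))"
      using s sub by (intro C) force
  qed
qed

lemma infsum_coset:
  fixes f :: "real \<times> real \<Rightarrow> complex"
  assumes f: "f (0, 0) = 0"
  shows "infsum f (coset a) = infsum (\<lambda>k :: int \<times> int. f (fst a + of_int (fst k), snd a + of_int (snd k))) UNIV"
proof -
  let ?h = "\<lambda>k :: int \<times> int. (fst a + of_int (fst k), snd a + of_int (snd k))"
  have inj: "inj ?h" by (auto simp: inj_on_def)
  have "infsum f (coset a) = infsum f (range ?h)"
  proof (rule infsum_cong_neutral)
    fix k assume k: "k \<in> range ?h - coset a"
    then obtain i j :: int where "k = (fst a + of_int i, snd a + of_int j)" by auto
    with k have "k = (0, 0)" by (auto simp: coset_def)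
    then show "f k = 0" by (simp add: f)
  next
    fix k assume k: "k \<in> coset a - range ?h"
    then obtain i j :: int where "fst k - fst a = of_int i" "snd k - snd a = of_int j"
      by (auto simp: coset_def elim!: Ints_cases)
    then have "k = ?h (i, j)" by (cases k) auto
    with k show "f k = 0" by blast
  qed auto
  also have "\<dots> = infsum (f \<circ> ?h) UNIV" by (rule infsum_reindex[OF inj])
  finally show ?thesis by (simp add: o_def)
qed

lemma hecke_term_scale:
  assumes "N > 0"
  shows "hecke_term s (w / of_nat N) = of_nat N ^ 2 * of_nat N powr s * hecke_term s w"
proof (cases "w = 0")
  case False
  then show ?thesis using assms
    by (simp add: hecke_term_exp norm_divide ln_div power_divide powr_def Ln_of_nat algebra_simps exp_diff exp_minus field_simps)
qed simp

lemma chi_ecis: "chi x p q = ecis (real q * fst x - real p * snd x)"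
  by (simp add: chi_def ecis_exp)

lemma ecis_residues:
  assumes "real N * x1 \<in> \<int>" "real N * x2 \<in> \<int>"
  shows "ecis (of_int (int q + int N * j) * x1 - of_int (int p + int N * i) * x2) = chi (x1, x2) p q"
  unfolding chi_ecis
proof (rule ecis_cong)
  have "of_int j * (real N * x1) - of_int i * (real N * x2) \<in> \<int>"
    by (intro Ints_diff Ints_mult assms Ints_of_int)
  then show "of_int (int q + int N * j) * x1 - of_int (int p + int N * i) * x2 -
     (real q * fst (x1, x2) - real p * snd (x1, x2)) \<in> \<int>"
    by (simp add: algebra_simps)
qed

lemma lat_residues:
  assumes "N > 0"
  shows "lat z (i, j) + (of_real (real p / real N) * z + of_real (real q / real N)) =
    lat z (int p + int N * i, int q + int N * j) / of_nat N"
  using assms by (simp add: lat_def field_simps)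

text \<open>The continued value is a limit along positive reals, by continuity of h at 0. This gives
  its uniqueness, and it lets identities known for Re s > 0 pass to s = 0.\<close>

lemma continuation_at_0_limit:
  assumes U: "open U" "0 \<in> U" and h: "h holomorphic_on U" and eq: "\<And>s. Re s > 0 \<Longrightarrow> h s = g s"
  shows "((\<lambda>t::real. g (of_real t)) \<longlongrightarrow> h 0) (at_right 0)"
proof -
  have "isCont h 0" using U h holomorphic_on_imp_continuous_on continuous_on_eq_continuous_at by blast
  then have "(h \<longlongrightarrow> h 0) (nhds 0)" by (simp add: isCont_def tendsto_at_iff_tendsto_nhds)
  moreover have "filterlim (\<lambda>t::real. complex_of_real t) (nhds 0) (at_right 0)"
    using tendsto_of_real[of "\<lambda>t. t" 0 "at_right 0", where ?'a = complex] by (simp add: tendsto_ident_at)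
  ultimately have "((\<lambda>t::real. h (of_real t)) \<longlongrightarrow> h 0) (at_right 0)"
    by (rule filterlim_compose)
  moreover have "eventually (\<lambda>t::real. h (of_real t) = g (of_real t)) (at_right 0)"
    using eventually_at_right_less[of "0::real"] by eventually_elim (auto intro: eq)
  ultimately show ?thesis by (rule Lim_transform_eventually)
qed

lemma continuation_at_0_eq:
  assumes "open U" "connected U" "{s. Re s > 0} \<subseteq> U" "0 \<in> U" "h holomorphic_on U"
    "\<And>s. Re s > 0 \<Longrightarrow> h s = g s"
  shows "continuation_at_0 g = h 0"
  unfolding continuation_at_0_def
proof (rule the_equality)
  show "\<exists>h' U. open U \<and> connected U \<and> {s. Re s > 0} \<subseteq> U \<and> 0 \<in> U \<and>
     h' holomorphic_on U \<and> (\<forall>s. Re s > 0 \<longrightarrow> h' s = g s) \<and> h 0 = h' 0"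
    using assms by blast
  fix v assume "\<exists>h' U. open U \<and> connected U \<and> {s. Re s > 0} \<subseteq> U \<and> 0 \<in> U \<and>
     h' holomorphic_on U \<and> (\<forall>s. Re s > 0 \<longrightarrow> h' s = g s) \<and> v = h' 0"
  then obtain h' U' where h': "open U'" "0 \<in> U'" "h' holomorphic_on U'" "\<And>s. Re s > 0 \<Longrightarrow> h' s = g s" "v = h' 0"
    by blast
  show "v = h 0"
    using tendsto_unique[OF _ continuation_at_0_limit[OF h'(1-4)] continuation_at_0_limit[OF assms(1,4,5,6)]] h'(5)
    by simp
qed


lemma finite_exception_bound':
  fixes f :: "'k \<Rightarrow> complex" and b :: "'k \<Rightarrow> real"
  assumes "finite E" "\<And>k. b k > 0" "\<And>k. k \<notin> E \<Longrightarrow> norm (f k) \<le> C * b k"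
  obtains C' where "\<And>k. norm (f k) \<le> C' * b k"
  by (rule finite_exception_bound[of E b "UNIV :: unit set" "\<lambda>k _. f k" C "\<lambda>k. norm (f k)"])
     (use assms in auto)

lemma has_sum_diff:
  fixes f g :: "'k \<Rightarrow> complex"
  assumes "(f has_sum a) A" "(g has_sum b) A"
  shows "((\<lambda>k. f k - g k) has_sum (a - b)) A"
  using has_sum_add[OF assms(1), of "\<lambda>k. - g k" "- b"] assms(2) by (simp add: has_sum_uminus)

text \<open>Weight 2 lattice sums converge only conditionally; the iterated sum, first over the second
  coordinate, is the one that can be rearranged.\<close>

definition row_sum :: "nat \<Rightarrow> real \<Rightarrow> complex \<Rightarrow> complex" where
  "row_sum m x \<tau> = infsum (\<lambda>q::int. ecis (of_int q * x) * inverse ((\<tau> + of_int q) ^ m)) UNIV"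

lemma row_summable:
  assumes m: "m \<ge> 2"
  shows "(\<lambda>q::int. ecis (of_int q * x) * inverse ((\<tau> + of_int q) ^ m)) summable_on UNIV"
proof -
  \<comment> \<open>Beyond this threshold both |\<open>\<tau>\<close> + q| >= (1 + |q|) / 4 and
    |\<open>\<tau>\<close> + q| >= 1 hold; the second allows replacing the exponent m by 2.\<close>
  define K where "K = \<lceil>2 * norm \<tau> + 2\<rceil>"
  let ?f = "\<lambda>q::int. ecis (of_int q * x) * inverse ((\<tau> + of_int q) ^ m)"
  let ?b = "\<lambda>q::int. (1 + \<bar>real_of_int q\<bar>) powr (- 2)"
  have 1: "norm (?f q) \<le> 16 * ?b q" if "q \<notin> {-K..K}" for q
  proof -
    have "\<bar>q\<bar> > K" using that by auto
    then have q: "\<bar>real_of_int q\<bar> \<ge> 2 * norm \<tau> + 2" unfolding K_def by linarith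
    have tri: "\<bar>real_of_int q\<bar> \<le> norm (\<tau> + of_int q) + norm \<tau>"
      using norm_triangle_ineq4[of "\<tau> + of_int q" \<tau>] by simp
    have gen: "(1 + a) / 4 \<le> n \<and> 1 \<le> n" if "a \<ge> 2 * t + 2" "a \<le> n + t" "t \<ge> 0" for a n t :: real
      using that by auto
    have l: "norm (\<tau> + of_int q) \<ge> (1 + \<bar>real_of_int q\<bar>) / 4" "norm (\<tau> + of_int q) \<ge> 1" 
      using gen[OF q tri norm_ge_zero] by auto
    have "((1 + \<bar>real_of_int q\<bar>) / 4) ^ 2 \<le> norm (\<tau> + of_int q) ^ 2"
      using l by (intro power_mono) auto
    also have "\<dots> \<le> norm (\<tau> + of_int q) ^ m" using l m by (intro power_increasing) auto
    finally have "inverse (norm (\<tau> + of_int q) ^ m) \<le> inverse (((1 + \<bar>real_of_int q\<bar>) / 4) ^ 2)"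
      by (intro le_imp_inverse_le) auto
    also have "\<dots> = 16 * ?b q"
    proof -
      have e: "?b q = inverse ((1 + \<bar>real_of_int q\<bar>) ^ 2)"
        using powr_realpow[of "1 + \<bar>real_of_int q\<bar>" 2] by (simp add: powr_minus)
      show ?thesis unfolding e power_divide by (simp add: field_simps)
    qed
    finally show ?thesis by (simp add: norm_mult norm_inverse norm_power)
  qed
  have fin: "finite {-K..K}" and b: "\<And>q. ?b q > 0" by (auto simp: add_pos_nonneg)
  from finite_exception_bound'[where b = ?b and f = ?f, OF fin b 1]
  obtain C where C: "\<And>q. norm (?f q) \<le> C * ?b q" by blast
  show ?thesis
    by (rule abs_summable_summable, rule summable_on_comparison_test[OF summable_on_cmult_right[OF summable_on_int_powr] C]) auto
qed

lemma row_has_sum: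
  "m \<ge> 2 \<Longrightarrow> ((\<lambda>q::int. ecis (of_int q * x) * inverse ((\<tau> + of_int q) ^ m)) has_sum row_sum m x \<tau>) UNIV"
  unfolding row_sum_def by (intro has_sum_infsum row_summable)

lemma row_lipschitz:
  assumes "Im \<tau> > 0" "m \<ge> 2"
  shows "row_sum m x \<tau> = (- (2 * of_real pi * \<i>)) ^ m / fact (m - 1) *
     coset_sum (m - 1) (- x) (- (2 * of_real pi * \<i> * \<tau>))"
  using infsumI[OF lipschitz_formula[OF assms, of x]] by (simp add: row_sum_def divide_inverse)

lemma row_minus: "m \<ge> 2 \<Longrightarrow> row_sum m x (- \<tau>) = (-1) ^ m * row_sum m (- x) \<tau>"
proof -
  assume m: "m \<ge> 2"
  have "((\<lambda>q::int. ecis (of_int (- q) * x) * inverse ((- \<tau> + of_int (- q)) ^ m)) has_sum row_sum m x (- \<tau>)) UNIV"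
    using has_sum_reindex_bij_betw[of uminus UNIV UNIV, where f = "\<lambda>q. ecis (of_int q * x) * inverse ((- \<tau> + of_int q) ^ m)"]
      row_has_sum[OF m, of x "- \<tau>"] bij_uminus by blast
  moreover have "ecis (of_int (- q) * x) * inverse ((- \<tau> + of_int (- q)) ^ m) =
      (-1) ^ m * (ecis (of_int q * (- x)) * inverse ((\<tau> + of_int q) ^ m))" for q
  proof -
    have "- \<tau> + of_int (- q) = (-1) * (\<tau> + of_int q)" by simp
    then show ?thesis by (simp only: power_mult_distrib inverse_mult_distrib) (simp add: power_inverse[symmetric])
  qed
  ultimately have "((\<lambda>q::int. (-1) ^ m * (ecis (of_int q * (- x)) * inverse ((\<tau> + of_int q) ^ m))) has_sum row_sum m x (- \<tau>)) UNIV"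
    by (simp only:)
  moreover have "((\<lambda>q::int. (-1) ^ m * (ecis (of_int q * (- x)) * inverse ((\<tau> + of_int q) ^ m))) has_sum
      (-1) ^ m * row_sum m (- x) \<tau>) UNIV"
    by (intro has_sum_cmult_right row_has_sum m)
  ultimately show ?thesis by (rule has_sum_unique)
qed

text \<open>By the Lipschitz formula the row decays exponentially in |Im \<open>\<tau>\<close>|; the
  bound 1 / Im^2 is all that the outer summation asks for. The lower half plane is reached by
  \<open>row_minus\<close>.\<close>

lemma row_decay:
  assumes "\<delta> > 0"
  obtains C where "C \<ge> 0" "\<And>\<tau>. \<bar>Im \<tau>\<bar> \<ge> \<delta> \<Longrightarrow> norm (row_sum 2 0 \<tau>) \<le> C / (Im \<tau>) ^ 2"
proof -
  have "2 * pi * \<delta> > 0" using assms by simp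
  from coset_sum_decay[OF this, of 1 0] obtain C where
    C: "\<And>X. Re X \<ge> 2 * pi * \<delta> \<Longrightarrow> norm (coset_sum 1 0 X) \<le> C * exp (- (coset_rep 0 * Re X))" by blast
  have rep: "coset_rep 0 = 1" by (simp add: coset_rep_def)
  define C' where "C' = (2 * pi) ^ 2 * (\<bar>C\<bar> * 2 / (2 * pi) ^ 2)"
  have up: "norm (row_sum 2 0 \<tau>) \<le> C' / (Im \<tau>) ^ 2" if "Im \<tau> \<ge> \<delta>" for \<tau>
  proof -
    have t: "Im \<tau> > 0" using that assms by simp
    have r: "row_sum 2 0 \<tau> = (2 * of_real pi * \<i>) ^ 2 * coset_sum 1 0 (- (2 * of_real pi * \<i> * \<tau>))"
      using row_lipschitz[OF t, of 2 0] by simp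
    have n: "norm ((2 * complex_of_real pi * \<i>) ^ 2) = (2 * pi) ^ 2"
      by (simp add: norm_power norm_mult)
    have "norm (coset_sum 1 0 (- (2 * of_real pi * \<i> * \<tau>))) \<le> C * exp (- (2 * pi * Im \<tau>))"
      using C[of "- (2 * of_real pi * \<i> * \<tau>)"] that by (simp add: rep)
    also have "\<dots> \<le> \<bar>C\<bar> * exp (- (2 * pi * Im \<tau>))" by (intro mult_right_mono) auto
    also have "\<dots> \<le> \<bar>C\<bar> * (2 / (2 * pi * Im \<tau>) ^ 2)"
    proof -
      have "(2 * pi * Im \<tau>) ^ 2 \<le> 2 * exp (2 * pi * Im \<tau>)"
        using power_le_exp[of "2 * pi * Im \<tau>" 1 2] t by (simp add: numeral_2_eq_2)
      then have "exp (- (2 * pi * Im \<tau>)) \<le> 2 / (2 * pi * Im \<tau>) ^ 2"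
        using t by (simp add: exp_minus field_simps)
      then show ?thesis by (intro mult_left_mono) auto
    qed
    finally have "norm (row_sum 2 0 \<tau>) \<le> (2 * pi) ^ 2 * (\<bar>C\<bar> * (2 / (2 * pi * Im \<tau>) ^ 2))"
      unfolding r norm_mult n by (intro mult_left_mono) auto
    then show ?thesis by (simp add: C'_def power_mult_distrib)
  qed
  have "norm (row_sum 2 0 \<tau>) \<le> C' / (Im \<tau>) ^ 2" if "\<bar>Im \<tau>\<bar> \<ge> \<delta>" for \<tau>
    using up[of \<tau>] up[of "- \<tau>"] row_minus[of 2 0 \<tau>] that by (auto simp: abs_if split: if_splits)
  moreover have "C' \<ge> 0" by (simp add: C'_def)
  ultimately show ?thesis using that by blast
qed

lemma row_outer_summable:
  assumes z: "Im z > 0" and N: "N > 0" and \<beta>: "\<And>i. Im (\<beta> i) = 0"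
  shows "(\<lambda>i::int. row_sum 2 0 ((of_real (real p / real N) + of_int i) * z + \<beta> i)) summable_on UNIV"
proof -
  define \<alpha> where "\<alpha> = real p / real N"
  have "Im z / N > 0" using z N by simp
  from row_decay[OF this] obtain C where C: "C \<ge> 0"
    "\<And>\<tau>. \<bar>Im \<tau>\<bar> \<ge> Im z / N \<Longrightarrow> norm (row_sum 2 0 \<tau>) \<le> C / (Im \<tau>) ^ 2" by blast
  let ?f = "\<lambda>i::int. row_sum 2 0 ((of_real \<alpha> + of_int i) * z + \<beta> i)"
  let ?b = "\<lambda>q::int. (1 + \<bar>real_of_int q\<bar>) powr (- 2)"
  \<comment> \<open>At most one row has \<open>\<alpha>\<close> + i = 0; its points lie on the real
    axis, where \<open>row_decay\<close> gives nothing.\<close>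
  define E where "E = {i::int. \<alpha> + of_int i = 0}"
  have "E \<subseteq> {- \<lfloor>\<alpha>\<rfloor>}"
  proof
    fix i assume "i \<in> E"
    then have "\<alpha> = of_int (- i)" by (simp add: E_def)
    then have "\<lfloor>\<alpha>\<rfloor> = - i" by (metis floor_of_int)
    then show "i \<in> {- \<lfloor>\<alpha>\<rfloor>}" by simp
  qed
  then have fin: "finite E" using finite_subset by blast
  \<comment> \<open>Combines 1 + |i| <= (1 + |\<open>\<alpha>\<close>|) + |t| with 1 <= N |t|, for t
    = \<open>\<alpha>\<close> + i.\<close>
  define K where "K = 1 + N * (1 + \<bar>\<alpha>\<bar>)"
  have 1: "norm (?f i) \<le> (C * K ^ 2 / (Im z) ^ 2) * ?b i" if i: "i \<notin> E" for i
  proof -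
    define t where "t = \<alpha> + of_int i"
    have t_eq: "t = real_of_int (int p + int N * i) / N" using N by (simp add: t_def \<alpha>_def field_simps)
    moreover have t_nz: "t \<noteq> 0" using i by (simp add: E_def t_def)
    ultimately have "real_of_int (int p + int N * i) \<noteq> 0" by auto
    then have "int p + int N * i \<noteq> 0" by (metis of_int_0)
    then have "1 \<le> \<bar>int p + int N * i\<bar>" by linarith
    then have "1 \<le> \<bar>real_of_int (int p + int N * i)\<bar>" by linarith
    then have t1: "\<bar>t\<bar> \<ge> 1 / N"
      using N t_eq by (simp add: abs_divide divide_right_mono)
    have "1 + \<bar>real_of_int i\<bar> \<le> (1 + \<bar>\<alpha>\<bar>) * 1 + \<bar>t\<bar>"
      using abs_triangle_ineq4[of t \<alpha>] by (simp add: t_def)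
    also have "\<dots> \<le> (1 + \<bar>\<alpha>\<bar>) * (N * \<bar>t\<bar>) + \<bar>t\<bar>"
      using t1 N by (intro add_right_mono mult_left_mono) (auto simp: field_simps)
    also have "\<dots> = K * \<bar>t\<bar>" by (simp add: K_def algebra_simps)
    finally have Kt: "1 + \<bar>real_of_int i\<bar> \<le> K * \<bar>t\<bar>" .
    have im: "Im ((of_real \<alpha> + of_int i) * z + \<beta> i) = t * Im z" using \<beta> by (simp add: t_def)
    have "\<bar>t * Im z\<bar> \<ge> Im z / N" using t1 z N by (simp add: abs_mult field_simps)
    then have "norm (?f i) \<le> C / (t * Im z) ^ 2" using C(2) im by metis
    also have "\<dots> = C / (Im z) ^ 2 * (1 / t ^ 2)" by (simp add: power_mult_distrib)
    also have "\<dots> \<le> C / (Im z) ^ 2 * (K ^ 2 / (1 + \<bar>real_of_int i\<bar>) ^ 2)"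
    proof (intro mult_left_mono)
      have "(1 + \<bar>real_of_int i\<bar>) ^ 2 \<le> (K * \<bar>t\<bar>) ^ 2" using Kt by (intro power_mono) auto
      then have "(1 + \<bar>real_of_int i\<bar>) ^ 2 \<le> K ^ 2 * t ^ 2" by (simp add: power_mult_distrib)
      moreover have "(1 + \<bar>real_of_int i\<bar>) ^ 2 > 0" by (intro zero_less_power) auto
      moreover have "t ^ 2 > 0" using t_nz by simp
      ultimately show "1 / t ^ 2 \<le> K ^ 2 / (1 + \<bar>real_of_int i\<bar>) ^ 2"
        by (simp add: pos_le_divide_eq pos_divide_le_eq)
    qed (use C in auto)
    also have "\<dots> = (C * K ^ 2 / (Im z) ^ 2) * ?b i"
      using powr_realpow[of "1 + \<bar>real_of_int i\<bar>" 2] by (simp add: powr_minus field_simps)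
    finally show ?thesis .
  qed
  have b: "\<And>q. ?b q > 0" by (auto simp: add_pos_nonneg)
  from finite_exception_bound'[where b = ?b and f = ?f, OF fin b 1]
  obtain C where C: "\<And>q. norm (?f q) \<le> C * ?b q" by blast
  show ?thesis unfolding \<alpha>_def[symmetric]
    by (rule abs_summable_summable, rule summable_on_comparison_test[OF summable_on_cmult_right[OF summable_on_int_powr] C]) auto
qed

text \<open>The value at \<open>s = 0\<close> of the regularized coset sum.\<close>

definition iter :: "complex \<Rightarrow> nat \<Rightarrow> nat \<Rightarrow> nat \<Rightarrow> complex" where
  "iter z N p q = infsum (\<lambda>i::int. row_sum 2 0 ((of_real (real p / real N) + of_int i) * z + of_real (real q / real N))) UNIV"

lemma hecke_term_at_0: "hecke_term 0 w = inverse (w ^ 2)"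
  by (simp add: hecke_term_def powr_def)

text \<open>At s = 0 the differences still converge absolutely, so the double sum may be evaluated
  row by row; only then are the two conditionally convergent iterated sums separated.\<close>

lemma hecke_diff_at_0:
  assumes z: "Im z > 0" and N: "N > 0"
  shows "hecke_diff (of_real (real p / real N) * z + of_real (real q / real N)) z 0 = iter z N p q - iter z N 0 0"
proof -
  define \<delta> where "\<delta> = of_real (real p / real N) * z + complex_of_real (real q / real N)"
  let ?g = "\<lambda>k. hecke_term 0 (lat z k + \<delta>) - hecke_term 0 (lat z k)"
  have s: "?g summable_on UNIV" using z by (intro hecke_diff_summable) auto
  have 1: "((\<lambda>j. inverse ((\<tau> + of_int j) ^ 2)) has_sum row_sum 2 0 \<tau>) UNIV" for \<tau>
    using row_has_sum[of 2 0 \<tau>] by simp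
  have inner: "((\<lambda>j. ?g (i, j)) has_sum
      row_sum 2 0 ((of_real (real p / real N) + of_int i) * z + of_real (real q / real N))
        - row_sum 2 0 ((of_real (real 0 / real N) + of_int i) * z + of_real (real 0 / real N))) UNIV" for i
    using has_sum_diff[OF 1 1, of "(of_real (real p / real N) + of_int i) * z + of_real (real q / real N)"
       "(of_real (real 0 / real N) + of_int i) * z + of_real (real 0 / real N)"]
    by (simp add: hecke_term_at_0 lat_def \<delta>_def algebra_simps)
  have "(?g has_sum hecke_diff \<delta> z 0) (Sigma UNIV (\<lambda>_. UNIV))"
    using s by (simp add: hecke_diff_def)
  from has_sum_SigmaD[OF this inner]
  have "((\<lambda>i. row_sum 2 0 ((of_real (real p / real N) + of_int i) * z + of_real (real q / real N))
        - row_sum 2 0 ((of_real (real 0 / real N) + of_int i) * z + of_real (real 0 / real N))) has_sum hecke_diff \<delta> z 0) UNIV" .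
  moreover have "((\<lambda>i. row_sum 2 0 ((of_real (real p / real N) + of_int i) * z + of_real (real q / real N))
        - row_sum 2 0 ((of_real (real 0 / real N) + of_int i) * z + of_real (real 0 / real N))) has_sum iter z N p q - iter z N 0 0) UNIV"
    unfolding iter_def by (intro has_sum_diff has_sum_infsum row_outer_summable z N) auto
  ultimately show ?thesis unfolding \<delta>_def by (rule has_sum_unique)
qed

text \<open>Clearing the denominator merges the cosets into one lattice: (p/N + i) z + q/N + j = (P
  z + Q) / N with P = p + N i and Q = q + N j, and the character depends only on residues. Since the
  order of summation matters, Q is summed within a fixed row first, then P.\<close>

lemma iter_sum:
  assumes z: "Im z > 0" and N: "N > 0" and x: "real N * x1 \<in> \<int>" "real N * x2 \<in> \<int>"
  shows "((\<lambda>P::int. ecis (- (of_int P * x2)) * row_sum 2 x1 (of_int P * z)) has_sum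
    (\<Sum>p<N. \<Sum>q<N. chi (x1, x2) p q * iter z N p q) / of_nat N ^ 2) UNIV"
proof -
  have r: "(\<Sum>q<N. chi (x1, x2) p q * row_sum 2 0 ((of_real (real p / real N) + of_int i) * z + of_real (real q / real N)))
     = of_nat N ^ 2 * (ecis (- (of_int (int p + int N * i) * x2)) * row_sum 2 x1 (of_int (int p + int N * i) * z))" for p i
  proof -
    define P where "P = int p + int N * i"
    have "((\<lambda>Q::int. of_nat N ^ 2 * (ecis (- (of_int P * x2)) * (ecis (of_int Q * x1) * inverse ((of_int P * z + of_int Q) ^ 2)))) has_sum
      (\<Sum>q<N. chi (x1, x2) p q * row_sum 2 0 ((of_real (real p / real N) + of_int i) * z + of_real (real q / real N)))) UNIV"
    proof (rule has_sum_residues[OF N])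
      fix q assume "q < N"
      have "((\<lambda>j::int. chi (x1, x2) p q * inverse (((of_real (real p / real N) + of_int i) * z + of_real (real q / real N) + of_int j) ^ 2)) has_sum
        chi (x1, x2) p q * row_sum 2 0 ((of_real (real p / real N) + of_int i) * z + of_real (real q / real N))) UNIV"
        using row_has_sum[of 2 0] by (intro has_sum_cmult_right) simp
      moreover have "chi (x1, x2) p q * inverse (((of_real (real p / real N) + of_int i) * z + of_real (real q / real N) + of_int j) ^ 2)
        = of_nat N ^ 2 * (ecis (- (of_int P * x2)) * (ecis (of_int (int q + int N * j) * x1) * inverse ((of_int P * z + of_int (int q + int N * j)) ^ 2)))" for j
      proof -
        have e: "(of_real (real p / real N) + of_int i) * z + of_real (real q / real N) + of_int j
           = (of_int P * z + of_int (int q + int N * j)) / of_nat N"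
          using N by (simp add: P_def field_simps)
        have "chi (x1, x2) p q = ecis (- (of_int P * x2)) * ecis (of_int (int q + int N * j) * x1)"
          unfolding ecis_residues[OF x, of q j p i, symmetric] P_def[symmetric] ecis_add[symmetric] by (simp add: algebra_simps)
        then show ?thesis unfolding e power_divide by (simp add: divide_inverse mult_ac)
      qed
      ultimately show "((\<lambda>j. of_nat N ^ 2 * (ecis (- (of_int P * x2)) * (ecis (of_int (int q + int N * j) * x1) * inverse ((of_int P * z + of_int (int q + int N * j)) ^ 2)))) has_sum
         chi (x1, x2) p q * row_sum 2 0 ((of_real (real p / real N) + of_int i) * z + of_real (real q / real N))) UNIV" by simp
    qed
    moreover have "((\<lambda>Q::int. of_nat N ^ 2 * (ecis (- (of_int P * x2)) * (ecis (of_int Q * x1) * inverse ((of_int P * z + of_int Q) ^ 2)))) has_sum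
      of_nat N ^ 2 * (ecis (- (of_int P * x2)) * row_sum 2 x1 (of_int P * z))) UNIV"
      by (intro has_sum_cmult_right row_has_sum) auto
    ultimately show ?thesis unfolding P_def by (rule has_sum_unique)
  qed
  have "((\<lambda>P::int. of_nat N ^ 2 * (ecis (- (of_int P * x2)) * row_sum 2 x1 (of_int P * z))) has_sum
    (\<Sum>p<N. \<Sum>q<N. chi (x1, x2) p q * iter z N p q)) UNIV"
  proof (rule has_sum_residues[OF N])
    fix p assume "p < N"
    have "((\<lambda>i. \<Sum>q<N. chi (x1, x2) p q * row_sum 2 0 ((of_real (real p / real N) + of_int i) * z + of_real (real q / real N))) has_sum
       (\<Sum>q<N. chi (x1, x2) p q * iter z N p q)) UNIV"
      unfolding iter_def
      by (intro has_sum_finite_sum has_sum_cmult_right has_sum_infsum row_outer_summable z N) auto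
    then show "((\<lambda>i. of_nat N ^ 2 * (ecis (- (of_int (int p + int N * i) * x2)) * row_sum 2 x1 (of_int (int p + int N * i) * z))) has_sum
      (\<Sum>q<N. chi (x1, x2) p q * iter z N p q)) UNIV" unfolding r .
  qed
  from has_sum_cmult_right[OF this, of "1 / of_nat N ^ 2"] show ?thesis using N by simp
qed

text \<open>The trivial character in \<open>iter_sum\<close>. It is the rescaling relation at s = 0
  and provides the zero that cancels the pole in \<open>hecke_sum_continuation\<close>.\<close>

lemma iter_total:
  assumes z: "Im z > 0" and N: "N > 0"
  shows "(\<Sum>p<N. \<Sum>q<N. iter z N p q) = of_nat N ^ 2 * iter z N 0 0"
proof -
  have "((\<lambda>P::int. row_sum 2 0 (of_int P * z)) has_sum (\<Sum>p<N. \<Sum>q<N. iter z N p q) / of_nat N ^ 2) UNIV"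
  proof -
    have chi: "chi (0, 0) p q = 1" for p q by (simp add: chi_ecis)
    have e: "ecis (- (of_int P * 0)) * w = w" for P :: int and w by simp
    have "real N * 0 \<in> \<int>" by simp
    from iter_sum[OF z N this this] show ?thesis unfolding chi e by (simp only: mult_1)
  qed
  moreover have "((\<lambda>P::int. row_sum 2 0 (of_int P * z)) has_sum iter z N 0 0) UNIV"
    using has_sum_infsum[OF row_outer_summable[OF z N, of "\<lambda>_. 0" 0]] by (simp add: iter_def)
  ultimately have "(\<Sum>p<N. \<Sum>q<N. iter z N p q) / of_nat N ^ 2 = iter z N 0 0" by (rule has_sum_unique)
  then show ?thesis using N by (simp add: field_simps)
qed

text \<open>The sum factors into two geometric sums, one of which runs over a nontrivial root of
  unity. It removes the part of the coset values that is common to all cosets.\<close>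

lemma sum_chi_eq_0:
  assumes x: "real N * x1 \<in> \<int>" "real N * x2 \<in> \<int>" and nz: "\<not> (x1 \<in> \<int> \<and> x2 \<in> \<int>)"
  shows "(\<Sum>p<N. \<Sum>q<N. chi (x1, x2) p q) = 0"
proof -
  have geo: "(\<Sum>q<N. ecis (real q * x)) = 0" if "real N * x \<in> \<int>" "x \<notin> \<int>" for x
  proof -
    have ne: "ecis x \<noteq> 1"
    proof
      assume "ecis x = 1"
      then have "cos (2 * pi * x) = 1" by (simp add: ecis_def complex_eq_iff)
      then obtain n :: int where "2 * pi * x = of_int n * 2 * pi" unfolding cos_one_2pi_int by blast
      then have "x = of_int n" by simp
      with that show False by simp
    qed
    have p: "ecis (real q * x) = ecis x ^ q" for q
      by (simp only: ecis_def Complex.DeMoivre mult_ac)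
    have "ecis x ^ N = 1" using p[of N] that by (simp add: ecis_Ints)
    then show ?thesis using geometric_sum[OF ne, of N] by (simp add: p)
  qed
  have "(\<Sum>p<N. \<Sum>q<N. chi (x1, x2) p q) = (\<Sum>p<N. ecis (real p * (- x2))) * (\<Sum>q<N. ecis (real q * x1))"
    unfolding sum_product by (intro sum.cong refl) (simp add: chi_ecis algebra_simps flip: ecis_add)
  moreover have "(\<Sum>p<N. ecis (real p * (- x2))) = 0 \<or> (\<Sum>q<N. ecis (real q * x1)) = 0"
  proof (cases "x1 \<in> \<int>")
    case True
    then have "- x2 \<notin> \<int>" "real N * (- x2) \<in> \<int>" using nz x by auto
    then show ?thesis using geo[of "- x2"] by blast
  next
    case False
    then show ?thesis using geo[of x1] x by blast
  qed
  ultimately show ?thesis by auto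
qed


section \<open>Continuation in weight 2 and the modular transformation of phi\<close>

definition hecke_sum :: "complex \<Rightarrow> complex \<Rightarrow> complex \<Rightarrow> complex" where
  "hecke_sum z \<delta> s = infsum (\<lambda>k. hecke_term s (lat z k + \<delta>)) UNIV"

abbreviation level_point :: "nat \<Rightarrow> complex \<Rightarrow> nat \<Rightarrow> nat \<Rightarrow> complex" where
  "level_point N z p q \<equiv> of_real (real p / real N) * z + of_real (real q / real N)"

lemma hecke_sum_coset:
  "infsum (\<lambda>k. inverse (lin k z ^ 2) * of_real (norm (lin k z)) powr (- s)) (coset (real p / real N, real q / real N))
    = hecke_sum z (level_point N z p q) s"
proof -
  have "infsum (\<lambda>k. hecke_term s (lin k z)) (coset (real p / real N, real q / real N)) =
    infsum (\<lambda>k :: int \<times> int. hecke_term s (lin (real p / real N + of_int (fst k), real q / real N + of_int (snd k)) z)) UNIV"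
    by (subst infsum_coset) (simp_all add: lin_def)
  moreover have "lin (real p / real N + of_int (fst k), real q / real N + of_int (snd k)) z = lat z k + level_point N z p q" for k
    by (simp add: lin_def lat_def algebra_simps)
  ultimately show ?thesis by (simp add: hecke_sum_def hecke_term_def)
qed

lemma hecke_sum_split:
  assumes "Im z > 0" "Re s > 0"
  shows "hecke_sum z \<delta> s = hecke_diff \<delta> z s + hecke_sum z 0 s"
proof -
  have "((\<lambda>k. (hecke_term s (lat z k + \<delta>) - hecke_term s (lat z k)) + hecke_term s (lat z k)) has_sum
      hecke_diff \<delta> z s + hecke_sum z 0 s) UNIV"
    unfolding hecke_diff_def hecke_sum_def add_0_right
    using hecke_diff_summable[of z s \<delta>] hecke_summable[of z s "\<lambda>_. 0"] assms
    by (intro has_sum_add has_sum_infsum) auto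
  then show ?thesis by (simp add: hecke_sum_def infsumI)
qed

lemma hecke_sum_chi:
  assumes z: "Im z > 0" and s: "Re s > 0" and N: "N > 0" and x: "real N * x1 \<in> \<int>" "real N * x2 \<in> \<int>"
  shows "(\<Sum>p<N. \<Sum>q<N. chi (x1, x2) p q * hecke_sum z (level_point N z p q) s) =
    of_nat N ^ 2 * of_nat N powr s *
      infsum (\<lambda>k. ecis (of_int (snd k) * x1 - of_int (fst k) * x2) * hecke_term s (lat z k)) UNIV"
proof -
  let ?g = "\<lambda>k. ecis (of_int (snd k) * x1 - of_int (fst k) * x2) * hecke_term s (lat z k)"
  have "of_nat N ^ 2 * of_nat N powr s * infsum (\<lambda>(i, j). ?g (int p + int N * i, int q + int N * j)) UNIV
    = chi (x1, x2) p q * hecke_sum z (level_point N z p q) s" for p q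
  proof -
    have "of_nat N ^ 2 * of_nat N powr s * ?g (int p + int N * i, int q + int N * j) =
        chi (x1, x2) p q * hecke_term s (lat z (i, j) + level_point N z p q)" for i j
      unfolding lat_residues[OF N] hecke_term_scale[OF N] fst_conv snd_conv ecis_residues[OF x]
      by (simp add: mult_ac)
    then have "(\<lambda>k. of_nat N ^ 2 * of_nat N powr s * (case k of (i, j) \<Rightarrow> ?g (int p + int N * i, int q + int N * j))) =
      (\<lambda>k. chi (x1, x2) p q * hecke_term s (lat z k + level_point N z p q))"
      by (auto simp only: fun_eq_iff split: prod.split)
    then show ?thesis unfolding hecke_sum_def infsum_cmult_right'[symmetric] by simp
  qed
  then have "(\<Sum>p<N. \<Sum>q<N. chi (x1, x2) p q * hecke_sum z (level_point N z p q) s) =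
    of_nat N ^ 2 * of_nat N powr s * (\<Sum>p<N. \<Sum>q<N. infsum (\<lambda>(i, j). ?g (int p + int N * i, int q + int N * j)) UNIV)"
    by (simp only: sum_distrib_left)
  also have "(\<Sum>p<N. \<Sum>q<N. infsum (\<lambda>(i, j). ?g (int p + int N * i, int q + int N * j)) UNIV) = infsum ?g UNIV"
    by (rule infsum_residues2[OF N hecke_summable[OF z s]])
  finally show ?thesis .
qed

text \<open>Summing over all cosets of \<open>\<int>\<^sup>2\<close> in \<open>(1/N)\<int>\<^sup>2\<close> rescales the sum over \<open>\<int>\<^sup>2\<close>. This gives a linear
  equation for the latter, and hence its continuation, in terms of the convergent \<open>hecke_diff\<close>.\<close>

lemma hecke_sum_0:
  assumes z: "Im z > 0" and s: "Re s > 0" and N: "N > 0"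
  shows "(\<Sum>p<N. \<Sum>q<N. hecke_diff (level_point N z p q) z s) = of_nat N ^ 2 * (of_nat N powr s - 1) * hecke_sum z 0 s"
proof -
  have "real N * 0 \<in> \<int>" by simp
  from hecke_sum_chi[OF z s N this this]
  have "(\<Sum>p<N. \<Sum>q<N. hecke_sum z (level_point N z p q) s) = of_nat N ^ 2 * of_nat N powr s * hecke_sum z 0 s"
    by (simp add: chi_ecis hecke_sum_def)
  then show ?thesis
    unfolding hecke_sum_split[OF z s, of "level_point N z _ _"]
    by (simp add: sum.distrib power2_eq_square algebra_simps)
qed

text \<open>By \<open>hecke_sum_0\<close>, T(s) = N^2 (N^s - 1) \<open>hecke_sum z 0 s\<close> with
  T holomorphic for Re s > -1/2. Dividing continues the sum past 0, because the simple zero of N^s -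
  1 is met by T(0) = 0.\<close>

lemma hecke_sum_continuation:
  fixes N :: nat
  assumes z: "Im z > 0" and N: "N \<ge> 2"
  obtains h U where "open U" "connected U" "{s. Re s > 0} \<subseteq> U" "0 \<in> U" "U \<subseteq> {s. Re s > - (1 / 2)}"
    "h holomorphic_on U" "\<And>s. Re s > 0 \<Longrightarrow> h s = hecke_sum z 0 s"
proof -
  \<comment> \<open>So small that N^s = 1 has only the solution s = 0 in the disc: |Im s| ln N < r N
    = 1/2, far below 2 pi.\<close>
  define r where "r = 1 / (2 * real N)"
  define U where "U = {s. Re s > 0} \<union> ball (0::complex) r"
  have r: "r > 0" "r \<le> 1 / 4" using N by (auto simp: r_def field_simps)
  have U: "open U" "0 \<in> U" unfolding U_def using r by (auto intro: open_Un open_halfspace_Re_gt)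
  have conn: "connected U" unfolding U_def
  proof (rule connected_Un)
    have "of_real (r / 2) \<in> {s. Re s > 0} \<inter> ball (0::complex) r" using r by auto
    then show "{s. Re s > 0} \<inter> ball (0::complex) r \<noteq> {}" by blast
  qed (auto intro: convex_connected convex_halfspace_Re_gt)
  have sub: "U \<subseteq> {s. Re s > - (1 / 2)}"
  proof
    fix s assume "s \<in> U"
    then show "s \<in> {s. Re s > - (1 / 2)}"
      using abs_Re_le_cmod[of s] r by (auto simp: U_def)
  qed
  define T where "T s = (\<Sum>p<N. \<Sum>q<N. hecke_diff (level_point N z p q) z s)" for s
  define P where "P s = (of_nat N :: complex) powr s" for s
  have P: "P s = exp (s * of_real (ln N))" for s using N by (simp add: P_def powr_def Ln_of_nat)
  have T0: "T 0 = 0"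
  proof -
    have N0: "N > 0" using N by simp
    have "T 0 = (\<Sum>p<N. \<Sum>q<N. iter z N p q) - of_nat N ^ 2 * iter z N 0 0"
      unfolding T_def hecke_diff_at_0[OF z N0] by (simp add: sum_subtractf power2_eq_square)
    then show ?thesis by (simp add: iter_total[OF z N0])
  qed
  have "T holomorphic_on U" unfolding T_def[abs_def]
    by (intro holomorphic_on_sum holomorphic_on_subset[OF hecke_diff_holomorphic[OF z] sub])
  from pole_lemma_open[OF this U(1), of 0]
  have A: "(\<lambda>s. if s = 0 then deriv T 0 else (T s - T 0) / (s - 0)) holomorphic_on U" (is "?A holomorphic_on U") .
  have "P holomorphic_on U" unfolding P[abs_def] by (intro holomorphic_intros)
  from pole_lemma_open[OF this U(1), of 0]
  have B: "(\<lambda>s. if s = 0 then deriv P 0 else (P s - P 0) / (s - 0)) holomorphic_on U" (is "?B holomorphic_on U") .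
  have P0: "P 0 = 1" by (simp add: P)
  have lnN: "ln (real N) > 0" using N by simp
  have dP: "deriv P 0 = of_real (ln N)"
    unfolding P[abs_def] by (rule DERIV_imp_deriv) (auto intro!: derivative_eq_intros)
  have P1: "P s \<noteq> 1" if s: "s \<in> U" "s \<noteq> 0" for s
  proof
    assume "P s = 1"
    then obtain n :: int where n: "Re s * ln N = 0" "Im s * ln N = of_int (2 * n) * pi"
      by (auto simp: P exp_eq_1)
    then have "Re s = 0" using lnN by simp
    with s have "s \<in> ball 0 r" by (auto simp: U_def)
    then have "\<bar>Im s\<bar> < r" using abs_Im_le_cmod[of s] by (auto simp: dist_norm)
    then have "\<bar>Im s * ln N\<bar> < r * ln N" using lnN by (simp add: abs_mult)
    also have "r * ln N \<le> r * N" using r N ln_le_minus_one[of "real N"] by (intro mult_left_mono) auto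
    also have "\<dots> = 1 / 2" using N by (simp add: r_def)
    finally have "\<bar>of_int (2 * n) * pi\<bar> < 1 / 2" using n by simp
    moreover have "\<bar>of_int (2 * n) * pi\<bar> = 2 * pi * \<bar>of_int n\<bar>" by (simp add: abs_mult)
    moreover have "n \<noteq> 0 \<Longrightarrow> 1 \<le> \<bar>real_of_int n\<bar>" by linarith
    moreover have "2 * pi * 1 \<le> 2 * pi * \<bar>real_of_int n\<bar>" if "1 \<le> \<bar>real_of_int n\<bar>"
      using that by (intro mult_left_mono) auto
    ultimately have "n = 0" using pi_gt3 by fastforce
    then have "Im s = 0" using n lnN by simp
    with \<open>Re s = 0\<close> s show False by (simp add: complex_eq_iff)
  qed
  have Bnz: "?B s \<noteq> 0" if "s \<in> U" for s
    using P1[OF that] lnN by (auto simp: dP P0)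
  \<comment> \<open>The difference quotients \<open>?A\<close> and \<open>?B\<close> have the common
    zero at 0 divided out; at 0 the new denominator is N^2 ln N.\<close>
  define h where "h s = ?A s / (of_nat N ^ 2 * ?B s)" for s
  have h: "h holomorphic_on U" unfolding h_def[abs_def]
    by (intro holomorphic_on_divide holomorphic_on_mult A B holomorphic_on_const) (use Bnz N in auto)
  have "h s = hecke_sum z 0 s" if s: "Re s > 0" for s
  proof -
    have s0: "s \<noteq> 0" "s \<in> U" using s by (auto simp: U_def)
    have "P s - 1 \<noteq> 0" using P1 s0 by auto
    moreover have "T s = of_nat N ^ 2 * (P s - 1) * hecke_sum z 0 s"
      unfolding T_def P_def using hecke_sum_0[OF z s, of N] N by simp
    ultimately show ?thesis using s0 N by (simp add: h_def T0 P0 field_simps)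
  qed
  then show ?thesis using that[OF U(1) conn _ U(2) sub h] by (auto simp: U_def)
qed

text \<open>The constant v is the continued value of the sum over Z^2 itself. It is never evaluated;
  what matters is that it does not depend on p and q.\<close>

lemma eisenstein_2:
  assumes z: "Im z > 0" and N: "N \<ge> 2"
  obtains v where "\<And>p q. eisenstein_G 2 (real p / real N, real q / real N) z = hecke_diff (level_point N z p q) z 0 + v"
    "\<And>p q. ((\<lambda>t::real. hecke_sum z (level_point N z p q) (of_real t)) \<longlongrightarrow>
        eisenstein_G 2 (real p / real N, real q / real N) z) (at_right 0)"
proof -
  obtain U h where U: "open U" "connected U" "{s. Re s > 0} \<subseteq> U" "0 \<in> U" "U \<subseteq> {s. Re s > - (1 / 2)}"
    "h holomorphic_on U" "\<And>s. Re s > 0 \<Longrightarrow> h s = hecke_sum z 0 s"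
    by (rule hecke_sum_continuation[OF z N]) (rule that, assumption+)
  have G: "eisenstein_G 2 (real p / real N, real q / real N) z = continuation_at_0 (\<lambda>s. hecke_sum z (level_point N z p q) s)" for p q
    by (simp add: eisenstein_G_def hecke_sum_coset)
  have hol: "(\<lambda>s. hecke_diff (level_point N z p q) z s + h s) holomorphic_on U" for p q
    by (rule holomorphic_on_add[OF holomorphic_on_subset[OF hecke_diff_holomorphic[OF z] U(5)] U(6)])
  have eq: "hecke_diff (level_point N z p q) z s + h s = hecke_sum z (level_point N z p q) s" if "Re s > 0" for s p q
    unfolding U(7)[OF that] by (rule hecke_sum_split[OF z that, symmetric])
  have 1: "eisenstein_G 2 (real p / real N, real q / real N) z = hecke_diff (level_point N z p q) z 0 + h 0" for p q
    unfolding G by (rule continuation_at_0_eq[OF U(1-4) hol eq])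
  have 2: "((\<lambda>t::real. hecke_sum z (level_point N z p q) (of_real t)) \<longlongrightarrow>
        eisenstein_G 2 (real p / real N, real q / real N) z) (at_right 0)" for p q
    unfolding 1 by (rule continuation_at_0_limit[OF U(1,4) hol eq])
  show ?thesis by (rule that[OF 1 2])
qed

text \<open>Two faces of weight 2: the iterated sum leads to the Fourier expansion, the regularised
  limit to the modular transformation. In the first, the unknown constant is killed by
  \<open>sum_chi_eq_0\<close>, which uses that x is not integral.\<close>

lemma phi_2_has_sum:
  assumes z: "Im z > 0" and N: "N > 0" and x: "real N * x1 \<in> \<int>" "real N * x2 \<in> \<int>"
    and nz: "\<not> (x1 \<in> \<int> \<and> x2 \<in> \<int>)"
  shows "((\<lambda>P::int. 1 / (2 * of_real pi * \<i>) ^ 2 * (ecis (- (of_int P * x2)) * row_sum 2 x1 (of_int P * z))) has_sum phi 2 N (x1, x2) z) UNIV"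
    "((\<lambda>t::real. 1 / (2 * of_real pi * \<i>) ^ 2 * infsum (\<lambda>k. ecis (of_int (snd k) * x1 - of_int (fst k) * x2) * hecke_term (of_real t) (lat z k)) UNIV)
       \<longlongrightarrow> phi 2 N (x1, x2) z) (at_right 0)"
proof -
  \<comment> \<open>For N = 1 both x1 and x2 would be integers; the continuation argument rests on a
    proper rescaling, N >= 2.\<close>
  have "N \<noteq> 1" using nz x by auto
  then have N2: "N \<ge> 2" using N by simp
  obtain v where v: "\<And>p q. eisenstein_G 2 (real p / real N, real q / real N) z = hecke_diff (level_point N z p q) z 0 + v"
    "\<And>p q. ((\<lambda>t::real. hecke_sum z (level_point N z p q) (of_real t)) \<longlongrightarrow>
        eisenstein_G 2 (real p / real N, real q / real N) z) (at_right 0)"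
    using eisenstein_2[OF z N2] by blast
  have phi: "phi 2 N (x1, x2) z = 1 / (2 * of_real pi * \<i>) ^ 2 / of_nat N ^ 2 *
     (\<Sum>p<N. \<Sum>q<N. chi (x1, x2) p q * eisenstein_G 2 (real p / real N, real q / real N) z)"
    by (simp add: phi_def power_mult_distrib)
  have "(\<Sum>p<N. \<Sum>q<N. chi (x1, x2) p q * eisenstein_G 2 (real p / real N, real q / real N) z)
    = (\<Sum>p<N. \<Sum>q<N. chi (x1, x2) p q * iter z N p q + chi (x1, x2) p q * (v - iter z N 0 0))"
    unfolding v(1) hecke_diff_at_0[OF z N] by (intro sum.cong refl) (simp add: algebra_simps)
  also have "\<dots> = (\<Sum>p<N. \<Sum>q<N. chi (x1, x2) p q * iter z N p q) + (\<Sum>p<N. \<Sum>q<N. chi (x1, x2) p q) * (v - iter z N 0 0)"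
    by (simp add: sum.distrib sum_distrib_right)
  also have "\<dots> = (\<Sum>p<N. \<Sum>q<N. chi (x1, x2) p q * iter z N p q)" by (simp add: sum_chi_eq_0[OF x nz])
  finally have e: "(\<Sum>p<N. \<Sum>q<N. chi (x1, x2) p q * eisenstein_G 2 (real p / real N, real q / real N) z)
     = (\<Sum>p<N. \<Sum>q<N. chi (x1, x2) p q * iter z N p q)" .
  show "((\<lambda>P::int. 1 / (2 * of_real pi * \<i>) ^ 2 * (ecis (- (of_int P * x2)) * row_sum 2 x1 (of_int P * z))) has_sum phi 2 N (x1, x2) z) UNIV"
    using has_sum_cmult_right[OF iter_sum[OF z N x], of "1 / (2 * of_real pi * \<i>) ^ 2"] unfolding phi e by simp
  have NP: "((\<lambda>t::real. of_nat N powr of_real t) \<longlongrightarrow> (1::complex)) (at_right 0)"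
  proof -
    have "((\<lambda>t::real. exp (complex_of_real t * of_real (ln N))) \<longlongrightarrow> exp (complex_of_real 0 * of_real (ln N))) (at_right 0)"
      by (intro tendsto_intros)
    then show ?thesis using N by (simp add: powr_def Ln_of_nat)
  qed
  have "((\<lambda>t::real. 1 / (2 * of_real pi * \<i>) ^ 2 / of_nat N ^ 2 / of_nat N powr of_real t *
     (\<Sum>p<N. \<Sum>q<N. chi (x1, x2) p q * hecke_sum z (level_point N z p q) (of_real t))) \<longlongrightarrow>
     1 / (2 * of_real pi * \<i>) ^ 2 / of_nat N ^ 2 / 1 *
     (\<Sum>p<N. \<Sum>q<N. chi (x1, x2) p q * eisenstein_G 2 (real p / real N, real q / real N) z)) (at_right 0)"
    using N by (intro tendsto_intros NP v(2)) auto
  moreover have "eventually (\<lambda>t::real. 1 / (2 * of_real pi * \<i>) ^ 2 / of_nat N ^ 2 / of_nat N powr of_real t *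
     (\<Sum>p<N. \<Sum>q<N. chi (x1, x2) p q * hecke_sum z (level_point N z p q) (of_real t)) =
     1 / (2 * of_real pi * \<i>) ^ 2 * infsum (\<lambda>k. ecis (of_int (snd k) * x1 - of_int (fst k) * x2) * hecke_term (of_real t) (lat z k)) UNIV) (at_right 0)"
    using eventually_at_right_less[of "0::real"]
  proof eventually_elim
    fix t :: real assume "t > 0"
    then have "Re (of_real t) > 0" by simp
    from hecke_sum_chi[OF z this N x] N
    show "1 / (2 * of_real pi * \<i>) ^ 2 / of_nat N ^ 2 / of_nat N powr of_real t *
     (\<Sum>p<N. \<Sum>q<N. chi (x1, x2) p q * hecke_sum z (level_point N z p q) (of_real t)) =
     1 / (2 * of_real pi * \<i>) ^ 2 * infsum (\<lambda>k. ecis (of_int (snd k) * x1 - of_int (fst k) * x2) * hecke_term (of_real t) (lat z k)) UNIV"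
      by simp
  qed
  ultimately have "((\<lambda>t::real. 1 / (2 * of_real pi * \<i>) ^ 2 * infsum (\<lambda>k. ecis (of_int (snd k) * x1 - of_int (fst k) * x2) * hecke_term (of_real t) (lat z k)) UNIV)
      \<longlongrightarrow> 1 / (2 * of_real pi * \<i>) ^ 2 / of_nat N ^ 2 / 1 *
     (\<Sum>p<N. \<Sum>q<N. chi (x1, x2) p q * eisenstein_G 2 (real p / real N, real q / real N) z)) (at_right 0)"
    by (rule Lim_transform_eventually)
  then show "((\<lambda>t::real. 1 / (2 * of_real pi * \<i>) ^ 2 * infsum (\<lambda>k. ecis (of_int (snd k) * x1 - of_int (fst k) * x2) * hecke_term (of_real t) (lat z k)) UNIV)
       \<longlongrightarrow> phi 2 N (x1, x2) z) (at_right 0)"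
    unfolding phi by simp
qed

lemma phi_lattice:
  assumes m: "m > 2" and z: "Im z > 0" and N: "N > 0" and x: "real N * x1 \<in> \<int>" "real N * x2 \<in> \<int>"
  shows "phi m N (x1, x2) z = fact (m - 1) / (2 * of_real pi * \<i>) ^ m *
    infsum (\<lambda>k. ecis (of_int (snd k) * x1 - of_int (fst k) * x2) * inverse (lat z k ^ m)) UNIV"
proof -
  let ?g = "\<lambda>k. ecis (of_int (snd k) * x1 - of_int (fst k) * x2) * inverse (lat z k ^ m)"
  have "of_nat N ^ m * infsum (\<lambda>(i, j). ?g (int p + int N * i, int q + int N * j)) UNIV
    = chi (x1, x2) p q * eisenstein_G m (real p / real N, real q / real N) z" for p q
  proof -
    have "eisenstein_G m (real p / real N, real q / real N) z =
      infsum (\<lambda>k :: int \<times> int. inverse (lin (real p / real N + of_int (fst k), real q / real N + of_int (snd k)) z ^ m)) UNIV"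
      using m by (simp add: eisenstein_G_def infsum_coset lin_def)
    also have "\<dots> = infsum (\<lambda>k. inverse ((lat z k + level_point N z p q) ^ m)) UNIV"
      by (intro infsum_cong) (simp add: lin_def lat_def algebra_simps)
    finally have G: "eisenstein_G m (real p / real N, real q / real N) z = infsum (\<lambda>k. inverse ((lat z k + level_point N z p q) ^ m)) UNIV" .
    have "of_nat N ^ m * ?g (int p + int N * i, int q + int N * j) =
        chi (x1, x2) p q * inverse ((lat z (i, j) + level_point N z p q) ^ m)" for i j
      unfolding lat_residues[OF N] fst_conv snd_conv ecis_residues[OF x] power_divide
      using N by (simp add: divide_inverse mult_ac)
    then have "(\<lambda>k. of_nat N ^ m * (case k of (i, j) \<Rightarrow> ?g (int p + int N * i, int q + int N * j))) =
      (\<lambda>k. chi (x1, x2) p q * inverse ((lat z k + level_point N z p q) ^ m))"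
      by (auto simp only: fun_eq_iff split: prod.split)
    then show ?thesis unfolding G infsum_cmult_right'[symmetric] by simp
  qed
  then have "(\<Sum>p<N. \<Sum>q<N. chi (x1, x2) p q * eisenstein_G m (real p / real N, real q / real N) z) =
    of_nat N ^ m * (\<Sum>p<N. \<Sum>q<N. infsum (\<lambda>(i, j). ?g (int p + int N * i, int q + int N * j)) UNIV)"
    by (simp only: sum_distrib_left)
  also have "(\<Sum>p<N. \<Sum>q<N. infsum (\<lambda>(i, j). ?g (int p + int N * i, int q + int N * j)) UNIV) = infsum ?g UNIV"
    by (rule infsum_residues2[OF N lat_inverse_summable[OF z m]])
  finally show ?thesis using N by (simp add: phi_def power_mult_distrib)
qed

theorem phi_has_sum:
  assumes m: "m \<ge> 2" and z: "Im z > 0" and N: "N > 0" and x: "real N * x1 \<in> \<int>" "real N * x2 \<in> \<int>"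
    and nz: "m = 2 \<Longrightarrow> \<not> (x1 \<in> \<int> \<and> x2 \<in> \<int>)"
  shows "((\<lambda>P::int. fact (m - 1) / (2 * of_real pi * \<i>) ^ m * (ecis (- (of_int P * x2)) * row_sum m x1 (of_int P * z))) has_sum phi m N (x1, x2) z) UNIV"
proof (cases "m = 2")
  case True
  then show ?thesis using phi_2_has_sum(1)[OF z N x nz] by simp
next
  case False
  then have m2: "m > 2" using m by simp
  let ?g = "\<lambda>k. ecis (of_int (snd k) * x1 - of_int (fst k) * x2) * inverse (lat z k ^ m)"
  have "(?g has_sum infsum ?g UNIV) (Sigma UNIV (\<lambda>_. UNIV))"
    using has_sum_infsum[OF lat_inverse_summable[OF z m2]] by simp
  moreover have "((\<lambda>Q. ?g (P, Q)) has_sum ecis (- (of_int P * x2)) * row_sum m x1 (of_int P * z)) UNIV" for P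
    using has_sum_cmult_right[OF row_has_sum[OF m, of x1 "of_int P * z"], of "ecis (- (of_int P * x2))"]
    by (simp add: lat_def mult.assoc[symmetric] ecis_add[symmetric])
  ultimately have "((\<lambda>P. ecis (- (of_int P * x2)) * row_sum m x1 (of_int P * z)) has_sum infsum ?g UNIV) UNIV"
    by (rule has_sum_SigmaD) 
  from has_sum_cmult_right[OF this] show ?thesis unfolding phi_lattice[OF m2 z N x] .
qed

text \<open>The matrix permutes Z^2, and along this permutation the linear form is multiplied by c z
  + d and the character at x becomes the one at x'. In weight 2 the permutation is carried out on
  the regularised sum for t > 0, before t tends to 0.\<close>

theorem phi_modular:
  fixes a b c d :: int
  assumes m: "m \<ge> 2" and z: "Im z > 0" and N: "N > 0" and x: "real N * x1 \<in> \<int>" "real N * x2 \<in> \<int>"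
    and nz: "m = 2 \<Longrightarrow> \<not> (x1 \<in> \<int> \<and> x2 \<in> \<int>)"
    and det: "a * d - b * c = 1"
  defines "w \<equiv> (of_int a * z + of_int b) / (of_int c * z + of_int d)"
    and "x1' \<equiv> of_int a * x1 + of_int c * x2" and "x2' \<equiv> of_int b * x1 + of_int d * x2"
  shows "Im w > 0" "real N * x1' \<in> \<int>" "real N * x2' \<in> \<int>" "m = 2 \<Longrightarrow> \<not> (x1' \<in> \<int> \<and> x2' \<in> \<int>)"
    "phi m N (x1, x2) w = (of_int c * z + of_int d) ^ m * phi m N (x1', x2') z"
proof -
  define j where "j = of_int c * z + of_int d"
  have "(c, d) \<noteq> (0, 0)" using det by auto
  then have j: "j \<noteq> 0" using lat_nonzero[OF z, of "(c, d)"] by (simp add: j_def lat_def)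
  have detr: "real_of_int a * real_of_int d - real_of_int b * real_of_int c = 1"
    using det by (metis of_int_1 of_int_diff of_int_mult)
  have "Im w = Im z * (real_of_int a * real_of_int d - real_of_int b * real_of_int c) / (norm j) ^ 2"
    unfolding w_def j_def[symmetric] by (simp add: Im_divide cmod_power2) (simp add: j_def algebra_simps)
  then show wim: "Im w > 0" using z j detr by simp
  have "real N * x1' = of_int a * (real N * x1) + of_int c * (real N * x2)"
    "real N * x2' = of_int b * (real N * x1) + of_int d * (real N * x2)" by (simp_all add: x1'_def x2'_def algebra_simps)
  then show x': "real N * x1' \<in> \<int>" "real N * x2' \<in> \<int>" 
    by (simp_all only:) (intro Ints_add Ints_mult Ints_of_int x)+
  show nz': "\<not> (x1' \<in> \<int> \<and> x2' \<in> \<int>)" if "m = 2"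
  proof
    assume i: "x1' \<in> \<int> \<and> x2' \<in> \<int>"
    have "of_int d * x1' - of_int c * x2' = (real_of_int a * real_of_int d - real_of_int b * real_of_int c) * x1"
      "of_int a * x2' - of_int b * x1' = (real_of_int a * real_of_int d - real_of_int b * real_of_int c) * x2"
      by (simp_all add: x1'_def x2'_def algebra_simps)
    moreover have "of_int d * x1' - of_int c * x2' \<in> \<int>" "of_int a * x2' - of_int b * x1' \<in> \<int>"
      using i by (auto intro!: Ints_diff Ints_mult)
    ultimately show False using nz[OF that] detr by simp
  qed
  define T where "T k = (fst k * a + snd k * c, fst k * b + snd k * d)" for k :: "int \<times> int"
  have bij: "bij T"
  proof (rule bijI')
    fix k l :: "int \<times> int"
    have inv: "fst k = d * fst (T k) - c * snd (T k)" "snd k = a * snd (T k) - b * fst (T k)" for k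
    proof -
      have "d * fst (T k) - c * snd (T k) = fst k * (a * d - b * c)" "a * snd (T k) - b * fst (T k) = snd k * (a * d - b * c)"
        by (simp_all add: T_def algebra_simps)
      then show "fst k = d * fst (T k) - c * snd (T k)" "snd k = a * snd (T k) - b * fst (T k)" using det by simp_all
    qed
    show "(T k = T l) = (k = l)" using inv by (metis prod_eqI)
    have "T (d * fst k - c * snd k, a * snd k - b * fst k) = (fst k * (a * d - b * c), snd k * (a * d - b * c))"
      by (simp add: T_def algebra_simps)
    then show "\<exists>l. k = T l" using det by (metis mult.right_neutral prod.collapse)
  qed
  have latT: "lat z (T k) = j * lat w k" for k
  proof -
    have "j * w = of_int a * z + of_int b" using j by (simp add: w_def j_def[symmetric])
    moreover have "j * lat w k = of_int (fst k) * (j * w) + of_int (snd k) * j"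
      by (simp add: lat_def algebra_simps)
    ultimately show ?thesis by (simp add: lat_def T_def j_def algebra_simps)
  qed
  have chT: "of_int (snd k) * x1 - of_int (fst k) * x2 =
      of_int (snd (T k)) * x1' - of_int (fst (T k)) * x2'" for k
  proof -
    have "of_int (snd (T k)) * x1' - of_int (fst (T k)) * x2' =
       (real_of_int a * real_of_int d - real_of_int b * real_of_int c) * (of_int (snd k) * x1 - of_int (fst k) * x2)"
      by (simp add: T_def x1'_def x2'_def algebra_simps)
    then show ?thesis using detr by simp
  qed
  have reindex: "infsum (\<lambda>k. ecis (of_int (snd k) * x1 - of_int (fst k) * x2) * G (j * lat w k)) UNIV =
     infsum (\<lambda>k. ecis (of_int (snd k) * x1' - of_int (fst k) * x2') * G (lat z k)) UNIV" for G
    unfolding chT latT[symmetric]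
    using infsum_reindex_bij_betw[OF bij, of "\<lambda>k. ecis (of_int (snd k) * x1' - of_int (fst k) * x2') * G (lat z k)"] .
  show "phi m N (x1, x2) w = (of_int c * z + of_int d) ^ m * phi m N (x1', x2') z"
  proof (cases "m = 2")
    case False
    then have m2: "m > 2" using m by simp
    have "infsum (\<lambda>k. ecis (of_int (snd k) * x1 - of_int (fst k) * x2) * inverse (lat w k ^ m)) UNIV =
      infsum (\<lambda>k. j ^ m * (ecis (of_int (snd k) * x1 - of_int (fst k) * x2) * inverse ((j * lat w k) ^ m))) UNIV"
      using j by (intro infsum_cong) (simp add: power_mult_distrib)
    also have "\<dots> = j ^ m * infsum (\<lambda>k. ecis (of_int (snd k) * x1' - of_int (fst k) * x2') * inverse (lat z k ^ m)) UNIV"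
      unfolding infsum_cmult_right' using reindex[of "\<lambda>u. inverse (u ^ m)"] by simp
    finally show ?thesis unfolding phi_lattice[OF m2 wim N x] phi_lattice[OF m2 z N x'] j_def[symmetric] by simp
  next
    case True
    \<comment> \<open>The regularised term is multiplicative, so the automorphy factor splits off as
      \<open>hecke_term\<close> at j, which tends to j^(-2).\<close>
    have mult: "hecke_term s (j * w) = hecke_term s j * hecke_term s w" for s w
      using j by (cases "w = 0") (simp_all add: hecke_term_exp norm_mult ln_mult power_mult_distrib exp_add[symmetric] algebra_simps)
    have hj: "((\<lambda>t::real. hecke_term (of_real t) j) \<longlongrightarrow> inverse (j ^ 2)) (at_right 0)"
    proof -
      have "((\<lambda>t::real. inverse (j ^ 2) * exp (- (complex_of_real t * of_real (ln (norm j))))) \<longlongrightarrow>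
          inverse (j ^ 2) * exp (- (complex_of_real 0 * of_real (ln (norm j))))) (at_right 0)"
        by (intro tendsto_intros)
      then show ?thesis using j by (simp add: hecke_term_exp)
    qed
    let ?C = "1 / (2 * of_real pi * \<i>) ^ 2 :: complex"
    have "((\<lambda>t::real. hecke_term (of_real t) j * (?C * infsum (\<lambda>k. ecis (of_int (snd k) * x1 - of_int (fst k) * x2) * hecke_term (of_real t) (lat w k)) UNIV))
       \<longlongrightarrow> inverse (j ^ 2) * phi 2 N (x1, x2) w) (at_right 0)"
      using True by (intro tendsto_mult hj phi_2_has_sum(2)[OF wim N x nz])
    moreover have "hecke_term s j * (?C * infsum (\<lambda>k. ecis (of_int (snd k) * x1 - of_int (fst k) * x2) * hecke_term s (lat w k)) UNIV)
       = ?C * infsum (\<lambda>k. ecis (of_int (snd k) * x1' - of_int (fst k) * x2') * hecke_term s (lat z k)) UNIV" for s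
    proof -
      have "hecke_term s j * infsum (\<lambda>k. ecis (of_int (snd k) * x1 - of_int (fst k) * x2) * hecke_term s (lat w k)) UNIV =
         infsum (\<lambda>k. ecis (of_int (snd k) * x1 - of_int (fst k) * x2) * hecke_term s (j * lat w k)) UNIV"
        unfolding infsum_cmult_right'[symmetric] mult by (simp add: mult_ac)
      then show ?thesis unfolding reindex[of "hecke_term s"] by (simp add: mult.left_commute)
    qed
    ultimately have "((\<lambda>t::real. ?C * infsum (\<lambda>k. ecis (of_int (snd k) * x1' - of_int (fst k) * x2') * hecke_term (of_real t) (lat z k)) UNIV)
       \<longlongrightarrow> inverse (j ^ 2) * phi 2 N (x1, x2) w) (at_right 0)" by simp
    moreover have "((\<lambda>t::real. ?C * infsum (\<lambda>k. ecis (of_int (snd k) * x1' - of_int (fst k) * x2') * hecke_term (of_real t) (lat z k)) UNIV)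
       \<longlongrightarrow> phi 2 N (x1', x2') z) (at_right 0)"
      using nz' True by (intro phi_2_has_sum(2)[OF z N x']) auto
    ultimately have "inverse (j ^ 2) * phi 2 N (x1, x2) w = phi 2 N (x1', x2') z"
      by (rule tendsto_unique[rotated]) simp
    then show ?thesis using True j unfolding j_def[symmetric] by (auto simp: field_simps)
  qed
qed


section \<open>Fourier expansions of modular forms\<close>

definition eis_const :: "nat \<Rightarrow> real \<Rightarrow> complex" where
  "eis_const m x = of_real (- (periodic_bernoulli m x / real m))"

text \<open>In the row through the origin the term q = 0 is the inverse of 0, hence 0, which is just
  the omission of the origin; the rest is the Fourier series of a periodic Bernoulli
  function.\<close>

lemma row_sum_0:
  assumes "m \<ge> 2"
  shows "fact (m - 1) / (2 * of_real pi * \<i>) ^ m * row_sum m x 0 = eis_const m x"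
proof -
  have "((\<lambda>q. (- fact m / (2 * of_real pi * \<i>) ^ m) * (ecis (of_int q * x) * inverse ((0 + of_int q) ^ m)))
     has_sum of_real (periodic_bernoulli m x)) UNIV"
  proof (rule has_sum_cong[THEN iffD1, OF _ periodic_bernoulli_fourier[OF assms, of x]])
    fix q :: int
    show "(if q = 0 then 0 else - fact m / (2 * complex_of_real pi * \<i> * of_int q) ^ m) * ecis (of_int q * x) =
       (- fact m / (2 * of_real pi * \<i>) ^ m) * (ecis (of_int q * x) * inverse ((0 + of_int q) ^ m))"
      using assms by (cases "q = 0") (simp_all add: power_mult_distrib divide_inverse mult_ac)
  qed
  moreover have "((\<lambda>q. (- fact m / (2 * of_real pi * \<i>) ^ m) * (ecis (of_int q * x) * inverse ((0 + of_int q) ^ m)))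
     has_sum (- fact m / (2 * of_real pi * \<i>) ^ m) * row_sum m x 0) UNIV"
    by (intro has_sum_cmult_right row_has_sum assms)
  ultimately have e: "of_real (periodic_bernoulli m x) = (- fact m / (2 * of_real pi * \<i>) ^ m) * row_sum m x 0"
    by (rule has_sum_unique)
  have f: "fact m = of_nat m * (fact (m - 1) :: complex)" using assms fact_reduce[of m] by simp
  have "of_nat m * (fact (m - 1) / (2 * of_real pi * \<i>) ^ m * row_sum m x 0) = - of_real (periodic_bernoulli m x)"
    unfolding e f by simp
  then show ?thesis using assms by (simp add: eis_const_def field_simps)
qed

definition eis_term :: "nat \<Rightarrow> real \<Rightarrow> real \<Rightarrow> complex \<Rightarrow> nat \<Rightarrow> complex" where
  "eis_term k x w z p = ecis (real p * w) * coset_sum k x (- (2 * of_real pi * \<i> * of_nat p * z))"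

text \<open>Rows P > 0 come from the Lipschitz formula, rows P < 0 are reflected to positive ones,
  and row 0 is the constant. The normalising factor of \<open>phi\<close> cancels the constant of
  the Lipschitz formula; evenness of m settles both signs.\<close>

lemma phi_expansion:
  assumes m: "m \<ge> 2" "even m" and z: "Im z > 0" and N: "N > 0" and x: "real N * x1 \<in> \<int>" "real N * x2 \<in> \<int>"
    and nz: "m = 2 \<Longrightarrow> \<not> (x1 \<in> \<int> \<and> x2 \<in> \<int>)"
  shows "((\<lambda>p. eis_term (m - 1) (- x1) (- x2) z p + eis_term (m - 1) x1 x2 z p) has_sum
    phi m N (x1, x2) z - eis_const m x1) {1..}"
proof -
  define C where "C = fact (m - 1) / (2 * of_real pi * \<i>) ^ m"
  define f where "f P = C * (ecis (- (of_int P * x2)) * row_sum m x1 (of_int P * z))" for P :: int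
  have f: "(f has_sum phi m N (x1, x2) z) UNIV"
    unfolding f_def C_def by (rule phi_has_sum[OF m(1) z N x nz])
  have f0: "f 0 = eis_const m x1"
    using row_sum_0[OF m(1), of x1] by (simp add: f_def C_def)
  have Cm: "C * ((- (2 * of_real pi * \<i>)) ^ m / fact (m - 1) * u) = u" for u
    using m by (simp add: C_def)
  have pz: "Im (of_nat p * z) > 0" if "p \<ge> 1" for p using that z by simp
  have fp: "f (int p) = eis_term (m - 1) (- x1) (- x2) z p" if "p \<ge> 1" for p
  proof -
    have "f (int p) = ecis (- (real p * x2)) * (C * row_sum m x1 (of_nat p * z))" by (simp add: f_def)
    then show ?thesis unfolding row_lipschitz[OF pz[OF that] m(1)] Cm by (simp add: eis_term_def mult.assoc)
  qed
  have fn: "f (- int p) = eis_term (m - 1) x1 x2 z p" if "p \<ge> 1" for p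
  proof -
    have "f (- int p) = ecis (real p * x2) * (C * row_sum m (- x1) (of_nat p * z))"
      using row_minus[OF m(1), of x1 "of_nat p * z"] m(2) by (simp add: f_def)
    then show ?thesis unfolding row_lipschitz[OF pz[OF that] m(1)] Cm by (simp add: eis_term_def mult.assoc)
  qed
  have inj: "inj_on int {1..}" "inj_on (\<lambda>p. - int p) {1..}" by (auto simp: inj_on_def)
  have sf: "f summable_on A" for A
    using has_sum_imp_summable[OF f] summable_on_subset_banach by blast
  define A where "A = infsum f (int ` {1..})"
  define B where "B = infsum f ((\<lambda>p. - int p) ` {1..})"
  have A: "(f has_sum A) (int ` {1..})" and B: "(f has_sum B) ((\<lambda>p. - int p) ` {1..})"
    unfolding A_def B_def by (intro has_sum_infsum sf)+
  have "(f has_sum (A + B)) (int ` {1..} \<union> (\<lambda>p. - int p) ` {1..})"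
    by (rule has_sum_Un_disjoint[OF A B]) auto
  moreover have "int ` {1..} \<union> (\<lambda>p. - int p) ` {1..} = UNIV - {0}"
  proof (intro equalityI subsetI)
    fix P :: int assume "P \<in> UNIV - {0}"
    then have "P = int (nat P) \<and> nat P \<ge> 1 \<or> P = - int (nat (- P)) \<and> nat (- P) \<ge> 1" by auto
    then show "P \<in> int ` {1..} \<union> (\<lambda>p. - int p) ` {1..}" by blast
  qed auto
  moreover have "(f has_sum (phi m N (x1, x2) z - f 0)) (UNIV - {0})"
    using has_sum_Diff[OF f has_sum_finite[of "{0}" f]] by simp
  ultimately have AB: "A + B = phi m N (x1, x2) z - eis_const m x1"
    using has_sum_unique f0 by metis
  have "((\<lambda>p. f (int p)) has_sum A) {1..}" using A has_sum_reindex[OF inj(1), of f A] by (simp add: o_def)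
  then have 1: "((\<lambda>p. eis_term (m - 1) (- x1) (- x2) z p) has_sum A) {1..}"
    by (rule has_sum_cong[THEN iffD1, rotated]) (use fp in auto)
  have "((\<lambda>p. f (- int p)) has_sum B) {1..}" using B has_sum_reindex[OF inj(2), of f B] by (simp add: o_def)
  then have 2: "((\<lambda>p. eis_term (m - 1) x1 x2 z p) has_sum B) {1..}"
    by (rule has_sum_cong[THEN iffD1, rotated]) (use fn in auto)
  from has_sum_add[OF 1 2] AB show ?thesis by simp
qed

section \<open>q-expansions of the Eisenstein series\<close>

definition q_expansion :: "nat \<Rightarrow> (nat \<Rightarrow> complex) \<Rightarrow> (complex \<Rightarrow> complex) \<Rightarrow> bool" where
  "q_expansion N a f \<longleftrightarrow> N > 0 \<and>
     (\<forall>z. Im z > 0 \<longrightarrow> (\<lambda>j. a j * exp (2 * of_real pi * \<i> * of_nat j * z / of_nat N)) sums f z)"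

definition divisor_pairs :: "nat \<Rightarrow> (nat \<times> nat) set" where
  "divisor_pairs j = {(p, r). p \<ge> 1 \<and> r \<ge> 1 \<and> p * r = j}"

lemma finite_divisor_pairs: "finite (divisor_pairs j)"
proof -
  have "divisor_pairs j \<subseteq> {..j} \<times> {..j}" by (auto simp: divisor_pairs_def)
  then show ?thesis by (rule finite_subset) auto
qed

lemma has_sum_divisor_pairs:
  fixes f :: "nat \<times> nat \<Rightarrow> complex"
  assumes "(f has_sum S) ({1..} \<times> {1..})"
  shows "((\<lambda>j. \<Sum>k\<in>divisor_pairs j. f k) has_sum S) {1..}"
proof -
  have bij: "bij_betw snd (Sigma {1..} divisor_pairs) ({1..} \<times> {1..})"
  proof (rule bij_betw_imageI)
    show "inj_on snd (Sigma {1..} divisor_pairs)" by (auto simp: inj_on_def divisor_pairs_def)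
    show "snd ` Sigma {1..} divisor_pairs = {1..} \<times> {1..}"
    proof (intro equalityI subsetI)
      fix k :: "nat \<times> nat" assume "k \<in> {1..} \<times> {1..}"
      then have "(fst k * snd k, k) \<in> Sigma {1..} divisor_pairs" by (cases k) (auto simp: divisor_pairs_def)
      then show "k \<in> snd ` Sigma {1..} divisor_pairs" by (metis image_eqI snd_conv)
    qed (auto simp: divisor_pairs_def)
  qed
  have "((\<lambda>k. f (snd k)) has_sum S) (Sigma {1..} divisor_pairs)"
    using has_sum_reindex_bij_betw[OF bij, of f S] assms by simp
  then show ?thesis
    by (rule has_sum_SigmaD) (auto intro: has_sum_finite finite_divisor_pairs)
qed

text \<open>A double series over p and the elements R / N of the coset, whose exponent depends only
  on j = p R. Absolute convergence permits collecting equal j, which gives the familiar divisor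
  sums.\<close>

lemma eis_term_q_expansion:
  assumes N: "N > 0" and x: "real N * x \<in> \<int>" 
  obtains c where "\<And>z. Im z > 0 \<Longrightarrow> ((\<lambda>j. c j * exp (2 * of_real pi * \<i> * of_nat j * z / of_nat N)) has_sum
     infsum (eis_term k x w z) {1..}) {1..}" "\<And>z. Im z > 0 \<Longrightarrow> eis_term k x w z summable_on {1..}"
proof -
  \<comment> \<open>Since N x is an integer, the coset lies in (1/N) Z, so
    \<open>pos_coset x\<close> can be indexed by positive integers R, with weight 0 off the
    coset.\<close>
  define b where "b R = (if real R / real N - x \<in> \<int> then of_real ((real R / real N) ^ k) else (0::complex))" for R :: nat
  define c where "c j = (\<Sum>(p, R)\<in>divisor_pairs j. ecis (real p * w) * b R)" for j
  have 1: "((\<lambda>R. b R * exp (- (of_real (real R / real N) * X))) has_sum coset_sum k x X) {1..}"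
    "(\<lambda>R. norm (b R * exp (- (of_real (real R / real N) * X)))) summable_on {1..}" if X: "Re X > 0" for X
  proof -
    let ?S = "{R::nat. R \<ge> 1 \<and> real R / real N - x \<in> \<int>}"
    have bij: "bij_betw (\<lambda>R. real R / real N) ?S (pos_coset x)"
    proof (rule bij_betw_imageI)
      show "inj_on (\<lambda>R. real R / real N) ?S" using N by (auto simp: inj_on_def)
      show "(\<lambda>R. real R / real N) ` ?S = pos_coset x"
      proof (intro equalityI subsetI)
        fix r assume r: "r \<in> pos_coset x"
        then have "real N * (r - x) \<in> \<int>" by (auto simp: pos_coset_def)
        then have "real N * (r - x) + real N * x \<in> \<int>" using x by (rule Ints_add)
        then obtain i where i: "real N * r = of_int i" by (auto simp: algebra_simps elim: Ints_cases)
        have "real N * r > 0" using r N by (simp add: pos_coset_def)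
        then have ipos: "i > 0" using i by simp
        then have "r = real (nat i) / real N" using i N by (simp add: field_simps)
        moreover have "nat i \<ge> 1" using ipos by linarith
        ultimately show "r \<in> (\<lambda>R. real R / real N) ` ?S"
          using r by (intro image_eqI[of _ _ "nat i"]) (auto simp: pos_coset_def)
      qed (use N in \<open>auto simp: pos_coset_def\<close>)
    qed
    have "((\<lambda>R. of_real (real R / real N) ^ k * exp (- (of_real (real R / real N) * X))) has_sum coset_sum k x X) ?S"
      using has_sum_reindex_bij_betw[OF bij, of "\<lambda>r. of_real r ^ k * exp (- (of_real r * X))"] coset_sum_has_sum(1)[OF X, of k x]
      by blast
    then show "((\<lambda>R. b R * exp (- (of_real (real R / real N) * X))) has_sum coset_sum k x X) {1..}"
      by (rule has_sum_cong_neutral[THEN iffD1, rotated -1]) (auto simp: b_def)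
    have "(\<lambda>R. norm (of_real (real R / real N) ^ k * exp (- (of_real (real R / real N) * X)))) summable_on ?S"
      using summable_on_reindex_bij_betw[OF bij, of "\<lambda>r. norm (of_real r ^ k * exp (- (of_real r * X)))"] coset_sum_has_sum(2)[OF X, of k x]
      by blast
    then show "(\<lambda>R. norm (b R * exp (- (of_real (real R / real N) * X)))) summable_on {1..}"
      by (rule summable_on_cong_neutral[THEN iffD1, rotated -1]) (auto simp: b_def)
  qed
  have main: "((\<lambda>j. c j * exp (2 * of_real pi * \<i> * of_nat j * z / of_nat N)) has_sum
     infsum (eis_term k x w z) {1..}) {1..} \<and> eis_term k x w z summable_on {1..}" if z: "Im z > 0" for z
  proof -
    define X where "X p = - (2 * of_real pi * \<i> * of_nat p * z)" for p :: nat
    define t where "t = 2 * pi * Im z"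
    have t: "t > 0" using z by (simp add: t_def)
    have ReX: "Re (X p) = real p * t" for p by (simp add: X_def t_def)
    have X: "Re (X p) > 0" if "p \<ge> 1" for p using that t by (simp add: ReX)
    define f where "f k = ecis (real (fst k) * w) * (b (snd k) * exp (- (of_real (real (snd k) / real N) * X (fst k))))" for k :: "nat \<times> nat"
    have inner: "((\<lambda>R. f (p, R)) has_sum eis_term k x w z p) {1..}" if "p \<ge> 1" for p
      unfolding f_def eis_term_def fst_conv snd_conv X_def[symmetric]
      by (intro has_sum_cmult_right 1 X that)
    \<comment> \<open>The weights \<open>b R\<close> are nonnegative, so the norms are the terms at
      the real argument p t; summability over R, then over p, reduces to the decay of
      \<open>coset_sum\<close> on the real axis.\<close>
    have nf: "norm (f (p, R)) = Re (b R * exp (- (of_real (real R / real N) * complex_of_real (real p * t))))" 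
      "0 \<le> Re (b R * exp (- (of_real (real R / real N) * complex_of_real (real p * t))))" for p R
    proof -
      have "norm (exp (- (of_real (real R / real N) * X p))) = exp (- (real R / real N * (real p * t)))"
        by (simp add: norm_exp_eq_Re ReX)
      moreover have "exp (- (of_real (real R / real N) * complex_of_real (real p * t))) = of_real (exp (- (real R / real N * (real p * t))))"
        by (simp flip: exp_of_real)
      ultimately show "norm (f (p, R)) = Re (b R * exp (- (of_real (real R / real N) * complex_of_real (real p * t))))" 
      "0 \<le> Re (b R * exp (- (of_real (real R / real N) * complex_of_real (real p * t))))"
        by (auto simp: f_def norm_mult b_def norm_power norm_divide)
    qed
    have nsum: "((\<lambda>R. norm (f (p, R))) has_sum Re (coset_sum k x (of_real (real p * t)))) {1..}" if "p \<ge> 1" for p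
      unfolding nf(1) using that t by (intro has_sum_Re 1) auto
    obtain C where C: "\<And>X. Re X \<ge> t \<Longrightarrow> norm (coset_sum k x X) \<le> C * exp (- (coset_rep x * Re X))"
      using coset_sum_decay[OF t] by blast
    have bnd: "Re (coset_sum k x (of_real (real p * t))) \<le> \<bar>C\<bar> * exp (- (coset_rep x * t)) ^ p" if "p \<ge> 1" for p
    proof -
      have "1 * t \<le> real p * t" using that t by (intro mult_right_mono) auto
      then have "norm (coset_sum k x (of_real (real p * t))) \<le> C * exp (- (coset_rep x * (real p * t)))"
        using C[of "of_real (real p * t)"] by simp
      also have "\<dots> \<le> \<bar>C\<bar> * exp (- (coset_rep x * (real p * t)))" by (intro mult_right_mono) auto
      also have "exp (- (coset_rep x * (real p * t))) = exp (- (coset_rep x * t)) ^ p"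
        by (simp add: exp_of_nat_mult[symmetric] mult_ac)
      finally show ?thesis using complex_Re_le_cmod order_trans by blast
    qed
    have "summable (\<lambda>p. exp (- (coset_rep x * t)) ^ p)"
      using t coset_rep(1)[of x] by (intro summable_geometric) auto
    then have "(\<lambda>p. exp (- (coset_rep x * t)) ^ p) summable_on UNIV"
      by (intro norm_summable_imp_summable_on) simp
    then have geo: "(\<lambda>p. \<bar>C\<bar> * exp (- (coset_rep x * t)) ^ p) summable_on {1..}"
      by (intro summable_on_cmult_right) (rule summable_on_subset_banach, auto)
    have inf: "infsum (\<lambda>R. norm (f (p, R))) {1..} = Re (coset_sum k x (of_real (real p * t)))" if "p \<ge> 1" for p
      using nsum[OF that] by (rule infsumI)
    have nn: "0 \<le> Re (coset_sum k x (of_real (real p * t)))" if "p \<ge> 1" for p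
      using infsum_nonneg[of "{1..}" "\<lambda>R. norm (f (p, R))"] inf[OF that] by simp
    have "(\<lambda>k. norm (f k)) summable_on Sigma {1..} (\<lambda>_. {1..})"
      unfolding Infinite_Sum.abs_summable_on_Sigma_iff
    proof (intro conjI ballI)
      show "(\<lambda>y. norm (f (p, y))) summable_on {1..}" if "p \<in> {1..}" for p
        using nsum[of p] that has_sum_imp_summable by auto
      have "(\<lambda>p. Re (coset_sum k x (of_real (real p * t)))) summable_on {1..}"
        by (rule summable_on_comparison_test[OF geo]) (use bnd nn in auto)
      moreover have "(\<lambda>p. norm (infsum (\<lambda>y. norm (f (p, y))) {1..})) summable_on {1..} \<longleftrightarrow>
          (\<lambda>p. Re (coset_sum k x (of_real (real p * t)))) summable_on {1..}"
        by (rule summable_on_cong) (use inf nn in auto)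
      ultimately show "(\<lambda>p. norm (infsum (\<lambda>y. norm (f (p, y))) {1..})) summable_on {1..}" by simp
    qed
    then have fs: "f summable_on Sigma {1..} (\<lambda>_. {1..})" by (rule abs_summable_summable)
    then have fS: "(f has_sum infsum f (Sigma {1..} (\<lambda>_. {1..}))) (Sigma {1..} (\<lambda>_. {1..}))" by (rule has_sum_infsum)
    have e: "(eis_term k x w z has_sum infsum f (Sigma {1..} (\<lambda>_. {1..}))) {1..}"
      by (rule has_sum_SigmaD[OF fS]) (use inner in auto)
    then have e2: "infsum (eis_term k x w z) {1..} = infsum f (Sigma {1..} (\<lambda>_. {1..}))" by (rule infsumI)
    have "((\<lambda>j. \<Sum>k\<in>divisor_pairs j. f k) has_sum infsum f (Sigma {1..} (\<lambda>_. {1..}))) {1..}"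
      by (rule has_sum_divisor_pairs[OF fS])
    moreover have "(\<Sum>k\<in>divisor_pairs j. f k) = c j * exp (2 * of_real pi * \<i> * of_nat j * z / of_nat N)" for j
      unfolding c_def sum_distrib_right
    proof (intro sum.cong refl)
      fix k assume "k \<in> divisor_pairs j"
      then have j: "of_nat j = (of_nat (fst k) * of_nat (snd k) :: complex)" by (auto simp: divisor_pairs_def)
      have "exp (- (of_real (real (snd k) / real N) * X (fst k))) = exp (2 * of_real pi * \<i> * of_nat j * z / of_nat N)"
        by (simp add: X_def j mult_ac)
      then show "f k = (case k of (p, R) \<Rightarrow> ecis (real p * w) * b R) * exp (2 * of_real pi * \<i> * of_nat j * z / of_nat N)"
        by (simp add: f_def case_prod_unfold)
    qed
    ultimately show ?thesis using e e2 has_sum_imp_summable by auto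
  qed
  show ?thesis using that[of c] main by blast
qed

theorem phi_q_expansion:
  assumes m: "m \<ge> 2" "even m" and N: "N > 0" and x: "real N * x1 \<in> \<int>" "real N * x2 \<in> \<int>"
    and nz: "m = 2 \<Longrightarrow> \<not> (x1 \<in> \<int> \<and> x2 \<in> \<int>)"
  obtains a where "q_expansion N a (phi m N (x1, x2))" "a 0 = eis_const m x1"
proof -
  have "real N * (- x1) \<in> \<int>" using x by simp
  from eis_term_q_expansion[OF N this, of "m - 1" "- x2"] obtain c1 where
    c1: "\<And>z. Im z > 0 \<Longrightarrow> ((\<lambda>j. c1 j * exp (2 * of_real pi * \<i> * of_nat j * z / of_nat N)) has_sum
     infsum (eis_term (m - 1) (- x1) (- x2) z) {1..}) {1..}" "\<And>z. Im z > 0 \<Longrightarrow> eis_term (m - 1) (- x1) (- x2) z summable_on {1..}"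
    by blast
  from eis_term_q_expansion[OF N x(1), of "m - 1" x2] obtain c2 where
    c2: "\<And>z. Im z > 0 \<Longrightarrow> ((\<lambda>j. c2 j * exp (2 * of_real pi * \<i> * of_nat j * z / of_nat N)) has_sum
     infsum (eis_term (m - 1) x1 x2 z) {1..}) {1..}" "\<And>z. Im z > 0 \<Longrightarrow> eis_term (m - 1) x1 x2 z summable_on {1..}"
    by blast
  define a where "a j = (if j = 0 then eis_const m x1 else c1 j + c2 j)" for j
  have "(\<lambda>j. a j * exp (2 * of_real pi * \<i> * of_nat j * z / of_nat N)) sums phi m N (x1, x2) z" if z: "Im z > 0" for z
  proof -
    let ?e = "\<lambda>j. exp (2 * of_real pi * \<i> * of_nat j * z / of_nat N)"
    have "phi m N (x1, x2) z - eis_const m x1 = infsum (eis_term (m - 1) (- x1) (- x2) z) {1..} + infsum (eis_term (m - 1) x1 x2 z) {1..}"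
      using infsumI[OF phi_expansion[OF m z N x nz]] infsum_add[OF c1(2)[OF z] c2(2)[OF z]] by simp
    then have "((\<lambda>j. c1 j * ?e j + c2 j * ?e j) has_sum phi m N (x1, x2) z - eis_const m x1) {1..}"
      using has_sum_add[OF c1(1)[OF z] c2(1)[OF z]] by simp
    then have "((\<lambda>j. a j * ?e j) has_sum phi m N (x1, x2) z - eis_const m x1) {1..}"
      by (rule has_sum_cong[THEN iffD1, rotated]) (auto simp: a_def algebra_simps)
    from has_sum_Un_disjoint[OF has_sum_finite[of "{0}"] this]
    have "((\<lambda>j. a j * ?e j) has_sum phi m N (x1, x2) z) ({0} \<union> {1..})" by (simp add: a_def)
    moreover have "{0} \<union> {1..} = (UNIV :: nat set)" by auto
    ultimately show ?thesis by (simp add: has_sum_imp_sums)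
  qed
  then have "q_expansion N a (phi m N (x1, x2))" using N by (simp add: q_expansion_def)
  then show ?thesis using that[of a] by (simp add: a_def)
qed


section \<open>Decay at the cusp and primitives normalised there\<close>

abbreviation upper_half :: "complex set" where
  "upper_half \<equiv> {z. Im z > 0}"

lemma open_upper_half: "open upper_half"
  by (rule open_halfspace_Im_gt)

lemma convex_upper_half: "convex upper_half"
  by (rule convex_halfspace_Im_gt)

text \<open>Convergence on the half plane is convergence of the power series on the punctured unit
  disc, since q = exp(2 pi i z / N) is onto. The uniqueness and decay statements become local facts
  at q = 0.\<close>

lemma q_expansion_disc:
  assumes "q_expansion N a f"
  obtains P where "P holomorphic_on ball 0 1" "P 0 = a 0"
    "\<And>z. Im z > 0 \<Longrightarrow> f z = P (exp (2 * of_real pi * \<i> * z / of_nat N))"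
proof -
  have N: "N > 0" and s: "\<And>z. Im z > 0 \<Longrightarrow> (\<lambda>j. a j * exp (2 * of_real pi * \<i> * of_nat j * z / of_nat N)) sums f z"
    using assms by (auto simp: q_expansion_def)
  have pw: "exp (2 * of_real pi * \<i> * of_nat j * z / of_nat N) = exp (2 * of_real pi * \<i> * z / of_nat N) ^ j" for j z
    by (simp add: exp_of_nat_mult[symmetric] mult_ac)
  define P where "P w = suminf (\<lambda>j. a j * w ^ j)" for w
  have P: "(\<lambda>j. a j * w ^ j) sums P w" if "norm w < 1" for w
  proof (cases "w = 0")
    case True
    then show ?thesis using powser_sums_zero[of a] by (simp add: P_def sums_iff)
  next
    case False
    \<comment> \<open>A preimage of w under q; its imaginary part -N ln |w| / (2 pi) is positive as
      |w| < 1.\<close>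
    define z where "z = of_nat N * Ln w / (2 * of_real pi * \<i>)"
    have "Im z = - real N * ln (norm w) / (2 * pi)"
      using False by (simp add: z_def Im_divide power2_eq_square)
    moreover have "real N * ln (norm w) / (2 * pi) < 0"
      using that False N by (intro divide_neg_pos mult_pos_neg) auto
    ultimately have "Im z > 0" by simp
    moreover have "exp (2 * of_real pi * \<i> * z / of_nat N) = w"
      using N False by (simp add: z_def)
    ultimately have "(\<lambda>j. a j * w ^ j) sums f z" using s[of z] by (simp add: pw)
    then show ?thesis by (simp add: P_def sums_iff)
  qed
  have "P holomorphic_on ball 0 1"
    by (rule power_series_holomorphic[of _ _ a]) (use P in auto)
  moreover have "P 0 = a 0" using powser_sums_zero[of a] by (simp add: P_def sums_iff)
  moreover have "f z = P (exp (2 * of_real pi * \<i> * z / of_nat N))" if "Im z > 0" for z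
    using s[OF that] by (simp add: pw P_def sums_iff)
  ultimately show ?thesis using that by blast
qed

lemma norm_q_lt_1: "Im z > 0 \<Longrightarrow> N > 0 \<Longrightarrow> norm (exp (2 * of_real pi * \<i> * z / of_nat N)) < 1"
  by (simp add: norm_exp_eq_Re)

lemma q_expansion_holomorphic:
  assumes "q_expansion N a f"
  shows "f holomorphic_on upper_half"
proof -
  obtain P where P: "P holomorphic_on ball 0 1" "P 0 = a 0"
    "\<And>z. Im z > 0 \<Longrightarrow> f z = P (exp (2 * of_real pi * \<i> * z / of_nat N))"
    using q_expansion_disc[OF assms] by metis
  have N: "N > 0" using assms by (simp add: q_expansion_def)
  have "(P \<circ> (\<lambda>z. exp (2 * of_real pi * \<i> * z / of_nat N))) holomorphic_on upper_half"
    by (rule holomorphic_on_compose_gen[OF _ P(1)]) (use N norm_q_lt_1 in \<open>auto intro!: holomorphic_intros\<close>)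
  then show ?thesis by (rule holomorphic_transform) (simp add: P)
qed

text \<open>P(w) - P(0) = w Q(w) with Q holomorphic on the disc, hence bounded on the compact disc
  that Im z >= \<open>\<delta>\<close> maps into.\<close>

lemma q_expansion_decay:
  assumes f: "q_expansion N a f" and \<delta>: "\<delta> > 0"
  obtains C where "C \<ge> 0" "\<And>z. Im z \<ge> \<delta> \<Longrightarrow> norm (f z - a 0) \<le> C * exp (- (2 * pi / real N * Im z))"
proof -
  obtain P where P: "P holomorphic_on ball 0 1" "P 0 = a 0"
    "\<And>z. Im z > 0 \<Longrightarrow> f z = P (exp (2 * of_real pi * \<i> * z / of_nat N))"
    using q_expansion_disc[OF f] by metis
  have N: "N > 0" using f by (simp add: q_expansion_def)
  define Q where "Q w = (if w = 0 then deriv P 0 else (P w - P 0) / (w - 0))" for w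
  have Q: "Q holomorphic_on ball 0 1"
    unfolding Q_def[abs_def] by (rule pole_lemma_open[OF P(1)]) simp
  define \<rho> where "\<rho> = exp (- (2 * pi / real N * \<delta>))"
  have \<rho>: "\<rho> < 1" using \<delta> N by (simp add: \<rho>_def)
  have "compact (Q ` cball 0 \<rho>)"
    by (intro compact_continuous_image holomorphic_on_imp_continuous_on holomorphic_on_subset[OF Q])
       (use \<rho> in auto)
  then obtain C where C: "\<And>w. w \<in> cball 0 \<rho> \<Longrightarrow> norm (Q w) \<le> C"
    by (metis bounded_iff compact_imp_bounded imageI)
  have "norm (f z - a 0) \<le> \<bar>C\<bar> * exp (- (2 * pi / real N * Im z))" if z: "Im z \<ge> \<delta>" for z
  proof -
    define w where "w = exp (2 * of_real pi * \<i> * z / of_nat N)"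
    have w: "norm w = exp (- (2 * pi / real N * Im z))" by (simp add: w_def norm_exp_eq_Re)
    have "2 * pi / real N * \<delta> \<le> 2 * pi / real N * Im z" using z by (intro mult_left_mono) auto
    then have "w \<in> cball 0 \<rho>" using w by (simp add: \<rho>_def)
    then have "norm (Q w) \<le> \<bar>C\<bar>" using C by fastforce
    moreover have "f z - a 0 = Q w * w"
      using P(2) P(3)[of z] z \<delta> by (simp add: Q_def w_def)
    ultimately show ?thesis using w by (simp add: norm_mult mult_right_mono)
  qed
  then show ?thesis using that[of "\<bar>C\<bar>"] by simp
qed

lemma q_expansion_limit:
  assumes "q_expansion N a f"
  shows "((\<lambda>t::real. f (Complex x t)) \<longlongrightarrow> a 0) at_top"
proof -
  obtain C where C: "C \<ge> 0" "\<And>z. Im z \<ge> 1 \<Longrightarrow> norm (f z - a 0) \<le> C * exp (- (2 * pi / real N * Im z))"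
    using q_expansion_decay[OF assms, of 1] by auto
  have N: "N > 0" using assms by (simp add: q_expansion_def)
  have "((\<lambda>t::real. f (Complex x t) - a 0) \<longlongrightarrow> 0) at_top"
  proof (rule Lim_null_comparison)
    show "\<forall>\<^sub>F t in at_top. norm (f (Complex x t) - a 0) \<le> C * exp (- (2 * pi / real N * t))"
      using eventually_ge_at_top[of "1::real"]
    proof eventually_elim
      fix t :: real assume "t \<ge> 1"
      then show "norm (f (Complex x t) - a 0) \<le> C * exp (- (2 * pi / real N * t))"
        using C(2)[of "Complex x t"] by simp
    qed
    have "((\<lambda>t. C * exp (- (e * t))) \<longlongrightarrow> 0) at_top" if "e > 0" for e :: real
      using that by real_asymp
    from this[of "2 * pi / real N"]
    show "((\<lambda>t. C * exp (- (2 * pi / real N * t))) \<longlongrightarrow> 0) at_top" using N by simp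
  qed
  then show ?thesis by (rule LIM_zero_cancel)
qed

text \<open>The limit along a vertical line sees only the constant coefficient, whatever level and
  coefficients are used; this makes the \<open>THE\<close> in \<open>const_term\<close> well
  defined.\<close>

lemma q_expansion_const_term:
  assumes "q_expansion N a f"
  shows "const_term f = a 0"
  unfolding const_term_def
proof (rule the_equality)
  show "\<exists>(N'::nat) (a'::nat \<Rightarrow> complex). N' > 0 \<and> a 0 = a' 0 \<and>
     (\<forall>z. Im z > 0 \<longrightarrow> (\<lambda>j. a' j * exp (2 * of_real pi * \<i> * of_nat j * z / of_nat N')) sums f z)"
    using assms by (auto simp: q_expansion_def)
  fix v assume "\<exists>(N'::nat) (a'::nat \<Rightarrow> complex). N' > 0 \<and> v = a' 0 \<and>
     (\<forall>z. Im z > 0 \<longrightarrow> (\<lambda>j. a' j * exp (2 * of_real pi * \<i> * of_nat j * z / of_nat N')) sums f z)"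
  then obtain N' a' where "q_expansion N' a' f" "v = a' 0" by (auto simp: q_expansion_def)
  with tendsto_unique[OF _ q_expansion_limit[of N' a' f 0] q_expansion_limit[OF assms, of 0]]
  show "v = a 0" by simp
qed

lemma q_expansion_cong:
  assumes "q_expansion N a f" "\<And>z. Im z > 0 \<Longrightarrow> g z = f z"
  shows "q_expansion N a g"
  using assms by (simp add: q_expansion_def)

text \<open>With s = u / v, the j-th term of level N becomes term u j of level N v, and the real
  translation b' is only a phase. A rational s therefore suffices.\<close>

lemma q_expansion_upper:
  fixes \<kappa> :: complex and s b' :: real
  assumes f: "q_expansion N a f" and s: "s \<in> \<rat>" "s > 0"
  obtains N' a' where "q_expansion N' a' (\<lambda>z. \<kappa> * f (of_real s * z + of_real b'))" "a' 0 = \<kappa> * a 0"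
proof -
  obtain i j :: int where ij: "j > 0" "s = of_int i / of_int j"
    using s(1) by (metis Rats_cases')
  define u where "u = nat i" define v where "v = nat j"
  have "i > 0" using ij s(2) by (simp add: zero_less_divide_iff)
  then have uv: "u > 0" "v > 0" "s = real u / real v" using ij by (auto simp: u_def v_def)
  have N: "N > 0" and e: "\<And>z. Im z > 0 \<Longrightarrow> (\<lambda>j. a j * exp (2 * of_real pi * \<i> * of_nat j * z / of_nat N)) sums f z"
    using f by (auto simp: q_expansion_def)
  \<comment> \<open>Supported on multiples of u, so that the reindexing k = u j loses
    nothing.\<close>
  define a' where "a' k = (if u dvd k then \<kappa> * a (k div u) * exp (2 * of_real pi * \<i> * of_nat (k div u) * of_real b' / of_nat N) else 0)" for k
  have "(\<lambda>k. a' k * exp (2 * of_real pi * \<i> * of_nat k * z / of_nat (N * v))) sums (\<kappa> * f (of_real s * z + of_real b'))"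
    if z: "Im z > 0" for z
  proof -
    have "Im (of_real s * z + of_real b') > 0" using z s by simp
    from sums_mult[OF e[OF this], of \<kappa>]
    have "(\<lambda>j. \<kappa> * (a j * exp (2 * of_real pi * \<i> * of_nat j * (of_real s * z + of_real b') / of_nat N))) sums (\<kappa> * f (of_real s * z + of_real b'))" .
    moreover have "\<kappa> * (a j * exp (2 * of_real pi * \<i> * of_nat j * (of_real s * z + of_real b') / of_nat N))
       = a' (u * j) * exp (2 * of_real pi * \<i> * of_nat (u * j) * z / of_nat (N * v))" for j
    proof -
      have "2 * of_real pi * \<i> * of_nat j * (of_real s * z + of_real b') / of_nat N =
        2 * of_real pi * \<i> * of_nat j * of_real b' / of_nat N + 2 * of_real pi * \<i> * of_nat (u * j) * z / of_nat (N * v)"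
      proof -
        have "complex_of_real s = of_nat u / of_nat v" using uv by simp
        then show ?thesis using uv(1,2) N by (simp add: field_simps)
      qed
      then show ?thesis using uv by (simp add: a'_def exp_add del: of_nat_mult)
    qed
    ultimately have "(\<lambda>j. a' (u * j) * exp (2 * of_real pi * \<i> * of_nat (u * j) * z / of_nat (N * v))) sums (\<kappa> * f (of_real s * z + of_real b'))"
      by simp
    moreover have "strict_mono (\<lambda>j. u * j)" using uv by (simp add: strict_mono_def)
    ultimately show ?thesis
      by (subst (asm) sums_mono_reindex[of "\<lambda>j. u * j" "\<lambda>k. a' k * exp (2 * of_real pi * \<i> * of_nat k * z / of_nat (N * v))"])
         (auto simp: a'_def dvd_def)
  qed
  then have "q_expansion (N * v) a' (\<lambda>z. \<kappa> * f (of_real s * z + of_real b'))"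
    using N uv by (simp add: q_expansion_def)
  moreover have "a' 0 = \<kappa> * a 0" by (simp add: a'_def)
  ultimately show ?thesis using that by blast
qed

lemma poly_growth:
  fixes q :: "complex poly"
  obtains K D where "K \<ge> 0" "\<And>z. norm (poly q z) \<le> K * (1 + norm z) ^ D"
proof -
  have "\<exists>K D. K \<ge> 0 \<and> (\<forall>z. norm (poly q z) \<le> K * (1 + norm z) ^ D)"
  proof (induction q)
    case 0
    show ?case by (intro exI[of _ 0]) simp
  next
    case (pCons c q)
    then obtain K D where K: "K \<ge> 0" "\<And>z. norm (poly q z) \<le> K * (1 + norm z) ^ D" by blast
    have "norm (poly (pCons c q) z) \<le> (norm c + K) * (1 + norm z) ^ Suc D" for z
    proof -
      have 1: "1 \<le> (1 + norm z) ^ Suc D" by (intro one_le_power) simp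
      have "norm (poly (pCons c q) z) \<le> norm c + norm z * norm (poly q z)"
        using norm_triangle_ineq[of c "z * poly q z"] by (simp add: norm_mult)
      also have "\<dots> \<le> norm c * (1 + norm z) ^ Suc D + (1 + norm z) * (K * (1 + norm z) ^ D)"
        using mult_left_mono[OF 1, of "norm c"] K by (intro add_mono mult_mono) auto
      finally show ?thesis by (simp add: algebra_simps)
    qed
    then show ?case using K(1) by (intro exI[of _ "norm c + K"] exI[of _ "Suc D"]) simp
  qed
  then show ?thesis using that by blast
qed

text \<open>Half of the rate 2 pi / N is spent on the polynomial. Bounding Re z lets Im z control
  norm z.\<close>

lemma poly_times_decay:
  assumes f: "q_expansion N a f" and \<delta>: "\<delta> > 0"
  obtains C where "C \<ge> 0"
    "\<And>z. Im z \<ge> \<delta> \<Longrightarrow> \<bar>Re z\<bar> \<le> R \<Longrightarrow> norm (poly q z * (f z - a 0)) \<le> C * exp (- (pi / real N * Im z))"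
proof -
  have N: "N > 0" using f by (simp add: q_expansion_def)
  obtain C where C: "C \<ge> 0" "\<And>z. Im z \<ge> \<delta> \<Longrightarrow> norm (f z - a 0) \<le> C * exp (- (2 * pi / real N * Im z))"
    using q_expansion_decay[OF f \<delta>] by metis
  obtain K D where K: "K \<ge> 0" "\<And>z. norm (poly q z) \<le> K * (1 + norm z) ^ D" using poly_growth[of q] by metis
  define \<epsilon> where "\<epsilon> = pi / real N"
  have \<epsilon>: "\<epsilon> > 0" using N by (simp add: \<epsilon>_def)
  define B where "B = fact D / \<epsilon> ^ D * exp (\<epsilon> * (1 + \<bar>R\<bar>))"
  have "norm (poly q z * (f z - a 0)) \<le> (K * B * C) * exp (- (\<epsilon> * Im z))"
    if z: "Im z \<ge> \<delta>" "\<bar>Re z\<bar> \<le> R" for z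
  proof -
    have "(1 + norm z) ^ D \<le> fact D / \<epsilon> ^ D * exp (\<epsilon> * (1 + norm z))" by (rule power_le_exp) (use \<epsilon> in auto)
    also have "norm z \<le> \<bar>R\<bar> + Im z" using cmod_le[of z] z \<delta> by auto
    then have "fact D / \<epsilon> ^ D * exp (\<epsilon> * (1 + norm z)) \<le> fact D / \<epsilon> ^ D * exp (\<epsilon> * (1 + (\<bar>R\<bar> + Im z)))"
      using \<epsilon> by (intro mult_left_mono) auto
    also have "\<dots> = B * exp (\<epsilon> * Im z)" by (simp add: B_def algebra_simps flip: exp_add)
    finally have "norm (poly q z) \<le> K * (B * exp (\<epsilon> * Im z))"
      using K order_trans[OF K(2)[of z] mult_left_mono] by blast
    then have "norm (poly q z) * norm (f z - a 0) \<le> (K * (B * exp (\<epsilon> * Im z))) * (C * exp (- (2 * \<epsilon> * Im z)))"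
      using C(2)[OF z(1)] by (intro mult_mono) (auto simp: \<epsilon>_def K B_def)
    also have "\<dots> = (K * B * C) * (exp (\<epsilon> * Im z) * exp (- (2 * \<epsilon> * Im z)))" by (simp add: mult_ac)
    also have "exp (\<epsilon> * Im z) * exp (- (2 * \<epsilon> * Im z)) = exp (- (\<epsilon> * Im z))" by (simp flip: exp_add)
    finally show ?thesis by (simp add: norm_mult)
  qed
  moreover have "K * B * C \<ge> 0" using K C \<epsilon> by (simp add: B_def)
  ultimately show ?thesis using that[of "K * B * C"] by (simp add: \<epsilon>_def)
qed

text \<open>Exponential decay makes a primitive converge along vertical rays, with the same limit on
  all of them. Subtracting that limit gives the primitive that vanishes at the cusp, and the
  integral from z to the cusp is then -G z.\<close>

lemma cusp_primitive:
  assumes f: "q_expansion N a f"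
  obtains G where "\<And>z. Im z > 0 \<Longrightarrow> (G has_field_derivative poly q z * (f z - a 0)) (at z)"
    "\<And>z. Im z > 0 \<Longrightarrow> ((\<lambda>t. poly q (z + \<i> * of_real t) * (f (z + \<i> * of_real t) - a 0) * \<i>) has_integral - G z) {0..}"
    "\<And>x. ((\<lambda>t. G (Complex x t)) \<longlongrightarrow> 0) at_top"
proof -
  have N: "N > 0" using f by (simp add: q_expansion_def)
  define g where "g z = poly q z * (f z - a 0)" for z
  define \<epsilon> where "\<epsilon> = pi / real N"
  have \<epsilon>: "\<epsilon> > 0" using N by (simp add: \<epsilon>_def)
  have "g holomorphic_on upper_half"
    unfolding g_def[abs_def] by (intro holomorphic_intros q_expansion_holomorphic[OF f])
  from holomorphic_convex_primitive'[OF convex_upper_half open_upper_half this]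
  obtain G0 where "\<And>z. z \<in> upper_half \<Longrightarrow> (G0 has_field_derivative g z) (at z within upper_half)" by blast
  then have G0: "(G0 has_field_derivative g z) (at z)" if "Im z > 0" for z
    using that at_within_open[OF _ open_upper_half] by (metis mem_Collect_eq)
  define h where "h z t = g (z + \<i> * of_real t) * \<i>" for z and t :: real
  have FTC: "(h z has_integral (G0 (z + \<i> * of_real T) - G0 z)) {0..T}" if z: "Im z > 0" and T: "T \<ge> 0" for z T
  proof -
    have "(h z has_integral (G0 (z + \<i> * of_real T) - G0 (z + \<i> * of_real 0))) {0..T}"
    proof (rule fundamental_theorem_of_calculus[OF T])
      fix t assume "t \<in> {0..T}"
      then have "Im (z + \<i> * of_real t) > 0" using z by simp
      have "((\<lambda>w. G0 (z + \<i> * w)) has_field_derivative g (z + \<i> * of_real t) * \<i>) (at (of_real t))"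
        by (rule DERIV_chain2[where f = G0 and g = "\<lambda>w. z + \<i> * w", OF G0[OF \<open>Im (z + \<i> * of_real t) > 0\<close>]])
           (auto intro!: derivative_eq_intros)
      from has_vector_derivative_real_field[OF this]
      show "((\<lambda>t. G0 (z + \<i> * of_real t)) has_vector_derivative h z t) (at t within {0..T})"
        by (simp add: h_def)
    qed
    then show ?thesis by simp
  qed
  have hbound: "\<exists>C\<ge>0. \<forall>t\<ge>0. norm (h z t) \<le> C * exp (- (\<epsilon> * (Im z + t)))" if z: "Im z > 0" for z
  proof -
    obtain C where C: "C \<ge> 0"
      "\<And>w. Im w \<ge> Im z \<Longrightarrow> \<bar>Re w\<bar> \<le> \<bar>Re z\<bar> \<Longrightarrow> norm (poly q w * (f w - a 0)) \<le> C * exp (- (pi / real N * Im w))"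
      using poly_times_decay[OF f z] by metis
    have "norm (h z t) \<le> C * exp (- (\<epsilon> * (Im z + t)))" if "t \<ge> 0" for t
      using C(2)[of "z + \<i> * of_real t"] that by (simp add: h_def g_def norm_mult \<epsilon>_def)
    then show ?thesis using C(1) by blast
  qed
  have lim: "\<exists>L. (\<lambda>k::nat. G0 (z + \<i> * of_real (real k))) \<longlonglongrightarrow> L \<and> (h z has_integral (L - G0 z)) {0..}" if z: "Im z > 0" for z
  proof -
    obtain C where C: "C \<ge> 0" "\<And>t. t \<ge> 0 \<Longrightarrow> norm (h z t) \<le> C * exp (- (\<epsilon> * (Im z + t)))"
      using hbound[OF z] by auto
    \<comment> \<open>Truncations extended by 0, so that dominated convergence leads from finite
      intervals to the ray.\<close>
    define hk where "hk k t = (if t \<in> {0..real k} then h z t else 0)" for k t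
    have hk: "(hk k has_integral (G0 (z + \<i> * of_real (real k)) - G0 z)) {0..}" for k
      unfolding hk_def
      by (subst has_integral_restrict) (use FTC[OF z, of "real k"] in auto)
    let ?b = "\<lambda>t. C * exp (- (\<epsilon> * Im z)) * exp (- \<epsilon> * t)"
    have b: "?b integrable_on {0..}"
      using has_integral_mult_right[OF has_integral_exp_minus_to_infinity[OF \<epsilon>, of 0]] unfolding integrable_on_def by blast
    have bd: "norm (hk k t) \<le> ?b t" if "t \<in> {0..}" for k t
    proof -
      have "exp (- (\<epsilon> * (Im z + t))) = exp (- (\<epsilon> * Im z)) * exp (- \<epsilon> * t)" by (simp add: algebra_simps flip: exp_add)
      then show ?thesis using C(2)[of t] C(1) that by (auto simp: hk_def)
    qed
    have cv: "(\<lambda>k. hk k t) \<longlonglongrightarrow> h z t" if "t \<in> {0..}" for t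
    proof (rule tendsto_eventually)
      obtain k0 :: nat where "t \<le> real k0" using real_arch_simple by blast
      then show "\<forall>\<^sub>F k in sequentially. hk k t = h z t"
        using that by (intro eventually_sequentiallyI[of k0]) (auto simp: hk_def)
    qed
    have int: "h z integrable_on {0..}" "(\<lambda>k. integral {0..} (hk k)) \<longlonglongrightarrow> integral {0..} (h z)"
      using dominated_convergence[of hk "{0..}" ?b "h z"] hk b bd cv by (auto simp: integrable_on_def)
    have "integral {0..} (hk k) = G0 (z + \<i> * of_real (real k)) - G0 z" for k
      using hk by (rule integral_unique)
    then have "(\<lambda>k. (G0 (z + \<i> * of_real (real k)) - G0 z) + G0 z) \<longlonglongrightarrow> integral {0..} (h z) + G0 z"
      using int(2) by (intro tendsto_add tendsto_const) simp
    then have "(\<lambda>k. G0 (z + \<i> * of_real (real k))) \<longlonglongrightarrow> integral {0..} (h z) + G0 z" by simp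
    moreover have "(h z has_integral ((integral {0..} (h z) + G0 z) - G0 z)) {0..}"
      using int(1) by (simp add: integrable_integral)
    ultimately show ?thesis by blast
  qed
  obtain L where L: "(\<lambda>k::nat. G0 (\<i> + \<i> * of_real (real k))) \<longlonglongrightarrow> L" using lim[of \<i>] by auto
  have same: "(\<lambda>k::nat. G0 (z + \<i> * of_real (real k))) \<longlonglongrightarrow> L" if z: "Im z > 0" for z
  proof -
    define \<delta> where "\<delta> = min (Im z) 1"
    have \<delta>: "\<delta> > 0" using z by (simp add: \<delta>_def)
    obtain C where C: "C \<ge> 0"
      "\<And>w. Im w \<ge> \<delta> \<Longrightarrow> \<bar>Re w\<bar> \<le> \<bar>Re z\<bar> \<Longrightarrow> norm (poly q w * (f w - a 0)) \<le> C * exp (- (pi / real N * Im w))"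
      using poly_times_decay[OF f \<delta>] by metis
    have bd: "norm (G0 (z + \<i> * of_real (real k)) - G0 (\<i> + \<i> * of_real (real k))) \<le> C * exp (- (\<epsilon> * real k)) * norm (z - \<i>)" for k
    proof -
      \<comment> \<open>A half strip of height at least k containing both points. There the
        derivative is O(exp(-\<open>\<epsilon>\<close> k)), so the two primitives approach each
        other.\<close>
      let ?S = "{w. Im w \<ge> \<delta> + real k} \<inter> {w. Re w \<le> \<bar>Re z\<bar>} \<inter> {w. Re w \<ge> - \<bar>Re z\<bar>}"
      have "norm (G0 (z + \<i> * of_real (real k)) - G0 (\<i> + \<i> * of_real (real k)))
        \<le> C * exp (- (\<epsilon> * real k)) * norm ((z + \<i> * of_real (real k)) - (\<i> + \<i> * of_real (real k)))"
      proof (rule field_differentiable_bound[of ?S G0 g])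
        show "convex ?S"
          by (intro convex_Int convex_halfspace_Im_ge convex_halfspace_Re_le convex_halfspace_Re_ge)
        fix w assume w: "w \<in> ?S"
        then have "Im w > 0" using \<delta> by (auto intro: less_le_trans[of 0 "\<delta> + real k"] add_pos_nonneg)
        then show "(G0 has_field_derivative g w) (at w within ?S)" using G0 has_field_derivative_at_within by blast
        have "norm (g w) \<le> C * exp (- (\<epsilon> * Im w))" using C(2)[of w] w by (auto simp: g_def \<epsilon>_def)
        also have "\<dots> \<le> C * exp (- (\<epsilon> * real k))" using w C(1) \<epsilon> \<delta> by (intro mult_left_mono) auto
        finally show "norm (g w) \<le> C * exp (- (\<epsilon> * real k))" .
      qed (auto simp: \<delta>_def)
      then show ?thesis by simp
    qed
    have cv: "(\<lambda>k. C * exp (- (\<epsilon> * real k)) * norm (z - \<i>)) \<longlonglongrightarrow> 0"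
      using \<epsilon> by real_asymp
    have "(\<lambda>k. G0 (z + \<i> * of_real (real k)) - G0 (\<i> + \<i> * of_real (real k))) \<longlonglongrightarrow> 0"
      by (rule Lim_null_comparison[OF always_eventually[OF allI[OF bd]] cv])
    from tendsto_add[OF this L] show ?thesis by simp
  qed
  define G where "G z = G0 z - L" for z
  have 1: "(G has_field_derivative g z) (at z)" if "Im z > 0" for z
    unfolding G_def[abs_def] using DERIV_diff[OF G0[OF that] DERIV_const[of L]] by simp
  have 2: "(h z has_integral - G z) {0..}" if z: "Im z > 0" for z
    using lim[OF z] LIMSEQ_unique[OF same[OF z]] by (auto simp: G_def)
  have 3: "((\<lambda>t. G (Complex x t)) \<longlongrightarrow> 0) at_top" for x
  proof -
    have z1: "Im (Complex x 1) > 0" by simp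
    obtain C where C: "C \<ge> 0" "\<And>w. Im w \<ge> 1 \<Longrightarrow> \<bar>Re w\<bar> \<le> \<bar>x\<bar> \<Longrightarrow> norm (poly q w * (f w - a 0)) \<le> C * exp (- (pi / real N * Im w))"
      using poly_times_decay[OF f zero_less_one] by metis
    have "norm (G (Complex x t)) \<le> C * exp (- (\<epsilon> * t)) / \<epsilon>" if t: "t \<ge> 1" for t
    proof -
      have hi: "(h (Complex x t) has_integral - G (Complex x t)) {0..}" using t by (intro 2) simp
      have bi: "((\<lambda>\<tau>. C * exp (- (\<epsilon> * t)) * exp (- \<epsilon> * \<tau>)) has_integral C * exp (- (\<epsilon> * t)) * (exp (- \<epsilon> * 0) / \<epsilon>)) {0..}"
        by (intro has_integral_mult_right has_integral_exp_minus_to_infinity \<epsilon>)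
      have "norm (- G (Complex x t)) \<le> C * exp (- (\<epsilon> * t)) * (exp (- \<epsilon> * 0) / \<epsilon>)"
      proof (rule integral_norm_bound_integral[of "h (Complex x t)" "{0..}" "\<lambda>\<tau>. C * exp (- (\<epsilon> * t)) * exp (- \<epsilon> * \<tau>)", unfolded integral_unique[OF hi] integral_unique[OF bi]])
        show "h (Complex x t) integrable_on {0..}" using hi by (auto simp: integrable_on_def)
        show "(\<lambda>\<tau>. C * exp (- (\<epsilon> * t)) * exp (- \<epsilon> * \<tau>)) integrable_on {0..}" using bi by (auto simp: integrable_on_def)
        fix \<tau> :: real assume \<tau>: "\<tau> \<in> {0..}"
        have "norm (h (Complex x t) \<tau>) \<le> C * exp (- (\<epsilon> * (t + \<tau>)))"
          using C(2)[of "Complex x t + \<i> * of_real \<tau>"] t \<tau> by (simp add: h_def g_def norm_mult \<epsilon>_def)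
        then show "norm (h (Complex x t) \<tau>) \<le> C * exp (- (\<epsilon> * t)) * exp (- \<epsilon> * \<tau>)"
          by (simp add: mult.assoc algebra_simps flip: exp_add)
      qed
      then show ?thesis by simp
    qed
    then have ev: "\<forall>\<^sub>F t in at_top. norm (G (Complex x t)) \<le> C * exp (- (\<epsilon> * t)) / \<epsilon>"
      by (intro eventually_at_top_linorderI[of 1])
    have "((\<lambda>t. C * exp (- (\<epsilon> * t)) / \<epsilon>) \<longlongrightarrow> 0) at_top" using \<epsilon> by real_asymp
    from Lim_null_comparison[OF ev this] show ?thesis .
  qed
  show ?thesis by (rule that[of G]) (use 1 2 3 in \<open>auto simp: g_def h_def[abs_def]\<close>)
qed


section \<open>Period integrals and Dedekind sums\<close>

text \<open>\<open>moment e k x X\<close> is the integral of \<open>X\<^sup>e\<close> against \<open>coset_sum (k + 1) x\<close> from \<open>X\<close> to infinity.\<close>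

fun moment :: "nat \<Rightarrow> nat \<Rightarrow> real \<Rightarrow> complex \<Rightarrow> complex" where
  "moment 0 k x X = coset_sum k x X"
| "moment (Suc e) 0 x X = 0"
| "moment (Suc e) (Suc k) x X = X ^ Suc e * coset_sum (Suc k) x X + of_nat (Suc e) * moment e k x X"

text \<open>The recursion of \<open>moment\<close> with \<open>coset_sum\<close> replaced by its
  part holomorphic at 0; \<open>moment_pole\<close> follows the pole coefficient in the same way.
  The clause with Suc e and 0 is a filler: it is not reached from e <= k.\<close>

fun moment_reg :: "nat \<Rightarrow> nat \<Rightarrow> real \<Rightarrow> complex \<Rightarrow> complex" where
  "moment_reg 0 k x X = (-1) ^ k * coset_reg k x X"
| "moment_reg (Suc e) 0 x X = 0"
| "moment_reg (Suc e) (Suc k) x X = X ^ Suc e * ((-1) ^ Suc k * coset_reg (Suc k) x X) + of_nat (Suc e) * moment_reg e k x X"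

fun moment_pole :: "nat \<Rightarrow> nat \<Rightarrow> real" where
  "moment_pole 0 k = fact k"
| "moment_pole (Suc e) 0 = 0"
| "moment_pole (Suc e) (Suc k) = fact (Suc k) + real (Suc e) * moment_pole e k"

lemma moment_deriv:
  assumes "Re X > 0" "e \<le> k"
  shows "(moment e k x has_field_derivative - (X ^ e * coset_sum (Suc k) x X)) (at X)"
  using assms
proof (induction e arbitrary: k)
  case 0
  have "moment 0 k x = coset_sum k x" by (rule ext) simp
  then show ?case using coset_sum_deriv[OF assms(1), of k x] by simp
next
  case (Suc e)
  then obtain k' where k: "k = Suc k'" "e \<le> k'" by (cases k) auto
  have m: "moment (Suc e) k x = (\<lambda>X. X ^ Suc e * coset_sum (Suc k') x X + of_nat (Suc e) * moment e k' x X)"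
    unfolding k by (rule ext) simp
  have p: "((\<lambda>X. X ^ Suc e) has_field_derivative of_nat (Suc e) * X ^ e) (at X)"
    using DERIV_power_Suc[OF DERIV_ident, of e X UNIV] by simp
  have "((\<lambda>X. X ^ Suc e * coset_sum (Suc k') x X + of_nat (Suc e) * moment e k' x X) has_field_derivative
     (of_nat (Suc e) * X ^ e * coset_sum (Suc k') x X + - coset_sum (Suc (Suc k')) x X * X ^ Suc e)
       + of_nat (Suc e) * - (X ^ e * coset_sum (Suc k') x X)) (at X)"
    by (intro DERIV_add DERIV_mult' DERIV_cmult p coset_sum_deriv Suc.IH Suc.prems k DERIV_cong[OF DERIV_mult[OF p coset_sum_deriv]]) auto
  then show ?case unfolding m by (simp add: k algebra_simps)
qed

text \<open>In the recursion X^e lowers a pole of order k + 1 to order k - e + 1, and lowering e and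
  k together keeps this order, so a single pole term collects everything.\<close>

lemma moment_eq_reg:
  assumes "Re X > 0" "X \<in> strip" "e \<le> k"
  shows "moment e k x X = moment_reg e k x X + of_real (moment_pole e k) / X ^ Suc (k - e)"
  using assms(3)
proof (induction e arbitrary: k)
  case 0
  then show ?case using coset_sum_eq_reg[OF assms(1,2)] by simp
next
  case (Suc e)
  then obtain k' where k: "k = Suc k'" "e \<le> k'" by (cases k) auto
  have X0: "X \<noteq> 0" using assms by auto
  have "X ^ Suc e * (fact (Suc k') / X ^ Suc (Suc k')) = fact (Suc k') / X ^ Suc (k' - e)"
  proof -
    have "X ^ Suc (Suc k') = X ^ Suc e * X ^ Suc (k' - e)" using k(2) by (simp flip: power_add power_Suc)
    then show ?thesis using X0 by simp
  qed
  then show ?case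
    unfolding k using Suc.IH[OF k(2)] coset_sum_eq_reg[OF assms(1,2), of "Suc k'" x]
    by (simp add: ring_distribs add_divide_distrib del: power_Suc of_nat_Suc)
qed

lemma moment_real: "t > 0 \<Longrightarrow> moment e k x (of_real t) \<in> \<real>"
proof (induction e arbitrary: k)
  case 0
  then show ?case by (simp add: coset_sum_real)
next
  case (Suc e)
  show ?case
  proof (cases k)
    case (Suc k')
    show ?thesis unfolding Suc moment.simps
      by (intro Reals_add Reals_mult Reals_power Reals_of_real coset_sum_real Suc.prems Suc.IH Reals_of_nat)
  qed simp
qed

lemma moment_reg_holomorphic: "moment_reg e k x holomorphic_on strip"
proof (induction e arbitrary: k)
  case 0
  have "coset_reg k x holomorphic_on strip"
    using coset_reg_deriv open_strip by (meson holomorphic_on_open)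
  moreover have "moment_reg 0 k x = (\<lambda>X. (-1) ^ k * coset_reg k x X)" by (rule ext) simp
  ultimately show ?case by (auto intro: holomorphic_intros)
next
  case (Suc e)
  show ?case
  proof (cases k)
    case 0
    have "moment_reg (Suc e) k x = (\<lambda>X. 0)" unfolding 0 by (rule ext) simp
    then show ?thesis by simp
  next
    case (Suc k')
    have "coset_reg k x holomorphic_on strip" for k
      using coset_reg_deriv open_strip by (meson holomorphic_on_open)
    moreover have "moment_reg (Suc e) k x = (\<lambda>X. X ^ Suc e * ((-1) ^ Suc k' * coset_reg (Suc k') x X) + of_nat (Suc e) * moment_reg e k' x X)"
      unfolding Suc by (rule ext) simp
    ultimately show ?thesis using Suc.IH by (auto intro!: holomorphic_intros simp del: power_Suc)
  qed
qed

text \<open>At X = 0 all terms with a positive power of X drop out; only the innermost term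
  survives, and the factors collected on the way multiply to e!.\<close>

lemma moment_reg_0: "e \<le> k \<Longrightarrow> moment_reg e k x 0 = fact e * ((-1) ^ (k - e) * coset_reg (k - e) x 0)"
proof (induction e arbitrary: k)
  case (Suc e)
  then obtain k' where k: "k = Suc k'" "e \<le> k'" by (cases k) auto
  then show ?case using Suc.IH[OF k(2)] by (simp add: mult.assoc)
qed simp

lemma moment_decay:
  assumes "\<delta> > 0"
  obtains C where "C \<ge> 0" "\<And>t. t \<ge> \<delta> \<Longrightarrow> norm (moment e k x (of_real t)) \<le> C * exp (- (coset_rep x / 2 * t))"
proof -
  have y: "coset_rep x > 0" by (rule coset_rep)
  have "\<exists>C\<ge>0. \<forall>t\<ge>\<delta>. norm (moment e k x (of_real t)) \<le> C * exp (- (coset_rep x / 2 * t))"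
  proof (induction e arbitrary: k)
    case 0
    obtain C where C: "\<And>X. Re X \<ge> \<delta> \<Longrightarrow> norm (coset_sum k x X) \<le> C * exp (- (coset_rep x * Re X))"
      using coset_sum_decay[OF assms] by metis
    have "norm (moment 0 k x (of_real t)) \<le> \<bar>C\<bar> * exp (- (coset_rep x / 2 * t))" if "t \<ge> \<delta>" for t
    proof -
      have "norm (moment 0 k x (of_real t)) \<le> C * exp (- (coset_rep x * t))" using C[of "of_real t"] that by simp
      also have "\<dots> \<le> \<bar>C\<bar> * exp (- (coset_rep x / 2 * t))"
        using y that assms by (intro mult_mono) auto
      finally show ?thesis .
    qed
    then show ?case by (intro exI[of _ "\<bar>C\<bar>"]) auto
  next
    case (Suc e)
    show ?case
    proof (cases k)
      case 0
      then show ?thesis by (intro exI[of _ 0]) simp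
    next
      case (Suc k')
      obtain C where C: "C \<ge> 0" "\<And>t. t \<ge> \<delta> \<Longrightarrow> norm (moment e k' x (of_real t)) \<le> C * exp (- (coset_rep x / 2 * t))"
        using Suc.IH by blast
      obtain D where D: "\<And>X. Re X \<ge> \<delta> \<Longrightarrow> norm (coset_sum k x X) \<le> D * exp (- (coset_rep x * Re X))"
        using coset_sum_decay[OF assms] by metis
      \<comment> \<open>From \<open>power_le_exp\<close>: half of the decay of
        \<open>coset_sum\<close> absorbs the power of t.\<close>
      define B where "B = fact (Suc e) / (coset_rep x / 2) ^ Suc e"
      have B: "B \<ge> 0" using y by (simp add: B_def)
      have "norm (moment (Suc e) k x (of_real t)) \<le> (B * \<bar>D\<bar> + real (Suc e) * C) * exp (- (coset_rep x / 2 * t))" if t: "t \<ge> \<delta>" for t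
      proof -
        have "norm (moment (Suc e) k x (of_real t)) \<le> norm (complex_of_real t ^ Suc e) * norm (coset_sum k x (of_real t)) + real (Suc e) * norm (moment e k' x (of_real t))"
          unfolding Suc moment.simps by (rule order_trans[OF norm_triangle_ineq]) (simp add: norm_mult del: power_Suc of_nat_Suc)
        also have "\<dots> \<le> (B * exp (coset_rep x / 2 * t)) * (\<bar>D\<bar> * exp (- (coset_rep x * t))) + real (Suc e) * (C * exp (- (coset_rep x / 2 * t)))"
        proof (intro add_mono mult_mono)
          show "norm (complex_of_real t ^ Suc e) \<le> B * exp (coset_rep x / 2 * t)"
            using power_le_exp[of t "coset_rep x / 2" "Suc e"] t y assms by (simp add: B_def norm_power del: power_Suc)
          have "norm (coset_sum k x (of_real t)) \<le> D * exp (- (coset_rep x * t))" using D[of "of_real t"] t by simp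
          also have "\<dots> \<le> \<bar>D\<bar> * exp (- (coset_rep x * t))" by (intro mult_right_mono) auto
          finally show "norm (coset_sum k x (of_real t)) \<le> \<bar>D\<bar> * exp (- (coset_rep x * t))" .
        qed (use C t B in auto)
        also have "(B * exp (coset_rep x / 2 * t)) * (\<bar>D\<bar> * exp (- (coset_rep x * t))) = B * \<bar>D\<bar> * (exp (coset_rep x / 2 * t) * exp (- (coset_rep x * t)))" by simp
        also have "exp (coset_rep x / 2 * t) * exp (- (coset_rep x * t)) = exp (- (coset_rep x / 2 * t))"
          by (simp flip: exp_add)
        finally show ?thesis by (simp add: algebra_simps)
      qed
      moreover have "B * \<bar>D\<bar> + real (Suc e) * C \<ge> 0" using B C by simp
      ultimately show ?thesis by blast
    qed
  qed
  then show ?thesis using that by blast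
qed

text \<open>Writing r = c r' distributes the coset of x over the classes of (x + j) / c, and on each
  class the root of unity e(r p a / c) is constant. This is the origin of the finite sum over j in
  the Dedekind sum; the sign \<open>\<epsilon>\<close> treats x and -x together.\<close>

lemma coset_split:
  fixes a c :: int and \<epsilon> :: real
  assumes c: "c > 0" and X: "Re X > 0" and \<epsilon>: "\<epsilon> = 1 \<or> \<epsilon> = -1"
  shows "coset_sum k (\<epsilon> * x) (X - 2 * of_real pi * \<i> * of_real (real p * (of_int a / of_int c))) =
    (\<Sum>j\<in>{0..<c}. ecis (\<epsilon> * (real p * (of_int a * ((x + of_int j) / of_int c)))) *
        (of_int c ^ k * coset_sum k (\<epsilon> * ((x + of_int j) / of_int c)) (of_int c * X)))"
proof -
  let ?Z = "X - 2 * of_real pi * \<i> * of_real (real p * (of_int a / of_int c))"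
  let ?f = "\<lambda>r. of_real r ^ k * exp (- (of_real r * ?Z)) :: complex"
  let ?y = "\<lambda>j::int. \<epsilon> * ((x + of_int j) / of_int c)"
  let ?B = "\<lambda>j::int. (\<lambda>r. of_int c * r) ` pos_coset (?y j)"
  have cr: "real_of_int c > 0" using c by simp
  have \<epsilon>2: "\<epsilon> * \<epsilon> = 1" "\<epsilon> \<noteq> 0" using \<epsilon> by auto
  have \<epsilon>Z: "\<epsilon> * t \<in> \<int> \<longleftrightarrow> t \<in> \<int>" for t using \<epsilon> by auto
  have trm: "?f (of_int c * r) = ecis (\<epsilon> * (real p * (of_int a * ((x + of_int j) / of_int c)))) *
        (of_int c ^ k * (of_real r ^ k * exp (- (of_real r * (of_int c * X)))))" if r: "r \<in> pos_coset (?y j)" for r j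
  proof -
    have "- (of_real (of_int c * r) * ?Z) = - (of_real r * (of_int c * X)) + 2 * of_real pi * \<i> * of_real (r * (real p * of_int a))"
      using c by (simp add: field_simps)
    then have "exp (- (of_real (of_int c * r) * ?Z)) = exp (- (of_real r * (of_int c * X)) + 2 * of_real pi * \<i> * of_real (r * (real p * of_int a)))"
      by (simp only:)
    also have "\<dots> = exp (- (of_real r * (of_int c * X))) * ecis (r * (real p * of_int a))"
      by (simp only: exp_add ecis_exp)
    \<comment> \<open>Here r differs from its representative by an integer, and p a is an integer
      too.\<close>
    also have "ecis (r * (real p * of_int a)) = ecis (\<epsilon> * (real p * (of_int a * ((x + of_int j) / of_int c))))"
    proof (rule ecis_cong)
      have "(r - ?y j) * (real p * of_int a) \<in> \<int>"
        using r by (intro Ints_mult) (auto simp: pos_coset_def)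
      then show "r * (real p * of_int a) - \<epsilon> * (real p * (of_int a * ((x + of_int j) / of_int c))) \<in> \<int>"
        by (simp add: algebra_simps)
    qed
    finally show ?thesis by (simp add: power_mult_distrib mult_ac)
  qed
  have h1: "(?f has_sum (\<Sum>j\<in>{0..<c}. ecis (\<epsilon> * (real p * (of_int a * ((x + of_int j) / of_int c)))) *
        (of_int c ^ k * coset_sum k (?y j) (of_int c * X)))) (\<Union>j\<in>{0..<c}. ?B j)"
  proof (rule sum_has_sum)
    fix j assume "j \<in> {0..<c}"
    have "((\<lambda>r. ecis (\<epsilon> * (real p * (of_int a * ((x + of_int j) / of_int c)))) *
        (of_int c ^ k * (of_real r ^ k * exp (- (of_real r * (of_int c * X)))))) has_sum
        ecis (\<epsilon> * (real p * (of_int a * ((x + of_int j) / of_int c)))) *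
        (of_int c ^ k * coset_sum k (?y j) (of_int c * X))) (pos_coset (?y j))"
      using c X by (intro has_sum_cmult_right coset_sum_has_sum) auto
    then have "((\<lambda>r. ?f (of_int c * r)) has_sum
        ecis (\<epsilon> * (real p * (of_int a * ((x + of_int j) / of_int c)))) *
        (of_int c ^ k * coset_sum k (?y j) (of_int c * X))) (pos_coset (?y j))"
      by (rule has_sum_cong[THEN iffD1, rotated]) (use trm in auto)
    then show "(?f has_sum ecis (\<epsilon> * (real p * (of_int a * ((x + of_int j) / of_int c)))) *
        (of_int c ^ k * coset_sum k (?y j) (of_int c * X))) (?B j)"
      using c by (subst has_sum_reindex) (auto simp: inj_on_def o_def)
  next
    fix j j' assume jj: "j \<in> {0..<c}" "j' \<in> {0..<c}" "j \<noteq> j'"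
    show "?B j \<inter> ?B j' = {}"
    proof (rule ccontr)
      assume "?B j \<inter> ?B j' \<noteq> {}"
      then obtain r where "r \<in> pos_coset (?y j)" "r \<in> pos_coset (?y j')" using cr by auto
      then have "r - ?y j \<in> \<int>" "r - ?y j' \<in> \<int>" by (auto simp: pos_coset_def)
      then have "(r - ?y j') - (r - ?y j) \<in> \<int>" by (rule Ints_diff[rotated])
      moreover have "(r - ?y j') - (r - ?y j) = \<epsilon> * (of_int (j - j') / of_int c)"
        using cr by (simp add: field_simps)
      ultimately have "real_of_int (j - j') / real_of_int c \<in> \<int>" by (simp only: \<epsilon>Z)
      then obtain i where "real_of_int (j - j') / real_of_int c = of_int i" by (auto elim: Ints_cases)
      then have "real_of_int (j - j') = real_of_int (i * c)" using cr by (simp add: field_simps)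
      then have "j - j' = i * c" by linarith
      then have "c dvd j - j'" by simp
      then have "j mod c = j' mod c" by (simp add: mod_eq_dvd_iff)
      then show False using jj by simp
    qed
  qed auto
  have h2: "(\<Union>j\<in>{0..<c}. ?B j) = pos_coset (\<epsilon> * x)"
  proof (intro equalityI subsetI)
    fix r assume "r \<in> (\<Union>j\<in>{0..<c}. ?B j)"
    then obtain j r' where r': "r = of_int c * r'" "r' > 0" "r' - ?y j \<in> \<int>" by (auto simp: pos_coset_def)
    have "of_int c * (r' - ?y j) + \<epsilon> * of_int j \<in> \<int>"
      by (intro Ints_add[OF Ints_mult[OF Ints_of_int r'(3)]]) (simp only: \<epsilon>Z Ints_of_int)
    moreover have "of_int c * (r' - ?y j) + \<epsilon> * of_int j = r - \<epsilon> * x"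
      using cr r'(1) by (simp add: field_simps)
    ultimately show "r \<in> pos_coset (\<epsilon> * x)" using r' cr by (simp add: pos_coset_def)
  next
    fix r assume r: "r \<in> pos_coset (\<epsilon> * x)"
    then have "\<epsilon> * (r - \<epsilon> * x) \<in> \<int>" using \<epsilon>Z by (simp add: pos_coset_def)
    then obtain i where i: "\<epsilon> * (r - \<epsilon> * x) = of_int i" by (auto elim: Ints_cases)
    then have ri: "r = \<epsilon> * (x + of_int i)" using \<epsilon>2
      by (metis (no_types, opaque_lifting) add.commute diff_eq_eq distrib_left mult.assoc mult_1)
    define j where "j = i mod c"
    have "r / of_int c - ?y j = \<epsilon> * of_int (i div c)"
    proof -
      have "i - j = c * (i div c)" by (simp add: j_def minus_mod_eq_mult_div)
      then have "real_of_int i - real_of_int j = real_of_int c * real_of_int (i div c)"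
        by (metis of_int_diff of_int_mult)
      then have "real_of_int i = real_of_int j + real_of_int c * real_of_int (i div c)" by simp
      then show ?thesis unfolding ri using cr by (simp add: field_simps)
    qed
    then have "r / of_int c \<in> pos_coset (?y j)"
      using r cr \<epsilon>Z[of "of_int (i div c)"] by (simp add: pos_coset_def)
    moreover have "r = of_int c * (r / of_int c)" using cr by simp
    moreover have "j \<in> {0..<c}" using c by (simp add: j_def)
    ultimately show "r \<in> (\<Union>j\<in>{0..<c}. ?B j)" by blast
  qed
  have "(?f has_sum coset_sum k (\<epsilon> * x) ?Z) (pos_coset (\<epsilon> * x))"
    using X by (intro coset_sum_has_sum) auto
  from has_sum_unique[OF this h1[unfolded h2]] show ?thesis .
qed


section \<open>Boundary limits of weighted Fourier series\<close>

lemma has_sum_int_symmetric: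
  fixes f :: "int \<Rightarrow> complex"
  assumes f: "(f has_sum S) UNIV"
  shows "(\<lambda>n. f (int (Suc n)) + f (- int (Suc n))) sums (S - f 0)"
proof -
  have inj: "inj (\<lambda>n. int (Suc n))" "inj (\<lambda>n. - int (Suc n))" by (auto simp: inj_on_def)
  have sf: "f summable_on A" for A
    using has_sum_imp_summable[OF f] summable_on_subset_banach by blast
  let ?A = "range (\<lambda>n. int (Suc n))" and ?B = "range (\<lambda>n. - int (Suc n))"
  have A: "(f has_sum infsum f ?A) ?A" and B: "(f has_sum infsum f ?B) ?B"
    by (intro has_sum_infsum sf)+
  have un: "?A \<union> ?B = UNIV - {0}"
  proof (intro equalityI subsetI)
    fix P :: int assume "P \<in> UNIV - {0}"
    then have "P = int (Suc (nat (P - 1))) \<or> P = - int (Suc (nat (- P - 1)))" by auto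
    then show "P \<in> ?A \<union> ?B" by blast
  qed auto
  have "(f has_sum (infsum f ?A + infsum f ?B)) (?A \<union> ?B)"
    by (rule has_sum_Un_disjoint[OF A B]) auto
  moreover have "(f has_sum (S - f 0)) (UNIV - {0})"
    using has_sum_Diff[OF f has_sum_finite[of "{0}" f]] by simp
  ultimately have S: "infsum f ?A + infsum f ?B = S - f 0"
    unfolding un by (rule has_sum_unique)
  have h1: "((\<lambda>n. f (int (Suc n))) has_sum infsum f ?A) UNIV"
    using A has_sum_reindex[OF inj(1), of f "infsum f ?A"] by (simp add: o_def)
  have h2: "((\<lambda>n. f (- int (Suc n))) has_sum infsum f ?B) UNIV"
    using B has_sum_reindex[OF inj(2), of f "infsum f ?B"] by (simp add: o_def)
  show ?thesis using sums_add[OF has_sum_imp_sums[OF h1] has_sum_imp_sums[OF h2]] unfolding S .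
qed

text \<open>Real-valued: up to sign 2 cos(2 pi p u) for even s and 2 sin(2 pi p u) for odd s. It is
  the pair of frequencies p and -p that survives in the real part.\<close>

definition theta :: "nat \<Rightarrow> real \<Rightarrow> nat \<Rightarrow> complex" where
  "theta s u p = \<i> ^ s * (ecis (real p * u) + (-1) ^ s * ecis (- (real p * u)))"

lemma norm_theta: "norm (theta s u p) \<le> 2"
proof -
  have "norm (theta s u p) = norm (ecis (real p * u) + (-1) ^ s * ecis (- (real p * u)))"
    by (simp add: theta_def norm_mult norm_power)
  also have "\<dots> \<le> 1 + 1" by (rule order_trans[OF norm_triangle_ineq]) (simp add: norm_mult norm_power)
  finally show ?thesis by simp
qed

lemma theta_1: "theta (Suc 0) u p = - 2 * of_real (sin (2 * pi * (real p * u)))"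
  by (simp add: theta_def ecis_def complex_eq_iff)

lemma theta_sums:
  assumes "s \<ge> 2"
  shows "(\<lambda>n. theta s u (Suc n) / of_nat (Suc n) ^ s) sums (- (\<i> ^ s * (2 * of_real pi * \<i>) ^ s / fact s * of_real (periodic_bernoulli s u)))"
proof -
  let ?w = "2 * of_real pi * \<i> :: complex"
  have w: "?w \<noteq> 0" by simp
  from has_sum_int_symmetric[OF periodic_bernoulli_fourier[OF assms, of u]]
  have "(\<lambda>n. - (fact s / (?w * of_nat (Suc n)) ^ s) * ecis (real (Suc n) * u) - fact s / (- (?w * of_nat (Suc n))) ^ s * ecis (- (real (Suc n) * u)))
     sums of_real (periodic_bernoulli s u)"
    by (simp del: of_nat_Suc)
  from sums_mult[OF this, of "- (\<i> ^ s * ?w ^ s / fact s)"]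
  have "(\<lambda>n. - (\<i> ^ s * ?w ^ s / fact s) * (- (fact s / (?w * of_nat (Suc n)) ^ s) * ecis (real (Suc n) * u) - fact s / (- (?w * of_nat (Suc n))) ^ s * ecis (- (real (Suc n) * u))))
     sums (- (\<i> ^ s * ?w ^ s / fact s * of_real (periodic_bernoulli s u)))" by simp
  moreover have "- (\<i> ^ s * ?w ^ s / fact s) * (- (fact s / (?w * of_nat (Suc n)) ^ s) * ecis (real (Suc n) * u) - fact s / (- (?w * of_nat (Suc n))) ^ s * ecis (- (real (Suc n) * u)))
     = theta s u (Suc n) / of_nat (Suc n) ^ s" for n
  proof -
    have ws: "?w ^ s \<noteq> 0" "(of_nat (Suc n) :: complex) ^ s \<noteq> 0" "(fact s :: complex) \<noteq> 0" using w by (simp_all del: of_nat_Suc)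
    have m: "(- (?w * of_nat (Suc n))) ^ s = (-1) ^ s * (?w ^ s * of_nat (Suc n) ^ s)"
      by (metis mult_minus1 power_mult_distrib)
    have mm: "1 / (-1 :: complex) ^ s = (-1) ^ s" by (cases "even s") auto
    have "fact s / ((-1) ^ s * (?w ^ s * of_nat (Suc n) ^ s)) = (-1) ^ s * (fact s / (?w ^ s * of_nat (Suc n) ^ s))"
      by (cases "even s") auto
    then show ?thesis unfolding m power_mult_distrib[of ?w] theta_def
      using ws by (simp add: field_simps del: of_nat_Suc)
  qed
  ultimately show ?thesis by simp
qed

lemma abel_summation:
  fixes a g :: "nat \<Rightarrow> complex"
  shows "(\<Sum>i<n. a i * g i) = (\<Sum>i<n. a i) * g n + (\<Sum>i<n. (\<Sum>l<Suc i. a l) * (g i - g (Suc i)))"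
  by (induction n) (simp_all add: algebra_simps)

lemma sin_partial_sums_bounded:
  assumes "u \<notin> \<int>"
  obtains B where "B \<ge> 0" "\<And>n. norm (\<Sum>i<n. complex_of_real (sin (2 * pi * (real (Suc i) * u)))) \<le> B"
proof -
  have ne: "ecis u \<noteq> 1"
  proof
    assume "ecis u = 1"
    then have "cos (2 * pi * u) = 1" by (simp add: ecis_def complex_eq_iff)
    then obtain n :: int where "2 * pi * u = of_int n * 2 * pi" unfolding cos_one_2pi_int by blast
    then have "u = of_int n" by simp
    with assms show False by simp
  qed
  have p: "ecis (real (Suc i) * u) = ecis u * ecis u ^ i" for i
    by (simp only: ecis_def Complex.DeMoivre cis_mult) (simp add: algebra_simps)
  have "norm (\<Sum>i<n. complex_of_real (sin (2 * pi * (real (Suc i) * u)))) \<le> 2 / norm (ecis u - 1)" for n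
  proof -
    have "(\<Sum>i<n. complex_of_real (sin (2 * pi * (real (Suc i) * u)))) = of_real (Im (\<Sum>i<n. ecis (real (Suc i) * u)))"
      by (simp add: Im_ecis del: of_nat_Suc)
    then have "norm (\<Sum>i<n. complex_of_real (sin (2 * pi * (real (Suc i) * u)))) \<le> norm (\<Sum>i<n. ecis (real (Suc i) * u))"
      by (simp only: norm_of_real abs_Im_le_cmod)
    also have "(\<Sum>i<n. ecis (real (Suc i) * u)) = ecis u * ((ecis u ^ n - 1) / (ecis u - 1))"
      unfolding p by (simp add: sum_distrib_left[symmetric] geometric_sum[OF ne])
    also have "norm \<dots> = norm (ecis u ^ n - 1) / norm (ecis u - 1)" by (simp add: norm_mult norm_divide)
    also have "\<dots> \<le> 2 / norm (ecis u - 1)"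
      using norm_triangle_ineq4[of "ecis u ^ n" 1] by (intro divide_right_mono) (auto simp: norm_power)
    finally show ?thesis .
  qed
  then show ?thesis using that[of "2 / norm (ecis u - 1)"] by simp
qed

text \<open>The series is the imaginary part of -Ln(1 - exp(-t) e(u)), and for u outside Z the point
  1 - e(u) lies off the branch cut, so Abel's limit is the value of the logarithm there.\<close>

lemma sin_exp_limit:
  assumes u: "u \<notin> \<int>"
  shows "\<And>t. t > 0 \<Longrightarrow> summable (\<lambda>n. complex_of_real (sin (2 * pi * (real (Suc n) * u)) / real (Suc n) * exp (- (real (Suc n) * t))))"
    "((\<lambda>t. suminf (\<lambda>n. complex_of_real (sin (2 * pi * (real (Suc n) * u)) / real (Suc n) * exp (- (real (Suc n) * t)))))
      \<longlongrightarrow> of_real (- (pi * periodic_bernoulli 1 u))) (at_right 0)"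
proof -
  let ?f = "\<lambda>t n. complex_of_real (sin (2 * pi * (real (Suc n) * u)) / real (Suc n) * exp (- (real (Suc n) * t)))"
  define w where "w t = of_real (exp (- t)) * ecis u" for t
  have s: "?f t sums of_real (Im (- Ln (1 - w t)))" if t: "t > 0" for t
  proof -
    have "norm (- w t) < 1" using t by (simp add: w_def norm_mult)
    from Ln_series'[OF this] have "(\<lambda>n. - (w t ^ n) / of_nat n) sums Ln (1 - w t)" by simp
    from sums_minus[OF this] have "(\<lambda>n. w t ^ n / of_nat n) sums (- Ln (1 - w t))" by simp
    then have "(\<lambda>n. w t ^ Suc n / of_nat (Suc n)) sums (- Ln (1 - w t))"
      by (subst sums_Suc_iff) simp
    from sums_Im[OF this] have "(\<lambda>n. Im (w t ^ Suc n / of_nat (Suc n))) sums Im (- Ln (1 - w t))" .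
    moreover have "Im (w t ^ Suc n / of_nat (Suc n)) = sin (2 * pi * (real (Suc n) * u)) / real (Suc n) * exp (- (real (Suc n) * t))" for n
    proof -
      have "w t ^ Suc n = of_real (exp (- (real (Suc n) * t))) * ecis (real (Suc n) * u)"
        unfolding w_def power_mult_distrib
        by (simp only: ecis_def Complex.DeMoivre of_real_power[symmetric] exp_of_nat_mult[symmetric]) (simp add: mult_ac)
      then show ?thesis by (simp add: Im_ecis Im_divide_of_nat del: of_nat_Suc power_Suc)
    qed
    ultimately show ?thesis by (simp only: sums_of_real_iff)
  qed
  show "\<And>t. t > 0 \<Longrightarrow> summable (?f t)" using s sums_summable by blast
  have re: "Re (1 - ecis u) > 0"
  proof -
    have "cos (2 * pi * u) \<noteq> 1"
    proof
      assume "cos (2 * pi * u) = 1"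
      then obtain n :: int where "2 * pi * u = of_int n * 2 * pi" unfolding cos_one_2pi_int by blast
      then have "u = of_int n" by simp
      with u show False by simp
    qed
    then show ?thesis using cos_le_one[of "2 * pi * u"] by (simp add: Re_ecis less_le del: cos_le_one)
  qed
  have "((\<lambda>t. of_real (Im (- Ln (1 - w t)))) \<longlongrightarrow> complex_of_real (Im (- Ln (1 - w 0)))) (at_right 0)"
  proof (intro tendsto_intros)
    show "(w \<longlongrightarrow> w 0) (at_right 0)" unfolding w_def by (intro tendsto_intros)
    show "1 - w 0 \<notin> \<real>\<^sub>\<le>\<^sub>0" using re by (auto simp: w_def complex_nonpos_Reals_iff)
  qed
  moreover have "eventually (\<lambda>t. of_real (Im (- Ln (1 - w t))) = suminf (?f t)) (at_right 0)"
    using eventually_at_right_less[of "0::real"] by eventually_elim (use s in \<open>simp add: sums_iff\<close>)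
  ultimately have "((\<lambda>t. suminf (?f t)) \<longlongrightarrow> complex_of_real (Im (- Ln (1 - w 0)))) (at_right 0)"
    by (rule Lim_transform_eventually)
  moreover have "Im (- Ln (1 - w 0)) = - (pi * periodic_bernoulli 1 u)"
  proof -
    define v where "v = frac u"
    have v: "v > 0" "v < 1" using u frac_lt_1[of u] frac_ge_0[of u] by (auto simp: v_def frac_eq_0_iff less_le)
    have ev: "ecis u = ecis v" by (rule ecis_cong) (simp add: v_def frac_def)
    have sp: "sin (pi * v) > 0" using v by (intro sin_gt_zero) auto
    \<comment> \<open>Polar form of 1 - e(v): since sin(pi v) > 0 for 0 < v < 1, the argument is pi
      v - pi / 2, whose negative is -pi times the sawtooth.\<close>
    have "1 - ecis v = of_real (2 * sin (pi * v)) * cis (pi * v - pi / 2)"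
    proof -
      have "cos (2 * (pi * v)) = 1 - 2 * sin (pi * v) ^ 2" by (rule cos_double_sin)
      moreover have "sin (2 * (pi * v)) = 2 * sin (pi * v) * cos (pi * v)" by (rule sin_double)
      ultimately show ?thesis
        by (simp add: complex_eq_iff Re_ecis Im_ecis cos_diff sin_diff power2_eq_square mult.assoc)
    qed
    also have "Ln \<dots> = of_real (ln (2 * sin (pi * v))) + \<i> * of_real (pi * v - pi / 2)"
    proof -
      have e: "of_real (2 * sin (pi * v)) * cis (pi * v - pi / 2) = exp (of_real (ln (2 * sin (pi * v))) + \<i> * of_real (pi * v - pi / 2))"
        using sp by (simp add: exp_add cis_conv_exp exp_of_real)
      have "pi * v < pi * 1" using v by (intro mult_strict_left_mono) auto
      moreover have "pi * v > 0" using v by simp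
      ultimately have "- pi < pi * v - pi / 2" "pi * v - pi / 2 \<le> pi" using pi_gt_zero by linarith+
      then show ?thesis unfolding e by (intro Ln_exp) simp_all
    qed
    finally have hI: "Im (Ln (1 - ecis v)) = pi * v - pi / 2" by simp
    have "bernoulli_poly 1 v = v - 1 / 2"
    proof -
      have d: "bernoulli_poly 1 1 - bernoulli_poly 1 0 = 1" using bernoulli_poly_1_minus_0[of 1] by simp
      have r: "bernoulli_poly 1 1 = - bernoulli_poly 1 0" using bernoulli_poly_reflect[of 1 0] by simp
      have b0: "fps_nth (bernoulli_gen 0) 0 = 1" using bernoulli_poly_0[of 0] unfolding bernoulli_poly_gen by simp
      have "bernoulli_poly 1 w = fps_nth (bernoulli_gen 0) 1 + w" for w
        using bernoulli_poly_sum[of 1 w] b0 by simp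
      from this[of v] this[of 0] d r show ?thesis by simp
    qed
    then have pb: "periodic_bernoulli 1 u = v - 1 / 2"
      using u by (simp add: periodic_bernoulli_def v_def frac_def)
    show ?thesis unfolding pb using hI by (simp add: w_def ev algebra_simps)
  qed
  ultimately show "((\<lambda>t. suminf (?f t)) \<longlongrightarrow> of_real (- (pi * periodic_bernoulli 1 u))) (at_right 0)" by simp
qed

lemma sawtooth_limit:
  fixes k J :: "real \<Rightarrow> complex"
  assumes J: "\<And>t. t > 0 \<Longrightarrow> k t = k0 * of_real (exp (- t)) + of_real t * J t"
    and J1: "\<And>t. t > 0 \<Longrightarrow> norm (J t) \<le> B"
    and J2: "\<And>t t'. 0 < t \<Longrightarrow> t \<le> t' \<Longrightarrow> norm (J t' - J t) \<le> B * (t' - t) / (1 + t) ^ 2"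
    and summ: "\<And>t. t > 0 \<Longrightarrow> summable (\<lambda>n. norm (k (real (Suc n) * t)))"
  shows "((\<lambda>t. suminf (\<lambda>n. of_real (sin (2 * pi * (real (Suc n) * u)) / real (Suc n)) * k (real (Suc n) * t)))
     \<longlongrightarrow> of_real (- (pi * periodic_bernoulli 1 u)) * k0) (at_right 0)"
proof (cases "u \<in> \<int>")
  case True
  have "sin (2 * pi * (real (Suc n) * u)) = 0" for n
  proof -
    have "real (Suc n) * u \<in> \<int>" using True by (intro Ints_mult) auto
    then have "Im (ecis (real (Suc n) * u)) = 0" by (simp add: ecis_Ints)
    then show ?thesis by (simp add: Im_ecis del: of_nat_Suc)
  qed
  then show ?thesis using True by (simp add: periodic_bernoulli_def del: of_nat_Suc)
next
  case False
  obtain S where S: "S \<ge> 0" "\<And>n. norm (\<Sum>i<n. complex_of_real (sin (2 * pi * (real (Suc i) * u)))) \<le> S"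
    using sin_partial_sums_bounded[OF False] by metis
  have B: "B \<ge> 0" using J1[of 1] norm_ge_zero order_trans by (metis zero_less_one)
  let ?a = "\<lambda>n. complex_of_real (sin (2 * pi * (real (Suc n) * u)))"
  let ?e = "\<lambda>t n. complex_of_real (sin (2 * pi * (real (Suc n) * u)) / real (Suc n) * exp (- (real (Suc n) * t)))"
  let ?F = "\<lambda>t n. of_real (sin (2 * pi * (real (Suc n) * u)) / real (Suc n)) * k (real (Suc n) * t)"
  have sF: "summable (?F t)" if t: "t > 0" for t
  proof (rule summable_norm_cancel, rule summable_comparison_test[OF _ summ[OF t]])
    have "norm (?F t n) \<le> 1 * norm (k (real (Suc n) * t))" for n
      unfolding norm_mult
    proof (intro mult_right_mono)
      have "\<bar>sin (2 * pi * (real (Suc n) * u))\<bar> / real (Suc n) \<le> 1 / 1" by (intro frac_le) auto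
      then show "norm (complex_of_real (sin (2 * pi * (real (Suc n) * u)) / real (Suc n))) \<le> 1"
        unfolding norm_of_real abs_divide by (simp del: of_nat_Suc)
    qed auto
    then show "\<exists>N. \<forall>n\<ge>N. norm (norm (?F t n)) \<le> norm (k (real (Suc n) * t))" by simp
  qed
  have F_eq: "?F t n = k0 * ?e t n + ?a n * (of_real t * J (real (Suc n) * t))" if t: "t > 0" for t n
  proof -
    have p: "real (Suc n) * t > 0" using t by simp
    show ?thesis unfolding J[OF p] using of_nat_neq_0[of n, where ?'a = complex]
      by (simp add: field_simps del: of_nat_Suc)
  qed
  have bound: "norm (suminf (?F t) - k0 * suminf (?e t)) \<le> 2 * S * B * t" if t: "t > 0" for t
  proof -
    define g where "g n = of_real t * J (real (Suc n) * t)" for n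
    have "(\<lambda>n. ?F t n - k0 * ?e t n) sums (suminf (?F t) - k0 * suminf (?e t))"
      using sF[OF t] sin_exp_limit(1)[OF False t] by (intro sums_diff sums_mult summable_sums)
    then have ag: "(\<lambda>n. ?a n * g n) sums (suminf (?F t) - k0 * suminf (?e t))"
      unfolding F_eq[OF t] g_def by simp
    have "norm (\<Sum>i<n. ?a i * g i) \<le> 2 * S * B * t" for n
    proof -
      have g1: "norm (g n) \<le> B * t" using J1[of "real (Suc n) * t"] t by (simp add: g_def norm_mult mult.commute[of B] del: of_nat_Suc)
      have g2: "norm (g i - g (Suc i)) \<le> B * t * (1 / (1 + real i * t) - 1 / (1 + real (Suc i) * t))" for i
      proof -
        have p: "0 < real (Suc i) * t" "real (Suc i) * t \<le> real (Suc (Suc i)) * t" using t by (auto intro: mult_right_mono)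
        have "norm (g i - g (Suc i)) = t * norm (J (real (Suc (Suc i)) * t) - J (real (Suc i) * t))"
          using t by (simp add: g_def norm_minus_commute flip: right_diff_distrib norm_mult)
             (simp add: norm_mult norm_minus_commute)
        also have "\<dots> \<le> t * (B * (real (Suc (Suc i)) * t - real (Suc i) * t) / (1 + real (Suc i) * t) ^ 2)"
          using t by (intro mult_left_mono J2 p) auto
        also have "\<dots> = B * t * (t / ((1 + real (Suc i) * t) * (1 + real (Suc i) * t)))"
          by (simp add: algebra_simps power2_eq_square)
        \<comment> \<open>Replacing one factor of the square by its predecessor makes the sum
          telescope, uniformly in n.\<close>
        also have "\<dots> \<le> B * t * (t / ((1 + real i * t) * (1 + real (Suc i) * t)))"
          using t B by (intro mult_left_mono divide_left_mono mult_right_mono mult_pos_pos) (auto simp: add_pos_nonneg algebra_simps)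
        also have "t / ((1 + real i * t) * (1 + real (Suc i) * t)) = 1 / (1 + real i * t) - 1 / (1 + real (Suc i) * t)"
        proof -
          have "1 + real i * t > 0" "1 + real (Suc i) * t > 0" using t by (auto intro: add_pos_nonneg)
          then show ?thesis by (simp add: field_simps)
        qed
        finally show ?thesis .
      qed
      have e: "(\<Sum>i<n. ?a i * g i) = (\<Sum>i<n. ?a i) * g n + (\<Sum>i<n. (\<Sum>l<Suc i. ?a l) * (g i - g (Suc i)))"
        by (rule abel_summation)
      have "norm (\<Sum>i<n. ?a i * g i) \<le> norm ((\<Sum>i<n. ?a i) * g n) + norm (\<Sum>i<n. (\<Sum>l<Suc i. ?a l) * (g i - g (Suc i)))"
        unfolding e by (rule norm_triangle_ineq)
      also have "norm ((\<Sum>i<n. ?a i) * g n) \<le> S * (B * t)"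
        unfolding norm_mult using S g1 by (intro mult_mono) auto
      also have "norm (\<Sum>i<n. (\<Sum>l<Suc i. ?a l) * (g i - g (Suc i))) \<le>
          (\<Sum>i<n. S * (B * t * (1 / (1 + real i * t) - 1 / (1 + real (Suc i) * t))))"
      proof (rule sum_norm_le)
        fix i
        show "norm ((\<Sum>l<Suc i. ?a l) * (g i - g (Suc i))) \<le> S * (B * t * (1 / (1 + real i * t) - 1 / (1 + real (Suc i) * t)))"
          unfolding norm_mult by (rule mult_mono[OF S(2) g2 S(1)]) simp
      qed
      also have "\<dots> = S * (B * t) * (\<Sum>i<n. 1 / (1 + real i * t) - 1 / (1 + real (Suc i) * t))"
        by (simp only: sum_distrib_left mult.assoc)
      also have "\<dots> \<le> S * (B * t) * 1"
      proof (rule mult_left_mono)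
        have "(\<Sum>i<n. 1 / (1 + real i * t) - 1 / (1 + real (Suc i) * t)) = 1 / (1 + real 0 * t) - 1 / (1 + real n * t)"
          by (rule sum_lessThan_telescope')
        also have "\<dots> \<le> 1" using t by (simp add: add_pos_nonneg)
        finally show "(\<Sum>i<n. 1 / (1 + real i * t) - 1 / (1 + real (Suc i) * t)) \<le> 1" .
      qed (use S B t in auto)
      finally show ?thesis by (simp add: algebra_simps)
    qed
    then show ?thesis using ag by (intro LIMSEQ_le_const2[OF tendsto_norm[OF ag[unfolded sums_def]]]) auto
  qed
  have "((\<lambda>t. suminf (?F t) - k0 * suminf (?e t)) \<longlongrightarrow> 0) (at_right 0)"
  proof (rule Lim_null_comparison)
    show "\<forall>\<^sub>F t in at_right 0. norm (suminf (?F t) - k0 * suminf (?e t)) \<le> 2 * S * B * t"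
      using eventually_at_right_less[of "0::real"] by eventually_elim (use bound in auto)
    have "((\<lambda>t. 2 * S * B * t) \<longlongrightarrow> 2 * S * B * 0) (at_right 0)" by (intro tendsto_intros)
    then show "((\<lambda>t. 2 * S * B * t) \<longlongrightarrow> 0) (at_right 0)" by simp
  qed
  from tendsto_add[OF this tendsto_mult[OF tendsto_const[of k0] sin_exp_limit(2)[OF False]]]
  show ?thesis by (simp add: mult.commute del: of_nat_Suc)
qed


text \<open>The two coset sums have the same pole, which cancels in f; so on the positive axis f is
  a difference of coset sums and decays exponentially, as does f 0 exp(-t). Their difference
  vanishes at 0, hence J = H / t is holomorphic there, and its derivative is O(1 / (1 +
  t)^2).\<close>

lemma sawtooth_weight:
  fixes x :: real and k :: nat
  defines "f \<equiv> (\<lambda>z. (-1) ^ k * (coset_reg k x z - coset_reg k (- x) z))"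
  obtains J B where "\<And>t. t > 0 \<Longrightarrow> f (of_real t) = f 0 * of_real (exp (- t)) + of_real t * J t"
    "\<And>t::real. t > 0 \<Longrightarrow> norm (J t) \<le> B"
    "\<And>t t'. 0 < t \<Longrightarrow> t \<le> t' \<Longrightarrow> norm (J t' - J t) \<le> B * (t' - t) / (1 + t) ^ 2"
proof -
  define f' where "f' z = (-1) ^ k * (coset_reg (Suc k) x z - coset_reg (Suc k) (- x) z)" for z
  have fd: "(f has_field_derivative f' z) (at z)" if "z \<in> strip" for z
    unfolding f_def f'_def by (intro DERIV_cmult DERIV_diff coset_reg_deriv that)
  define H where "H z = f z - f 0 * exp (- z)" for z
  define H' where "H' z = f' z + f 0 * exp (- z)" for z
  have Hd: "(H has_field_derivative H' z) (at z)" if "z \<in> strip" for z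
    unfolding H_def[abs_def] H'_def using that by (auto intro!: derivative_eq_intros fd)
  have hol: "H holomorphic_on strip" using Hd open_strip by (meson holomorphic_on_open)
  define Jc where "Jc z = (if z = 0 then deriv H 0 else (H z - H 0) / (z - 0))" for z
  have Jhol: "Jc holomorphic_on strip"
    unfolding Jc_def[abs_def] by (rule pole_lemma_open[OF hol open_strip])
  have H0: "H 0 = 0" by (simp add: H_def)
  have Jd: "(Jc has_field_derivative deriv Jc z) (at z)" if "z \<in> strip" for z
    using holomorphic_derivI[OF Jhol open_strip that] .
  \<comment> \<open>At most 1, so the rate \<open>\<epsilon>\<close> also covers the comparison
    function exp(-t).\<close>
  define \<epsilon> where "\<epsilon> = min (coset_rep x) (coset_rep (- x))"
  have \<epsilon>: "\<epsilon> > 0" "\<epsilon> \<le> coset_rep x" "\<epsilon> \<le> coset_rep (- x)" "\<epsilon> \<le> 1"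
    using coset_rep[of x] coset_rep[of "- x"] by (auto simp: \<epsilon>_def)
  have dec: "\<exists>C\<ge>0. \<forall>t\<ge>1. norm (coset_sum j y (of_real t)) \<le> C * exp (- (\<epsilon> * t))" if y: "\<epsilon> \<le> coset_rep y" for j y
  proof -
    obtain C where C: "\<And>X. Re X \<ge> 1 \<Longrightarrow> norm (coset_sum j y X) \<le> C * exp (- (coset_rep y * Re X))"
      using coset_sum_decay[OF zero_less_one] by metis
    have "norm (coset_sum j y (of_real t)) \<le> \<bar>C\<bar> * exp (- (\<epsilon> * t))" if t: "t \<ge> 1" for t
    proof -
      have "norm (coset_sum j y (of_real t)) \<le> C * exp (- (coset_rep y * t))" using C[of "of_real t"] t by simp
      also have "\<dots> \<le> \<bar>C\<bar> * exp (- (\<epsilon> * t))" using y t by (intro mult_mono) auto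
      finally show ?thesis .
    qed
    then show ?thesis by (intro exI[of _ "\<bar>C\<bar>"]) auto
  qed
  have diff: "(-1) ^ j * (coset_reg j x (of_real t) - coset_reg j (- x) (of_real t)) =
      coset_sum j x (of_real t) - coset_sum j (- x) (of_real t)" if "t > 0" for j t
    using coset_sum_eq_reg[of "of_real t" j x] coset_sum_eq_reg[of "of_real t" j "- x"] that
    by (simp add: right_diff_distrib)
  obtain C1 where C1: "C1 \<ge> 0" "\<And>t. t \<ge> 1 \<Longrightarrow> norm (coset_sum k x (of_real t)) \<le> C1 * exp (- (\<epsilon> * t))"
    using dec[OF \<epsilon>(2)] by metis
  obtain C2 where C2: "C2 \<ge> 0" "\<And>t. t \<ge> 1 \<Longrightarrow> norm (coset_sum k (- x) (of_real t)) \<le> C2 * exp (- (\<epsilon> * t))"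
    using dec[OF \<epsilon>(3)] by metis
  obtain C3 where C3: "C3 \<ge> 0" "\<And>t. t \<ge> 1 \<Longrightarrow> norm (coset_sum (Suc k) x (of_real t)) \<le> C3 * exp (- (\<epsilon> * t))"
    using dec[OF \<epsilon>(2)] by metis
  obtain C4 where C4: "C4 \<ge> 0" "\<And>t. t \<ge> 1 \<Longrightarrow> norm (coset_sum (Suc k) (- x) (of_real t)) \<le> C4 * exp (- (\<epsilon> * t))"
    using dec[OF \<epsilon>(3)] by metis
  define C where "C = C1 + C2 + C3 + C4 + norm (f 0)"
  have Cge: "C \<ge> 0" using C1 C2 C3 C4 by (simp add: C_def)
  have e1: "norm (f 0 * exp (- complex_of_real t)) \<le> norm (f 0) * exp (- (\<epsilon> * t))" if "t \<ge> 1" for t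
  proof -
    have "\<epsilon> * t \<le> 1 * t" using \<epsilon> that by (intro mult_right_mono) auto
    then show ?thesis by (simp add: norm_mult norm_exp_eq_Re mult_left_mono)
  qed
  have Hb: "norm (H (of_real t)) \<le> C * exp (- (\<epsilon> * t))" if t: "t \<ge> 1" for t
  proof -
    have "H (of_real t) = (coset_sum k x (of_real t) - coset_sum k (- x) (of_real t)) - f 0 * exp (- complex_of_real t)"
      using diff[of t k] t by (simp add: H_def f_def)
    then have "norm (H (of_real t)) \<le> norm (coset_sum k x (of_real t)) + norm (coset_sum k (- x) (of_real t)) + norm (f 0 * exp (- complex_of_real t))"
      using norm_triangle_ineq4[of "coset_sum k x (of_real t) - coset_sum k (- x) (of_real t)" "f 0 * exp (- complex_of_real t)"]
        norm_triangle_ineq4[of "coset_sum k x (of_real t)" "coset_sum k (- x) (of_real t)"] by simp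
    also have "\<dots> \<le> (C1 + C2 + norm (f 0)) * exp (- (\<epsilon> * t))" using C1(2)[OF t] C2(2)[OF t] e1[OF t] by (simp add: algebra_simps)
    also have "\<dots> \<le> C * exp (- (\<epsilon> * t))" using C3(1) C4(1) by (intro mult_right_mono) (auto simp: C_def)
    finally show ?thesis .
  qed
  have H'b: "norm (H' (of_real t)) \<le> C * exp (- (\<epsilon> * t))" if t: "t \<ge> 1" for t
  proof -
    have "f' (of_real t) = - (coset_sum (Suc k) x (of_real t) - coset_sum (Suc k) (- x) (of_real t))"
    proof -
      have "f' (of_real t) = - ((-1) ^ Suc k * (coset_reg (Suc k) x (of_real t) - coset_reg (Suc k) (- x) (of_real t)))"
        by (simp add: f'_def)
      also have "\<dots> = - (coset_sum (Suc k) x (of_real t) - coset_sum (Suc k) (- x) (of_real t))"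
        using t by (subst diff) auto
      finally show ?thesis .
    qed
    then have "H' (of_real t) = f 0 * exp (- complex_of_real t) - (coset_sum (Suc k) x (of_real t) - coset_sum (Suc k) (- x) (of_real t))"
      by (simp add: H'_def)
    then have "norm (H' (of_real t)) \<le> norm (coset_sum (Suc k) x (of_real t)) + norm (coset_sum (Suc k) (- x) (of_real t)) + norm (f 0 * exp (- complex_of_real t))"
      using norm_triangle_ineq4[of "f 0 * exp (- complex_of_real t)" "coset_sum (Suc k) x (of_real t) - coset_sum (Suc k) (- x) (of_real t)"]
        norm_triangle_ineq4[of "coset_sum (Suc k) x (of_real t)" "coset_sum (Suc k) (- x) (of_real t)"] by simp
    also have "\<dots> \<le> (C3 + C4 + norm (f 0)) * exp (- (\<epsilon> * t))" using C3(2)[OF t] C4(2)[OF t] e1[OF t] by (simp add: algebra_simps)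
    also have "\<dots> \<le> C * exp (- (\<epsilon> * t))" using C1(1) C2(1) by (intro mult_right_mono) (auto simp: C_def)
    finally show ?thesis .
  qed
  have seg: "compact (of_real ` {0..1::real} :: complex set)" by (intro compact_continuous_image continuous_intros) auto
  have "compact (Jc ` of_real ` {0..1::real})"
    by (intro compact_continuous_image seg holomorphic_on_imp_continuous_on holomorphic_on_subset[OF Jhol]) auto
  then obtain B1 where B1: "\<And>t::real. t \<in> {0..1} \<Longrightarrow> norm (Jc (of_real t)) \<le> B1"
    by (metis bounded_iff compact_imp_bounded imageI)
  have "compact (deriv Jc ` of_real ` {0..1::real})"
    by (intro compact_continuous_image seg holomorphic_on_imp_continuous_on
        holomorphic_on_subset[OF holomorphic_deriv[OF Jhol open_strip]]) auto
  then obtain B2 where B2: "\<And>t::real. t \<in> {0..1} \<Longrightarrow> norm (deriv Jc (of_real t)) \<le> B2"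
    by (metis bounded_iff compact_imp_bounded imageI)
  \<comment> \<open>From (1 + t)^2 <= 2 / \<open>\<epsilon>\<close>^2 exp(\<open>\<epsilon>\<close>
    (1 + t)): it trades the exponential decay for 1 / (1 + t)^2 when t > 1. On [0, 1] the same is
    achieved by the factor 4 at B2.\<close>
  define D where "D = 2 * C * (fact 2 / \<epsilon> ^ 2 * exp \<epsilon>)"
  have D: "D \<ge> 0" using Cge by (simp add: D_def)
  have B1': "B1 \<ge> 0" "B2 \<ge> 0"
    using order.trans[OF norm_ge_zero B1[of 0]] order.trans[OF norm_ge_zero B2[of 0]] by simp_all
  have dJ: "norm (deriv Jc (of_real t)) \<le> (4 * B2 + D) / (1 + t) ^ 2" if t: "t \<ge> 0" for t :: real
  proof (cases "t \<le> 1")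
    case True
    have "(1 + t) ^ 2 \<le> (1 + 1) ^ 2" using True t by (intro power_mono) auto
    then have "B2 * (1 + t) ^ 2 \<le> B2 * 4" using B1' by (intro mult_left_mono) auto
    then have "B2 \<le> (4 * B2 + D) / (1 + t) ^ 2"
      using t D by (subst pos_le_divide_eq) (auto intro: zero_less_power add_pos_nonneg)
    then show ?thesis using B2[of t] True t by simp
  next
    case False
    then have t1: "t \<ge> 1" by simp
    have quot: "((\<lambda>z. H z / z) has_field_derivative (H' (of_real t) * of_real t - H (of_real t) * 1) / (of_real t * of_real t)) (at (of_real t))"
      using t1 by (intro DERIV_divide Hd DERIV_ident) auto
    have "(Jc has_field_derivative (H' (of_real t) * of_real t - H (of_real t) * 1) / (of_real t * of_real t)) (at (of_real t))"
      by (rule has_field_derivative_transform_within_open[OF quot, of "- {0}"]) (use t1 in \<open>auto simp: Jc_def H0\<close>)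
    then have "deriv Jc (of_real t) = (H' (of_real t) * of_real t - H (of_real t)) / (of_real t * of_real t)"
      by (simp add: DERIV_imp_deriv)
    then have "norm (deriv Jc (of_real t)) = norm (H' (of_real t) * of_real t - H (of_real t)) / (t * t)"
      using t by (simp add: norm_divide norm_mult)
    also have "\<dots> \<le> (norm (H' (of_real t)) * t + norm (H (of_real t))) / (t * t)"
      using norm_triangle_ineq4[of "H' (of_real t) * of_real t" "H (of_real t)"] t by (intro divide_right_mono) (auto simp: norm_mult)
    also have "\<dots> \<le> (C * exp (- (\<epsilon> * t)) * (t * t) + C * exp (- (\<epsilon> * t)) * (t * t)) / (t * t)"
    proof (intro divide_right_mono add_mono)
      have "norm (H' (of_real t)) * t \<le> C * exp (- (\<epsilon> * t)) * t" using H'b[OF t1] t by (intro mult_right_mono) auto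
      also have "\<dots> \<le> C * exp (- (\<epsilon> * t)) * (t * t)" using t1 Cge by (intro mult_left_mono) auto
      finally show "norm (H' (of_real t)) * t \<le> C * exp (- (\<epsilon> * t)) * (t * t)" .
      have "1 * 1 \<le> t * t" using t1 by (intro mult_mono) auto
      then have "C * exp (- (\<epsilon> * t)) * 1 \<le> C * exp (- (\<epsilon> * t)) * (t * t)" using Cge by (intro mult_left_mono) auto
      then show "norm (H (of_real t)) \<le> C * exp (- (\<epsilon> * t)) * (t * t)" using Hb[OF t1] by simp
    qed (use t in auto)
    also have "\<dots> = 2 * C * exp (- (\<epsilon> * t))" using t1 by (simp add: field_simps)
    also have "\<dots> \<le> D / (1 + t) ^ 2"
    proof -
      have "(1 + t) ^ 2 \<le> fact 2 / \<epsilon> ^ 2 * exp (\<epsilon> * (1 + t))" using t \<epsilon> by (intro power_le_exp) auto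
      then have "exp (- (\<epsilon> * t)) * (1 + t) ^ 2 \<le> exp (- (\<epsilon> * t)) * (fact 2 / \<epsilon> ^ 2 * exp (\<epsilon> * (1 + t)))"
        by (intro mult_left_mono) auto
      also have "\<dots> = fact 2 / \<epsilon> ^ 2 * (exp (- (\<epsilon> * t)) * exp (\<epsilon> * (1 + t)))" by simp
      also have "exp (- (\<epsilon> * t)) * exp (\<epsilon> * (1 + t)) = exp \<epsilon>" by (simp add: algebra_simps flip: exp_add)
      finally have "2 * C * (exp (- (\<epsilon> * t)) * (1 + t) ^ 2) \<le> D"
        unfolding D_def using Cge by (intro mult_left_mono) auto
      then show ?thesis using t by (subst pos_le_divide_eq) (auto intro: zero_less_power add_pos_nonneg simp: mult_ac)
    qed
    also have "\<dots> \<le> (4 * B2 + D) / (1 + t) ^ 2" using B1' by (intro divide_right_mono) auto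
    finally show ?thesis .
  qed
  define B where "B = B1 + C + (4 * B2 + D)"
  have Bge: "B \<ge> 4 * B2 + D" using B1' Cge by (simp add: B_def)
  show ?thesis
  proof (rule that[of "\<lambda>t. Jc (of_real t)" B])
    fix t :: real assume t: "t > 0"
    show "f (of_real t) = f 0 * of_real (exp (- t)) + of_real t * Jc (of_real t)"
      using t by (simp add: Jc_def H0 H_def exp_of_real[symmetric])
    show "norm (Jc (of_real t)) \<le> B"
    proof (cases "t \<le> 1")
      case True
      then show ?thesis using B1[of t] t Cge B1' D by (simp add: B_def)
    next
      case False
      have "norm (Jc (of_real t)) = norm (H (of_real t)) / t" using t by (simp add: Jc_def H0 norm_divide)
      also have "\<dots> \<le> norm (H (of_real t)) / 1" using False by (intro divide_left_mono) auto
      also have "\<dots> \<le> C * exp (- (\<epsilon> * t))" using Hb[of t] False by simp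
      also have "\<dots> \<le> C * 1" using Cge \<epsilon> t by (intro mult_left_mono) auto
      finally show ?thesis using B1' D by (simp add: B_def)
    qed
    fix t' assume tt: "t \<le> t'"
    have "norm (Jc (of_real t') - Jc (of_real t)) \<le> (4 * B2 + D) / (1 + t) ^ 2 * norm (complex_of_real t' - of_real t)"
    proof (rule field_differentiable_bound[of "closed_segment (of_real t) (of_real t')" Jc "deriv Jc"])
      fix z assume "z \<in> closed_segment (complex_of_real t) (of_real t')"
      then obtain r where r: "z = of_real r" "t \<le> r"
        using tt by (auto simp: closed_segment_of_real closed_segment_eq_real_ivl)
      show "(Jc has_field_derivative deriv Jc z) (at z within closed_segment (complex_of_real t) (of_real t'))"
        using Jd[of z] r by (auto intro: has_field_derivative_at_within)
      have "norm (deriv Jc z) \<le> (4 * B2 + D) / (1 + r) ^ 2" using dJ[of r] r t by simp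
      also have "\<dots> \<le> (4 * B2 + D) / (1 + t) ^ 2"
        using r t B1' D by (intro divide_left_mono power_mono mult_pos_pos zero_less_power) auto
      finally show "norm (deriv Jc z) \<le> (4 * B2 + D) / (1 + t) ^ 2" .
    qed auto
    also have "norm (complex_of_real t' - of_real t) = t' - t" using tt by (simp flip: of_real_diff)
    also have "(4 * B2 + D) / (1 + t) ^ 2 * (t' - t) \<le> B / (1 + t) ^ 2 * (t' - t)"
      using Bge tt by (intro mult_right_mono divide_right_mono) auto
    finally show "norm (Jc (of_real t') - Jc (of_real t)) \<le> B * (t' - t) / (1 + t) ^ 2" by simp
  qed
qed

lemma moment_summable:
  assumes "t > 0"
  shows "summable (\<lambda>n. norm (moment e k x (of_real (real (Suc n) * t))))"
proof -
  obtain C where C: "\<And>t'. t' \<ge> t \<Longrightarrow> norm (moment e k x (of_real t')) \<le> C * exp (- (coset_rep x / 2 * t'))"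
    using moment_decay[OF assms] by metis
  show ?thesis
  proof (rule summable_comparison_test)
    have "exp (- (coset_rep x / 2 * t)) < 1" using coset_rep(1)[of x] assms by simp
    then have "summable (\<lambda>n. exp (- (coset_rep x / 2 * t)) ^ n)" by (intro summable_geometric) simp
    then show "summable (\<lambda>n. C * exp (- (coset_rep x / 2 * t)) ^ Suc n)"
      by (intro summable_mult) (simp only: summable_Suc_iff)
    have "norm (norm (moment e k x (of_real (real (Suc n) * t)))) \<le> C * exp (- (coset_rep x / 2 * t)) ^ Suc n" for n
    proof -
      have "t \<le> real (Suc n) * t" using assms by simp
      from C[OF this] have "norm (moment e k x (of_real (real (Suc n) * t))) \<le> C * exp (- (coset_rep x / 2 * (real (Suc n) * t)))" .
      also have "exp (- (coset_rep x / 2 * (real (Suc n) * t))) = exp (- (coset_rep x / 2 * t)) ^ Suc n"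
        by (simp only: exp_of_nat_mult[symmetric]) (simp add: mult_ac)
      finally show ?thesis by simp
    qed
    then show "\<exists>N. \<forall>n\<ge>N. norm (norm (moment e k x (of_real (real (Suc n) * t)))) \<le> C * exp (- (coset_rep x / 2 * t)) ^ Suc n"
      by blast
  qed
qed

lemma moment_reg_bounded:
  assumes "e \<le> k"
  obtains B where "\<And>t. t \<ge> 0 \<Longrightarrow> norm (moment_reg e k x (of_real t)) \<le> B"
proof -
  have "compact (of_real ` {0..1::real} :: complex set)" by (intro compact_continuous_image continuous_intros) auto
  then have "compact (moment_reg e k x ` of_real ` {0..1::real})"
    by (intro compact_continuous_image holomorphic_on_imp_continuous_on holomorphic_on_subset[OF moment_reg_holomorphic]) auto
  then obtain B1 where B1: "\<And>t::real. t \<in> {0..1} \<Longrightarrow> norm (moment_reg e k x (of_real t)) \<le> B1"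
    by (metis bounded_iff compact_imp_bounded imageI)
  obtain C where C: "C \<ge> 0" "\<And>t. t \<ge> 1 \<Longrightarrow> norm (moment e k x (of_real t)) \<le> C * exp (- (coset_rep x / 2 * t))"
    using moment_decay[OF zero_less_one] by metis
  have B10: "B1 \<ge> 0" using order.trans[OF norm_ge_zero B1[of 0]] by simp
  have "norm (moment_reg e k x (of_real t)) \<le> B1 + (C + \<bar>moment_pole e k\<bar>)" if t: "t \<ge> 0" for t
  proof (cases "t \<le> 1")
    case True
    then show ?thesis using B1[of t] t C(1) by simp
  next
    case False
    then have t1: "t \<ge> 1" by simp
    have "moment_reg e k x (of_real t) = moment e k x (of_real t) - of_real (moment_pole e k) / of_real t ^ Suc (k - e)"
      using moment_eq_reg[of "of_real t" e k x] t1 assms by simp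
    then have "norm (moment_reg e k x (of_real t)) \<le> norm (moment e k x (of_real t)) + \<bar>moment_pole e k\<bar> / t ^ Suc (k - e)"
      using norm_triangle_ineq4[of "moment e k x (of_real t)" "of_real (moment_pole e k) / of_real t ^ Suc (k - e)"] t
      by (simp add: norm_divide norm_power norm_mult)
    also have "\<dots> \<le> C * 1 + \<bar>moment_pole e k\<bar> / 1"
    proof (intro add_mono divide_left_mono)
      have "exp (- (coset_rep x / 2 * t)) \<le> 1" using coset_rep(1)[of x] t by simp
      then have "C * exp (- (coset_rep x / 2 * t)) \<le> C * 1" using C(1) by (intro mult_left_mono)
      then show "norm (moment e k x (of_real t)) \<le> C * 1" using C(2)[OF t1] by simp
      show "1 \<le> t ^ Suc (k - e)" using t1 by (rule one_le_power)
    qed (use t1 in auto)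
    finally show ?thesis using B10 by simp
  qed
  then show ?thesis using that by blast
qed

text \<open>The combination of x and -x that multiplies \<open>theta\<close> with s = e + 1 in the
  real part of the period; the sign is the one of \<open>theta\<close>.\<close>

definition moment_reg_sym :: "nat \<Rightarrow> nat \<Rightarrow> real \<Rightarrow> complex \<Rightarrow> complex" where
  "moment_reg_sym e k x X = moment_reg e k x X + (-1) ^ Suc e * moment_reg e k (- x) X"

definition moment_sym :: "nat \<Rightarrow> nat \<Rightarrow> real \<Rightarrow> complex \<Rightarrow> complex" where
  "moment_sym e k x X = moment e k x X + (-1) ^ Suc e * moment e k (- x) X"

text \<open>For e >= 1 the factor 1 / n^(e+1) and bounded weights permit termwise passage to the
  limit by Tannery's theorem. For e = 0 the symmetrised weight is a difference, and the sawtooth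
  limit takes over.\<close>

lemma moment_series_limit:
  assumes e: "e \<le> k"
  shows "((\<lambda>t. suminf (\<lambda>n. theta (Suc e) u (Suc n) / of_nat (Suc n) ^ Suc e * moment_reg_sym e k x (of_real (real (Suc n) * t))))
    \<longlongrightarrow> - (\<i> ^ Suc e * (2 * of_real pi * \<i>) ^ Suc e / fact (Suc e) * of_real (periodic_bernoulli (Suc e) u)) * moment_reg_sym e k x 0)
    (at_right 0)"
proof (cases "e = 0")
  case True
  obtain J B where J: "\<And>t. t > 0 \<Longrightarrow> (-1) ^ k * (coset_reg k x (of_real t) - coset_reg k (- x) (of_real t)) =
      (-1) ^ k * (coset_reg k x 0 - coset_reg k (- x) 0) * of_real (exp (- t)) + of_real t * J t"
    "\<And>t::real. t > 0 \<Longrightarrow> norm (J t) \<le> B"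
    "\<And>t t'. 0 < t \<Longrightarrow> t \<le> t' \<Longrightarrow> norm (J t' - J t) \<le> B * (t' - t) / (1 + t) ^ 2"
    using sawtooth_weight[of k x] by metis
  have sym: "moment_reg_sym e k x z = (-1) ^ k * (coset_reg k x z - coset_reg k (- x) z)" for z
    by (simp add: moment_reg_sym_def True right_diff_distrib)
  have sm: "summable (\<lambda>n. norm (moment_reg_sym e k x (of_real (real (Suc n) * t))))" if t: "t > 0" for t
  proof (rule summable_comparison_test)
    show "summable (\<lambda>n. norm (moment 0 k x (of_real (real (Suc n) * t))) + norm (moment 0 k (- x) (of_real (real (Suc n) * t))))"
      by (intro summable_add moment_summable t)
    have "norm (norm (moment_reg_sym e k x (of_real (real (Suc n) * t)))) \<le>
      norm (moment 0 k x (of_real (real (Suc n) * t))) + norm (moment 0 k (- x) (of_real (real (Suc n) * t)))" for n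
    proof -
      define t' where "t' = real (Suc n) * t"
      have t': "t' > 0" using t by (simp add: t'_def)
      have "moment_reg_sym e k x (of_real t') = moment 0 k x (of_real t') - moment 0 k (- x) (of_real t')"
        using coset_sum_eq_reg[of "of_real t'" k x] coset_sum_eq_reg[of "of_real t'" k "- x"] t'
        by (simp add: sym right_diff_distrib)
      then show ?thesis unfolding t'_def[symmetric] using norm_triangle_ineq4 by simp
    qed
    then show "\<exists>N. \<forall>n\<ge>N. norm (norm (moment_reg_sym e k x (of_real (real (Suc n) * t)))) \<le>
      norm (moment 0 k x (of_real (real (Suc n) * t))) + norm (moment 0 k (- x) (of_real (real (Suc n) * t)))" by blast
  qed
  have "((\<lambda>t. suminf (\<lambda>n. of_real (sin (2 * pi * (real (Suc n) * u)) / real (Suc n)) * moment_reg_sym e k x (of_real (real (Suc n) * t))))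
     \<longlongrightarrow> of_real (- (pi * periodic_bernoulli 1 u)) * moment_reg_sym e k x 0) (at_right 0)"
    by (rule sawtooth_limit[where J = J and B = B]) (use J sm in \<open>simp_all add: sym\<close>)
  from tendsto_mult[OF tendsto_const[of "- 2 :: complex"] this]
  have "((\<lambda>t. - 2 * suminf (\<lambda>n. of_real (sin (2 * pi * (real (Suc n) * u)) / real (Suc n)) * moment_reg_sym e k x (of_real (real (Suc n) * t))))
     \<longlongrightarrow> - 2 * (of_real (- (pi * periodic_bernoulli 1 u)) * moment_reg_sym e k x 0)) (at_right 0)" .
  moreover have "eventually (\<lambda>t. - 2 * suminf (\<lambda>n. of_real (sin (2 * pi * (real (Suc n) * u)) / real (Suc n)) * moment_reg_sym e k x (of_real (real (Suc n) * t)))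
    = suminf (\<lambda>n. theta (Suc e) u (Suc n) / of_nat (Suc n) ^ Suc e * moment_reg_sym e k x (of_real (real (Suc n) * t)))) (at_right 0)"
    using eventually_at_right_less[of "0::real"]
  proof eventually_elim
    fix t :: real assume t: "t > 0"
    have "summable (\<lambda>n. of_real (sin (2 * pi * (real (Suc n) * u)) / real (Suc n)) * moment_reg_sym e k x (of_real (real (Suc n) * t)))"
    proof (rule summable_norm_cancel, rule summable_comparison_test[OF _ sm[OF t]])
      have "norm (complex_of_real (sin (2 * pi * (real (Suc n) * u)) / real (Suc n)) * moment_reg_sym e k x (of_real (real (Suc n) * t))) \<le>
          1 * norm (moment_reg_sym e k x (of_real (real (Suc n) * t)))" for n
        unfolding norm_mult
      proof (intro mult_right_mono)
        have "\<bar>sin (2 * pi * (real (Suc n) * u))\<bar> / real (Suc n) \<le> 1 / 1" by (intro frac_le) auto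
        then show "norm (complex_of_real (sin (2 * pi * (real (Suc n) * u)) / real (Suc n))) \<le> 1"
          unfolding norm_of_real abs_divide by (simp del: of_nat_Suc)
      qed auto
      then show "\<exists>N. \<forall>n\<ge>N. norm (norm (of_real (sin (2 * pi * (real (Suc n) * u)) / real (Suc n)) * moment_reg_sym e k x (of_real (real (Suc n) * t)))) \<le>
         norm (moment_reg_sym e k x (of_real (real (Suc n) * t)))" by simp
    qed
    from suminf_mult[OF this, of "- 2", symmetric]
    show "- 2 * suminf (\<lambda>n. of_real (sin (2 * pi * (real (Suc n) * u)) / real (Suc n)) * moment_reg_sym e k x (of_real (real (Suc n) * t)))
    = suminf (\<lambda>n. theta (Suc e) u (Suc n) / of_nat (Suc n) ^ Suc e * moment_reg_sym e k x (of_real (real (Suc n) * t)))"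
      by (simp add: True theta_1 mult.assoc del: of_nat_Suc)
  qed
  ultimately have "((\<lambda>t. suminf (\<lambda>n. theta (Suc e) u (Suc n) / of_nat (Suc n) ^ Suc e * moment_reg_sym e k x (of_real (real (Suc n) * t))))
     \<longlongrightarrow> - 2 * (of_real (- (pi * periodic_bernoulli 1 u)) * moment_reg_sym e k x 0)) (at_right 0)"
    by (rule Lim_transform_eventually)
  moreover have "- 2 * (of_real (- (pi * periodic_bernoulli 1 u)) * moment_reg_sym e k x 0) =
    - (\<i> ^ Suc e * (2 * of_real pi * \<i>) ^ Suc e / fact (Suc e) * of_real (periodic_bernoulli (Suc e) u)) * moment_reg_sym e k x 0"
  proof -
    have ii: "\<i> ^ Suc 0 * (2 * of_real pi * \<i>) ^ Suc 0 = (- 2 * of_real pi :: complex)" by (simp add: complex_eq_iff)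
    show ?thesis unfolding True ii by simp
  qed
  ultimately show ?thesis by (simp only:)
next
  case False
  then have s2: "Suc e \<ge> 2" by simp
  obtain B1 where B1: "\<And>t. t \<ge> 0 \<Longrightarrow> norm (moment_reg e k x (of_real t)) \<le> B1" using moment_reg_bounded[OF e] by metis
  obtain B2 where B2: "\<And>t. t \<ge> 0 \<Longrightarrow> norm (moment_reg e k (- x) (of_real t)) \<le> B2" using moment_reg_bounded[OF e] by metis
  have B: "norm (moment_reg_sym e k x (of_real t)) \<le> B1 + B2" if "t \<ge> 0" for t
    unfolding moment_reg_sym_def
    by (rule order_trans[OF norm_triangle_ineq]) (use B1[OF that] B2[OF that] in \<open>simp add: norm_mult norm_power\<close>)
  define F where "F = (\<lambda>n t. theta (Suc e) u (Suc n) / of_nat (Suc n) ^ Suc e * moment_reg_sym e k x (of_real (real (Suc n) * t)))"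
  have "eventually (\<lambda>t. summable (\<lambda>n. norm (F n t))) (at_right 0) \<and>
      summable (\<lambda>n. norm (theta (Suc e) u (Suc n) / of_nat (Suc n) ^ Suc e * moment_reg_sym e k x 0)) \<and>
      ((\<lambda>t. suminf (\<lambda>n. F n t)) \<longlongrightarrow> suminf (\<lambda>n. theta (Suc e) u (Suc n) / of_nat (Suc n) ^ Suc e * moment_reg_sym e k x 0)) (at_right 0)"
  proof (rule tannerys_theorem)
    show "((\<lambda>t. F n t) \<longlongrightarrow> theta (Suc e) u (Suc n) / of_nat (Suc n) ^ Suc e * moment_reg_sym e k x 0) (at_right 0)" for n
      unfolding F_def
    proof (intro tendsto_mult tendsto_const)
      have hol: "moment_reg_sym e k x holomorphic_on strip"
        unfolding moment_reg_sym_def[abs_def] by (intro holomorphic_intros moment_reg_holomorphic)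
      then have "isCont (moment_reg_sym e k x) 0"
        using open_strip holomorphic_on_imp_continuous_on continuous_on_eq_continuous_at zero_in_strip by blast
      moreover have "((\<lambda>t. complex_of_real (real (Suc n) * t)) \<longlongrightarrow> complex_of_real (real (Suc n) * 0)) (at_right 0)"
        by (intro tendsto_intros)
      ultimately show "((\<lambda>t. moment_reg_sym e k x (of_real (real (Suc n) * t))) \<longlongrightarrow> moment_reg_sym e k x 0) (at_right 0)"
        using isCont_tendsto_compose[of 0 "moment_reg_sym e k x"] by simp
    qed
    define M where "M n = 2 * (B1 + B2) * (1 / real (Suc n) ^ 2)" for n
    have B0: "B1 + B2 \<ge> 0" using order.trans[OF norm_ge_zero B[of 0]] by simp
    have "norm (F n t) \<le> M n" if t: "t > 0" for n t
    proof -
      have "norm (F n t) = norm (theta (Suc e) u (Suc n)) / real (Suc n) ^ Suc e * norm (moment_reg_sym e k x (of_real (real (Suc n) * t)))"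
        unfolding F_def norm_mult norm_divide norm_power by (simp only: norm_of_nat)
      also have "\<dots> \<le> 2 / real (Suc n) ^ 2 * (B1 + B2)"
        using s2 t B0 by (intro mult_mono frac_le norm_theta power_increasing B) auto
      finally show ?thesis by (simp add: M_def)
    qed
    then show "eventually (\<lambda>(n, t). norm (F n t) \<le> M n) (at_top \<times>\<^sub>F at_right 0)"
      unfolding eventually_prod_filter
      by (intro exI[of _ "\<lambda>_. True"] exI[of _ "\<lambda>t. t > 0"]) (auto intro: eventually_at_right_less)
    have "summable (\<lambda>n. 1 / real (Suc n) ^ 2)"
      using inverse_power_summable[of 2, where ?'a = real] summable_Suc_iff[of "\<lambda>n. 1 / real n ^ 2"] by (simp add: divide_inverse)
    then show "summable M" unfolding M_def by (rule summable_mult)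
  qed simp
  moreover have "suminf (\<lambda>n. theta (Suc e) u (Suc n) / of_nat (Suc n) ^ Suc e * moment_reg_sym e k x 0) =
     - (\<i> ^ Suc e * (2 * of_real pi * \<i>) ^ Suc e / fact (Suc e) * of_real (periodic_bernoulli (Suc e) u)) * moment_reg_sym e k x 0"
    using sums_mult2[OF theta_sums[OF s2, of u], of "moment_reg_sym e k x 0"] by (rule sums_unique[symmetric])
  ultimately show ?thesis unfolding F_def by metis
qed


section \<open>The cuspidal primitive at a rational cusp\<close>

definition moment_series :: "real \<Rightarrow> nat \<Rightarrow> nat \<Rightarrow> real \<Rightarrow> real \<Rightarrow> complex \<Rightarrow> complex" where
  "moment_series b e k x v Y =
     suminf (\<lambda>n. ecis (real (Suc n) * v) / of_real (b * real (Suc n)) ^ Suc e * moment e k x (of_real (b * real (Suc n)) * Y))"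

text \<open>The divisor (b p)^(e+1) undoes the powers of b p from the chain rule and from the e-th
  power of the argument. What remains is Y^e times terms that no longer depend on e, those of the
  expansion of \<open>phi\<close> on a vertical line.\<close>

lemma moment_series_deriv:
  assumes b: "b > 0" and e: "e \<le> k" and Y: "Re Y > 0"
  shows "summable (\<lambda>n. ecis (real (Suc n) * v) / of_real (b * real (Suc n)) ^ Suc e * moment e k x (of_real (b * real (Suc n)) * Y))"
    "summable (\<lambda>n. ecis (real (Suc n) * v) * coset_sum (Suc k) x (of_real (b * real (Suc n)) * Y))"
    "(moment_series b e k x v has_field_derivative
       - (Y ^ e * suminf (\<lambda>n. ecis (real (Suc n) * v) * coset_sum (Suc k) x (of_real (b * real (Suc n)) * Y)))) (at Y)"
proof -
  define S where "S = {Z. Re Z > Re Y / 2} \<inter> ball 0 (norm Y + 1)"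
  define f where "f n Z = ecis (real (Suc n) * v) / of_real (b * real (Suc n)) ^ Suc e * moment e k x (of_real (b * real (Suc n)) * Z)" for n Z
  define h where "h n Z = ecis (real (Suc n) * v) * coset_sum (Suc k) x (of_real (b * real (Suc n)) * Z)" for n Z
  define \<delta> where "\<delta> = b * Re Y / 2"
  have \<delta>: "\<delta> > 0" using b Y by (simp add: \<delta>_def)
  obtain C where C: "\<And>X. Re X \<ge> \<delta> \<Longrightarrow> norm (coset_sum (Suc k) x X) \<le> C * exp (- (coset_rep x * Re X))"
    using coset_sum_decay[OF \<delta>] by metis
  define \<rho> where "\<rho> = exp (- (coset_rep x * \<delta>))"
  have \<rho>: "\<rho> > 0" "\<rho> < 1" using coset_rep(1)[of x] \<delta> by (simp_all add: \<rho>_def)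
  have Re_ge: "Re (of_real (b * real (Suc n)) * Z) \<ge> \<delta> * real (Suc n)" if "Re Z \<ge> Re Y / 2" for Z n
  proof -
    have "b * real (Suc n) * (Re Y / 2) \<le> b * real (Suc n) * Re Z" using that b by (intro mult_left_mono) auto
    then show ?thesis by (simp add: \<delta>_def algebra_simps)
  qed
  have \<delta>n: "\<delta> \<le> \<delta> * real (Suc n)" for n using \<delta> by simp
  have h_bound: "norm (h n Z) \<le> \<bar>C\<bar> * \<rho> ^ Suc n" if Z: "Re Z \<ge> Re Y / 2" for n Z
  proof -
    let ?X = "of_real (b * real (Suc n)) * Z"
    have "norm (h n Z) = norm (coset_sum (Suc k) x ?X)" by (simp add: h_def norm_mult)
    also have "\<dots> \<le> C * exp (- (coset_rep x * Re ?X))" using Re_ge[OF Z, of n] \<delta>n[of n] by (intro C) linarith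
    also have "\<dots> \<le> \<bar>C\<bar> * exp (- (coset_rep x * (\<delta> * real (Suc n))))"
      using Re_ge[OF Z, of n] coset_rep(1)[of x] by (intro mult_mono) auto
    also have "exp (- (coset_rep x * (\<delta> * real (Suc n)))) = \<rho> ^ Suc n"
      by (simp only: \<rho>_def exp_of_nat_mult[symmetric]) (simp add: mult_ac)
    finally show ?thesis .
  qed
  have geo: "summable (\<lambda>n. c * \<rho> ^ Suc n)" for c
    using summable_geometric[of \<rho>] \<rho> by (intro summable_mult) (simp only: summable_Suc_iff, simp)
  show sh: "summable (\<lambda>n. ecis (real (Suc n) * v) * coset_sum (Suc k) x (of_real (b * real (Suc n)) * Y))"
    unfolding h_def[symmetric]
    by (rule summable_norm_cancel, rule summable_comparison_test[OF _ geo[of "\<bar>C\<bar>"]]) (use h_bound Y in auto)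
  have fd: "(f n has_field_derivative - (Z ^ e * h n Z)) (at Z within S)" if Z: "Z \<in> S" for n Z
  proof -
    let ?c = "of_real (b * real (Suc n)) :: complex"
    have c0: "?c \<noteq> 0" using b by (simp del: of_nat_Suc)
    have "Re Z > 0" using Z Y by (simp add: S_def)
    then have "Re (?c * Z) > 0" using b by simp
    then have "((\<lambda>Z. moment e k x (?c * Z)) has_field_derivative - ((?c * Z) ^ e * coset_sum (Suc k) x (?c * Z)) * ?c) (at Z)"
      by (intro DERIV_chain2[where f = "moment e k x" and g = "\<lambda>Z. ?c * Z", OF moment_deriv[OF _ e]]) (auto intro!: derivative_eq_intros)
    from DERIV_cmult[OF this, of "ecis (real (Suc n) * v) / ?c ^ Suc e"]
    have "(f n has_field_derivative ecis (real (Suc n) * v) / ?c ^ Suc e * (- ((?c * Z) ^ e * coset_sum (Suc k) x (?c * Z)) * ?c)) (at Z)"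
      unfolding f_def .
    moreover have "ecis (real (Suc n) * v) / ?c ^ Suc e * (- ((?c * Z) ^ e * coset_sum (Suc k) x (?c * Z)) * ?c) = - (Z ^ e * h n Z)"
      using c0 by (simp add: h_def power_mult_distrib)
    ultimately show ?thesis using has_field_derivative_at_within by metis
  qed
  have cv: "convex S" unfolding S_def by (intro convex_Int convex_halfspace_Re_gt convex_ball)
  have oS: "open S" unfolding S_def by (intro open_Int open_halfspace_Re_gt open_ball)
  have YS: "Y \<in> S" using Y by (simp add: S_def)
  \<comment> \<open>The decay of moments is known on the real axis only; convergence is therefore
    checked at Re Y and carried to Y by the uniformly convergent derivatives.\<close>
  have x0: "of_real (Re Y) \<in> S" using Y abs_Re_le_cmod[of Y] by (simp add: S_def)
  have u: "uniformly_convergent_on S (\<lambda>n Z. \<Sum>i<n. - (Z ^ e * h i Z))"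
  proof (rule Weierstrass_m_test'[OF _ geo[of "(norm Y + 1) ^ e * \<bar>C\<bar>"]])
    fix n Z assume Z: "Z \<in> S"
    have "norm (Z ^ e) \<le> (norm Y + 1) ^ e" using Z by (simp add: S_def norm_power power_mono)
    moreover have "norm (h n Z) \<le> \<bar>C\<bar> * \<rho> ^ Suc n" using Z by (intro h_bound) (simp add: S_def)
    ultimately show "norm (- (Z ^ e * h n Z)) \<le> (norm Y + 1) ^ e * \<bar>C\<bar> * \<rho> ^ Suc n"
      unfolding norm_minus_cancel norm_mult mult.assoc by (intro mult_mono) auto
  qed
  have sx0: "summable (\<lambda>n. f n (of_real (Re Y)))"
  proof (rule summable_norm_cancel, rule summable_comparison_test)
    have t: "b * Re Y > 0" using b Y by simp
    show "summable (\<lambda>n. 1 / b ^ Suc e * norm (moment e k x (of_real (real (Suc n) * (b * Re Y)))))"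
      by (intro summable_mult moment_summable t)
    have "norm (norm (f n (of_real (Re Y)))) \<le> 1 / b ^ Suc e * norm (moment e k x (of_real (real (Suc n) * (b * Re Y))))" for n
    proof -
      have "b ^ Suc e \<le> (b * real (Suc n)) ^ Suc e" using b by (intro power_mono) auto
      then have "1 / (b * real (Suc n)) ^ Suc e \<le> 1 / b ^ Suc e"
        using b by (intro divide_left_mono mult_pos_pos zero_less_power) auto
      moreover have "norm (f n (of_real (Re Y))) = 1 / (b * real (Suc n)) ^ Suc e * norm (moment e k x (of_real (real (Suc n) * (b * Re Y))))"
      proof -
        have "norm (complex_of_real (b * real (Suc n)) ^ Suc e) = (b * real (Suc n)) ^ Suc e"
          using b by (simp only: norm_power norm_of_real) simp
        moreover have "of_real (b * real (Suc n)) * complex_of_real (Re Y) = of_real (real (Suc n) * (b * Re Y))" by simp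
        ultimately show ?thesis unfolding f_def norm_mult norm_divide by (simp only: norm_ecis)
      qed
      ultimately have "norm (f n (of_real (Re Y))) \<le> 1 / b ^ Suc e * norm (moment e k x (of_real (real (Suc n) * (b * Re Y))))"
        by (simp only:) (intro mult_right_mono, auto)
      then show ?thesis unfolding real_norm_def abs_norm_cancel .
    qed
    then show "\<exists>N. \<forall>n\<ge>N. norm (norm (f n (of_real (Re Y)))) \<le> 1 / b ^ Suc e * norm (moment e k x (of_real (real (Suc n) * (b * Re Y))))"
      by blast
  qed
  have YI: "Y \<in> interior S" using YS oS by (simp add: interior_open)
  note D = has_field_derivative_series'[OF cv fd u x0 sx0 YI]
  show "summable (\<lambda>n. ecis (real (Suc n) * v) / of_real (b * real (Suc n)) ^ Suc e * moment e k x (of_real (b * real (Suc n)) * Y))"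
    using D(1) unfolding f_def .
  have "suminf (\<lambda>n. - (Y ^ e * h n Y)) = - (Y ^ e * suminf (\<lambda>n. h n Y))"
    using sh unfolding h_def[symmetric] by (subst suminf_minus) (auto intro: summable_mult simp: suminf_mult)
  then show "(moment_series b e k x v has_field_derivative
       - (Y ^ e * suminf (\<lambda>n. ecis (real (Suc n) * v) * coset_sum (Suc k) x (of_real (b * real (Suc n)) * Y)))) (at Y)"
    using D(2) unfolding f_def h_def moment_series_def[abs_def] by simp
qed

lemma moment_series_tendsto_0:
  assumes b: "b > 0" and e: "e \<le> k"
  shows "((\<lambda>T. moment_series b e k x v (of_real T)) \<longlongrightarrow> 0) at_top"
proof -
  obtain C where C: "C \<ge> 0" "\<And>t. t \<ge> b \<Longrightarrow> norm (moment e k x (of_real t)) \<le> C * exp (- (coset_rep x / 2 * t))"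
    using moment_decay[OF b] by metis
  define \<sigma> where "\<sigma> = coset_rep x / 2 * b"
  have \<sigma>: "\<sigma> > 0" using b coset_rep(1)[of x] by (simp add: \<sigma>_def)
  have geo: "summable (\<lambda>n. c * exp (- \<sigma>) ^ n)" for c
    using \<sigma> by (intro summable_mult summable_geometric) auto
  define K where "K = suminf (\<lambda>n. C / b ^ Suc e * exp (- \<sigma>) ^ n)"
  have bound: "norm (moment_series b e k x v (of_real T)) \<le> exp (- (\<sigma> * T)) * K" if T: "T \<ge> 1" for T
  proof -
    let ?f = "\<lambda>n. ecis (real (Suc n) * v) / of_real (b * real (Suc n)) ^ Suc e * moment e k x (of_real (b * real (Suc n)) * of_real T)"
    have fb: "norm (?f n) \<le> exp (- (\<sigma> * T)) * (C / b ^ Suc e * exp (- \<sigma>) ^ n)" for n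
    proof -
      define t where "t = b * real (Suc n) * T"
      have "real (Suc n) * T \<ge> real n + T"
      proof -
        have "real n * 1 \<le> real n * T" using T by (intro mult_left_mono) auto
        then show ?thesis by (simp add: algebra_simps)
      qed
      then have "b * (real n + T) \<le> b * (real (Suc n) * T)" using b by (intro mult_left_mono) auto
      then have tb: "t \<ge> b * (real n + T)" by (simp add: t_def mult.assoc)
      moreover have "b * (real n + T) \<ge> b * 1" using b T by (intro mult_left_mono) auto
      ultimately have "t \<ge> b" by simp
      then have "norm (moment e k x (of_real t)) \<le> C * exp (- (coset_rep x / 2 * t))" by (rule C(2))
      also have "\<dots> \<le> C * exp (- (coset_rep x / 2 * (b * (real n + T))))"
        using tb C(1) coset_rep(1)[of x] by (intro mult_left_mono) auto
      also have "exp (- (coset_rep x / 2 * (b * (real n + T)))) = exp (- (\<sigma> * T)) * exp (- \<sigma>) ^ n"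
        by (simp add: \<sigma>_def algebra_simps flip: exp_add exp_of_nat_mult)
      finally have m: "norm (moment e k x (of_real t)) \<le> C * (exp (- (\<sigma> * T)) * exp (- \<sigma>) ^ n)" .
      have "b ^ Suc e \<le> (b * real (Suc n)) ^ Suc e" using b by (intro power_mono) auto
      then have i: "1 / (b * real (Suc n)) ^ Suc e \<le> 1 / b ^ Suc e"
        using b by (intro divide_left_mono mult_pos_pos zero_less_power) auto
      have "norm (?f n) = 1 / (b * real (Suc n)) ^ Suc e * norm (moment e k x (of_real t))"
      proof -
        have "norm (complex_of_real (b * real (Suc n)) ^ Suc e) = (b * real (Suc n)) ^ Suc e"
          using b by (simp only: norm_power norm_of_real) simp
        moreover have "of_real (b * real (Suc n)) * complex_of_real T = of_real t" by (simp add: t_def)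
        ultimately show ?thesis unfolding norm_mult norm_divide by (simp only: norm_ecis)
      qed
      also have "\<dots> \<le> 1 / b ^ Suc e * (C * (exp (- (\<sigma> * T)) * exp (- \<sigma>) ^ n))"
        using b by (intro mult_mono i m) auto
      finally show ?thesis by (simp add: mult_ac)
    qed
    have "norm (suminf ?f) \<le> suminf (\<lambda>n. exp (- (\<sigma> * T)) * (C / b ^ Suc e * exp (- \<sigma>) ^ n))"
      by (rule norm_suminf_le[OF fb]) (intro summable_mult geo)
    also have "\<dots> = exp (- (\<sigma> * T)) * K" unfolding K_def by (rule suminf_mult[OF geo])
    finally show ?thesis by (simp add: moment_series_def)
  qed
  show ?thesis
  proof (rule Lim_null_comparison)
    show "\<forall>\<^sub>F T in at_top. norm (moment_series b e k x v (of_real T)) \<le> exp (- (\<sigma> * T)) * K"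
      using eventually_ge_at_top[of "1::real"] by eventually_elim (rule bound)
    show "((\<lambda>T. exp (- (\<sigma> * T)) * K) \<longlongrightarrow> 0) at_top" using \<sigma> by real_asymp
  qed
qed

text \<open>On the line z = a/c + i Y the real part a/c enters only through roots of unity, which
  \<open>coset_split\<close> evaluates. The numbers y j and u j are the arguments of the two
  Bernoulli functions in the Dedekind sum.\<close>

lemma phi_vertical_sums:
  fixes a c :: int
  assumes m: "m = k + 2" "even k" and N: "N > 0" and x: "real N * x1 \<in> \<int>" "real N * x2 \<in> \<int>"
    and nz: "m = 2 \<Longrightarrow> \<not> (x1 \<in> \<int> \<and> x2 \<in> \<int>)" and c: "c > 0" and Y: "Re Y > 0"
  defines "b \<equiv> 2 * pi * of_int c" and "y \<equiv> \<lambda>j. (x1 + of_int j) / of_int c"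
  defines "u \<equiv> \<lambda>j. x2 + of_int a * y j"
  shows "(\<lambda>n. \<Sum>j\<in>{0..<c}. of_int c ^ Suc k *
        (ecis (real (Suc n) * - u j) * coset_sum (Suc k) (- y j) (of_real (b * real (Suc n)) * Y)
       + ecis (real (Suc n) * u j) * coset_sum (Suc k) (y j) (of_real (b * real (Suc n)) * Y)))
     sums (phi m N (x1, x2) (of_real (of_int a / of_int c) + \<i> * Y) - eis_const m x1)"
proof -
  define z where "z = of_real (of_int a / of_int c) + \<i> * Y"
  have z: "Im z > 0" using Y by (simp add: z_def)
  have m2: "m \<ge> 2" "even m" "m - 1 = Suc k" using m by auto
  have inj: "inj_on Suc UNIV" by simp
  have ran: "range Suc = {1..}" by (auto simp: image_iff Suc_le_eq gr0_conv_Suc)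
  have "((\<lambda>p. eis_term (m - 1) (- x1) (- x2) z p + eis_term (m - 1) x1 x2 z p) has_sum
    phi m N (x1, x2) z - eis_const m x1) (range Suc)"
    unfolding ran by (rule phi_expansion[OF m2(1,2) z N x nz])
  from has_sum_imp_sums[OF has_sum_reindex[OF inj, THEN iffD1, OF this]]
  have s: "(\<lambda>n. eis_term (Suc k) (- x1) (- x2) z (Suc n) + eis_term (Suc k) x1 x2 z (Suc n)) sums
     (phi m N (x1, x2) z - eis_const m x1)"
    unfolding m2(3) o_def .
  have e: "eis_term (Suc k) (\<epsilon> * x1) (\<epsilon> * x2) z p =
     (\<Sum>j\<in>{0..<c}. of_int c ^ Suc k * (ecis (real p * (\<epsilon> * u j)) * coset_sum (Suc k) (\<epsilon> * y j) (of_real (b * real p) * Y)))"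
    if \<epsilon>: "\<epsilon> = 1 \<or> \<epsilon> = -1" and p: "p \<ge> 1" for \<epsilon> p
  proof -
    define X where "X = of_real (2 * pi * real p) * Y"
    have X: "Re X > 0" using p Y by (simp add: X_def)
    have arg: "- (2 * of_real pi * \<i> * of_nat p * z) = X - 2 * of_real pi * \<i> * of_real (real p * (of_int a / of_int c))"
      by (simp add: X_def z_def algebra_simps)
    have cX: "of_int c * X = of_real (b * real p) * Y" by (simp add: X_def b_def mult_ac)
    have "eis_term (Suc k) (\<epsilon> * x1) (\<epsilon> * x2) z p = ecis (real p * (\<epsilon> * x2)) *
       (\<Sum>j\<in>{0..<c}. ecis (\<epsilon> * (real p * (of_int a * y j))) * (of_int c ^ Suc k * coset_sum (Suc k) (\<epsilon> * y j) (of_real (b * real p) * Y)))"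
      unfolding eis_term_def arg coset_split[OF c X \<epsilon>] cX y_def ..
    also have "\<dots> = (\<Sum>j\<in>{0..<c}. of_int c ^ Suc k * (ecis (real p * (\<epsilon> * u j)) * coset_sum (Suc k) (\<epsilon> * y j) (of_real (b * real p) * Y)))"
      unfolding sum_distrib_left
    proof (rule sum.cong[OF refl])
      fix j
      have "ecis (real p * (\<epsilon> * u j)) = ecis (real p * (\<epsilon> * x2)) * ecis (\<epsilon> * (real p * (of_int a * y j)))"
        unfolding ecis_add[symmetric] by (simp add: u_def algebra_simps)
      then show "ecis (real p * (\<epsilon> * x2)) * (ecis (\<epsilon> * (real p * (of_int a * y j))) * (of_int c ^ Suc k * coset_sum (Suc k) (\<epsilon> * y j) (of_real (b * real p) * Y))) =
         of_int c ^ Suc k * (ecis (real p * (\<epsilon> * u j)) * coset_sum (Suc k) (\<epsilon> * y j) (of_real (b * real p) * Y))"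
        by (simp only: mult_ac)
    qed
    finally show ?thesis .
  qed
  have "eis_term (Suc k) (- x1) (- x2) z (Suc n) + eis_term (Suc k) x1 x2 z (Suc n) =
    (\<Sum>j\<in>{0..<c}. of_int c ^ Suc k *
        (ecis (real (Suc n) * - u j) * coset_sum (Suc k) (- y j) (of_real (b * real (Suc n)) * Y)
       + ecis (real (Suc n) * u j) * coset_sum (Suc k) (y j) (of_real (b * real (Suc n)) * Y)))" for n
    using e[of "- 1" "Suc n"] e[of 1 "Suc n"]
    by (simp add: sum.distrib ring_distribs del: of_nat_Suc power_Suc)
  with s show ?thesis unfolding z_def by (simp only:)
qed

text \<open>With real weights, conjugation exchanges e(pu) and e(-pu), so averaging with the
  conjugate symmetrises the weights and produces \<open>theta\<close>.\<close>

lemma real_part_theta: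
  assumes "Kp \<in> \<real>" "Km \<in> \<real>"
  shows "of_real (Re (- (\<i> ^ s * (ecis (- (real p * u)) * Km + ecis (real p * u) * Kp)))) =
     - (1 / 2) * theta s u p * (Kp + (-1) ^ s * Km)"
proof -
  obtain r q where r: "Kp = of_real r" "Km = of_real q" using assms by (auto elim!: Reals_cases)
  have two: "of_real (Re w) = (w + cnj w) / 2" for w by (simp add: complex_add_cnj)
  have i: "cnj (\<i> ^ s) = (-1) ^ s * \<i> ^ s"
    by (metis complex_cnj_i complex_cnj_power mult_minus1 power_mult_distrib)
  have s2: "(-1 :: complex) ^ s * (-1) ^ s = 1" by (cases "even s") auto
  define E where "E = ecis (real p * u)"
  define F where "F = ecis (- (real p * u))"
  have cE: "cnj E = F" "cnj F = E" by (simp_all add: E_def F_def ecis_cnj)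
  show ?thesis
    unfolding two theta_def E_def[symmetric] F_def[symmetric] r
    by (cases "even s") (simp_all add: i cE field_simps)
qed

text \<open>G is first identified with a sum of moment series along the line over a/c. Its real part
  is a theta series with a regular part, whose limit is known, and a pole in Y; comparison with the
  assumed limit, from which K / Y^M is subtracted, determines Re L.\<close>

theorem period_limit:
  fixes a c :: int and L :: complex
  assumes m: "m = k + 2" "even k" and N: "N > 0" and x: "real N * x1 \<in> \<int>" "real N * x2 \<in> \<int>"
    and nz: "m = 2 \<Longrightarrow> \<not> (x1 \<in> \<int> \<and> x2 \<in> \<int>)" and c: "c > 0" and e: "e \<le> k"
    and G: "\<And>z. Im z > 0 \<Longrightarrow> (G has_field_derivative
        (z - of_real (of_int a / of_int c)) ^ e * (phi m N (x1, x2) z - eis_const m x1)) (at z)"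
    and G0: "((\<lambda>t. G (Complex (of_int a / of_int c) t)) \<longlongrightarrow> 0) at_top"
    and L: "((\<lambda>Y. G (Complex (of_int a / of_int c) Y) - K * of_real (1 / Y ^ Suc (k - e))) \<longlongrightarrow> L) (at_right 0)"
  shows "Re L = (-1) ^ e * of_int c ^ (k - e) * dedekind_sum (Suc (k - e)) (Suc e) (x1, x2) a c"
proof -
  define \<alpha> where "\<alpha> = real_of_int a / real_of_int c"
  define b where "b = 2 * pi * real_of_int c"
  define y where "y j = (x1 + real_of_int j) / real_of_int c" for j :: int
  define u where "u j = x2 + real_of_int a * y j" for j
  have b: "b > 0" using c by (simp add: b_def)
  define W where "W Y = (\<Sum>j\<in>{0..<c}. of_int c ^ Suc k *
     (moment_series b e k (- y j) (- u j) Y + moment_series b e k (y j) (u j) Y))" for Y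
  have Wd: "(W has_field_derivative - (Y ^ e * (phi m N (x1, x2) (of_real \<alpha> + \<i> * Y) - eis_const m x1))) (at Y)"
    if Y: "Re Y > 0" for Y
  proof -
    let ?A = "\<lambda>x v n. ecis (real (Suc n) * v) * coset_sum (Suc k) x (of_real (b * real (Suc n)) * Y)"
    have "(W has_field_derivative (\<Sum>j\<in>{0..<c}. of_int c ^ Suc k *
       (- (Y ^ e * suminf (?A (- y j) (- u j))) + - (Y ^ e * suminf (?A (y j) (u j)))))) (at Y)"
      unfolding W_def[abs_def]
      by (intro DERIV_sum DERIV_cmult DERIV_add moment_series_deriv(3) b e Y)
    moreover have "(\<lambda>n. \<Sum>j\<in>{0..<c}. of_int c ^ Suc k * (?A (- y j) (- u j) n + ?A (y j) (u j) n)) sums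
       (\<Sum>j\<in>{0..<c}. of_int c ^ Suc k * (suminf (?A (- y j) (- u j)) + suminf (?A (y j) (u j))))"
      by (intro sums_sum sums_mult sums_add summable_sums moment_series_deriv(2)[OF b e Y])
    from sums_unique2[OF this phi_vertical_sums[OF m N x nz c Y, of a, folded b_def y_def, folded u_def]]
    have "(\<Sum>j\<in>{0..<c}. of_int c ^ Suc k * (suminf (?A (- y j) (- u j)) + suminf (?A (y j) (u j)))) =
       phi m N (x1, x2) (of_real \<alpha> + \<i> * Y) - eis_const m x1" by (simp only: \<alpha>_def)
    moreover have "(\<Sum>j\<in>{0..<c}. of_int c ^ Suc k * (- (Y ^ e * A j) + - (Y ^ e * B j))) = - (Y ^ e * (\<Sum>j\<in>{0..<c}. of_int c ^ Suc k * (A j + B j)))"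
      for A B :: "int \<Rightarrow> complex"
      unfolding sum_distrib_left sum_negf[symmetric] by (rule sum.cong[OF refl]) algebra
    ultimately show ?thesis by (simp only:)
  qed
  \<comment> \<open>Both sides have the same derivative in Y and vanish at infinity. The power of i
    comes from (z - a/c)^e = (i Y)^e and dz = i dY.\<close>
  have GW: "G (of_real \<alpha> + \<i> * Y) = - (\<i> ^ Suc e * W Y)" if Y: "Re Y > 0" for Y
  proof -
    define V where "V Y = G (of_real \<alpha> + \<i> * Y) + \<i> ^ Suc e * W Y" for Y
    have Vd: "(V has_field_derivative 0) (at Y within {Y. Re Y > 0})" if Y: "Y \<in> {Y. Re Y > 0}" for Y
    proof -
      have im: "Im (of_real \<alpha> + \<i> * Y) > 0" using Y by simp
      have "((\<lambda>Y. G (of_real \<alpha> + \<i> * Y)) has_field_derivative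
         (of_real \<alpha> + \<i> * Y - of_real (of_int a / of_int c)) ^ e * (phi m N (x1, x2) (of_real \<alpha> + \<i> * Y) - eis_const m x1) * \<i>) (at Y)"
        by (rule DERIV_chain2[where f = G and g = "\<lambda>Y. of_real \<alpha> + \<i> * Y", OF G[OF im]]) (auto intro!: derivative_eq_intros)
      from DERIV_add[OF this DERIV_cmult[OF Wd, of Y "\<i> ^ Suc e"]]
      have "(V has_field_derivative (of_real \<alpha> + \<i> * Y - of_real (of_int a / of_int c)) ^ e * (phi m N (x1, x2) (of_real \<alpha> + \<i> * Y) - eis_const m x1) * \<i>
         + \<i> ^ Suc e * - (Y ^ e * (phi m N (x1, x2) (of_real \<alpha> + \<i> * Y) - eis_const m x1))) (at Y)"
        using Y unfolding V_def[abs_def] by simp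
      moreover have "(of_real \<alpha> + \<i> * Y - of_real (of_int a / of_int c)) ^ e = \<i> ^ e * Y ^ e"
        by (simp add: \<alpha>_def power_mult_distrib)
      ultimately have "(V has_field_derivative 0) (at Y)" by (simp add: algebra_simps)
      then show ?thesis by (rule has_field_derivative_at_within)
    qed
    obtain C where C: "\<And>Y. Y \<in> {Y. Re Y > 0} \<Longrightarrow> V Y = C"
      using has_field_derivative_zero_constant[OF convex_halfspace_Re_gt Vd] by blast
    have "((\<lambda>t. G (of_real \<alpha> + \<i> * of_real t)) \<longlongrightarrow> 0) at_top"
      using G0 by (simp add: Complex_eq \<alpha>_def)
    moreover have "((\<lambda>t. W (of_real t)) \<longlongrightarrow> (\<Sum>j\<in>{0..<c}. of_int c ^ Suc k * (0 + 0))) at_top"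
      unfolding W_def by (intro tendsto_sum tendsto_mult tendsto_const tendsto_add moment_series_tendsto_0 b e)
    ultimately have "((\<lambda>t. V (of_real t)) \<longlongrightarrow> 0 + \<i> ^ Suc e * (\<Sum>j\<in>{0..<c}. of_int c ^ Suc k * (0 + 0))) at_top"
      unfolding V_def by (intro tendsto_add tendsto_mult tendsto_const)
    then have "((\<lambda>t. V (of_real t)) \<longlongrightarrow> 0) at_top" by simp
    moreover have "((\<lambda>t. V (of_real t)) \<longlongrightarrow> C) at_top"
      by (rule tendsto_eventually) (use eventually_gt_at_top[of "0::real"] in \<open>eventually_elim, auto intro: C\<close>)
    ultimately have "C = 0" using tendsto_unique[OF trivial_limit_at_top_linorder] by blast
    then have "V Y = 0" using C Y by simp
    then show ?thesis by (simp add: V_def add_eq_0_iff2)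
  qed
  define M where "M = Suc (k - e)"
  \<comment> \<open>Collects -1/2 from \<open>real_part_theta\<close>, c^(k+1) from
    \<open>coset_split\<close> and the divisor of \<open>moment_series\<close>.\<close>
  define \<kappa> :: complex where "\<kappa> = - (1 / 2) * of_int c ^ Suc k / of_real b ^ Suc e"
  define R where "R j t = suminf (\<lambda>n. theta (Suc e) (u j) (Suc n) / of_nat (Suc n) ^ Suc e * moment_reg_sym e k (y j) (of_real (real (Suc n) * t)))" for j t
  \<comment> \<open>Both moments have the same pole coefficient, which is independent of x;
    symmetrisation turns it into the factor 1 + (-1)^(e+1).\<close>
  define P where "P j = (1 + (-1) ^ Suc e) * of_real (moment_pole e k) * suminf (\<lambda>n. theta (Suc e) (u j) (Suc n) / of_nat (Suc n) ^ (Suc e + M))" for j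
  have ReG: "complex_of_real (Re (G (Complex \<alpha> Y))) = (\<Sum>j\<in>{0..<c}. \<kappa> * (R j (b * Y) + P j / of_real (b * Y) ^ M))" if Y: "Y > 0" for Y
  proof -
    have bY: "b * Y > 0" using b Y by simp
    have Yc: "Re (complex_of_real Y) > 0" using Y by simp
    let ?A = "\<lambda>x v n. ecis (real (Suc n) * v) / of_real (b * real (Suc n)) ^ Suc e * moment e k x (of_real (b * real (Suc n)) * of_real Y)"
    have "?A x v sums moment_series b e k x v (of_real Y)" for x v
      unfolding moment_series_def by (intro summable_sums moment_series_deriv(1) b e Yc)
    then have "(\<lambda>n. - (\<i> ^ Suc e * (\<Sum>j\<in>{0..<c}. of_int c ^ Suc k * (?A (- y j) (- u j) n + ?A (y j) (u j) n)))) sums (- (\<i> ^ Suc e * W (of_real Y)))"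
      unfolding W_def by (intro sums_minus sums_mult sums_sum sums_add)
    then have "(\<lambda>n. - (\<i> ^ Suc e * (\<Sum>j\<in>{0..<c}. of_int c ^ Suc k * (?A (- y j) (- u j) n + ?A (y j) (u j) n)))) sums G (Complex \<alpha> Y)"
      using GW[OF Yc] by (simp add: Complex_eq)
    from sums_Re[OF this]
    have s1: "(\<lambda>n. complex_of_real (Re (- (\<i> ^ Suc e * (\<Sum>j\<in>{0..<c}. of_int c ^ Suc k * (?A (- y j) (- u j) n + ?A (y j) (u j) n)))))) sums of_real (Re (G (Complex \<alpha> Y)))"
      by (rule sums_of_real)
    have t1: "complex_of_real (Re (- (\<i> ^ Suc e * (\<Sum>j\<in>{0..<c}. of_int c ^ Suc k * (?A (- y j) (- u j) n + ?A (y j) (u j) n)))))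
      = (\<Sum>j\<in>{0..<c}. \<kappa> * (theta (Suc e) (u j) (Suc n) / of_nat (Suc n) ^ Suc e * moment_sym e k (y j) (of_real (real (Suc n) * (b * Y)))))" for n
    proof -
      define t where "t = real (Suc n) * (b * Y)"
      have t: "t > 0" using bY by (simp add: t_def)
      have bt: "of_real (b * real (Suc n)) * complex_of_real Y = of_real t" by (simp add: t_def mult_ac)
      have Re_real: "Re (complex_of_real r * w) = r * Re w" for r w by simp
      define \<mu> where "\<mu> = real_of_int c ^ Suc k / (b * real (Suc n)) ^ Suc e"
      let ?Q = "\<lambda>j. - (\<i> ^ Suc e * (ecis (- (real (Suc n) * u j)) * moment e k (- y j) (of_real t) + ecis (real (Suc n) * u j) * moment e k (y j) (of_real t)))"
      have l: "complex_of_real \<mu> = of_int c ^ Suc k / of_real (b * real (Suc n)) ^ Suc e"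
        by (simp only: \<mu>_def of_real_divide of_real_power of_real_of_int_eq)
      have "- (\<i> ^ Suc e * (\<Sum>j\<in>{0..<c}. of_int c ^ Suc k * (?A (- y j) (- u j) n + ?A (y j) (u j) n))) = (\<Sum>j\<in>{0..<c}. of_real \<mu> * ?Q j)"
        unfolding bt l sum_distrib_left sum_negf[symmetric]
        by (rule sum.cong[OF refl]) (simp add: add_divide_distrib algebra_simps del: of_nat_Suc power_Suc)
      then have "Re (- (\<i> ^ Suc e * (\<Sum>j\<in>{0..<c}. of_int c ^ Suc k * (?A (- y j) (- u j) n + ?A (y j) (u j) n)))) = (\<Sum>j\<in>{0..<c}. \<mu> * Re (?Q j))"
        by (simp only: Re_sum Re_real)
      then have "complex_of_real (Re (- (\<i> ^ Suc e * (\<Sum>j\<in>{0..<c}. of_int c ^ Suc k * (?A (- y j) (- u j) n + ?A (y j) (u j) n)))))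
         = (\<Sum>j\<in>{0..<c}. of_real \<mu> * of_real (Re (?Q j)))"
        by (simp only: of_real_sum of_real_mult)
      also have "\<dots> = (\<Sum>j\<in>{0..<c}. \<kappa> * (theta (Suc e) (u j) (Suc n) / of_nat (Suc n) ^ Suc e * moment_sym e k (y j) (of_real t)))"
      proof (rule sum.cong[OF refl])
        fix j
        have "complex_of_real (Re (?Q j)) = - (1 / 2) * theta (Suc e) (u j) (Suc n) * moment_sym e k (y j) (of_real t)"
          unfolding moment_sym_def by (rule real_part_theta[OF moment_real[OF t] moment_real[OF t]])
        moreover have "complex_of_real \<mu> = of_int c ^ Suc k / of_real b ^ Suc e / of_nat (Suc n) ^ Suc e"
          unfolding l of_real_mult power_mult_distrib by (simp del: of_nat_Suc power_Suc)
        ultimately show "of_real \<mu> * of_real (Re (?Q j)) = \<kappa> * (theta (Suc e) (u j) (Suc n) / of_nat (Suc n) ^ Suc e * moment_sym e k (y j) (of_real t))"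
          by (simp add: \<kappa>_def del: of_nat_Suc power_Suc)
      qed
      finally show ?thesis unfolding t_def .
    qed
    have s2: "(\<lambda>n. theta (Suc e) (u j) (Suc n) / of_nat (Suc n) ^ Suc e * moment_sym e k (y j) (of_real (real (Suc n) * (b * Y)))) sums
        (R j (b * Y) + P j / of_real (b * Y) ^ M)" for j
    proof -
      have th: "norm (theta (Suc e) (u j) (Suc n) / of_nat (Suc n) ^ Suc l * w) \<le> 2 * norm w" for n l and w :: complex
      proof -
        have "norm (theta (Suc e) (u j) (Suc n)) / real (Suc n) ^ Suc l \<le> 2 / 1"
          by (intro frac_le norm_theta one_le_power) auto
        then have "norm (theta (Suc e) (u j) (Suc n)) / real (Suc n) ^ Suc l * norm w \<le> 2 * norm w" by (intro mult_right_mono) auto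
        then show ?thesis unfolding norm_mult norm_divide norm_power norm_of_nat .
      qed
      have sm: "summable (\<lambda>n. theta (Suc e) (u j) (Suc n) / of_nat (Suc n) ^ Suc e * moment_sym e k (y j) (of_real (real (Suc n) * (b * Y))))"
      proof (rule summable_norm_cancel, rule summable_comparison_test)
        show "summable (\<lambda>n. 2 * (norm (moment e k (y j) (of_real (real (Suc n) * (b * Y)))) + norm (moment e k (- y j) (of_real (real (Suc n) * (b * Y))))))"
          by (intro summable_mult summable_add moment_summable bY)
        have "norm (norm (theta (Suc e) (u j) (Suc n) / of_nat (Suc n) ^ Suc e * moment_sym e k (y j) (of_real (real (Suc n) * (b * Y))))) \<le>
          2 * (norm (moment e k (y j) (of_real (real (Suc n) * (b * Y)))) + norm (moment e k (- y j) (of_real (real (Suc n) * (b * Y)))))" for n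
        proof -
          have "norm (moment_sym e k (y j) w) \<le> norm (moment e k (y j) w) + norm (moment e k (- y j) w)" for w
            unfolding moment_sym_def by (rule order_trans[OF norm_triangle_ineq]) (simp add: norm_mult norm_power)
          then show ?thesis unfolding real_norm_def abs_norm_cancel by (intro order_trans[OF th] mult_left_mono) auto
        qed
        then show "\<exists>N. \<forall>n\<ge>N. norm (norm (theta (Suc e) (u j) (Suc n) / of_nat (Suc n) ^ Suc e * moment_sym e k (y j) (of_real (real (Suc n) * (b * Y))))) \<le>
          2 * (norm (moment e k (y j) (of_real (real (Suc n) * (b * Y)))) + norm (moment e k (- y j) (of_real (real (Suc n) * (b * Y)))))" by blast
      qed
      have sp: "summable (\<lambda>n. theta (Suc e) (u j) (Suc n) / of_nat (Suc n) ^ (Suc e + M))"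
      proof (rule summable_norm_cancel, rule summable_comparison_test)
        have "summable (\<lambda>n. 1 / real (Suc n) ^ 2)"
          using inverse_power_summable[of 2, where ?'a = real] summable_Suc_iff[of "\<lambda>n. 1 / real n ^ 2"] by (simp add: divide_inverse)
        then show "summable (\<lambda>n. 2 * (1 / real (Suc n) ^ 2))" by (rule summable_mult)
        have "norm (norm (theta (Suc e) (u j) (Suc n) / of_nat (Suc n) ^ (Suc e + M))) \<le> 2 * (1 / real (Suc n) ^ 2)" for n
        proof -
          have "norm (theta (Suc e) (u j) (Suc n)) / real (Suc n) ^ (Suc e + M) \<le> 2 / real (Suc n) ^ 2"
            by (intro frac_le norm_theta power_increasing) (auto simp: M_def)
          then show ?thesis unfolding real_norm_def abs_norm_cancel norm_divide norm_power norm_of_nat by simp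
        qed
        then show "\<exists>N. \<forall>n\<ge>N. norm (norm (theta (Suc e) (u j) (Suc n) / of_nat (Suc n) ^ (Suc e + M))) \<le> 2 * (1 / real (Suc n) ^ 2)" by blast
      qed
      let ?p = "\<lambda>n. (1 + (-1) ^ Suc e) * of_real (moment_pole e k) / of_real (b * Y) ^ M * (theta (Suc e) (u j) (Suc n) / of_nat (Suc n) ^ (Suc e + M))"
      have swap: "t / p * (q / (r * w)) = q / w * (t / (p * r))" for t p q r w :: complex by (simp add: mult_ac)
      have split: "theta (Suc e) (u j) (Suc n) / of_nat (Suc n) ^ Suc e * moment_sym e k (y j) (of_real (real (Suc n) * (b * Y))) =
         theta (Suc e) (u j) (Suc n) / of_nat (Suc n) ^ Suc e * moment_reg_sym e k (y j) (of_real (real (Suc n) * (b * Y))) + ?p n" for n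
      proof -
        let ?t = "complex_of_real (real (Suc n) * (b * Y))"
        have t0: "Re ?t > 0" "?t \<in> strip" using mult_pos_pos[OF _ bY, of "real (Suc n)"] by (simp_all add: strip_def del: of_nat_Suc)
        have "moment_sym e k (y j) ?t = moment_reg_sym e k (y j) ?t + (1 + (-1) ^ Suc e) * of_real (moment_pole e k) / ?t ^ M"
          unfolding moment_sym_def moment_reg_sym_def moment_eq_reg[OF t0 e] M_def[symmetric]
          by (simp add: algebra_simps add_divide_distrib del: power_Suc of_nat_Suc)
        moreover have "?t ^ M = of_nat (Suc n) ^ M * of_real (b * Y) ^ M"
          by (simp only: of_real_mult power_mult_distrib of_real_of_nat_eq)
        ultimately show ?thesis
          unfolding power_add[of _ "Suc e" M] by (simp only: distrib_left) (rule arg_cong2[where f = "(+)", OF refl swap])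
      qed
      have pp: "?p sums ((1 + (-1) ^ Suc e) * of_real (moment_pole e k) / of_real (b * Y) ^ M * suminf (\<lambda>n. theta (Suc e) (u j) (Suc n) / of_nat (Suc n) ^ (Suc e + M)))"
        by (intro sums_mult summable_sums sp)
      have "summable (\<lambda>n. (theta (Suc e) (u j) (Suc n) / of_nat (Suc n) ^ Suc e * moment_sym e k (y j) (of_real (real (Suc n) * (b * Y)))) - ?p n)"
        by (intro summable_diff sm sums_summable[OF pp])
      then have "summable (\<lambda>n. theta (Suc e) (u j) (Suc n) / of_nat (Suc n) ^ Suc e * moment_reg_sym e k (y j) (of_real (real (Suc n) * (b * Y))))"
        unfolding split by simp
      from sums_add[OF summable_sums[OF this] pp] show ?thesis
        unfolding split R_def P_def by (simp add: mult_ac del: power_Suc of_nat_Suc)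
    qed
    have "(\<lambda>n. \<Sum>j\<in>{0..<c}. \<kappa> * (theta (Suc e) (u j) (Suc n) / of_nat (Suc n) ^ Suc e * moment_sym e k (y j) (of_real (real (Suc n) * (b * Y))))) sums
      (\<Sum>j\<in>{0..<c}. \<kappa> * (R j (b * Y) + P j / of_real (b * Y) ^ M))"
      by (intro sums_sum sums_mult s2)
    with s1 show ?thesis unfolding t1 by (rule sums_unique2)
  qed
  define \<eta> where "\<eta> j = - (\<i> ^ Suc e * (2 * of_real pi * \<i>) ^ Suc e / fact (Suc e) * of_real (periodic_bernoulli (Suc e) (u j))) * moment_reg_sym e k (y j) 0" for j
  have Rlim: "((\<lambda>Y. R j (b * Y)) \<longlongrightarrow> \<eta> j) (at_right 0)" for j
  proof -
    have "filterlim (\<lambda>Y. b * Y) (at_right 0) (at_right 0)"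
    proof (rule filterlim_at_withinI)
      have "((\<lambda>Y. b * Y) \<longlongrightarrow> b * 0) (at_right 0)" by (intro tendsto_intros)
      then show "((\<lambda>Y. b * Y) \<longlongrightarrow> 0) (at_right 0)" by simp
      show "\<forall>\<^sub>F Y in at_right 0. b * Y \<in> {0<..} - {0}"
        using eventually_at_right_less[of "0::real"] by eventually_elim (use b in auto)
    qed
    from filterlim_compose[OF moment_series_limit[OF e, of "u j" "y j"] this]
    show ?thesis by (simp only: R_def \<eta>_def)
  qed
  define Q where "Q = (\<Sum>j\<in>{0..<c}. \<kappa> * (P j / of_real b ^ M)) - of_real (Re K)"
  have main: "((\<lambda>Y. (\<Sum>j\<in>{0..<c}. \<kappa> * R j (b * Y)) + Q * of_real (1 / Y ^ M)) \<longlongrightarrow> of_real (Re L)) (at_right 0)"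
  proof (rule Lim_transform_eventually)
    show "((\<lambda>Y. complex_of_real (Re (G (Complex (of_int a / of_int c) Y) - K * of_real (1 / Y ^ Suc (k - e))))) \<longlongrightarrow> of_real (Re L)) (at_right 0)"
      by (intro tendsto_of_real tendsto_Re L)
    show "\<forall>\<^sub>F Y in at_right 0. complex_of_real (Re (G (Complex (of_int a / of_int c) Y) - K * of_real (1 / Y ^ Suc (k - e)))) =
       (\<Sum>j\<in>{0..<c}. \<kappa> * R j (b * Y)) + Q * of_real (1 / Y ^ M)"
      using eventually_at_right_less[of "0::real"]
    proof eventually_elim
      fix Y :: real assume Y: "Y > 0"
      have "complex_of_real (Re (G (Complex (of_int a / of_int c) Y) - K * of_real (1 / Y ^ Suc (k - e)))) =
         of_real (Re (G (Complex \<alpha> Y))) - of_real (Re K) * of_real (1 / Y ^ M)"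
        unfolding M_def[symmetric] \<alpha>_def[symmetric] minus_complex.simps by simp
      moreover have pj: "P j / of_real (b * Y) ^ M = P j / of_real b ^ M * of_real (1 / Y ^ M)" for j
        by (simp add: power_mult_distrib)
      ultimately show "complex_of_real (Re (G (Complex (of_int a / of_int c) Y) - K * of_real (1 / Y ^ Suc (k - e)))) =
       (\<Sum>j\<in>{0..<c}. \<kappa> * R j (b * Y)) + Q * of_real (1 / Y ^ M)"
        unfolding ReG[OF Y] Q_def pj by (simp only: distrib_left sum.distrib left_diff_distrib sum_distrib_right mult.assoc add_diff_eq)
    qed
  qed
  have Rs: "((\<lambda>Y. \<Sum>j\<in>{0..<c}. \<kappa> * R j (b * Y)) \<longlongrightarrow> (\<Sum>j\<in>{0..<c}. \<kappa> * \<eta> j)) (at_right 0)"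
    by (intro tendsto_sum tendsto_mult tendsto_const Rlim)
  have Qlim: "((\<lambda>Y. Q * of_real (1 / Y ^ M)) \<longlongrightarrow> of_real (Re L) - (\<Sum>j\<in>{0..<c}. \<kappa> * \<eta> j)) (at_right 0)"
    using tendsto_diff[OF main Rs] by simp
  \<comment> \<open>Everything else converges, so Q / Y^M has a finite limit as Y tends to 0;
    multiplying by Y^M shows Q = 0, without evaluating K or P.\<close>
  have "Q = 0"
  proof -
    have "((\<lambda>Y::real. complex_of_real (Y ^ M)) \<longlongrightarrow> complex_of_real (0 ^ M)) (at_right 0)" by (intro tendsto_intros)
    from tendsto_mult[OF Qlim this]
    have "((\<lambda>Y. Q * of_real (1 / Y ^ M) * of_real (Y ^ M)) \<longlongrightarrow> 0) (at_right 0)" by (simp add: M_def)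
    moreover have "\<forall>\<^sub>F Y in at_right 0. Q * of_real (1 / Y ^ M) * of_real (Y ^ M) = Q"
      using eventually_at_right_less[of "0::real"] by eventually_elim simp
    ultimately have "((\<lambda>Y::real. Q) \<longlongrightarrow> 0) (at_right 0)" by (rule Lim_transform_eventually)
    then show ?thesis by (simp add: tendsto_const_iff)
  qed
  then have "((\<lambda>Y::real. 0::complex) \<longlongrightarrow> of_real (Re L) - (\<Sum>j\<in>{0..<c}. \<kappa> * \<eta> j)) (at_right 0)"
    using Qlim by simp
  then have ReL: "complex_of_real (Re L) = (\<Sum>j\<in>{0..<c}. \<kappa> * \<eta> j)"
    by (simp add: tendsto_const_iff)
  have "\<kappa> * \<eta> j = of_real ((-1) ^ e * of_int c ^ (k - e) *
     (periodic_bernoulli M (y j) / real M * (periodic_bernoulli (Suc e) (u j) / real (Suc e))))" for j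
  proof -
    \<comment> \<open>M = k - e + 1 and e + 1 have even sum k + 2; this parity is what lets
      \<open>periodic_bernoulli_symmetrize\<close> apply.\<close>
    have ek: "even k \<Longrightarrow> (-1 :: real) ^ Suc e = (-1) ^ M"
      using e by (auto simp: M_def minus_one_power_iff)
    have r0: "moment_reg_sym e k (y j) 0 = - (fact e * 2 / of_nat M) * of_real (periodic_bernoulli M (y j))"
    proof -
      let ?B = "\<lambda>x. bernoulli_poly M (1 - coset_rep x)"
      have "moment_reg_sym e k (y j) 0 = fact e * ((-1) ^ (k - e) * (of_real (?B (y j) / real M))) +
         (-1) ^ Suc e * (fact e * ((-1) ^ (k - e) * of_real (?B (- y j) / real M)))"
        unfolding moment_reg_sym_def moment_reg_0[OF e] coset_reg_0 M_def ..
      also have "\<dots> = complex_of_real (fact e / real M * ((-1) ^ (k - e) * (?B (y j) + (-1) ^ Suc e * ?B (- y j))))"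
        by (simp add: algebra_simps add_divide_distrib del: power_Suc)
      also have "(-1) ^ (k - e) * (?B (y j) + (-1) ^ Suc e * ?B (- y j)) = - (?B (- y j) + (-1) ^ M * ?B (y j))"
        unfolding ek[OF m(2)] by (cases "even (k - e)") (simp_all add: M_def)
      also have "\<dots> = - (2 * periodic_bernoulli M (y j))"
        by (subst periodic_bernoulli_symmetrize) (simp_all add: M_def)
      finally show ?thesis by simp
    qed
    \<comment> \<open>One factor comes from \<open>theta\<close>, the other from (2 pi i)^(e+1).
      With the signs of \<open>\<kappa>\<close>, \<open>\<eta>\<close> and \<open>r0\<close> the
      product gives (-1)^e, while the powers of 2 pi cancel against b.\<close>
    have i2: "\<i> ^ Suc e * \<i> ^ Suc e = (-1 :: complex) ^ Suc e" by (simp only: power_mult_distrib[symmetric] i_squared)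
    have bs: "of_real b ^ Suc e = (2 * of_real pi) ^ Suc e * (of_int c :: complex) ^ Suc e" 
      by (simp add: b_def power_mult_distrib)
    have ck: "(of_int c :: complex) ^ Suc k = of_int c ^ Suc e * of_int c ^ (k - e)"
      using e by (simp flip: power_add)
    have nzs: "(of_int c :: complex) ^ Suc e \<noteq> 0" "(2 * complex_of_real pi) ^ Suc e \<noteq> 0" "(of_nat M :: complex) \<noteq> 0" using c by (simp_all add: M_def del: of_nat_Suc)
    have "\<kappa> * \<eta> j = - ((\<i> ^ Suc e * \<i> ^ Suc e) * of_int c ^ (k - e) * (fact e / fact (Suc e)) *
       (of_real (periodic_bernoulli M (y j)) / of_nat M) * of_real (periodic_bernoulli (Suc e) (u j)))"
      unfolding \<kappa>_def \<eta>_def r0 bs ck power_mult_distrib[of "2 * of_real pi"]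
      using nzs by (simp add: field_simps del: power_Suc fact_Suc of_nat_Suc)
    also have "fact e / fact (Suc e) = (1 / of_nat (Suc e) :: complex)" by (simp del: of_nat_Suc)
    finally show ?thesis unfolding i2 by (simp add: mult_ac del: of_nat_Suc)
  qed
  then have "complex_of_real (Re L) = of_real (\<Sum>j\<in>{0..<c}. (-1) ^ e * of_int c ^ (k - e) *
     (periodic_bernoulli M (y j) / real M * (periodic_bernoulli (Suc e) (u j) / real (Suc e))))"
    unfolding ReL of_real_sum by (simp only:)
  then have "Re L = (\<Sum>j\<in>{0..<c}. (-1) ^ e * of_int c ^ (k - e) *
     (periodic_bernoulli M (y j) / real M * (periodic_bernoulli (Suc e) (u j) / real (Suc e))))"
    by (simp only: of_real_eq_iff)
  then show ?thesis
    unfolding dedekind_sum_def sum_distrib_left fst_conv snd_conv u_def y_def M_def .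
qed


section \<open>Scalar periods\<close>

lemma poly_primitive:
  fixes q :: "complex poly"
  obtains P where "\<And>z. (P has_field_derivative poly q z) (at z)" "P 0 = 0"
proof -
  have "poly q holomorphic_on UNIV" by (intro holomorphic_intros)
  from holomorphic_convex_primitive'[OF convex_UNIV open_UNIV this]
  obtain g where g: "\<And>z. (g has_field_derivative poly q z) (at z)" by auto
  have "((\<lambda>z. g z - g 0) has_field_derivative poly q z) (at z)" for z
    using DERIV_diff[OF g DERIV_const] by simp
  then show ?thesis by (rule that) simp
qed

lemma contour_integral_linepath_primitive:
  assumes "\<And>z. z \<in> S \<Longrightarrow> (P has_field_derivative f z) (at z)" "closed_segment u v \<subseteq> S"
  shows "contour_integral (linepath u v) f = P v - P u"
proof -
  have "(f has_contour_integral (P (pathfinish (linepath u v)) - P (pathstart (linepath u v)))) (linepath u v)"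
    by (rule contour_integral_primitive[of S]) (use assms in \<open>auto intro: has_field_derivative_at_within\<close>)
  then show ?thesis by (simp add: contour_integral_unique)
qed

text \<open>Both integrals are differences of one primitive, which also settles the orientation when
  v < u.\<close>

lemma Re_contour_integral_poly:
  fixes q :: "complex poly" and p :: "real \<Rightarrow> real"
  assumes "\<And>t. poly q (of_real t) = of_real (p t)"
  shows "Re (contour_integral (linepath (of_real u) (of_real v)) (poly q)) = (LBINT t=ereal u..ereal v. p t)"
proof -
  obtain P where P: "\<And>z. (P has_field_derivative poly q z) (at z)" using poly_primitive[of q] by metis
  have "contour_integral (linepath (of_real u) (of_real v)) (poly q) = P (of_real v) - P (of_real u)"
    by (rule contour_integral_linepath_primitive[of UNIV]) (use P in auto)
  moreover have "(LBINT t=ereal u..ereal v. p t) = Re (P (of_real v)) - Re (P (of_real u))"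
  proof (rule interval_integral_FTC_finite)
    have "p = (\<lambda>t. Re (poly q (of_real t)))" using assms by auto
    then show "continuous_on {min u v..max u v} p" by (simp only:) (intro continuous_intros)
    fix t
    have "((\<lambda>t. P (of_real t)) has_vector_derivative poly q (of_real t)) (at t within {min u v..max u v})"
      by (rule has_vector_derivative_real_field) (rule P)
    from bounded_linear.has_vector_derivative[OF bounded_linear_Re this]
    show "((\<lambda>t. Re (P (of_real t))) has_vector_derivative p t) (at t within {min u v..max u v})"
      by (simp add: assms)
  qed
  ultimately show ?thesis by simp
qed

text \<open>One coefficient of \<open>Psi\<close>: f is the form and f' its slash transform, a0 and
  a0' are their constant terms, q and q' the coefficient polynomials of F and of its transform, and
  w0 is the image of z0.\<close>

definition period :: "(complex \<Rightarrow> complex) \<Rightarrow> complex \<Rightarrow> complex poly \<Rightarrow> (complex \<Rightarrow> complex) \<Rightarrow> complex \<Rightarrow> complex poly \<Rightarrow>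
    complex \<Rightarrow> complex \<Rightarrow> complex" where
  "period f a0 q f' a0' q' z0 w0 =
     contour_integral (linepath z0 w0) (\<lambda>z. f z * poly q z)
     + a0 * contour_integral (linepath 0 z0) (poly q)
     - a0' * contour_integral (linepath 0 z0) (poly q')
     - integral {0..} (\<lambda>t::real. (f (z0 + \<i> * of_real t) - a0) * poly q (z0 + \<i> * of_real t) * \<i>)
     + integral {0..} (\<lambda>t::real. (f' (z0 + \<i> * of_real t) - a0') * poly q' (z0 + \<i> * of_real t) * \<i>)"

text \<open>With primitives \<open>A\<close>, \<open>A'\<close> of \<open>f q\<close>, \<open>f' q'\<close> normalised at the cusp, the period is \<open>A (w z) - A' z\<close>,
  which is constant since both terms have the same derivative.\<close>

lemma period_eq:
  assumes f: "q_expansion N a f" and f': "q_expansion N' a' f'"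
    and w: "\<And>z. Im z > 0 \<Longrightarrow> Im (w z) > 0" "\<And>z. Im z > 0 \<Longrightarrow> (w has_field_derivative w' z) (at z)"
    and rel: "\<And>z. Im z > 0 \<Longrightarrow> f (w z) * poly q (w z) * w' z = f' z * poly q' z"
    and z0: "Im z0 > 0"
  obtains P P' G G' where
    "\<And>z. (P has_field_derivative poly q z) (at z)" "P 0 = 0"
    "\<And>z. (P' has_field_derivative poly q' z) (at z)" "P' 0 = 0"
    "\<And>z. Im z > 0 \<Longrightarrow> (G has_field_derivative poly q z * (f z - a 0)) (at z)"
    "\<And>x. ((\<lambda>t. G (Complex x t)) \<longlongrightarrow> 0) at_top"
    "\<And>x. ((\<lambda>t. G' (Complex x t)) \<longlongrightarrow> 0) at_top"
    "\<And>z. Im z > 0 \<Longrightarrow> period f (a 0) q f' (a' 0) q' z0 (w z0) = a 0 * P (w z) + G (w z) - (a' 0 * P' z + G' z)"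
proof -
  obtain P where P: "\<And>z. (P has_field_derivative poly q z) (at z)" "P 0 = 0" using poly_primitive[of q] by metis
  obtain P' where P': "\<And>z. (P' has_field_derivative poly q' z) (at z)" "P' 0 = 0" using poly_primitive[of q'] by metis
  obtain G where G: "\<And>z. Im z > 0 \<Longrightarrow> (G has_field_derivative poly q z * (f z - a 0)) (at z)"
    "\<And>z. Im z > 0 \<Longrightarrow> ((\<lambda>t. poly q (z + \<i> * of_real t) * (f (z + \<i> * of_real t) - a 0) * \<i>) has_integral - G z) {0..}"
    "\<And>x. ((\<lambda>t. G (Complex x t)) \<longlongrightarrow> 0) at_top"
    by (rule cusp_primitive[OF f, of q]) (rule that, assumption+)
  obtain G' where G': "\<And>z. Im z > 0 \<Longrightarrow> (G' has_field_derivative poly q' z * (f' z - a' 0)) (at z)"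
    "\<And>z. Im z > 0 \<Longrightarrow> ((\<lambda>t. poly q' (z + \<i> * of_real t) * (f' (z + \<i> * of_real t) - a' 0) * \<i>) has_integral - G' z) {0..}"
    "\<And>x. ((\<lambda>t. G' (Complex x t)) \<longlongrightarrow> 0) at_top"
    by (rule cusp_primitive[OF f', of q']) (rule that, assumption+)
  define A where "A z = a 0 * P z + G z" for z
  define A' where "A' z = a' 0 * P' z + G' z" for z
  have A: "(A has_field_derivative f z * poly q z) (at z)" if "Im z > 0" for z
    using DERIV_add[OF DERIV_cmult[OF P(1), of "a 0"] G(1)[OF that]] by (simp add: A_def[abs_def] algebra_simps)
  have A': "(A' has_field_derivative f' z * poly q' z) (at z)" if "Im z > 0" for z
    using DERIV_add[OF DERIV_cmult[OF P'(1), of "a' 0"] G'(1)[OF that]] by (simp add: A'_def[abs_def] algebra_simps)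
  have "((\<lambda>z. A (w z) - A' z) has_field_derivative 0) (at z within upper_half)" if "z \<in> upper_half" for z
  proof -
    have z: "Im z > 0" using that by simp
    from DERIV_diff[OF DERIV_chain2[OF A[OF w(1)[OF z]] w(2)[OF z]] A'[OF z]]
    have "((\<lambda>z. A (w z) - A' z) has_field_derivative 0) (at z)" by (simp add: rel[OF z])
    then show ?thesis by (rule has_field_derivative_at_within)
  qed
  from has_field_derivative_zero_constant[OF convex_upper_half this]
  obtain C where C: "\<And>z. Im z > 0 \<Longrightarrow> A (w z) - A' z = C" by auto
  have seg: "closed_segment z0 (w z0) \<subseteq> upper_half"
    by (intro closed_segment_subset convex_upper_half) (use z0 w(1) in auto)
  have 1: "contour_integral (linepath z0 (w z0)) (\<lambda>z. f z * poly q z) = A (w z0) - A z0"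
    by (rule contour_integral_linepath_primitive[OF _ seg]) (use A in auto)
  have 2: "contour_integral (linepath 0 z0) (poly q) = P z0" "contour_integral (linepath 0 z0) (poly q') = P' z0"
    using contour_integral_linepath_primitive[of UNIV P "poly q" 0 z0] P
      contour_integral_linepath_primitive[of UNIV P' "poly q'" 0 z0] P' by auto
  have 3: "integral {0..} (\<lambda>t::real. (f (z0 + \<i> * of_real t) - a 0) * poly q (z0 + \<i> * of_real t) * \<i>) = - G z0"
    using integral_unique[OF G(2)[OF z0]] by (simp add: mult_ac)
  have 4: "integral {0..} (\<lambda>t::real. (f' (z0 + \<i> * of_real t) - a' 0) * poly q' (z0 + \<i> * of_real t) * \<i>) = - G' z0"
    using integral_unique[OF G'(2)[OF z0]] by (simp add: mult_ac)
  have "period f (a 0) q f' (a' 0) q' z0 (w z0) = A (w z0) - A' z0"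
    unfolding period_def 1 2 3 4 by (simp add: A_def A'_def)
  then have E: "period f (a 0) q f' (a' 0) q' z0 (w z0) = a 0 * P (w z) + G (w z) - (a' 0 * P' z + G' z)" if "Im z > 0" for z
    using C[OF z0] C[OF that] by (simp add: A_def A'_def)
  show ?thesis by (rule that[OF P P' G(1,3) G'(3) E])
qed

text \<open>The map fixes the cusp at infinity, so both cuspidal primitives vanish in the limit. The
  polynomial parts differ by a constant, which is read off at z = 0.\<close>

lemma period_upper:
  fixes s t :: real
  assumes f: "q_expansion N a f" and f': "q_expansion N' a' f'" and a': "a' 0 = \<kappa> * a 0"
    and s: "s > 0" and ff': "\<And>z. Im z > 0 \<Longrightarrow> f' z = \<kappa> * f (of_real s * z + of_real t)"
    and q: "\<And>z. \<kappa> * poly q' z = poly q (of_real s * z + of_real t) * of_real s"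
    and z0: "Im z0 > 0"
  shows "period f (a 0) q f' (a' 0) q' z0 (of_real s * z0 + of_real t) =
     a 0 * contour_integral (linepath 0 (of_real t)) (poly q)"
proof -
  define w where "w z = complex_of_real s * z + of_real t" for z
  have w: "Im (w z) > 0" if "Im z > 0" for z using that s by (simp add: w_def)
  have wd: "(w has_field_derivative of_real s) (at z)" for z
    unfolding w_def[abs_def] by (auto intro!: derivative_eq_intros)
  have rel: "f (w z) * poly q (w z) * of_real s = f' z * poly q' z" if "Im z > 0" for z
    using q[of z] ff'[OF that] by (simp add: w_def mult_ac)
  obtain P P' G G' where P: "\<And>z. (P has_field_derivative poly q z) (at z)" "P 0 = 0"
    and P': "\<And>z. (P' has_field_derivative poly q' z) (at z)" "P' 0 = 0"
    and G: "\<And>x. ((\<lambda>t. G (Complex x t)) \<longlongrightarrow> 0) at_top"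
    and G': "\<And>x. ((\<lambda>t. G' (Complex x t)) \<longlongrightarrow> 0) at_top"
    and E: "\<And>z. Im z > 0 \<Longrightarrow> period f (a 0) q f' (a' 0) q' z0 (w z0) = a 0 * P (w z) + G (w z) - (a' 0 * P' z + G' z)"
    by (rule period_eq[OF f f' w wd rel z0]) (assumption+, rule that, assumption+)
  have "((\<lambda>z. P (w z) - \<kappa> * P' z) has_field_derivative 0) (at z within UNIV)" for z
    using DERIV_diff[OF DERIV_chain2[OF P(1) wd] DERIV_cmult[OF P'(1), of \<kappa>], of z] q[of z] by (simp add: w_def)
  from has_field_derivative_zero_constant[OF convex_UNIV this]
  obtain C where C: "\<And>z. P (w z) - \<kappa> * P' z = C" by auto
  then have C0: "C = P (of_real t)" using C[of 0] P'(2) by (simp add: w_def)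
  have PP: "a 0 * P (w z) - a' 0 * P' z = a 0 * P (of_real t)" for z
    using arg_cong[OF C[of z], of "\<lambda>v. a 0 * v"] by (simp add: a' C0 algebra_simps)
  have E': "period f (a 0) q f' (a' 0) q' z0 (w z0) - a 0 * P (of_real t) = G (Complex t (s * \<tau>)) - G' (Complex 0 \<tau>)"
    if "\<tau> > 0" for \<tau>
  proof -
    have "w (Complex 0 \<tau>) = Complex t (s * \<tau>)" by (simp add: w_def complex_eq_iff)
    then show ?thesis using E[of "Complex 0 \<tau>"] PP[of "Complex 0 \<tau>"] that by (simp add: algebra_simps)
  qed
  have "filterlim (\<lambda>\<tau>. s * \<tau>) at_top at_top" using s by real_asymp
  from tendsto_diff[OF filterlim_compose[OF G this] G']
  have "((\<lambda>\<tau>. G (Complex t (s * \<tau>)) - G' (Complex 0 \<tau>)) \<longlongrightarrow> 0 - 0) at_top" .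
  moreover have "\<forall>\<^sub>F \<tau> in at_top. G (Complex t (s * \<tau>)) - G' (Complex 0 \<tau>) = period f (a 0) q f' (a' 0) q' z0 (w z0) - a 0 * P (of_real t)"
    using eventually_gt_at_top[of "0::real"] by eventually_elim (simp add: E')
  ultimately have "((\<lambda>\<tau>::real. period f (a 0) q f' (a' 0) q' z0 (w z0) - a 0 * P (of_real t)) \<longlongrightarrow> 0 - 0) at_top"
    by (rule Lim_transform_eventually)
  then have "period f (a 0) q f' (a' 0) q' z0 (w z0) = a 0 * P (of_real t)" by (simp add: tendsto_const_iff)
  moreover have "contour_integral (linepath 0 (of_real t)) (poly q) = P (of_real t)"
    using contour_integral_linepath_primitive[of UNIV P "poly q" 0 "of_real t"] P by simp
  ultimately show ?thesis by (simp add: w_def)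
qed

lemma Re_period_modular:
  fixes a b c d :: int
  assumes m: "m = k + 2" "even k" and N: "N > 0" and x: "real N * x1 \<in> \<int>" "real N * x2 \<in> \<int>"
    and nz: "m = 2 \<Longrightarrow> \<not> (x1 \<in> \<int> \<and> x2 \<in> \<int>)" and c: "c > 0" and det: "a * d - b * c = 1" and e: "e \<le> k"
    and z0: "Im z0 > 0"
    and f': "q_expansion N a' f'" "a' 0 = eis_const m (of_int a * x1 + of_int c * x2)"
    and ff': "\<And>z. Im z > 0 \<Longrightarrow> phi m N (x1, x2) ((of_int a * z + of_int b) / (of_int c * z + of_int d)) = (of_int c * z + of_int d) ^ m * f' z"
  defines "q \<equiv> [: - of_real (of_int a / of_int c), 1 :] ^ e" and "q' \<equiv> smult ((- 1 / of_int c) ^ e) ([: of_int d, of_int c :] ^ (k - e))"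
  shows "Re (period (phi m N (x1, x2)) (eis_const m x1) q f' (a' 0) q' z0 ((of_int a * z0 + of_int b) / (of_int c * z0 + of_int d))) =
     Re (eis_const m x1 * contour_integral (linepath 0 (of_real (of_int a / of_int c))) (poly q))
     + Re (a' 0 * contour_integral (linepath (of_real (- of_int d / of_int c)) 0) (poly q'))
     + (-1) ^ e * of_int c ^ (k - e) * dedekind_sum (Suc (k - e)) (Suc e) (x1, x2) a c"
proof -
  define \<alpha> where "\<alpha> = real_of_int a / of_int c"
  define \<delta> where "\<delta> = - real_of_int d / of_int c"
  have m2: "m \<ge> 2" "even m" using m by auto
  obtain a0 where f: "q_expansion N a0 (phi m N (x1, x2))" "a0 0 = eis_const m x1"
    using phi_q_expansion[OF m2 N x nz] by metis
  define w where "w z = (of_int a * z + of_int b) / (of_int c * z + of_int d)" for z :: complex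
  have c0: "(of_int c :: complex) \<noteq> 0" "real_of_int c > 0" using c by auto
  have j: "of_int c * z + of_int d \<noteq> (0 :: complex)" if "Im z > 0" for z
  proof
    assume "of_int c * z + of_int d = 0"
    then have "Im (of_int c * z + of_int d) = 0" by simp
    then show False using that c by simp
  qed
  have detc: "of_int a * of_int d - of_int b * of_int c = (1 :: complex)"
    using det by (metis of_int_1 of_int_diff of_int_mult)
  have w: "Im (w z) > 0" if "Im z > 0" for z
    unfolding w_def by (rule phi_modular(1)[OF m2(1) that N x nz det])
  have wd: "(w has_field_derivative 1 / (of_int c * z + of_int d) ^ 2) (at z)" if "Im z > 0" for z
  proof -
    have "(w has_field_derivative (of_int a * (of_int c * z + of_int d) - (of_int a * z + of_int b) * of_int c) / ((of_int c * z + of_int d) * (of_int c * z + of_int d))) (at z)"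
      unfolding w_def[abs_def] using j[OF that] by (auto intro!: derivative_eq_intros)
    moreover have "of_int a * (of_int c * z + of_int d) - (of_int a * z + of_int b) * of_int c = of_int a * of_int d - of_int b * of_int c"
      by (simp add: algebra_simps)
    ultimately show ?thesis by (simp add: detc power2_eq_square)
  qed
  have w\<alpha>: "w z - of_real \<alpha> = (- 1 / of_int c) / (of_int c * z + of_int d)" if "Im z > 0" for z
  proof -
    define J where "J = of_int c * z + (of_int d :: complex)"
    have J: "J \<noteq> 0" using j[OF that] by (simp add: J_def)
    have "of_int c * J * (w z - of_real \<alpha>) = of_int c * (of_int a * z + of_int b) - of_int a * J"
      using J c0 by (simp add: w_def \<alpha>_def right_diff_distrib flip: J_def)
    also have "\<dots> = - (of_int a * of_int d - of_int b * of_int c)" by (simp add: J_def algebra_simps)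
    finally have "(w z - of_real \<alpha>) * (of_int c * J) = - 1" unfolding detc by (simp add: mult_ac)
    then have "w z - of_real \<alpha> = - 1 / (of_int c * J)" using J c0 by (subst nonzero_eq_divide_eq) simp_all
    then show ?thesis by (simp add: J_def)
  qed
  have q: "poly q z = (z - of_real \<alpha>) ^ e" for z by (simp add: q_def \<alpha>_def)
  have q': "poly q' z = (- 1 / of_int c) ^ e * (of_int c * z + of_int d) ^ (k - e)" for z
    by (simp add: q'_def algebra_simps)
  \<comment> \<open>Count of exponents: m = k + 2 from the form, -e from (w -
    \<open>\<alpha>\<close>)^e and -2 from the derivative of w leave k - e.\<close>
  have rel: "phi m N (x1, x2) (w z) * poly q (w z) * (1 / (of_int c * z + of_int d) ^ 2) = f' z * poly q' z" if "Im z > 0" for z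
  proof -
    define J where "J = of_int c * z + (of_int d :: complex)"
    have J: "J \<noteq> 0" using j[OF that] by (simp add: J_def)
    have "J ^ m = J ^ (k - e) * J ^ e * J ^ 2" using e by (simp add: m flip: power_add)
    then have "phi m N (x1, x2) (w z) = J ^ (k - e) * J ^ e * J ^ 2 * f' z" using ff'[OF that] by (simp add: w_def J_def)
    moreover have "poly q (w z) = (- 1 / of_int c) ^ e / J ^ e" by (simp only: q w\<alpha>[OF that] power_divide J_def)
    ultimately show ?thesis unfolding q' J_def[symmetric] using J by simp
  qed
  obtain P P' G G' where P: "\<And>z. (P has_field_derivative poly q z) (at z)" "P 0 = 0"
    and P': "\<And>z. (P' has_field_derivative poly q' z) (at z)" "P' 0 = 0"
    and G: "\<And>z. Im z > 0 \<Longrightarrow> (G has_field_derivative poly q z * (phi m N (x1, x2) z - a0 0)) (at z)"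
      "\<And>x. ((\<lambda>t. G (Complex x t)) \<longlongrightarrow> 0) at_top"
    and G': "\<And>x. ((\<lambda>t. G' (Complex x t)) \<longlongrightarrow> 0) at_top"
    and E: "\<And>z. Im z > 0 \<Longrightarrow> period (phi m N (x1, x2)) (a0 0) q f' (a' 0) q' z0 (w z0) = a0 0 * P (w z) + G (w z) - (a' 0 * P' z + G' z)"
    by (rule period_eq[OF f(1) f'(1) w wd rel z0]) (assumption+, rule that, assumption+)
  define \<psi> where "\<psi> = period (phi m N (x1, x2)) (a0 0) q f' (a' 0) q' z0 (w z0)"
  define M where "M = Suc (k - e)"
  \<comment> \<open>The primitive of q' that vanishes at \<open>\<delta>\<close>.\<close>
  define Q where "Q z = (- 1 / of_int c) ^ e / (of_int c * of_nat M) * (of_int c * z + of_int d) ^ M" for z :: complex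
  have M0: "(of_nat M :: complex) \<noteq> 0" by (simp add: M_def del: of_nat_Suc)
  have Qd: "(Q has_field_derivative poly q' z) (at z)" for z
  proof -
    have "((\<lambda>z. (of_int c * z + of_int d) ^ M) has_field_derivative of_nat M * (of_int c * z + of_int d) ^ (k - e) * of_int c) (at z)"
      unfolding M_def by (rule DERIV_chain2[where f = "\<lambda>z. z ^ Suc (k - e)"]) (auto intro!: derivative_eq_intros simp del: of_nat_Suc power_Suc)
    from DERIV_cmult[OF this, of "(- 1 / of_int c) ^ e / (of_int c * of_nat M)"]
    show ?thesis using c0 M0 by (simp add: Q_def[abs_def] q')
  qed
  have "((\<lambda>z. P' z - Q z) has_field_derivative 0) (at z within UNIV)" for z
    using DERIV_diff[OF P'(1) Qd, of z] by simp
  from has_field_derivative_zero_constant[OF convex_UNIV this]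
  obtain C where C: "\<And>z. P' z - Q z = C" by auto
  have "Q (of_real \<delta>) = 0" using c0 by (simp add: Q_def \<delta>_def M_def)
  then have P'Q: "P' z = P' (of_real \<delta>) + Q z" for z using C[of z] C[of "of_real \<delta>"] by (simp add: algebra_simps)
  \<comment> \<open>The chosen point above \<open>\<delta>\<close> satisfies c z + d = i / (c Y), so
    the monomial part of the primitive contributes exactly K / Y^M.\<close>
  define K where "K = a' 0 * ((- 1 / of_int c) ^ e / (of_int c * of_nat M) * (\<i> / of_int c) ^ M)"
  have GE: "G (Complex \<alpha> Y) - K * of_real (1 / Y ^ M) =
     \<psi> - a0 0 * P (Complex \<alpha> Y) + a' 0 * P' (of_real \<delta>) + G' (Complex \<delta> (1 / (of_int c ^ 2 * Y)))" if Y: "Y > 0" for Y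
  proof -
    define z1 where "z1 = Complex \<delta> (1 / (of_int c ^ 2 * Y))"
    have z1: "Im z1 > 0" using Y c by (simp add: z1_def)
    have j1: "of_int c * z1 + of_int d = \<i> / of_int c * of_real (1 / Y)"
      using c Y by (simp add: z1_def \<delta>_def complex_eq_iff power2_eq_square field_simps)
    have "w z1 = of_real \<alpha> + (- 1 / of_int c) / (\<i> / of_int c * of_real (1 / Y))" using w\<alpha>[OF z1] unfolding j1 by (simp add: algebra_simps)
    also have "\<dots> = Complex \<alpha> Y" using c0 Y by (simp add: Complex_eq field_simps)
    finally have w1: "w z1 = Complex \<alpha> Y" .
    have "a' 0 * Q z1 = K * of_real (1 / Y ^ M)"
      unfolding Q_def K_def j1 power_mult_distrib by (simp add: power_one_over)
    then show ?thesis using E[OF z1] unfolding w1 \<psi>_def[symmetric] P'Q[of z1] z1_def[symmetric] by (simp add: algebra_simps)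
  qed
  have "((\<lambda>Y. P (Complex \<alpha> Y)) \<longlongrightarrow> P (of_real \<alpha>)) (at_right 0)"
  proof (rule isCont_tendsto_compose[OF DERIV_isCont[OF P(1)]])
    have "((\<lambda>Y. Complex \<alpha> Y) \<longlongrightarrow> Complex \<alpha> 0) (at_right 0)" by (intro tendsto_intros)
    then show "((\<lambda>Y. Complex \<alpha> Y) \<longlongrightarrow> of_real \<alpha>) (at_right 0)" by (simp add: complex_of_real_def)
  qed
  moreover have "((\<lambda>Y. G' (Complex \<delta> (1 / (of_int c ^ 2 * Y)))) \<longlongrightarrow> 0) (at_right 0)"
  proof (rule filterlim_compose[OF G'])
    have "filterlim (\<lambda>Y. 1 / (r ^ 2 * Y)) at_top (at_right 0)" if "r > 0" for r :: real using that by real_asymp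
    from this[OF c0(2)] show "filterlim (\<lambda>Y. 1 / (real_of_int c ^ 2 * Y)) at_top (at_right 0)" .
  qed
  ultimately have "((\<lambda>Y. \<psi> - a0 0 * P (Complex \<alpha> Y) + a' 0 * P' (of_real \<delta>) + G' (Complex \<delta> (1 / (of_int c ^ 2 * Y)))) \<longlongrightarrow>
      \<psi> - a0 0 * P (of_real \<alpha>) + a' 0 * P' (of_real \<delta>) + 0) (at_right 0)"
    by (intro tendsto_intros)
  moreover have "\<forall>\<^sub>F Y in at_right 0. \<psi> - a0 0 * P (Complex \<alpha> Y) + a' 0 * P' (of_real \<delta>) + G' (Complex \<delta> (1 / (of_int c ^ 2 * Y))) =
      G (Complex \<alpha> Y) - K * of_real (1 / Y ^ M)"
    using eventually_at_right_less[of "0::real"] by eventually_elim (simp only: GE)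
  ultimately have lim: "((\<lambda>Y. G (Complex \<alpha> Y) - K * of_real (1 / Y ^ M)) \<longlongrightarrow> \<psi> - a0 0 * P (of_real \<alpha>) + a' 0 * P' (of_real \<delta>) + 0) (at_right 0)"
    by (rule Lim_transform_eventually)
  have Gd: "(G has_field_derivative (z - of_real (of_int a / of_int c)) ^ e * (phi m N (x1, x2) z - eis_const m x1)) (at z)" if "Im z > 0" for z
    using G(1)[OF that] unfolding q f(2) \<alpha>_def .
  have "Re (\<psi> - a0 0 * P (of_real \<alpha>) + a' 0 * P' (of_real \<delta>) + 0) = (-1) ^ e * of_int c ^ (k - e) * dedekind_sum (Suc (k - e)) (Suc e) (x1, x2) a c"
    unfolding \<alpha>_def by (rule period_limit[OF m N x nz c e Gd G(2) lim[unfolded \<alpha>_def M_def]])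
  then have R: "Re \<psi> = Re (a0 0 * P (of_real \<alpha>)) + Re (a' 0 * (0 - P' (of_real \<delta>))) + (-1) ^ e * of_int c ^ (k - e) * dedekind_sum (Suc (k - e)) (Suc e) (x1, x2) a c"
    by (simp only: minus_complex.sel plus_complex.sel zero_complex.sel right_diff_distrib mult_zero_right)
  have "contour_integral (linepath 0 (of_real \<alpha>)) (poly q) = P (of_real \<alpha>)"
    "contour_integral (linepath (of_real \<delta>) 0) (poly q') = 0 - P' (of_real \<delta>)"
    using contour_integral_linepath_primitive[of UNIV P "poly q" 0 "of_real \<alpha>"] P
      contour_integral_linepath_primitive[of UNIV P' "poly q'" "of_real \<delta>" 0] P' by auto
  with R show ?thesis unfolding \<psi>_def f(2) w_def \<alpha>_def \<delta>_def by simp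
qed


section \<open>Polynomial coefficients, substitution and coefficientwise integrals\<close>

lemma pconst_0 [simp]: "pconst 0 = 0"
  and pconst_1: "pconst 1 = 1"
  and pconst_add: "pconst (a + b) = pconst a + pconst b"
  and pconst_mult: "pconst (a * b) = pconst a * pconst b"
  and pconst_minus: "pconst (- a) = - pconst a"
  and pconst_diff: "pconst (a - b) = pconst a - pconst b"
  and pconst_of_int: "pconst (of_int i) = of_int i"
  and pconst_of_nat: "pconst (of_nat j) = of_nat j"
  by (simp_all add: pconst_def single_add mult_single single_uminus single_diff)

lemma pconst_power: "pconst (a ^ k) = pconst a ^ k"
  by (induction k) (simp_all add: pconst_1 pconst_mult)

lemma lookup_map_0: "f 0 = 0 \<Longrightarrow> Poly_Mapping.lookup (Poly_Mapping.map f p) k = f (Poly_Mapping.lookup p k)"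
  by (simp add: Poly_Mapping.map.rep_eq when_def)

lemma lookup_pconst_mult: "Poly_Mapping.lookup (pconst c * P) \<mu> = c * Poly_Mapping.lookup P \<mu>"
  by (simp add: pconst_def lookup_map_0 flip: mult_map_scale_conv_mult)

text \<open>The basis polynomials of the expansions have real coefficients; marking them as images
  under this embedding makes \<open>re_poly\<close> act on the scalar periods alone.\<close>

definition complexify :: "real mpoly \<Rightarrow> complex mpoly" where
  "complexify = Poly_Mapping.map of_real"

lemma lookup_complexify: "Poly_Mapping.lookup (complexify P) \<mu> = of_real (Poly_Mapping.lookup P \<mu>)"
  by (simp add: complexify_def lookup_map_0)

lemma complexify_add: "complexify (P + Q) = complexify P + complexify Q"
  by (rule poly_mapping_eqI) (simp add: lookup_complexify lookup_add)

lemma complexify_mult: "complexify (P * Q) = complexify P * complexify Q"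
proof (rule poly_mapping_eqI)
  have S: "complex_of_real (Sum_any g) = Sum_any (\<lambda>l. of_real (g l))" for g :: "(nat \<Rightarrow>\<^sub>0 nat) \<Rightarrow> real"
    by (simp add: Sum_any.expand_set)
  have W: "complex_of_real (x when b) = (of_real x when b)" for x b by (simp add: when_def)
  fix \<mu> show "Poly_Mapping.lookup (complexify (P * Q)) \<mu> = Poly_Mapping.lookup (complexify P * complexify Q) \<mu>"
    unfolding lookup_complexify lookup_mult S of_real_mult W ..
qed

lemma complexify_single: "complexify (Poly_Mapping.single \<mu> c) = Poly_Mapping.single \<mu> (of_real c)"
  by (rule poly_mapping_eqI) (simp add: lookup_complexify lookup_single when_def)

lemma complexify_pconst: "complexify (pconst c) = pconst (of_real c)"
  and complexify_pvar: "complexify (pvar i) = pvar i"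
  by (simp_all add: pconst_def pvar_def complexify_single)

lemma complexify_1: "complexify 1 = 1"
  using complexify_pconst[of 1] by (simp add: pconst_1)

lemma complexify_power: "complexify (P ^ k) = complexify P ^ k"
  by (induction k) (simp_all add: complexify_1 complexify_mult)

lemma complexify_of_int: "complexify (of_int i) = of_int i"
  using complexify_pconst[of "of_int i"] by (simp add: pconst_of_int)

lemma complexify_of_nat: "complexify (of_nat i) = of_nat i"
  using complexify_pconst[of "of_nat i"] by (simp add: pconst_of_nat)

lemmas complexify_hom = complexify_add complexify_mult complexify_power complexify_pconst complexify_pvar
  complexify_of_int complexify_of_nat

lemma re_poly_sum_complexify:
  "re_poly (\<Sum>i\<in>S. pconst (c i) * complexify (R i)) = (\<Sum>i\<in>S. pconst (Re (c i)) * R i)"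
  by (rule poly_mapping_eqI) (simp add: re_poly_def lookup_map_0 lookup_sum lookup_pconst_mult lookup_complexify)

definition mon_subst :: "(nat \<Rightarrow> 'a mpoly) \<Rightarrow> (nat \<Rightarrow>\<^sub>0 nat) \<Rightarrow> 'a::comm_ring_1 mpoly" where
  "mon_subst s \<mu> = (\<Prod>i\<in>Poly_Mapping.keys \<mu>. s i ^ Poly_Mapping.lookup \<mu> i)"

lemma mon_subst_superset:
  assumes "finite A" "Poly_Mapping.keys \<mu> \<subseteq> A"
  shows "mon_subst s \<mu> = (\<Prod>i\<in>A. s i ^ Poly_Mapping.lookup \<mu> i)"
  unfolding mon_subst_def using assms by (intro prod.mono_neutral_left) (auto simp: in_keys_iff)

lemma mon_subst_add: "mon_subst s (\<mu> + \<nu>) = mon_subst s \<mu> * mon_subst s \<nu>"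
proof -
  let ?A = "Poly_Mapping.keys \<mu> \<union> Poly_Mapping.keys \<nu>"
  have "Poly_Mapping.keys (\<mu> + \<nu>) \<subseteq> ?A" by (rule keys_add)
  then show ?thesis
    using mon_subst_superset[of ?A \<mu> s] mon_subst_superset[of ?A \<nu> s] mon_subst_superset[of ?A "\<mu> + \<nu>" s]
    by (simp add: lookup_add power_add prod.distrib)
qed

lemma psubst_superset:
  assumes "finite A" "Poly_Mapping.keys P \<subseteq> A"
  shows "psubst s P = (\<Sum>\<mu>\<in>A. pconst (Poly_Mapping.lookup P \<mu>) * mon_subst s \<mu>)"
  unfolding psubst_def mon_subst_def[symmetric] using assms by (intro sum.mono_neutral_left) (auto simp: in_keys_iff)

lemma psubst_add: "psubst s (P + Q) = psubst s P + psubst s Q"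
proof -
  let ?A = "Poly_Mapping.keys P \<union> Poly_Mapping.keys Q"
  have "Poly_Mapping.keys (P + Q) \<subseteq> ?A" by (rule keys_add)
  then show ?thesis
    using psubst_superset[of ?A P s] psubst_superset[of ?A Q s] psubst_superset[of ?A "P + Q" s]
    by (simp add: lookup_add pconst_add distrib_right sum.distrib)
qed

lemma psubst_sum: "psubst s (\<Sum>i\<in>S. P i) = (\<Sum>i\<in>S. psubst s (P i))"
proof (cases "finite S")
  case True
  then show ?thesis by (induction rule: finite_induct) (simp_all add: psubst_add, simp add: psubst_def)
qed (simp add: psubst_def)

lemma psubst_single: "psubst s (Poly_Mapping.single \<mu> c) = pconst c * mon_subst s \<mu>"
  using psubst_superset[of "{\<mu>}" "Poly_Mapping.single \<mu> c" s] by simp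

lemma sum_singles: "(\<Sum>\<mu>\<in>Poly_Mapping.keys P. Poly_Mapping.single \<mu> (Poly_Mapping.lookup P \<mu>)) = P"
  by (rule poly_mapping_eqI) (simp add: lookup_sum lookup_single when_def in_keys_iff)

lemma psubst_mult: "psubst s (P * Q) = psubst s P * psubst s Q"
proof -
  let ?p = "Poly_Mapping.lookup P" and ?q = "Poly_Mapping.lookup Q"
  have "P * Q = (\<Sum>\<mu>\<in>Poly_Mapping.keys P. Poly_Mapping.single \<mu> (?p \<mu>)) * (\<Sum>\<nu>\<in>Poly_Mapping.keys Q. Poly_Mapping.single \<nu> (?q \<nu>))"
    by (simp only: sum_singles)
  also have "\<dots> = (\<Sum>\<mu>\<in>Poly_Mapping.keys P. \<Sum>\<nu>\<in>Poly_Mapping.keys Q. Poly_Mapping.single (\<mu> + \<nu>) (?p \<mu> * ?q \<nu>))"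
    by (simp only: sum_product mult_single)
  finally have "psubst s (P * Q) = (\<Sum>\<mu>\<in>Poly_Mapping.keys P. \<Sum>\<nu>\<in>Poly_Mapping.keys Q.
      (pconst (?p \<mu>) * pconst (?q \<nu>)) * (mon_subst s \<mu> * mon_subst s \<nu>))"
    by (simp only: psubst_sum psubst_single mon_subst_add pconst_mult)
  also have "\<dots> = psubst s P * psubst s Q"
    unfolding psubst_def mon_subst_def[symmetric] sum_product by (simp only: mult_ac)
  finally show ?thesis .
qed

lemma psubst_pconst: "psubst s (pconst c) = pconst c"
  using psubst_single[of s 0 c] by (simp add: mon_subst_def flip: pconst_def)

lemma psubst_pvar: "psubst s (pvar i) = s i"
  by (simp add: pvar_def psubst_single mon_subst_def pconst_1)

lemma psubst_power: "psubst s (P ^ k) = psubst s P ^ k"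
  using psubst_pconst[of s 1] by (induction k) (simp_all add: pconst_1 psubst_mult)

lemma act_sum: "act n \<gamma> (\<Sum>i\<in>S. pconst (c i) * P i) = (\<Sum>i\<in>S. pconst (c i) * act n \<gamma> (P i))"
proof -
  obtain K s where A: "\<And>Q. act n \<gamma> Q = K * psubst s Q" unfolding act_def by metis
  show ?thesis unfolding A psubst_sum psubst_mult psubst_pconst sum_distrib_left by (simp only: mult.left_commute)
qed

lemma act_F:
  "act n \<gamma> (F n z) = pconst (of_real ((det \<gamma> powr (- (real n - 1) / 2)) ^ 2)) *
     ((pconst z * (pconst (of_real (\<gamma> $ 1 $ 1)) * T1 + pconst (of_real (\<gamma> $ 2 $ 1)) * T2)
        + (pconst (of_real (\<gamma> $ 1 $ 2)) * T1 + pconst (of_real (\<gamma> $ 2 $ 2)) * T2)) ^ (n - 1) *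
      (pconst z * (pconst (of_real (\<gamma> $ 1 $ 1)) * T3 + pconst (of_real (\<gamma> $ 2 $ 1)) * T4)
        + (pconst (of_real (\<gamma> $ 1 $ 2)) * T3 + pconst (of_real (\<gamma> $ 2 $ 2)) * T4)) ^ (n - 1))"
proof -
  have e: "(pvar(1 := A, 2 := B, 3 := C, 4 := D)) 1 = A" "(pvar(1 := A, 2 := B, 3 := C, 4 := D)) 2 = B"
    "(pvar(1 := A, 2 := B, 3 := C, 4 := D)) 3 = C" "(pvar(1 := A, 2 := B, 3 := C, 4 := D)) 4 = D" for A B C D :: "complex mpoly"
    by simp_all
  show ?thesis unfolding act_def F_def psubst_mult psubst_power psubst_add psubst_pconst psubst_pvar e ..
qed

text \<open>The coefficient function is exhibited as the \<open>lookup\<close> of an actual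
  polynomial, so \<open>Abs_poly_mapping\<close> is inverted and finite support comes for
  free.\<close>

lemma coeffwise_sum:
  assumes "\<And>c. I (\<lambda>t. \<Sum>i\<in>S. g i t * c i) = (\<Sum>i\<in>S. I (g i) * c i)"
  shows "coeffwise I (\<lambda>t. \<Sum>i\<in>S. pconst (g i t) * P i) = (\<Sum>i\<in>S. pconst (I (g i)) * P i)"
proof -
  have "(\<lambda>\<mu>. I (\<lambda>t. Poly_Mapping.lookup (\<Sum>i\<in>S. pconst (g i t) * P i) \<mu>)) = Poly_Mapping.lookup (\<Sum>i\<in>S. pconst (I (g i)) * P i)"
    by (rule ext) (simp add: lookup_sum lookup_pconst_mult assms)
  then show ?thesis unfolding coeffwise_def by (simp only: Poly_Mapping.poly_mapping.lookup_inverse)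
qed

lemma seg_int_sum:
  assumes "finite S" "\<And>i. i \<in> S \<Longrightarrow> continuous_on (closed_segment u v) (g i)"
  shows "seg_int u v (\<lambda>z. \<Sum>i\<in>S. pconst (g i z) * P i) = (\<Sum>i\<in>S. pconst (contour_integral (linepath u v) (g i)) * P i)"
  unfolding seg_int_def
proof (rule coeffwise_sum)
  fix c :: "_ \<Rightarrow> complex"
  have "g i contour_integrable_on linepath u v" if "i \<in> S" for i
    using assms(2)[OF that] by (rule contour_integrable_continuous_linepath)
  then have "((\<lambda>t. \<Sum>i\<in>S. g i t * c i) has_contour_integral (\<Sum>i\<in>S. contour_integral (linepath u v) (g i) * c i)) (linepath u v)"
    by (intro has_contour_integral_sum assms(1) has_contour_integral_rmul has_contour_integral_integral)
  then show "contour_integral (linepath u v) (\<lambda>t. \<Sum>i\<in>S. g i t * c i) = (\<Sum>i\<in>S. contour_integral (linepath u v) (g i) * c i)"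
    by (rule contour_integral_unique)
qed

lemma cusp_int_sum:
  assumes "finite S" "\<And>i. i \<in> S \<Longrightarrow> (\<lambda>t::real. g i (u + \<i> * of_real t) * \<i>) integrable_on {0..}"
  shows "cusp_int u (\<lambda>z. \<Sum>i\<in>S. pconst (g i z) * P i) =
     (\<Sum>i\<in>S. pconst (integral {0..} (\<lambda>t::real. g i (u + \<i> * of_real t) * \<i>)) * P i)"
  unfolding cusp_int_def
proof (rule coeffwise_sum)
  fix c :: "_ \<Rightarrow> complex"
  have "((\<lambda>t::real. \<Sum>i\<in>S. g i (u + \<i> * of_real t) * \<i> * c i) has_integral
     (\<Sum>i\<in>S. integral {0..} (\<lambda>t::real. g i (u + \<i> * of_real t) * \<i>) * c i)) {0..}"
    by (intro has_integral_sum assms(1) has_integral_mult_left integrable_integral assms(2))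
  moreover have "(\<lambda>t::real. \<Sum>i\<in>S. g i (u + \<i> * of_real t) * \<i> * c i) = (\<lambda>t. (\<Sum>i\<in>S. g i (u + \<i> * of_real t) * c i) * \<i>)"
    unfolding sum_distrib_right by (intro ext sum.cong refl) (simp only: mult_ac)
  ultimately have "((\<lambda>t::real. (\<Sum>i\<in>S. g i (u + \<i> * of_real t) * c i) * \<i>) has_integral
     (\<Sum>i\<in>S. integral {0..} (\<lambda>t::real. g i (u + \<i> * of_real t) * \<i>) * c i)) {0..}" by (simp only:)
  then show "integral {0..} (\<lambda>t::real. (\<Sum>i\<in>S. g i (u + \<i> * of_real t) * c i) * \<i>) =
     (\<Sum>i\<in>S. integral {0..} (\<lambda>t::real. g i (u + \<i> * of_real t) * \<i>) * c i)"
    by (rule integral_unique)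
qed

lemma real_int_sum:
  fixes g :: "_ \<Rightarrow> real \<Rightarrow> real"
  assumes "finite S" "\<And>i. i \<in> S \<Longrightarrow> continuous_on UNIV (g i)"
  shows "real_int u v (\<lambda>z. \<Sum>i\<in>S. pconst (g i z) * P i) = (\<Sum>i\<in>S. pconst (LBINT t=ereal u..ereal v. g i t) * P i)"
  unfolding real_int_def
proof (rule coeffwise_sum)
  fix c :: "_ \<Rightarrow> real"
  have int: "interval_lebesgue_integrable lborel (ereal u) (ereal v) (h :: real \<Rightarrow> real)" if "continuous_on UNIV h" for h
    by (rule interval_integrable_isCont) (use that in \<open>auto simp: continuous_on_eq_continuous_at\<close>)
  show "(LBINT t=ereal u..ereal v. (\<Sum>i\<in>S. g i t * c i)) = (\<Sum>i\<in>S. (LBINT t=ereal u..ereal v. g i t) * c i)"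
    using assms
  proof (induction rule: finite_induct)
    case (insert i S)
    have "interval_lebesgue_integrable lborel (ereal u) (ereal v) (\<lambda>t. g i t * c i)"
      "interval_lebesgue_integrable lborel (ereal u) (ereal v) (\<lambda>t. \<Sum>i\<in>S. g i t * c i)"
      using insert.prems by (auto intro!: int continuous_intros)
    note add = interval_lebesgue_integral_add(2)[OF this]
    have IH: "(LBINT t=ereal u..ereal v. (\<Sum>i\<in>S. g i t * c i)) = (\<Sum>i\<in>S. (LBINT t=ereal u..ereal v. g i t) * c i)"
      by (rule insert.IH) (use insert.prems in auto)
    show ?case unfolding sum.insert[OF insert.hyps(1,2)] add IH by simp
  qed simp
qed

text \<open>Every part of \<open>Psi\<close> is linear in F, so fixed polynomials \<open>P i\<close>
  can be taken out and the five integrals for each i form one \<open>period\<close>. The P i must be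
  common to F and its transform.\<close>

lemma Psi_expand:
  fixes q q' :: "'i \<Rightarrow> complex poly"
  assumes S: "finite S" and FE: "\<And>z. F n z = (\<Sum>i\<in>S. pconst (poly (q i) z) * P i)"
    and AE: "\<And>z. act n \<gamma> (F n z) = (\<Sum>i\<in>S. pconst (poly (q' i) z) * P i)"
    and f: "q_expansion M a (phi (2 * n) N x)" and f': "q_expansion M' a' (slash (2 * n) (phi (2 * n) N x) \<gamma>)"
    and z0: "Im z0 > 0" and w0: "Im (moebius \<gamma> z0) > 0"
  shows "Psi n N x z0 \<gamma> = (\<Sum>i\<in>S. pconst (period (phi (2 * n) N x) (a 0) (q i)
      (slash (2 * n) (phi (2 * n) N x) \<gamma>) (a' 0) (q' i) z0 (moebius \<gamma> z0)) * P i)"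
proof -
  define f1 where "f1 = phi (2 * n) N x"
  define f2 where "f2 = slash (2 * n) f1 \<gamma>"
  define w where "w = moebius \<gamma> z0"
  note q1 = f[folded f1_def] and q2 = f'[folded f1_def, folded f2_def]
  have seg: "closed_segment z0 w \<subseteq> upper_half"
    by (intro closed_segment_subset convex_upper_half) (use z0 w0 in \<open>auto simp: w_def\<close>)
  have cont: "continuous_on (closed_segment z0 w) f1"
    by (intro holomorphic_on_imp_continuous_on holomorphic_on_subset[OF q_expansion_holomorphic[OF q1] seg])
  have mulF: "pconst c * (\<Sum>i\<in>S. pconst (r i) * P i) = (\<Sum>i\<in>S. pconst (c * r i) * P i)" for c r
    by (simp add: sum_distrib_left pconst_mult mult.assoc)
  have 1: "seg_int z0 w (\<lambda>z. pconst (f1 z) * F n z) =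
     (\<Sum>i\<in>S. pconst (contour_integral (linepath z0 w) (\<lambda>z. f1 z * poly (q i) z)) * P i)"
    unfolding FE mulF by (intro seg_int_sum S continuous_intros cont)
  have 2: "F_check n z0 = (\<Sum>i\<in>S. pconst (contour_integral (linepath 0 z0) (poly (q i))) * P i)"
    unfolding F_check_def FE[abs_def] by (intro seg_int_sum S continuous_intros)
  have "act n \<gamma> (F_check n z0) = (\<Sum>i\<in>S. pconst (contour_integral (linepath 0 z0) (poly (q i))) * act n \<gamma> (P i))"
    unfolding 2 by (rule act_sum)
  \<comment> \<open>The action is moved back under the integral, because its expansion in the P i is
    known for F z as a whole and not for a single P i.\<close>
  also have "\<dots> = seg_int 0 z0 (\<lambda>z. \<Sum>i\<in>S. pconst (poly (q i) z) * act n \<gamma> (P i))"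
    by (intro seg_int_sum[symmetric] S continuous_intros)
  also have "(\<lambda>z. \<Sum>i\<in>S. pconst (poly (q i) z) * act n \<gamma> (P i)) = (\<lambda>z. \<Sum>i\<in>S. pconst (poly (q' i) z) * P i)"
    unfolding AE[symmetric] FE act_sum ..
  also have "seg_int 0 z0 \<dots> = (\<Sum>i\<in>S. pconst (contour_integral (linepath 0 z0) (poly (q' i))) * P i)"
    by (intro seg_int_sum S continuous_intros)
  finally have 3: "act n \<gamma> (F_check n z0) = \<dots>" .
  have ray: "(\<lambda>t::real. (h (z0 + \<i> * of_real t) - b 0) * poly p (z0 + \<i> * of_real t) * \<i>) integrable_on {0..}"
    if "q_expansion L b h" for L b h p
    by (rule cusp_primitive[OF that, of p]) (use z0 in \<open>auto simp: integrable_on_def mult.commute[of "poly p _"]\<close>)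
  have 4: "cusp_int z0 (\<lambda>z. pconst (tilde f1 z) * F n z) =
     (\<Sum>i\<in>S. pconst (integral {0..} (\<lambda>t::real. (f1 (z0 + \<i> * of_real t) - a 0) * poly (q i) (z0 + \<i> * of_real t) * \<i>)) * P i)"
    unfolding FE mulF tilde_def q_expansion_const_term[OF q1] by (intro cusp_int_sum S ray[OF q1])
  have 5: "cusp_int z0 (\<lambda>z. pconst (tilde f2 z) * act n \<gamma> (F n z)) =
     (\<Sum>i\<in>S. pconst (integral {0..} (\<lambda>t::real. (f2 (z0 + \<i> * of_real t) - a' 0) * poly (q' i) (z0 + \<i> * of_real t) * \<i>)) * P i)"
    unfolding AE mulF tilde_def q_expansion_const_term[OF q2] by (intro cusp_int_sum S ray[OF q2])
  have "Psi n N x z0 \<gamma> = seg_int z0 w (\<lambda>z. pconst (f1 z) * F n z) + pconst (a 0) * F_check n z0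
     - pconst (a' 0) * act n \<gamma> (F_check n z0) - cusp_int z0 (\<lambda>z. pconst (tilde f1 z) * F n z)
     + cusp_int z0 (\<lambda>z. pconst (tilde f2 z) * act n \<gamma> (F n z))"
    unfolding Psi_def Let_def f1_def[symmetric] f2_def[symmetric] w_def[symmetric]
      q_expansion_const_term[OF q1] q_expansion_const_term[OF q2] ..
  also have "\<dots> = (\<Sum>i\<in>S. pconst (period f1 (a 0) (q i) f2 (a' 0) (q' i) z0 w) * P i)"
    unfolding 3 unfolding 1 2 4 5 mulF sum.distrib[symmetric] sum_subtractf[symmetric]
    by (rule sum.cong[OF refl]) (simp only: period_def pconst_add pconst_diff distrib_right left_diff_distrib)
  finally show ?thesis unfolding f1_def f2_def w_def .
qed

lemma two_variable_expand:
  fixes X Y X' Y' :: "'a::comm_ring_1 mpoly"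
  shows "(pconst u * X + pconst v * Y) ^ N * (pconst u * X' + pconst v * Y') ^ N =
    (\<Sum>(k, l)\<in>{..N} \<times> {..N}. pconst (u ^ (k + l) * v ^ (2 * N - (k + l))) *
      (of_nat (N choose k) * of_nat (N choose l) * X ^ k * Y ^ (N - k) * X' ^ l * Y' ^ (N - l)))"
proof -
  define A where "A k = of_nat (N choose k) * (pconst u * X) ^ k * (pconst v * Y) ^ (N - k)" for k
  define B where "B l = of_nat (N choose l) * (pconst u * X') ^ l * (pconst v * Y') ^ (N - l)" for l
  have AB: "A k * B l = pconst (u ^ (k + l) * v ^ (2 * N - (k + l))) *
      (of_nat (N choose k) * of_nat (N choose l) * X ^ k * Y ^ (N - k) * X' ^ l * Y' ^ (N - l))"
    if "(k, l) \<in> {..N} \<times> {..N}" for k l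
  proof -
    have e: "2 * N - (k + l) = (N - k) + (N - l)" using that by auto
    show ?thesis unfolding A_def B_def e pconst_mult pconst_power power_add power_mult_distrib
      by (simp only: mult_ac)
  qed
  have "(pconst u * X + pconst v * Y) ^ N = sum A {..N}" unfolding A_def by (rule binomial_ring)
  moreover have "(pconst u * X' + pconst v * Y') ^ N = sum B {..N}" unfolding B_def by (rule binomial_ring)
  ultimately have "(pconst u * X + pconst v * Y) ^ N * (pconst u * X' + pconst v * Y') ^ N = (\<Sum>(k, l)\<in>{..N} \<times> {..N}. A k * B l)"
    by (simp only: sum_product sum.cartesian_product)
  also have "\<dots> = (\<Sum>(k, l)\<in>{..N} \<times> {..N}. pconst (u ^ (k + l) * v ^ (2 * N - (k + l))) *
      (of_nat (N choose k) * of_nat (N choose l) * X ^ k * Y ^ (N - k) * X' ^ l * Y' ^ (N - l)))"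
    by (rule sum.cong[OF refl]) (use AB in \<open>auto simp only: case_prod_conv split: prod.split\<close>)
  finally show ?thesis .
qed

lemma mat2_entries [simp]:
  "mat2 a b c d $ 1 $ 1 = a" "mat2 a b c d $ 1 $ 2 = b" "mat2 a b c d $ 2 $ 1 = c" "mat2 a b c d $ 2 $ 2 = d"
  by (simp_all add: mat2_def)

lemma det_mat2: "det (mat2 a b c (d :: real)) = a * d - b * c"
  by (simp add: det_2)

lemma Phi_expand:
  fixes q q' :: "'i \<Rightarrow> complex poly"
  assumes "finite S" "\<And>z. F n z = (\<Sum>i\<in>S. pconst (poly (q i) z) * complexify (R i))"
    "\<And>z. act n \<gamma> (F n z) = (\<Sum>i\<in>S. pconst (poly (q' i) z) * complexify (R i))"
    "q_expansion M a (phi (2 * n) N x)" "q_expansion M' a' (slash (2 * n) (phi (2 * n) N x) \<gamma>)"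
    "Im z0 > 0" "Im (moebius \<gamma> z0) > 0"
  shows "Phi n N x z0 \<gamma> = (\<Sum>i\<in>S. pconst (Re (period (phi (2 * n) N x) (a 0) (q i)
      (slash (2 * n) (phi (2 * n) N x) \<gamma>) (a' 0) (q' i) z0 (moebius \<gamma> z0))) * R i)"
  unfolding Phi_def Psi_expand[OF assms] by (rule re_poly_sum_complexify)


section \<open>Expansions of F and assembly of the two cases\<close>

lemma pconst_linear:
  "pconst z * (pconst a * X + pconst c * Y) + pconst b * X + pconst d * Y = pconst (z * a + b) * X + pconst (z * c + d) * Y"
  "pconst u * X + pconst v * (pconst a * X + pconst c * Y) = pconst (u + v * a) * X + pconst (v * c) * Y"
  by (simp_all only: pconst_add pconst_mult distrib_left distrib_right add_ac mult_ac)

text \<open>The basis belonging to z T1 + T2 = (z - a/c) T1 + (1/c) (a T1 + c T2) and its copy in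
  T3, T4. Here N is n - 1, not the level, and i is the pair of summation indices of the
  theorem.\<close>

definition modular_monomial :: "nat \<Rightarrow> int \<Rightarrow> int \<Rightarrow> nat \<times> nat \<Rightarrow> 'a::field_char_0 mpoly" where
  "modular_monomial N a c i = pconst ((1 / of_int c) ^ (2 * N - (fst i + snd i))) *
     (of_nat (N choose fst i) * of_nat (N choose snd i) * T1 ^ fst i * (of_int a * T1 + of_int c * T2) ^ (N - fst i)
       * T3 ^ snd i * (of_int a * T3 + of_int c * T4) ^ (N - snd i))"

lemma complexify_modular_monomial: "complexify (modular_monomial N a c i) = modular_monomial N a c i"
  by (simp add: modular_monomial_def complexify_hom)

lemma shift_linear:
  fixes X Y :: "'a::field_char_0 mpoly"
  assumes c: "c \<noteq> 0"
  shows "pconst z * X + Y = pconst (z - of_int a / of_int c) * X + pconst (1 / of_int c) * (of_int a * X + of_int c * Y)"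
proof -
  have "pconst (z - of_int a / of_int c) * X + pconst (1 / of_int c) * (of_int a * X + of_int c * Y) =
    pconst ((z - of_int a / of_int c) + 1 / of_int c * of_int a) * X + pconst (1 / of_int c * of_int c) * Y"
    unfolding pconst_of_int[symmetric] by (rule pconst_linear(2))
  then show ?thesis using c by (simp add: pconst_1)
qed

text \<open>The determinant condition gives b X + d Y = (-1/c) X + (d/c) (a X + c Y), and the
  multiple of z is already of this shape. So the transform has the same basis as F, with pure powers
  of c z + d as coefficients.\<close>

lemma transform_linear:
  fixes X Y :: "'a::field_char_0 mpoly"
  assumes c: "c \<noteq> 0" and det: "a * d - b * c = 1"
  shows "pconst z * (of_int a * X + of_int c * Y) + of_int b * X + of_int d * Y =
     pconst (- 1 / of_int c) * X + pconst ((of_int c * z + of_int d) / of_int c) * (of_int a * X + of_int c * Y)"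
proof -
  have "of_int a * of_int d - of_int b * of_int c = (1 :: 'a)"
    using det by (metis of_int_1 of_int_diff of_int_mult)
  then have b: "of_int b = (of_int a * of_int d - 1) / (of_int c :: 'a)"
    using c by (simp add: field_simps)
  have e: "- 1 / of_int c + (of_int c * z + of_int d) / of_int c * of_int a = z * of_int a + of_int b"
    "(of_int c * z + of_int d) / of_int c * of_int c = z * of_int c + of_int d"
    unfolding b using c by (simp_all add: field_simps)
  have "pconst z * (of_int a * X + of_int c * Y) + of_int b * X + of_int d * Y =
     pconst (z * of_int a + of_int b) * X + pconst (z * of_int c + of_int d) * Y"
    unfolding pconst_of_int[symmetric] by (rule pconst_linear(1))
  also have "\<dots> = pconst (- 1 / of_int c) * X + pconst ((of_int c * z + of_int d) / of_int c) * (of_int a * X + of_int c * Y)"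
    unfolding pconst_of_int[symmetric] pconst_linear(2) e ..
  finally show ?thesis .
qed

lemma F_modular_expand:
  fixes z :: "'a::field_char_0"
  assumes c: "c \<noteq> 0"
  shows "(pconst z * T1 + T2) ^ N * (pconst z * T3 + T4) ^ N =
    (\<Sum>i\<in>{..N} \<times> {..N}. pconst ((z - of_int a / of_int c) ^ (fst i + snd i)) * modular_monomial N a c i)"
proof -
  note e1 = shift_linear[OF c, of z T1 T2 a] and e2 = shift_linear[OF c, of z T3 T4 a]
  show ?thesis
    unfolding e1 e2 two_variable_expand
    by (intro sum.cong refl) (simp only: split_beta modular_monomial_def pconst_mult mult.assoc)
qed

lemma transform_modular_expand:
  fixes z :: "'a::field_char_0"
  assumes c: "c \<noteq> 0" and det: "a * d - b * c = 1"
  shows "(pconst z * (of_int a * T1 + of_int c * T2) + of_int b * T1 + of_int d * T2) ^ N *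
      (pconst z * (of_int a * T3 + of_int c * T4) + of_int b * T3 + of_int d * T4) ^ N =
    (\<Sum>i\<in>{..N} \<times> {..N}. pconst ((- 1 / of_int c) ^ (fst i + snd i) * (of_int c * z + of_int d) ^ (2 * N - (fst i + snd i)))
       * modular_monomial N a c i)"
proof -
  note e1 = transform_linear[OF c det, of z T1 T2] and e2 = transform_linear[OF c det, of z T3 T4]
  have p: "(w / of_int c) ^ r = w ^ r * (1 / of_int c) ^ r" for w :: 'a and r by (simp add: power_divide)
  show ?thesis
    unfolding e1 e2 two_variable_expand p[of "of_int c * z + of_int d"]
    by (intro sum.cong refl) (simp only: split_beta modular_monomial_def pconst_mult mult.assoc)
qed

definition upper_monomial :: "nat \<Rightarrow> nat \<times> nat \<Rightarrow> 'a::comm_ring_1 mpoly" where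
  "upper_monomial N i = of_nat (N choose fst i) * of_nat (N choose snd i) * T1 ^ fst i * T2 ^ (N - fst i)
       * T3 ^ snd i * T4 ^ (N - snd i)"

lemma complexify_upper_monomial: "complexify (upper_monomial N i) = upper_monomial N i"
  by (simp add: upper_monomial_def complexify_hom)

lemma upper_expand:
  "(pconst u * T1 + pconst v * T2) ^ N * (pconst u * T3 + pconst v * T4) ^ N =
    (\<Sum>i\<in>{..N} \<times> {..N}. pconst (u ^ (fst i + snd i) * v ^ (2 * N - (fst i + snd i))) * upper_monomial N i)"
  unfolding two_variable_expand by (intro sum.cong refl) (simp only: split_beta upper_monomial_def)

lemma F_upper_expand:
  "(pconst z * T1 + T2) ^ N * (pconst z * T3 + T4) ^ N =
    (\<Sum>i\<in>{..N} \<times> {..N}. pconst (z ^ (fst i + snd i)) * upper_monomial N i)"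
  using upper_expand[of z 1 N] by (simp add: pconst_1)

lemma Phi_upper:
  fixes a b d :: real
  assumes n: "n \<ge> 1" and N: "N > 0" and x: "real N * x1 \<in> \<int>" "real N * x2 \<in> \<int>"
    and nz: "2 * n = 2 \<Longrightarrow> \<not> (x1 \<in> \<int> \<and> x2 \<in> \<int>)" and z0: "Im z0 > 0"
    and rat: "a \<in> \<rat>" "d \<in> \<rat>" and ad: "a * d > 0"
  shows "Phi n N (x1, x2) z0 (mat2 a b 0 d) = - pconst (periodic_bernoulli (2 * n) x1 / real (2 * n)) *
     real_int 0 (b / d) (\<lambda>t. (pconst t * T1 + T2) ^ (n - 1) * (pconst t * T3 + T4) ^ (n - 1))"
proof -
  define \<gamma> where "\<gamma> = mat2 a b 0 d"
  define K where "K = n - 1"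
  define S where "S = {..K} \<times> {..K}"
  have nK: "n = Suc K" using n by (simp add: K_def)
  have fS: "finite S" by (simp add: S_def)
  have nz': "a \<noteq> 0" "d \<noteq> 0" using ad by auto
  have s: "a / d > 0" "a / d \<in> \<rat>" using ad rat by (auto simp: zero_less_mult_iff zero_less_divide_iff)
  obtain a0 where f: "q_expansion N a0 (phi (2 * n) N (x1, x2))" "a0 0 = eis_const (2 * n) x1"
    by (rule phi_q_expansion[of "2 * n" N x1 x2]) (use n N x nz in auto)
  \<comment> \<open>The slash factor (a d)^n / d^(2n).\<close>
  define \<kappa> where "\<kappa> = complex_of_real ((a / d) ^ n)"
  have moeb: "moebius \<gamma> z = of_real (a / d) * z + of_real (b / d)" for z
    using nz' by (simp add: moebius_def \<gamma>_def add_divide_distrib)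
  have sl: "slash (2 * n) (phi (2 * n) N (x1, x2)) \<gamma> z = \<kappa> * phi (2 * n) N (x1, x2) (of_real (a / d) * z + of_real (b / d))" for z
  proof -
    have "(a * d) powr (real (2 * n) / 2) = (a * d) ^ n" using ad by (simp add: powr_realpow)
    moreover have "complex_of_real ((a * d) ^ n) * inverse (of_real d ^ (2 * n)) = \<kappa>"
    proof -
      have "complex_of_real d ^ (2 * n) = of_real d ^ n * of_real d ^ n" by (simp add: mult_2 power_add)
      then show ?thesis using nz' by (simp only: \<kappa>_def of_real_power of_real_mult of_real_divide power_mult_distrib power_divide) (simp add: field_simps)
    qed
    ultimately show ?thesis unfolding slash_def moeb by (simp add: \<gamma>_def det_mat2)
  qed
  obtain N' a' where f': "q_expansion N' a' (\<lambda>z. \<kappa> * phi (2 * n) N (x1, x2) (of_real (a / d) * z + of_real (b / d)))" "a' 0 = \<kappa> * a0 0"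
    by (rule q_expansion_upper[OF f(1) s(2) s(1)])
  have f2: "q_expansion N' a' (slash (2 * n) (phi (2 * n) N (x1, x2)) \<gamma>)"
    unfolding sl[abs_def] by (rule f'(1))
  define q :: "nat \<times> nat \<Rightarrow> complex poly" where "q i = [:0, 1:] ^ (fst i + snd i)" for i
  define q' :: "nat \<times> nat \<Rightarrow> complex poly" where
    "q' i = smult (of_real (1 / (a * d) ^ K * d ^ (2 * K - (fst i + snd i)))) ([: of_real b, of_real a :] ^ (fst i + snd i))" for i
  have q: "poly (q i) z = z ^ (fst i + snd i)" for i z by (simp add: q_def)
  have q': "poly (q' i) z = of_real (1 / (a * d) ^ K) * ((z * of_real a + of_real b) ^ (fst i + snd i) * of_real d ^ (2 * K - (fst i + snd i)))" for i z
    by (simp add: q'_def algebra_simps)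
  have FE: "F n z = (\<Sum>i\<in>S. pconst (poly (q i) z) * complexify (upper_monomial K i))" for z
    unfolding F_def K_def[symmetric] F_upper_expand S_def[symmetric] q complexify_upper_monomial ..
  have AE: "act n \<gamma> (F n z) = (\<Sum>i\<in>S. pconst (poly (q' i) z) * complexify (upper_monomial K i))" for z
  proof -
    have "(det \<gamma> powr (- (real n - 1) / 2)) ^ 2 = det \<gamma> powr (- real K)"
      by (simp add: power2_eq_square nK flip: powr_add)
    also have "\<dots> = 1 / (a * d) ^ K" using ad by (simp add: \<gamma>_def det_mat2 powr_minus_divide powr_realpow)
    finally have D: "(det \<gamma> powr (- (real n - 1) / 2)) ^ 2 = 1 / (a * d) ^ K" .
    have lin: "pconst z * (pconst (of_real a) * X + pconst (of_real 0) * Y) + (pconst (of_real b) * X + pconst (of_real d) * Y) =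
       pconst (z * of_real a + of_real b) * X + pconst (of_real d) * Y" for X Y :: "complex mpoly"
      using pconst_linear(1)[of z "of_real a" X 0 Y "of_real b" "of_real d"] by (simp add: add.assoc)
    show ?thesis
      unfolding act_F D unfolding \<gamma>_def mat2_entries lin K_def[symmetric] upper_expand S_def[symmetric] q' complexify_upper_monomial
      by (simp only: sum_distrib_left pconst_mult mult.assoc)
  qed
  have w0: "Im (moebius \<gamma> z0) > 0" unfolding moeb using mult_pos_pos[OF s(1) z0] by simp
  have per: "Re (period (phi (2 * n) N (x1, x2)) (a0 0) (q i) (slash (2 * n) (phi (2 * n) N (x1, x2)) \<gamma>) (a' 0) (q' i) z0 (moebius \<gamma> z0)) =
     - (periodic_bernoulli (2 * n) x1 / real (2 * n)) * (LBINT t=ereal 0..ereal (b / d). t ^ (fst i + snd i))" if i: "i \<in> S" for i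
  proof -
    define e where "e = fst i + snd i"
    have e: "e \<le> 2 * K" using i by (auto simp: e_def S_def)
    \<comment> \<open>The powers from the slash factor, from the determinant in the action and from
      the entry d combine to (a/d) / d^e: a power of the substituted variable a z / d + b / d times
      its derivative.\<close>
    have rel: "\<kappa> * poly (q' i) z = poly (q i) (of_real (a / d) * z + of_real (b / d)) * of_real (a / d)" for z
    proof -
      have "d ^ K * d ^ K = d ^ (2 * K - e) * d ^ e" using e by (simp add: mult_2 flip: power_add)
      then have "d ^ (2 * K - e) / (d ^ K * d ^ K) = 1 / d ^ e" using nz' by simp
      moreover have "(a / d) ^ n * (1 / (a * d) ^ K * d ^ (2 * K - e)) = a / d * (d ^ (2 * K - e) / (d ^ K * d ^ K))"
        using nz' by (simp add: nK power_divide power_mult_distrib)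
      ultimately have r: "(a / d) ^ n * (1 / (a * d) ^ K * d ^ (2 * K - e)) = a / d * (1 / d ^ e)" by simp
      have "\<kappa> * poly (q' i) z = of_real ((a / d) ^ n * (1 / (a * d) ^ K * d ^ (2 * K - e))) * (z * of_real a + of_real b) ^ e"
        unfolding q' \<kappa>_def e_def[symmetric] by (simp only: of_real_mult of_real_power mult_ac)
      also have "\<dots> = ((z * of_real a + of_real b) / of_real d) ^ e * of_real (a / d)"
        unfolding r by (simp add: power_divide mult_ac)
      also have "(z * of_real a + of_real b) / of_real d = of_real (a / d) * z + of_real (b / d)"
        by (simp add: add_divide_distrib mult_ac)
      finally show ?thesis by (simp only: q e_def)
    qed
    have "period (phi (2 * n) N (x1, x2)) (a0 0) (q i) (slash (2 * n) (phi (2 * n) N (x1, x2)) \<gamma>) (a' 0) (q' i) z0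
        (of_real (a / d) * z0 + of_real (b / d)) = a0 0 * contour_integral (linepath 0 (of_real (b / d))) (poly (q i))"
      by (rule period_upper[OF f(1) f2 f'(2) s(1) sl rel z0])
    moreover have "Re (contour_integral (linepath (of_real 0) (of_real (b / d))) (poly (q i))) = (LBINT t=ereal 0..ereal (b / d). t ^ e)"
      by (rule Re_contour_integral_poly) (simp add: q e_def)
    moreover have "Re (eis_const (2 * n) x1 * w) = - (periodic_bernoulli (2 * n) x1 / real (2 * n)) * Re w" for w
      by (simp add: eis_const_def)
    ultimately show ?thesis unfolding moeb f(2) e_def by (simp only: of_real_0)
  qed
  have "Phi n N (x1, x2) z0 \<gamma> = (\<Sum>i\<in>S. pconst (- (periodic_bernoulli (2 * n) x1 / real (2 * n)) * (LBINT t=ereal 0..ereal (b / d). t ^ (fst i + snd i))) * upper_monomial K i)"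
    unfolding Phi_expand[OF fS FE AE f(1) f2 z0 w0] by (intro sum.cong refl) (simp only: per)
  also have "\<dots> = - pconst (periodic_bernoulli (2 * n) x1 / real (2 * n)) *
      (\<Sum>i\<in>S. pconst (LBINT t=ereal 0..ereal (b / d). t ^ (fst i + snd i)) * upper_monomial K i)"
    by (simp only: pconst_mult pconst_minus sum_distrib_left mult.assoc)
  also have "(\<Sum>i\<in>S. pconst (LBINT t=ereal 0..ereal (b / d). t ^ (fst i + snd i)) * upper_monomial K i) =
      real_int 0 (b / d) (\<lambda>t. (pconst t * T1 + T2) ^ K * (pconst t * T3 + T4) ^ K)"
    unfolding F_upper_expand S_def[symmetric] by (rule real_int_sum[symmetric, OF fS]) (intro continuous_intros)
  finally show ?thesis unfolding \<gamma>_def K_def .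
qed

lemma Phi_modular:
  fixes a b c d :: int
  assumes n: "n \<ge> 1" and N: "N > 0" and x: "real N * x1 \<in> \<int>" "real N * x2 \<in> \<int>"
    and nz: "2 * n = 2 \<Longrightarrow> \<not> (x1 \<in> \<int> \<and> x2 \<in> \<int>)" and z0: "Im z0 > 0"
    and det: "a * d - b * c = 1" and c: "c > 0"
  shows "Phi n N (x1, x2) z0 (mat2 (of_int a) (of_int b) (of_int c) (of_int d)) =
      - pconst (periodic_bernoulli (2 * n) x1 / real (2 * n)) *
        real_int 0 (of_int a / of_int c) (\<lambda>t. (pconst t * T1 + T2) ^ (n - 1) * (pconst t * T3 + T4) ^ (n - 1))
      - pconst (periodic_bernoulli (2 * n) (of_int a * x1 + of_int c * x2) / real (2 * n)) *
        real_int (- of_int d / of_int c) 0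
          (\<lambda>t. (pconst t * (of_int a * T1 + of_int c * T2) + of_int b * T1 + of_int d * T2) ^ (n - 1)
             * (pconst t * (of_int a * T3 + of_int c * T4) + of_int b * T3 + of_int d * T4) ^ (n - 1))
      + (\<Sum>i\<in>{..n - 1} \<times> {..n - 1}. pconst ((- 1) ^ (fst i + snd i) * of_int c ^ (2 * (n - 1) - (fst i + snd i))
          * dedekind_sum (Suc (2 * (n - 1) - (fst i + snd i))) (Suc (fst i + snd i)) (x1, x2) a c) * modular_monomial (n - 1) a c i)"
proof -
  define \<gamma> where "\<gamma> = mat2 (real_of_int a) (of_int b) (of_int c) (of_int d)"
  define K where "K = n - 1"
  define S where "S = {..K} \<times> {..K}"
  define x1' where "x1' = of_int a * x1 + of_int c * x2"
  define x2' where "x2' = of_int b * x1 + of_int d * x2"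
  define f where "f = phi (2 * n) N (x1, x2)"
  define f2 where "f2 = slash (2 * n) f \<gamma>"
  have nK: "2 * n = 2 * K + 2" "2 * n \<ge> 2" "even (2 * n)" "even (2 * K)" using n by (simp_all add: K_def)
  have fS: "finite S" by (simp add: S_def)
  have c0: "c \<noteq> 0" using c by simp
  have detg: "det \<gamma> = 1" using det unfolding \<gamma>_def det_mat2 by (metis of_int_1 of_int_diff of_int_mult)
  have moeb: "moebius \<gamma> z = (of_int a * z + of_int b) / (of_int c * z + of_int d)" for z
    by (simp add: moebius_def \<gamma>_def)
  have j: "of_int c * z + of_int d \<noteq> (0 :: complex)" if "Im z > 0" for z
  proof
    assume "of_int c * z + of_int d = 0"
    then have "Im (of_int c * z + of_int d) = 0" by simp
    then show False using that c by simp
  qed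
  have pm: "Im ((of_int a * z + of_int b) / (of_int c * z + of_int d)) > 0" "real N * x1' \<in> \<int>" "real N * x2' \<in> \<int>"
    "2 * n = 2 \<Longrightarrow> \<not> (x1' \<in> \<int> \<and> x2' \<in> \<int>)"
    "phi (2 * n) N (x1, x2) ((of_int a * z + of_int b) / (of_int c * z + of_int d)) =
       (of_int c * z + of_int d) ^ (2 * n) * phi (2 * n) N (x1', x2') z" if z: "Im z > 0" for z :: complex
    unfolding x1'_def x2'_def by (rule phi_modular[OF nK(2) z N x nz det]; assumption)+
  have i: "Im \<i> > 0" by simp
  obtain a0 where f: "q_expansion N a0 f" "a0 0 = eis_const (2 * n) x1"
    unfolding f_def by (rule phi_q_expansion[OF nK(2,3) N x nz])
  obtain a' where f': "q_expansion N a' (phi (2 * n) N (x1', x2'))" "a' 0 = eis_const (2 * n) x1'"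
    by (rule phi_q_expansion[OF nK(2,3) N pm(2,3,4)[OF i]])
  have sl: "f2 z = inverse ((of_int c * z + of_int d) ^ (2 * n)) * f ((of_int a * z + of_int b) / (of_int c * z + of_int d))" for z
    unfolding f2_def slash_def detg moeb by (simp add: \<gamma>_def)
  \<comment> \<open>On the upper half plane the slash transform is again an Eisenstein series,
    attached to x', so its constant term is known; off the half plane nothing is claimed.\<close>
  have f2: "q_expansion N a' f2"
  proof (rule q_expansion_cong[OF f'(1)])
    fix z assume z: "Im z > 0"
    show "f2 z = phi (2 * n) N (x1', x2') z" unfolding sl f_def pm(5)[OF z] using j[OF z] by simp
  qed
  have ff': "phi (2 * n) N (x1, x2) ((of_int a * z + of_int b) / (of_int c * z + of_int d)) = (of_int c * z + of_int d) ^ (2 * n) * f2 z"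
    if "Im z > 0" for z
    unfolding sl f_def using j[OF that] by simp
  define q :: "nat \<times> nat \<Rightarrow> complex poly" where
    "q i = [: - of_real (of_int a / of_int c), 1 :] ^ (fst i + snd i)" for i
  define q' :: "nat \<times> nat \<Rightarrow> complex poly" where
    "q' i = smult ((- 1 / of_int c) ^ (fst i + snd i)) ([: of_int d, of_int c :] ^ (2 * K - (fst i + snd i)))" for i
  have q: "poly (q i) z = (z - of_int a / of_int c) ^ (fst i + snd i)" for i z by (simp add: q_def)
  have q': "poly (q' i) z = (- 1 / of_int c) ^ (fst i + snd i) * (of_int c * z + of_int d) ^ (2 * K - (fst i + snd i))" for i z
    by (simp add: q'_def algebra_simps)
  have FE: "F n z = (\<Sum>i\<in>S. pconst (poly (q i) z) * complexify (modular_monomial K a c i))" for z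
    unfolding F_def K_def[symmetric] F_modular_expand[OF c0, of z K a] S_def[symmetric] q complexify_modular_monomial ..
  have AE: "act n \<gamma> (F n z) = (\<Sum>i\<in>S. pconst (poly (q' i) z) * complexify (modular_monomial K a c i))" for z
  proof -
    have "act n \<gamma> (F n z) = (pconst z * (of_int a * T1 + of_int c * T2) + of_int b * T1 + of_int d * T2) ^ K *
      (pconst z * (of_int a * T3 + of_int c * T4) + of_int b * T3 + of_int d * T4) ^ K"
      unfolding act_F detg K_def[symmetric] unfolding \<gamma>_def mat2_entries of_real_of_int_eq pconst_of_int add.assoc
      by (simp add: pconst_1)
    then show ?thesis
      unfolding transform_modular_expand[OF c0 det] S_def[symmetric] q' complexify_modular_monomial .
  qed
  have w0: "Im (moebius \<gamma> z0) > 0" unfolding moeb by (rule pm(1)[OF z0])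
  define B1 where "B1 = periodic_bernoulli (2 * n) x1 / real (2 * n)"
  define B2 where "B2 = periodic_bernoulli (2 * n) x1' / real (2 * n)"
  define I1 where "I1 i = (LBINT t=ereal 0..ereal (of_int a / of_int c). (t - of_int a / of_int c) ^ (fst i + snd i))" for i :: "nat \<times> nat"
  define I2 where "I2 i = (LBINT t=ereal (- of_int d / of_int c)..ereal 0.
     (- 1 / of_int c) ^ (fst i + snd i) * (of_int c * t + of_int d) ^ (2 * K - (fst i + snd i)))" for i :: "nat \<times> nat"
  define D where "D i = (- 1) ^ (fst i + snd i) * of_int c ^ (2 * K - (fst i + snd i))
          * dedekind_sum (Suc (2 * K - (fst i + snd i))) (Suc (fst i + snd i)) (x1, x2) a c" for i
  have per: "Re (period f (a0 0) (q i) f2 (a' 0) (q' i) z0 (moebius \<gamma> z0)) = - B1 * I1 i - B2 * I2 i + D i" if i: "i \<in> S" for i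
  proof -
    have e: "fst i + snd i \<le> 2 * K" using i by (auto simp: S_def)
    have "Re (contour_integral (linepath (of_real 0) (of_real (of_int a / of_int c))) (poly (q i))) = I1 i"
      unfolding I1_def by (rule Re_contour_integral_poly) (simp add: q)
    moreover have "Re (contour_integral (linepath (of_real (- of_int d / of_int c)) (of_real 0)) (poly (q' i))) = I2 i"
      unfolding I2_def by (rule Re_contour_integral_poly) (simp add: q')
    moreover have "Re (eis_const (2 * n) x1 * w) = - B1 * Re w" "Re (a' 0 * w) = - B2 * Re w" for w
      by (simp_all add: eis_const_def B1_def B2_def f'(2))
    moreover have "Re (period f (a0 0) (q i) f2 (a' 0) (q' i) z0 (moebius \<gamma> z0)) =
       Re (eis_const (2 * n) x1 * contour_integral (linepath 0 (of_real (of_int a / of_int c))) (poly (q i)))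
       + Re (a' 0 * contour_integral (linepath (of_real (- of_int d / of_int c)) 0) (poly (q' i))) + D i"
      unfolding f(2) f_def q_def q'_def moeb D_def
      by (rule Re_period_modular[OF nK(1,4) N x nz c det e z0 f2 f'(2)[unfolded x1'_def] ff'])
    ultimately show ?thesis by (simp only: of_real_0)
  qed
  have "Phi n N (x1, x2) z0 \<gamma> = (\<Sum>i\<in>S. pconst (- B1 * I1 i - B2 * I2 i + D i) * modular_monomial K a c i)"
    unfolding Phi_expand[OF fS FE AE f(1)[unfolded f_def] f2[unfolded f2_def f_def] z0 w0] f_def[symmetric] f2_def[symmetric]
    by (intro sum.cong refl) (simp only: per)
  also have "\<dots> = - pconst B1 * (\<Sum>i\<in>S. pconst (I1 i) * modular_monomial K a c i)
     - pconst B2 * (\<Sum>i\<in>S. pconst (I2 i) * modular_monomial K a c i) + (\<Sum>i\<in>S. pconst (D i) * modular_monomial K a c i)"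
    unfolding sum_distrib_left sum_subtractf[symmetric] sum.distrib[symmetric]
    by (simp only: pconst_add pconst_diff pconst_mult pconst_minus distrib_right left_diff_distrib mult.assoc)
  also have "(\<Sum>i\<in>S. pconst (I1 i) * modular_monomial K a c i) =
      real_int 0 (of_int a / of_int c) (\<lambda>t. (pconst t * T1 + T2) ^ K * (pconst t * T3 + T4) ^ K)"
    unfolding F_modular_expand[OF c0, of _ K a] S_def[symmetric] I1_def
    by (rule real_int_sum[symmetric, OF fS]) (intro continuous_intros)
  also have "(\<Sum>i\<in>S. pconst (I2 i) * modular_monomial K a c i) = real_int (- of_int d / of_int c) 0
      (\<lambda>t. (pconst t * (of_int a * T1 + of_int c * T2) + of_int b * T1 + of_int d * T2) ^ K
             * (pconst t * (of_int a * T3 + of_int c * T4) + of_int b * T3 + of_int d * T4) ^ K)"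
    unfolding transform_modular_expand[OF c0 det] S_def[symmetric] I2_def
    by (rule real_int_sum[symmetric, OF fS]) (intro continuous_intros)
  finally show ?thesis unfolding \<gamma>_def K_def S_def B1_def B2_def x1'_def D_def .
qed

text \<open>The power of c in front of each Dedekind sum cancels the power of 1/c in
  \<open>modular_monomial\<close>, which leaves the integral linear forms of the theorem.\<close>

lemma modular_monomial_sum:
  fixes D :: "nat \<Rightarrow> nat \<Rightarrow> real"
  assumes n: "n \<ge> 1" and c: "c \<noteq> 0"
  shows "(\<Sum>i\<in>{..n - 1} \<times> {..n - 1}. pconst ((- 1) ^ (fst i + snd i) * of_int c ^ (2 * (n - 1) - (fst i + snd i))
          * D (Suc (2 * (n - 1) - (fst i + snd i))) (Suc (fst i + snd i))) * modular_monomial (n - 1) a c i) =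
    (\<Sum>k = 0..n - 1. \<Sum>l = 0..n - 1.
        pconst ((- 1) ^ (k + l) * real ((n - 1) choose k) * real ((n - 1) choose l) * D (2 * n - k - l - 1) (k + l + 1))
        * T1 ^ k * (of_int a * T1 + of_int c * T2) ^ (n - k - 1) * T3 ^ l * (of_int a * T3 + of_int c * T4) ^ (n - l - 1))"
proof -
  have "pconst ((- 1) ^ (k + l) * of_int c ^ (2 * (n - 1) - (k + l)) * D (Suc (2 * (n - 1) - (k + l))) (Suc (k + l))) * modular_monomial (n - 1) a c (k, l) =
      pconst ((- 1) ^ (k + l) * real ((n - 1) choose k) * real ((n - 1) choose l) * D (2 * n - k - l - 1) (k + l + 1))
        * T1 ^ k * (of_int a * T1 + of_int c * T2) ^ (n - k - 1) * T3 ^ l * (of_int a * T3 + of_int c * T4) ^ (n - l - 1)"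
    if kl: "k \<le> n - 1" "l \<le> n - 1" for k l
  proof -
    define r where "r = 2 * (n - 1) - (k + l)"
    define \<delta> where "\<delta> = D (Suc r) (Suc (k + l))"
    \<comment> \<open>All truncated subtractions are exact because k and l are at most n -
      1.\<close>
    have e: "2 * n - k - l - 1 = Suc r" "k + l + 1 = Suc (k + l)" "n - k - 1 = n - 1 - k" "n - l - 1 = n - 1 - l"
      using kl n by (auto simp: r_def)
    have "real_of_int c ^ r * (1 / of_int c) ^ r = 1" using c by (simp add: power_divide)
    then have "(- 1) ^ (k + l) * of_int c ^ r * \<delta> * (1 / of_int c) ^ r = (- 1) ^ (k + l) * \<delta>"
      by (simp add: mult_ac)
    from arg_cong[OF this, of pconst]
    have p: "pconst ((- 1) ^ (k + l) * of_int c ^ r * \<delta>) * pconst ((1 / of_int c) ^ r) = pconst ((- 1) ^ (k + l)) * pconst \<delta>"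
      by (simp only: pconst_mult)
    show ?thesis
      unfolding e \<delta>_def[symmetric] modular_monomial_def fst_conv snd_conv r_def[symmetric] mult.assoc[symmetric] p
      by (simp only: pconst_mult pconst_of_nat mult_ac)
  qed
  then show ?thesis unfolding sum.cartesian_product atLeast0AtMost
    by (intro sum.cong refl) auto
qed

theorem theorem13:
  fixes m n N :: nat and x1 x2 :: real and z0 :: complex
  assumes "m = 2 * n" and "m \<ge> 2"
    and "N > 0" and "real N * x1 \<in> \<int>" and "real N * x2 \<in> \<int>"
    and "m = 2 \<Longrightarrow> \<not> (x1 \<in> \<int> \<and> x2 \<in> \<int>)"
    and "Im z0 > 0"
  shows "(\<forall>a b d :: real. mat2 a b 0 d \<in> GL_plus_rat \<longrightarrow>
            Phi n N (x1, x2) z0 (mat2 a b 0 d) =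
              - pconst (periodic_bernoulli m x1 / real m) *
                real_int 0 (b / d)
                  (\<lambda>t. (pconst t * T1 + T2) ^ (n - 1) * (pconst t * T3 + T4) ^ (n - 1))) \<and>
         (\<forall>a b c d :: int. a * d - b * c = 1 \<longrightarrow> c > 0 \<longrightarrow>
            Phi n N (x1, x2) z0 (mat2 (of_int a) (of_int b) (of_int c) (of_int d)) =
              - pconst (periodic_bernoulli m x1 / real m) *
                real_int 0 (of_int a / of_int c)
                  (\<lambda>t. (pconst t * T1 + T2) ^ (n - 1) * (pconst t * T3 + T4) ^ (n - 1))
              - pconst (periodic_bernoulli m (of_int a * x1 + of_int c * x2) / real m) *
                real_int (- of_int d / of_int c) 0
                  (\<lambda>t. (pconst t * (of_int a * T1 + of_int c * T2)
                          + of_int b * T1 + of_int d * T2) ^ (n - 1)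
                     * (pconst t * (of_int a * T3 + of_int c * T4)
                          + of_int b * T3 + of_int d * T4) ^ (n - 1))
              + (\<Sum>k = 0..n - 1. \<Sum>l = 0..n - 1.
                  pconst ((- 1) ^ (k + l) * real ((n - 1) choose k) * real ((n - 1) choose l)
                          * dedekind_sum (m - k - l - 1) (k + l + 1) (x1, x2) a c)
                  * T1 ^ k * (of_int a * T1 + of_int c * T2) ^ (n - k - 1)
                  * T3 ^ l * (of_int a * T3 + of_int c * T4) ^ (n - l - 1)))"
proof (intro conjI allI impI)
  have n: "n \<ge> 1" using assms(1,2) by simp
  note nz = assms(6)[unfolded assms(1)]
  {
    fix a b d :: real assume g: "mat2 a b 0 d \<in> GL_plus_rat"
    then have "mat2 a b 0 d $ 1 $ 1 \<in> \<rat>" "mat2 a b 0 d $ 2 $ 2 \<in> \<rat>" "det (mat2 a b 0 d) > 0"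
      unfolding GL_plus_rat_def by blast+
    then have "a \<in> \<rat>" "d \<in> \<rat>" "a * d > 0" by (simp_all add: det_mat2)
    then show "Phi n N (x1, x2) z0 (mat2 a b 0 d) = - pconst (periodic_bernoulli m x1 / real m) *
       real_int 0 (b / d) (\<lambda>t. (pconst t * T1 + T2) ^ (n - 1) * (pconst t * T3 + T4) ^ (n - 1))"
      unfolding assms(1) by (intro Phi_upper n assms(3-5,7) nz)
  next
    fix a b c d :: int assume det: "a * d - b * c = 1" and c: "c > 0"
    then have c0: "c \<noteq> 0" by simp
    show "Phi n N (x1, x2) z0 (mat2 (of_int a) (of_int b) (of_int c) (of_int d)) =
              - pconst (periodic_bernoulli m x1 / real m) *
                real_int 0 (of_int a / of_int c)
                  (\<lambda>t. (pconst t * T1 + T2) ^ (n - 1) * (pconst t * T3 + T4) ^ (n - 1))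
              - pconst (periodic_bernoulli m (of_int a * x1 + of_int c * x2) / real m) *
                real_int (- of_int d / of_int c) 0
                  (\<lambda>t. (pconst t * (of_int a * T1 + of_int c * T2)
                          + of_int b * T1 + of_int d * T2) ^ (n - 1)
                     * (pconst t * (of_int a * T3 + of_int c * T4)
                          + of_int b * T3 + of_int d * T4) ^ (n - 1))
              + (\<Sum>k = 0..n - 1. \<Sum>l = 0..n - 1.
                  pconst ((- 1) ^ (k + l) * real ((n - 1) choose k) * real ((n - 1) choose l)
                          * dedekind_sum (m - k - l - 1) (k + l + 1) (x1, x2) a c)
                  * T1 ^ k * (of_int a * T1 + of_int c * T2) ^ (n - k - 1)
                  * T3 ^ l * (of_int a * T3 + of_int c * T4) ^ (n - l - 1))"
      unfolding assms(1) modular_monomial_sum[OF n c0, where D = "\<lambda>j k. dedekind_sum j k (x1, x2) a c", symmetric]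
      by (rule Phi_modular[OF n assms(3-5) nz assms(7) det c])
  }
qed

end
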